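(* Up to equivalence there are exactly 25 two-orbit partitions of $\mathbb Z^3$. They are represented by the following list. Each entry gives the space-group type of $Aut(\Pi)$; the index of $Aut(\Pi)$ in $Aut(\Lambda^3)$ written as $i_t\cdot i_k$; the two orbits, each given by its Wyckoff position and one point; and the triple $(\mathbf a^2,\mathbf b^2,\mathbf c^2)$ of squared lengths of the conventional basis vectors. 1. $Fm\bar3m$; $2\cdot1$; $4a\ (0,0,0)$, $4b\ (0,0,\frac12)$; $(16,16,16)$. 2. $Im\bar3m$; $4\cdot1$; $2a\ (0,0,0)$, $6b\ (0,0,\frac12)$; $(16,16,16)$. 3. $P4/mmm$; $2\cdot3$; $1c\ (\frac12,\frac12,0)$, $1d\ (\frac12,\frac12,\frac12)$; $(4,4,16)$. 4. $P4/mmm$; $2\cdot3$; $1b\ (0,0,\frac12)$, $1d\ (\frac12,\frac12,\frac12)$; $(8,8,4)$. 5. $P4/mmm$; $3\cdot3$; $1c\ (\frac12,\frac12,0)$, $2h\ (\frac12,\frac12,\frac13)$; $(4,4,36)$. 6. $P4/mmm$; $4\cdot3$; $2g\ (0,0,\frac78)$, $2g\ (0,0,\frac38)$; $(4,4,64)$. 7. $I4/mmm$; $4\cdot3$; $4e\ (\frac12,\frac12,\frac38)$, $4e\ (0,0,\frac38)$; $(8,8,64)$. 8. $P\bar3m1$; $3\cdot4$; $2d\ (\frac13,\frac23,\frac13)$, $1a\ (0,0,0)$; $(8,8,12)$. 9. $Fm\bar3m$; $16\cdot1$; $32f\ (\frac38,\frac38,\frac78)$, $32f\ (\frac38,\frac38,\frac38)$;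 $(64,64,64)$. 10. $R\bar3m$; $4\cdot4$; $6c\ (0,0,\frac38)$, $6c\ (0,0,\frac78)$; $(8,8,192)$. 11. $Cmmm$; $3\cdot6$; $2b\ (0,\frac12,0)$, $4g\ (\frac16,0,0)$; $(72,8,4)$. 12. $P4/mmm$; $8\cdot3$; $4l\ (\frac34,0,0)$, $4n\ (\frac14,\frac12,0)$; $(32,32,4)$. 13. $I4/mmm$; $8\cdot3$; $8i\ (0,\frac34,0)$, $8j\ (0,\frac34,\frac12)$; $(32,32,16)$. 14. $Cmmm$; $4\cdot6$; $4h\ (\frac38,\frac12,\frac12)$, $4h\ (\frac38,0,\frac12)$; $(64,16,4)$. 15. $Pmma$; $4\cdot6$; $2e\ (\frac14,0,\frac78)$, $2e\ (\frac14,0,\frac38)$; $(8,4,32)$. 16. $Cmcm$; $4\cdot6$; $4c\ (\frac12,\frac38,\frac34)$, $4c\ (0,\frac38,\frac34)$; $(16,32,8)$. 17. $I4_1/amd$; $8\cdot3$; $8e\ (\frac12,\frac14,0)$, $8e\ (0,\frac14,0)$; $(16,16,64)$. 18. $P4/m$; $5\cdot6$; $4j\ (\frac15,\frac35,0)$, $1a\ (0,0,0)$; $(20,20,4)$. 19. $Im\bar3m$; $32\cdot1$; $16f\ (\frac38,\frac38,\frac38)$, $48k\ (\frac38,\frac38,\frac78)$; $(64,64,64)$. 20. $Ia\bar3d$; $32\cdot1$; $16b\ (\frac38,\frac58,\frac18)$, $48g\ (\frac38,\frac58,\frac38)$; $(64,64,64)$. 21. $Cmcm$; $8\cdot6$;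 $8g\ (\frac38,\frac18,\frac34)$, $8g\ (\frac38,\frac58,\frac34)$; $(64,32,8)$. 22. $I4_1/amd$; $16\cdot3$; $16h\ (0,0,\frac38)$, $16h\ (0,0,\frac78)$; $(32,32,64)$. 23. $R\bar3$; $7\cdot8$; $3a\ (0,0,0)$, $18f\ (\frac5{21},\frac4{21},\frac13)$; $(56,56,12)$. 24. $I4_1/amd$; $32\cdot3$; $32i\ (\frac38,\frac18,0)$, $32i\ (\frac38,\frac18,\frac12)$; $(64,64,64)$. 25. $I4_1/acd$; $32\cdot3$; $32g\ (\frac18,\frac38,0)$, $32g\ (\frac18,\frac38,\frac12)$; $(64,64,64)$. Moreover, the entries that are direct superpositions of two-orbit partitions of $\mathbb Z^2$ are exactly numbers 3, 4, 5, 6, 11, 12, 14, 15, 18.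
   Context: $\Lambda^d$ denotes the lattice $\mathbb Z^d\subset\mathbb R^d$. $Aut(\Lambda^d)$ is the group of all isometries of $\mathbb R^d$ mapping $\mathbb Z^d$ to itself, including integral translations, so $Aut(\Lambda^d)\cong\mathbb Z^d\rtimes(S_d\rtimes (C_2)^d)$. An $n$-orbit partition of $\mathbb Z^d$ is a set partition of $\mathbb Z^d$ into exactly $n$ (unlabelled) classes that are precisely the orbits of some finite-index subgroup $H\le Aut(\Lambda^d)$. Two such partitions are equivalent if some element of $Aut(\Lambda^d)$ maps the classes of one onto the classes of the other. For a partition $\Pi$, $Aut(\Pi)$ is the subgroup of all elements of $Aut(\Lambda^d)$ mapping every class of $\Pi$ to itself (classes are not permuted). Index notation: $i_t=[\mathbb Z^3:T]$, where $T$ is the translation subgroup of $Aut(\Pi)$, and $i_k=48/|P|$, where $P$ is the point group (the quotient $Aut(\Pi)/T$); the index of $Aut(\Pi)$ in $Aut(\Lambda^3)$ is the product $i_t\cdot i_k$. Reading the list: space-group types (Hermann–Mauguin symbols), conventional settings and Wyckoff letters are those of the International Tables for Crystallography, with the origin always at a centre of symmetry (origin choice 2 where there are two choices) and hexagonal axes for $P\bar3m1$, $R\bar3m$, $R\bar3$ (so $\mathbf a,\mathbf b$ have equal length and enclose $120^\circ$, and $\mathbf c$ is orthogonal to both); in all other cases the basis vectors $\mathbf a,\mathbf b,\mathbf c$ are pairwise orthogonal. Here $\mathbf a^2,\mathbf b^2,\mathbf c^2$ are the squared Euclidean lengths. For each entry let $G$ be the space group of the listed type in this setting with this basis, and let $X_1,X_2$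 be the $G$-orbits of the two listed points (given in fractional coordinates with respect to $\mathbf a,\mathbf b,\mathbf c$). The entry represents the equivalence class of the partition of $\mathbb Z^3$ obtained from $\{X_1,X_2\}$ by a similarity of $\mathbb R^3$ carrying $X_1\cup X_2$, which is a copy of the cubic lattice with nearest-neighbour distance $2$, onto $\mathbb Z^3$; this similarity conjugates $G$ to $Aut(\Pi)$. A partition of $\mathbb Z^3$ is a direct superposition of a two-orbit partition $\{A,B\}$ of $\mathbb Z^2$ if it is equivalent to $\{A\times\mathbb Z,\,B\times\mathbb Z\}$. *)

theory Defs
  imports "HOL-Analysis.Analysis" "HOL-Algebra.Group_Action" "HOL-Algebra.Generated_Groups"
    "HOL-Library.Disjoint_Sets"
begin

section \<open>Orbit partitions of the integer lattice\<close>

definition integer_lattice :: "(real ^ 'n) set" where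
  "integer_lattice = {x. \<forall>i. x $ i \<in> \<int>}"

definition isometry :: "('a::metric_space \<Rightarrow> 'b::metric_space) \<Rightarrow> bool" where
  "isometry f \<longleftrightarrow> (\<forall>x y. dist (f x) (f y) = dist x y)"

definition similarity :: "('a::metric_space \<Rightarrow> 'b::metric_space) \<Rightarrow> bool" where
  "similarity f \<longleftrightarrow> (\<exists>r>0. \<forall>x y. dist (f x) (f y) = r * dist x y)"

text \<open>A set of maps as an (HOL-Algebra) monoid under composition; its natural action on points
  is given by the identity \<open>\<lambda>f. f\<close>.\<close>

definition transf :: "('a \<Rightarrow> 'a) set \<Rightarrow> ('a \<Rightarrow> 'a) monoid" where
  "transf C = \<lparr>carrier = C, mult = (\<circ>), one = id\<rparr>"

definition aut_lattice :: "(real ^ 'n \<Rightarrow> real ^ 'n) set" where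
  "aut_lattice = {f. isometry f \<and> f ` integer_lattice = integer_lattice}"

definition orbit_partitions :: "nat \<Rightarrow> (real ^ 'n) set set set" where
  "orbit_partitions k = {P. partition_on integer_lattice P \<and> card P = k \<and>
     (\<exists>H. subgroup H (transf aut_lattice) \<and> finite (rcosets\<^bsub>transf aut_lattice\<^esub> H) \<and>
          P = orbits (transf H) integer_lattice (\<lambda>f. f))}"

definition partition_equiv :: "((real ^ 'n) set set \<times> (real ^ 'n) set set) set" where
  "partition_equiv = {(P, P'). \<exists>g\<in>aut_lattice. (\<lambda>X. g ` X) ` P = P'}"

definition aut_partition :: "(real ^ 'n) set set \<Rightarrow> (real ^ 'n \<Rightarrow> real ^ 'n) set" where
  "aut_partition P = {f \<in> aut_lattice. \<forall>X\<in>P. f ` X = X}"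

definition translation_maps :: "(real ^ 'n \<Rightarrow> real ^ 'n) set" where
  "translation_maps = {f. \<exists>v. f = (\<lambda>x. x + v)}"

definition aut_index :: "(real ^ 'n) set set \<Rightarrow> nat" where
  "aut_index P = card (rcosets\<^bsub>transf aut_lattice\<^esub> (aut_partition P))"

text \<open>The index \<open>i\<^sub>t\<close>; the lattice is identified with the group of its translations.\<close>

definition translation_index :: "(real ^ 'n) set set \<Rightarrow> nat" where
  "translation_index P =
     card (rcosets\<^bsub>transf (aut_lattice \<inter> translation_maps)\<^esub> (aut_partition P \<inter> translation_maps))"

text \<open>The index \<open>i\<^sub>k\<close>; the number 48 is the order of the point group of the cubic lattice.\<close>

definition point_index :: "(real ^ 3) set set \<Rightarrow> real" where
  "point_index P =
     48 / real (order (transf (aut_partition P) Mod (aut_partition P \<inter> translation_maps)))"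

definition cylinder :: "(real ^ 2) set \<Rightarrow> (real ^ 3) set" where
  "cylinder A = {x. vector [x $ 1, x $ 2] \<in> A \<and> x $ 3 \<in> \<int>}"

definition direct_superposition :: "(real ^ 3) set set \<Rightarrow> bool" where
  "direct_superposition P \<longleftrightarrow>
     (\<exists>A B. {A, B} \<in> orbit_partitions 2 \<and> ({cylinder A, cylinder B}, P) \<in> partition_equiv)"


section \<open>Space groups in the settings of the International Tables\<close>

text \<open>Constructor names follow the Hermann--Mauguin symbols; \<open>_3\<close> stands for a three-fold
  rotoinversion axis, \<open>4_1\<close> for a screw axis, and other underscores for the slash.\<close>

datatype space_group_type =
    P4_m | P4_mmm | I4_mmm | I4_1_amd | I4_1_acd
  | Pmma | Cmcm | Cmmm
  | R_3 | P_3m1 | R_3m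
  | Fm_3m | Im_3m | Ia_3d

type_synonym coords = "real \<times> real \<times> real"

text \<open>The selected generators of the International Tables besides the unit translations, as
  coordinate triplets: first the centring translations, then the remaining generators
  (origin at a centre of symmetry; hexagonal axes, obverse setting, for \<open>R\<close> lattices).\<close>

fun generators :: "space_group_type \<Rightarrow> (coords \<Rightarrow> coords) set" where
  "generators P4_m = {\<lambda>(x,y,z). (-x, -y, z), \<lambda>(x,y,z). (-y, x, z), \<lambda>(x,y,z). (-x, -y, -z)}"
| "generators P4_mmm = {\<lambda>(x,y,z). (-x, -y, z), \<lambda>(x,y,z). (-y, x, z), \<lambda>(x,y,z). (-x, y, -z),
     \<lambda>(x,y,z). (-x, -y, -z)}"
| "generators I4_mmm = {\<lambda>(x,y,z). (x + 1/2, y + 1/2, z + 1/2),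
     \<lambda>(x,y,z). (-x, -y, z), \<lambda>(x,y,z). (-y, x, z), \<lambda>(x,y,z). (-x, y, -z),
     \<lambda>(x,y,z). (-x, -y, -z)}"
| "generators I4_1_amd = {\<lambda>(x,y,z). (x + 1/2, y + 1/2, z + 1/2),
     \<lambda>(x,y,z). (-x + 1/2, -y, z + 1/2), \<lambda>(x,y,z). (-y + 1/4, x + 3/4, z + 1/4),
     \<lambda>(x,y,z). (-x + 1/2, y, -z + 1/2), \<lambda>(x,y,z). (-x, -y, -z)}"
| "generators I4_1_acd = {\<lambda>(x,y,z). (x + 1/2, y + 1/2, z + 1/2),
     \<lambda>(x,y,z). (-x + 1/2, -y, z + 1/2), \<lambda>(x,y,z). (-y + 1/4, x + 3/4, z + 1/4),
     \<lambda>(x,y,z). (-x + 1/2, y, -z), \<lambda>(x,y,z). (-x, -y, -z)}"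
| "generators Pmma = {\<lambda>(x,y,z). (-x + 1/2, -y, z), \<lambda>(x,y,z). (-x, y, -z),
     \<lambda>(x,y,z). (-x, -y, -z)}"
| "generators Cmcm = {\<lambda>(x,y,z). (x + 1/2, y + 1/2, z),
     \<lambda>(x,y,z). (-x, -y, z + 1/2), \<lambda>(x,y,z). (-x, y, -z + 1/2), \<lambda>(x,y,z). (-x, -y, -z)}"
| "generators Cmmm = {\<lambda>(x,y,z). (x + 1/2, y + 1/2, z),
     \<lambda>(x,y,z). (-x, -y, z), \<lambda>(x,y,z). (-x, y, -z), \<lambda>(x,y,z). (-x, -y, -z)}"
| "generators R_3 = {\<lambda>(x,y,z). (x + 2/3, y + 1/3, z + 1/3),
     \<lambda>(x,y,z). (-y, x - y, z), \<lambda>(x,y,z). (-x, -y, -z)}"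
| "generators P_3m1 = {\<lambda>(x,y,z). (-y, x - y, z), \<lambda>(x,y,z). (y, x, -z), \<lambda>(x,y,z). (-x, -y, -z)}"
| "generators R_3m = {\<lambda>(x,y,z). (x + 2/3, y + 1/3, z + 1/3),
     \<lambda>(x,y,z). (-y, x - y, z), \<lambda>(x,y,z). (y, x, -z), \<lambda>(x,y,z). (-x, -y, -z)}"
| "generators Fm_3m = {\<lambda>(x,y,z). (x, y + 1/2, z + 1/2), \<lambda>(x,y,z). (x + 1/2, y, z + 1/2),
     \<lambda>(x,y,z). (-x, -y, z), \<lambda>(x,y,z). (-x, y, -z), \<lambda>(x,y,z). (z, x, y),
     \<lambda>(x,y,z). (y, x, -z), \<lambda>(x,y,z). (-x, -y, -z)}"
| "generators Im_3m = {\<lambda>(x,y,z). (x + 1/2, y + 1/2, z + 1/2),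
     \<lambda>(x,y,z). (-x, -y, z), \<lambda>(x,y,z). (-x, y, -z), \<lambda>(x,y,z). (z, x, y),
     \<lambda>(x,y,z). (y, x, -z), \<lambda>(x,y,z). (-x, -y, -z)}"
| "generators Ia_3d = {\<lambda>(x,y,z). (x + 1/2, y + 1/2, z + 1/2),
     \<lambda>(x,y,z). (-x + 1/2, -y, z + 1/2), \<lambda>(x,y,z). (-x, y + 1/2, -z + 1/2),
     \<lambda>(x,y,z). (z, x, y), \<lambda>(x,y,z). (y + 3/4, x + 1/4, -z + 1/4), \<lambda>(x,y,z). (-x, -y, -z)}"

definition coordinate_group :: "space_group_type \<Rightarrow> (coords \<Rightarrow> coords) set" where
  "coordinate_group T = generate (transf {f. bij f})
     ({\<lambda>(x,y,z). (x + 1, y, z), \<lambda>(x,y,z). (x, y + 1, z), \<lambda>(x,y,z). (x, y, z + 1)} \<union> generators T)"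

text \<open>\<open>frame p a b c\<close> maps fractional coordinates to points, for origin \<open>p\<close> and basis
  \<open>a\<close>, \<open>b\<close>, \<open>c\<close>.\<close>

definition frame :: "real ^ 3 \<Rightarrow> real ^ 3 \<Rightarrow> real ^ 3 \<Rightarrow> real ^ 3 \<Rightarrow> coords \<Rightarrow> real ^ 3" where
  "frame p a b c = (\<lambda>(x,y,z). p + x *\<^sub>R a + y *\<^sub>R b + z *\<^sub>R c)"

definition right_handed :: "real ^ 3 \<Rightarrow> real ^ 3 \<Rightarrow> real ^ 3 \<Rightarrow> bool" where
  "right_handed a b c \<longleftrightarrow> det (vector [a, b, c] :: real ^ 3 ^ 3) > 0"

definition space_group :: "space_group_type \<Rightarrow> (coords \<Rightarrow> real ^ 3) \<Rightarrow> (real ^ 3 \<Rightarrow> real ^ 3) set" where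
  "space_group T F = {g. \<exists>h\<in>coordinate_group T. g \<circ> F = F \<circ> h}"

text \<open>Space-group types are classes under conjugation by orientation-preserving affine maps.\<close>

definition has_space_group_type :: "(real ^ 3 \<Rightarrow> real ^ 3) set \<Rightarrow> space_group_type \<Rightarrow> bool" where
  "has_space_group_type K T \<longleftrightarrow>
     (\<exists>p a b c. right_handed a b c \<and> K = space_group T (frame p a b c))"

definition hexagonal_axes :: "space_group_type \<Rightarrow> bool" where
  "hexagonal_axes T \<longleftrightarrow> T \<in> {P_3m1, R_3m, R_3}"

text \<open>\<open>a\<close>, \<open>b\<close> enclose 120 degrees for hexagonal axes.\<close>

definition conventional_basis ::
    "space_group_type \<Rightarrow> coords \<Rightarrow> real ^ 3 \<Rightarrow> real ^ 3 \<Rightarrow> real ^ 3 \<Rightarrow> bool" where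
  "conventional_basis T sq a b c \<longleftrightarrow>
     right_handed a b c \<and> ((norm a)\<^sup>2, (norm b)\<^sup>2, (norm c)\<^sup>2) = sq \<and>
     a \<bullet> c = 0 \<and> b \<bullet> c = 0 \<and> a \<bullet> b = (if hexagonal_axes T then - (norm a * norm b) / 2 else 0)"

text \<open>The first coordinate triplet listed in the International Tables for each Wyckoff position
  that is used below, as the set of points it describes.\<close>

definition wyckoff_representatives :: "((space_group_type \<times> char) \<times> coords set) list" where
  "wyckoff_representatives = [
     ((P4_m, CHR ''a''), {(0, 0, 0)}),
     ((P4_m, CHR ''j''), {(x, y, 0) |x y. True}),
     ((P4_mmm, CHR ''b''), {(0, 0, 1/2)}),
     ((P4_mmm, CHR ''c''), {(1/2, 1/2, 0)}),
     ((P4_mmm, CHR ''d''), {(1/2, 1/2, 1/2)}),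
     ((P4_mmm, CHR ''g''), {(0, 0, z) |z. True}),
     ((P4_mmm, CHR ''h''), {(1/2, 1/2, z) |z. True}),
     ((P4_mmm, CHR ''l''), {(x, 0, 0) |x. True}),
     ((P4_mmm, CHR ''n''), {(x, 1/2, 0) |x. True}),
     ((I4_mmm, CHR ''e''), {(0, 0, z) |z. True}),
     ((I4_mmm, CHR ''i''), {(x, 0, 0) |x. True}),
     ((I4_mmm, CHR ''j''), {(x, 1/2, 0) |x. True}),
     ((I4_1_amd, CHR ''e''), {(0, 1/4, z) |z. True}),
     ((I4_1_amd, CHR ''h''), {(0, y, z) |y z. True}),
     ((I4_1_amd, CHR ''i''), UNIV),
     ((I4_1_acd, CHR ''g''), UNIV),
     ((Pmma, CHR ''e''), {(1/4, 0, z) |z. True}),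
     ((Cmcm, CHR ''c''), {(0, y, 1/4) |y. True}),
     ((Cmcm, CHR ''g''), {(x, y, 1/4) |x y. True}),
     ((Cmmm, CHR ''b''), {(1/2, 0, 0)}),
     ((Cmmm, CHR ''g''), {(x, 0, 0) |x. True}),
     ((Cmmm, CHR ''h''), {(x, 0, 1/2) |x. True}),
     ((R_3, CHR ''a''), {(0, 0, 0)}),
     ((R_3, CHR ''f''), UNIV),
     ((P_3m1, CHR ''a''), {(0, 0, 0)}),
     ((P_3m1, CHR ''d''), {(1/3, 2/3, z) |z. True}),
     ((R_3m, CHR ''c''), {(0, 0, z) |z. True}),
     ((Fm_3m, CHR ''a''), {(0, 0, 0)}),
     ((Fm_3m, CHR ''b''), {(1/2, 1/2, 1/2)}),
     ((Fm_3m, CHR ''f''), {(x, x, x) |x. True}),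
     ((Im_3m, CHR ''a''), {(0, 0, 0)}),
     ((Im_3m, CHR ''b''), {(0, 1/2, 1/2)}),
     ((Im_3m, CHR ''f''), {(x, x, x) |x. True}),
     ((Im_3m, CHR ''k''), {(x, x, z) |x z. True}),
     ((Ia_3d, CHR ''b''), {(1/8, 1/8, 1/8)}),
     ((Ia_3d, CHR ''g''), {(1/8, y, -y + 1/4) |y. True})]"

text \<open>Points belong to the same Wyckoff position iff their site-symmetry groups are conjugate in
  the space group. The site-symmetry group of the position itself is the one of a generic point of
  its representative set, i.e. the pointwise stabilizer of that set.\<close>

definition wyckoff_position :: "space_group_type \<Rightarrow> (coords \<Rightarrow> real ^ 3) \<Rightarrow> char \<Rightarrow> (real ^ 3) set" where
  "wyckoff_position T F l =
     (let G = space_group T F; L = F ` the (map_of wyckoff_representatives (T, l)) in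
      {x. \<exists>g\<in>G. stabilizer (transf G) (\<lambda>f. f) x =
             (\<lambda>h. g \<circ> h \<circ> inv_into UNIV g) ` {h \<in> G. \<forall>y\<in>L. h y = y}})"

text \<open>Number of points of \<open>X\<close> per conventional unit cell.\<close>

definition multiplicity_in_cell :: "(coords \<Rightarrow> real ^ 3) \<Rightarrow> (real ^ 3) set \<Rightarrow> nat" where
  "multiplicity_in_cell F X = card (X \<inter> F ` ({0..<1} \<times> {0..<1} \<times> {0..<1}))"


section \<open>The list\<close>

text \<open>The indices are \<open>i\<^sub>t\<close> and \<open>i\<^sub>k\<close>, the Wyckoff positions are given as multiplicity and letter,
  and the last field contains the squared lengths of the basis vectors.\<close>

datatype entry = Entry
  (sg: space_group_type) (idx_t: nat) (idx_k: nat)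
  (wyck1: "nat \<times> char") (point1: coords)
  (wyck2: "nat \<times> char") (point2: coords)
  (sq_lengths: coords)

definition entries :: "entry list" where
  "entries = [
     Entry Fm_3m    2 1  (4, CHR ''a'')  (0, 0, 0)         (4, CHR ''b'')  (0, 0, 1/2)       (16, 16, 16),
     Entry Im_3m    4 1  (2, CHR ''a'')  (0, 0, 0)         (6, CHR ''b'')  (0, 0, 1/2)       (16, 16, 16),
     Entry P4_mmm   2 3  (1, CHR ''c'')  (1/2, 1/2, 0)     (1, CHR ''d'')  (1/2, 1/2, 1/2)   (4, 4, 16),
     Entry P4_mmm   2 3  (1, CHR ''b'')  (0, 0, 1/2)       (1, CHR ''d'')  (1/2, 1/2, 1/2)   (8, 8, 4),
     Entry P4_mmm   3 3  (1, CHR ''c'')  (1/2, 1/2, 0)     (2, CHR ''h'')  (1/2, 1/2, 1/3)   (4, 4, 36),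
     Entry P4_mmm   4 3  (2, CHR ''g'')  (0, 0, 7/8)       (2, CHR ''g'')  (0, 0, 3/8)       (4, 4, 64),
     Entry I4_mmm   4 3  (4, CHR ''e'')  (1/2, 1/2, 3/8)   (4, CHR ''e'')  (0, 0, 3/8)       (8, 8, 64),
     Entry P_3m1    3 4  (2, CHR ''d'')  (1/3, 2/3, 1/3)   (1, CHR ''a'')  (0, 0, 0)         (8, 8, 12),
     Entry Fm_3m   16 1  (32, CHR ''f'') (3/8, 3/8, 7/8)   (32, CHR ''f'') (3/8, 3/8, 3/8)   (64, 64, 64),
     Entry R_3m     4 4  (6, CHR ''c'')  (0, 0, 3/8)       (6, CHR ''c'')  (0, 0, 7/8)       (8, 8, 192),
     Entry Cmmm     3 6  (2, CHR ''b'')  (0, 1/2, 0)       (4, CHR ''g'')  (1/6, 0, 0)       (72, 8, 4),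
     Entry P4_mmm   8 3  (4, CHR ''l'')  (3/4, 0, 0)       (4, CHR ''n'')  (1/4, 1/2, 0)     (32, 32, 4),
     Entry I4_mmm   8 3  (8, CHR ''i'')  (0, 3/4, 0)       (8, CHR ''j'')  (0, 3/4, 1/2)     (32, 32, 16),
     Entry Cmmm     4 6  (4, CHR ''h'')  (3/8, 1/2, 1/2)   (4, CHR ''h'')  (3/8, 0, 1/2)     (64, 16, 4),
     Entry Pmma     4 6  (2, CHR ''e'')  (1/4, 0, 7/8)     (2, CHR ''e'')  (1/4, 0, 3/8)     (8, 4, 32),
     Entry Cmcm     4 6  (4, CHR ''c'')  (1/2, 3/8, 3/4)   (4, CHR ''c'')  (0, 3/8, 3/4)     (16, 32, 8),
     Entry I4_1_amd 8 3  (8, CHR ''e'')  (1/2, 1/4, 0)     (8, CHR ''e'')  (0, 1/4, 0)       (16, 16, 64),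
     Entry P4_m     5 6  (4, CHR ''j'')  (1/5, 3/5, 0)     (1, CHR ''a'')  (0, 0, 0)         (20, 20, 4),
     Entry Im_3m   32 1  (16, CHR ''f'') (3/8, 3/8, 3/8)   (48, CHR ''k'') (3/8, 3/8, 7/8)   (64, 64, 64),
     Entry Ia_3d   32 1  (16, CHR ''b'') (3/8, 5/8, 1/8)   (48, CHR ''g'') (3/8, 5/8, 3/8)   (64, 64, 64),
     Entry Cmcm     8 6  (8, CHR ''g'')  (3/8, 1/8, 3/4)   (8, CHR ''g'')  (3/8, 5/8, 3/4)   (64, 32, 8),
     Entry I4_1_amd 16 3 (16, CHR ''h'') (0, 0, 3/8)       (16, CHR ''h'') (0, 0, 7/8)       (32, 32, 64),
     Entry R_3      7 8  (3, CHR ''a'')  (0, 0, 0)         (18, CHR ''f'') (5/21, 4/21, 1/3) (56, 56, 12),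
     Entry I4_1_amd 32 3 (32, CHR ''i'') (3/8, 1/8, 0)     (32, CHR ''i'') (3/8, 1/8, 1/2)   (64, 64, 64),
     Entry I4_1_acd 32 3 (32, CHR ''g'') (1/8, 3/8, 0)     (32, CHR ''g'') (1/8, 3/8, 1/2)   (64, 64, 64)]"

text \<open>Entries are numbered from 1.\<close>

definition entry :: "nat \<Rightarrow> entry" where
  "entry n = entries ! (n - 1)"

definition entry_frame :: "entry \<Rightarrow> (coords \<Rightarrow> real ^ 3) \<Rightarrow> bool" where
  "entry_frame e F \<longleftrightarrow>
     (\<exists>p a b c. conventional_basis (sg e) (sq_lengths e) a b c \<and> F = frame p a b c)"

definition entry_group :: "entry \<Rightarrow> (coords \<Rightarrow> real ^ 3) \<Rightarrow> (real ^ 3 \<Rightarrow> real ^ 3) set" where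
  "entry_group e F = space_group (sg e) F"

definition entry_orbit1 :: "entry \<Rightarrow> (coords \<Rightarrow> real ^ 3) \<Rightarrow> (real ^ 3) set" where
  "entry_orbit1 e F = orbit (transf (entry_group e F)) (\<lambda>f. f) (F (point1 e))"

definition entry_orbit2 :: "entry \<Rightarrow> (coords \<Rightarrow> real ^ 3) \<Rightarrow> (real ^ 3) set" where
  "entry_orbit2 e F = orbit (transf (entry_group e F)) (\<lambda>f. f) (F (point2 e))"

definition entry_similarity ::
    "entry \<Rightarrow> (coords \<Rightarrow> real ^ 3) \<Rightarrow> (real ^ 3 \<Rightarrow> real ^ 3) \<Rightarrow> bool" where
  "entry_similarity e F s \<longleftrightarrow>
     similarity s \<and> s ` (entry_orbit1 e F \<union> entry_orbit2 e F) = integer_lattice"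

definition entry_partition ::
    "entry \<Rightarrow> (coords \<Rightarrow> real ^ 3) \<Rightarrow> (real ^ 3 \<Rightarrow> real ^ 3) \<Rightarrow> (real ^ 3) set set" where
  "entry_partition e F s = {s ` entry_orbit1 e F, s ` entry_orbit2 e F}"

definition represented_partitions :: "entry \<Rightarrow> (real ^ 3) set set set" where
  "represented_partitions e =
     {entry_partition e F s |F s. entry_frame e F \<and> entry_similarity e F s}"

end

theory Submission
  imports Defs
begin

text \<open>A two-orbit partition is a colouring of \<open>\<int>\<^sup>3\<close> by two colours whose group of colour-preserving motions is
  transitive on each colour. After a motion and an exchange of the colours, \<open>0\<close> and \<open>(1, 0, 0)\<close> have
  different colours. Points of equal colour have congruent neighbourhoods, so what is known about the
  \<open>3 \<times> 3 \<times> 3\<close> cube around one point restricts the cube around every point of that colour. Propagating these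
  restrictions inside a finite window, with case distinctions where nothing more follows, ends in a
  contradiction or with the complete neighbourhoods of \<open>0\<close> and \<open>(1, 0, 0)\<close> in one of 25 periodic colourings.
  These neighbourhoods determine the whole colouring because the 25 colourings are rigid: a rotation that
  matches the overlap of adjacent neighbourhoods matches the neighbourhoods.

  For a periodic colouring the symmetry group, its indices and its site symmetries are found by finite
  checks. The 25 colourings are told apart by the two indices and the numbers of differently coloured
  neighbours of a point. A direct superposition is invariant under a translation by a unit vector; conversely
  such a colouring is one if the motions that fix the direction of this vector are transitive on each colour
  in a plane.\<close>

section \<open>Isometries of the integer lattice\<close>

text \<open>The group \<open>H\<close> of an orbit partition may be enlarged to all motions that
  preserve both classes: they contain \<open>H\<close>, hence are transitive on each class as well.
  The hypothesis thereby becomes a property of the colouring alone, and its local form can be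
  exploited in a finite window; the finite index of the groups of the 25 colourings is supplied by
  their periodicity. All evaluation happens inside the logic. Nothing is searched there: case
  distinctions, walks to a base point and words for site symmetries are recorded beforehand and
  merely checked, in integer arithmetic. Rigidity of the cube alone holds for 23 of the colourings.
  Entries 18 and 23 are perfect codes, the plane one times a line and the one of index 7 in space:
  every point of the larger class has exactly one neighbour in the smaller class. Around such a
  point there is a reflection that respects two layers of the cube and violates the third, so these
  two entries need the larger ball of squared radius 6.\<close>

lemma lattice_diff: "x \<in> integer_lattice \<Longrightarrow> y \<in> integer_lattice \<Longrightarrow> x - y \<in> integer_lattice"
  and lattice_zero: "0 \<in> integer_lattice"
  by (auto simp: integer_lattice_def)

lemma isometry_inj: "isometry f \<Longrightarrow> inj f"
  unfolding isometry_def inj_def by (metis dist_eq_0_iff)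

lemma isometry_affine:
  fixes f :: "'a::euclidean_space \<Rightarrow> 'a"
  assumes "isometry f"
  obtains Q where "orthogonal_transformation Q" "\<And>x. f x = Q x + f 0"
proof
  show "orthogonal_transformation (\<lambda>x. f x - f 0)"
    unfolding orthogonal_transformation_isometry using assms
    by (simp add: isometry_def dist_norm)
qed auto

lemma isometry_bij: "isometry (f :: 'a::euclidean_space \<Rightarrow> 'a) \<Longrightarrow> bij f"
proof -
  assume f: "isometry f"
  obtain Q where Q: "orthogonal_transformation Q" "\<And>x. f x = Q x + f 0"
    using isometry_affine[OF f] by blast
  have "surj f"
  proof (rule surjI)
    fix y show "f (inv_into UNIV Q (y - f 0)) = y"
      by (simp add: Q(2)[of "inv_into UNIV Q _"] orthogonal_transformation_surj[OF Q(1)] surj_f_inv_f)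
  qed
  with isometry_inj[OF f] show ?thesis by (simp add: bij_def)
qed

lemma isometry_comp: "isometry f \<Longrightarrow> isometry g \<Longrightarrow> isometry (f \<circ> g)"
  by (simp add: isometry_def)

lemma isometry_inv: "isometry (f :: 'a::euclidean_space \<Rightarrow> 'a) \<Longrightarrow> isometry (inv_into UNIV f)"
proof -
  assume f: "isometry f"
  then have "f (inv_into UNIV f x) = x" for x
    using isometry_bij[of f] by (simp add: bij_is_surj surj_f_inv_f)
  then show ?thesis using f unfolding isometry_def by metis
qed

section \<open>The automorphism group of the lattice and cosets in it, in any dimension\<close>

lemma aut_lattice_bij: "f \<in> aut_lattice \<Longrightarrow> bij f"
  by (simp add: aut_lattice_def isometry_bij)

lemma aut_lattice_comp: "f \<in> aut_lattice \<Longrightarrow> g \<in> aut_lattice \<Longrightarrow> f \<circ> g \<in> aut_lattice"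
  by (simp add: aut_lattice_def isometry_comp image_comp[symmetric] del: o_apply)

lemma aut_lattice_inv: "f \<in> aut_lattice \<Longrightarrow> inv_into UNIV f \<in> aut_lattice"
proof -
  assume f: "f \<in> aut_lattice"
  then have "inj f" "isometry f" "f ` integer_lattice = integer_lattice"
    by (auto simp: aut_lattice_def isometry_inj)
  then have "inv_into UNIV f ` integer_lattice = integer_lattice"
    by (metis image_inv_f_f)
  then show ?thesis using \<open>isometry f\<close> by (simp add: aut_lattice_def isometry_inv)
qed

lemma aut_lattice_id: "id \<in> aut_lattice"
  by (simp add: aut_lattice_def isometry_def)

lemma transf_simps [simp]:
  "carrier (transf C) = C" "mult (transf C) = (\<circ>)" "one (transf C) = id"
  by (simp_all add: transf_def)

lemma transf_group:
  assumes "\<And>f g. f \<in> C \<Longrightarrow> g \<in> C \<Longrightarrow> f \<circ> g \<in> C" "id \<in> C"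
    "\<And>f. f \<in> C \<Longrightarrow> bij f \<and> inv_into UNIV f \<in> C"
  shows "group (transf C)"
proof (rule groupI)
  fix f assume "f \<in> carrier (transf C)"
  then have "inv_into UNIV f \<in> carrier (transf C)" "inv_into UNIV f \<circ> f = id"
    using assms(3) by (auto simp: bij_is_inj)
  then show "\<exists>g\<in>carrier (transf C). g \<otimes>\<^bsub>transf C\<^esub> f = \<one>\<^bsub>transf C\<^esub>" by auto
qed (use assms in \<open>auto simp: o_assoc\<close>)

lemma transf_inv:
  assumes "group (transf C)" "f \<in> C" "bij f" "inv_into UNIV f \<in> C"
  shows "inv\<^bsub>transf C\<^esub> f = inv_into UNIV f"
  using assms by (intro group.inv_equality) (auto simp: bij_is_inj)

lemma aut_lattice_group: "group (transf aut_lattice)"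
  by (rule transf_group) (auto simp: aut_lattice_comp aut_lattice_id aut_lattice_inv aut_lattice_bij)

lemma aut_lattice_m_inv: "f \<in> aut_lattice \<Longrightarrow> inv\<^bsub>transf aut_lattice\<^esub> f = inv_into UNIV f"
  by (simp add: transf_inv aut_lattice_group aut_lattice_inv aut_lattice_bij)

lemma subgroup_transfI:
  assumes "group (transf C)" "H \<subseteq> C" "id \<in> H" "\<And>f g. f \<in> H \<Longrightarrow> g \<in> H \<Longrightarrow> f \<circ> g \<in> H"
    "\<And>f. f \<in> H \<Longrightarrow> bij f \<and> inv_into UNIV f \<in> H"
  shows "subgroup H (transf C)"
proof
  fix f assume "f \<in> H"
  then show "inv\<^bsub>transf C\<^esub> f \<in> H"
    using assms by (subst transf_inv) auto
qed (use assms in auto)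

lemma aut_partition_subgroup: "subgroup (aut_partition P) (transf aut_lattice)"
proof (rule subgroup_transfI)
  fix f assume f: "f \<in> aut_partition P"
  then have "bij f" by (auto simp: aut_partition_def aut_lattice_bij)
  moreover have "inv_into UNIV f ` X = X" if "f ` X = X" for X
    by (metis \<open>bij f\<close> bij_is_inj image_inv_f_f that)
  ultimately show "bij f \<and> inv_into UNIV f \<in> aut_partition P"
    using f by (auto simp: aut_partition_def aut_lattice_inv)
next
  fix f g assume "f \<in> aut_partition P" "g \<in> aut_partition P"
  moreover from this have "(f \<circ> g) ` X = X" if "X \<in> P" for X
    using that unfolding aut_partition_def by (metis (mono_tags, lifting) image_comp mem_Collect_eq)
  ultimately show "f \<circ> g \<in> aut_partition P"
    by (auto simp: aut_partition_def aut_lattice_comp simp del: o_apply)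
qed (auto simp: aut_lattice_group aut_partition_def aut_lattice_id)

lemma rcos_eq_iff:
  fixes G (structure)
  assumes "group G" "subgroup H G" "a \<in> carrier G" "b \<in> carrier G"
  shows "H #> a = H #> b \<longleftrightarrow> a \<otimes> inv b \<in> H"
proof -
  interpret group G by fact
  show ?thesis
  proof
    assume "H #> a = H #> b"
    then have "a \<in> H #> b" using assms rcos_self by blast
    then obtain h where h: "h \<in> H" "a = h \<otimes> b" by (auto simp: r_coset_def)
    have hc: "h \<in> carrier G" by (rule subgroup.mem_carrier[OF assms(2) h(1)])
    have "a \<otimes> inv b = h \<otimes> (b \<otimes> inv b)" unfolding h(2) using hc assms(4) by (intro m_assoc inv_closed)
    then have "a \<otimes> inv b = h" using hc assms(4) by (metis r_inv r_one)
    then show "a \<otimes> inv b \<in> H" using h by simp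
  next
    assume h: "a \<otimes> inv b \<in> H"
    have "a = (a \<otimes> inv b) \<otimes> b" using assms by (simp add: m_assoc)
    then have "a \<in> H #> b" using h by (auto simp: r_coset_def)
    then show "H #> a = H #> b" using assms repr_independence by blast
  qed
qed

text \<open>Two maps with the same fibres have equally many values. Every index below is computed
  this way: cosets are exchanged for a complete invariant of the coset that is easier to
  count.\<close>

lemma card_image_eq:
  assumes "\<And>x y. x \<in> A \<Longrightarrow> y \<in> A \<Longrightarrow> f x = f y \<longleftrightarrow> g x = g y"
  shows "card (f ` A) = card (g ` A)" and "finite (f ` A) \<longleftrightarrow> finite (g ` A)"
proof -
  define h where "h z = g (SOME x. x \<in> A \<and> f x = z)" for z
  have h: "h (f x) = g x" if "x \<in> A" for x
  proof -
    have "(SOME y. y \<in> A \<and> f y = f x) \<in> A \<and> f (SOME y. y \<in> A \<and> f y = f x) = f x"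
      by (rule someI[of _ x]) (use that in auto)
    then show ?thesis unfolding h_def using assms that by blast
  qed
  have "bij_betw h (f ` A) (g ` A)"
    unfolding bij_betw_def inj_on_def
    by (auto simp: h assms image_image cong: image_cong)
  then show "card (f ` A) = card (g ` A)" "finite (f ` A) \<longleftrightarrow> finite (g ` A)"
    by (auto dest: bij_betw_same_card bij_betw_finite)
qed

lemma rcosets_image: "rcosets\<^bsub>G\<^esub> H = (\<lambda>a. H #>\<^bsub>G\<^esub> a) ` carrier G"
  by (auto simp: RCOSETS_def)

text \<open>The linear part of a lattice automorphism maps the lattice into itself, so the pullback
  of an \<open>m\<close>-periodic set is again \<open>m\<close>-periodic and is determined by its
  trace on the finite box \<open>B\<close>. The dimension is kept general because superpositions
  need the plane as well as space.\<close>

lemma finite_pullbacks: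
  fixes A :: "(real ^ 'n) set"
  assumes m: "m > 0" and per: "\<And>x v. x \<in> integer_lattice \<Longrightarrow> v \<in> integer_lattice \<Longrightarrow> x + of_nat m *\<^sub>R v \<in> A \<longleftrightarrow> x \<in> A"
  shows "finite ((\<lambda>f. {x \<in> integer_lattice. f x \<in> A}) ` aut_lattice)"
proof -
  define B :: "(real ^ 'n) set" where "B = {x. \<forall>i. \<exists>k::nat. k < m \<and> x $ i = real k}"
  have "B \<subseteq> (\<lambda>h. \<chi> i. real (h i)) ` (UNIV \<rightarrow>\<^sub>E {..<m})"
  proof
    fix x assume "x \<in> B"
    then have "\<forall>i. \<exists>k. k < m \<and> x $ i = real k" by (simp add: B_def)
    then obtain h where h: "\<And>i. h i < m \<and> x $ i = real (h i)" by metis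
    then have "x = (\<chi> i. real (h i))" by (simp add: vec_eq_iff)
    moreover have "h \<in> UNIV \<rightarrow>\<^sub>E {..<m}" using h by auto
    ultimately show "x \<in> (\<lambda>h. \<chi> i. real (h i)) ` (UNIV \<rightarrow>\<^sub>E {..<m})" by blast
  qed
  then have fB: "finite B" by (rule finite_subset) (auto intro!: finite_imageI finite_PiE)
  have split: "\<exists>b v. b \<in> B \<and> v \<in> integer_lattice \<and> x = b + of_nat m *\<^sub>R v" if x: "x \<in> integer_lattice" for x :: "real ^ 'n"
  proof -
    have "\<forall>i. \<exists>k. x $ i = of_int k" using x by (auto simp: integer_lattice_def elim: Ints_cases)
    then obtain z :: "'n \<Rightarrow> int" where z: "\<And>i. x $ i = of_int (z i)" by metis
    define b v where "b = (\<chi> i. real_of_int (z i mod int m))" and "v = (\<chi> i. real_of_int (z i div int m))"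
    have "x $ i = b $ i + m * v $ i" for i
    proof -
      have "z i = z i mod int m + int m * (z i div int m)" by simp
      then show ?thesis unfolding z b_def v_def by (metis of_int_add of_int_mult of_int_of_nat_eq vec_lambda_beta)
    qed
    then have "x = b + of_nat m *\<^sub>R v" by (simp add: vec_eq_iff)
    moreover have "b \<in> B"
      unfolding B_def b_def using m by (auto intro!: exI[of _ "nat (z _ mod int m)"] simp: nat_less_iff)
    moreover have "v \<in> integer_lattice" by (simp add: v_def integer_lattice_def)
    ultimately show ?thesis by blast
  qed
  define R :: "(real ^ 'n \<Rightarrow> real ^ 'n) \<Rightarrow> (real ^ 'n) set" where "R f = {x \<in> integer_lattice. f x \<in> A}" for f
  have red: "f (b + of_nat m *\<^sub>R v) \<in> A \<longleftrightarrow> f b \<in> A"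
    if f: "f \<in> aut_lattice" and b: "b \<in> integer_lattice" and v: "v \<in> integer_lattice"
    for f :: "real ^ 'n \<Rightarrow> real ^ 'n" and b v
  proof -
    obtain Q where Q: "orthogonal_transformation Q" "\<And>x. f x = Q x + f 0"
      using isometry_affine[of f] f by (auto simp: aut_lattice_def)
    have lin: "linear Q" using Q(1) by (rule orthogonal_transformation_linear)
    have fl: "x \<in> integer_lattice \<Longrightarrow> f x \<in> integer_lattice" for x
      using f by (auto simp: aut_lattice_def)
    have "Q v = f v - f 0" using Q(2)[of v] by simp
    then have Qv: "Q v \<in> integer_lattice" using fl v by (simp add: lattice_diff lattice_zero)
    have "f (b + of_nat m *\<^sub>R v) = f b + of_nat m *\<^sub>R Q v"
      using Q(2)[of "b + _"] Q(2)[of b] by (simp add: linear_add[OF lin] linear_scale[OF lin])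
    then show ?thesis using per[OF fl[OF b] Qv] by simp
  qed
  have BL: "B \<subseteq> integer_lattice" by (auto simp: B_def integer_lattice_def) (metis Ints_of_nat)
  have inj: "R f = R g" if fg: "f \<in> aut_lattice" "g \<in> aut_lattice" and e: "R f \<inter> B = R g \<inter> B"
    for f g :: "real ^ 'n \<Rightarrow> real ^ 'n"
  proof -
    have "f x \<in> A \<longleftrightarrow> g x \<in> A" if x: "x \<in> integer_lattice" for x :: "real ^ 'n"
    proof -
      obtain b v where b: "b \<in> B" "v \<in> integer_lattice" "x = b + of_nat m *\<^sub>R v" using split[OF x] by blast
      then have "b \<in> integer_lattice" using BL by blast
      moreover have "f b \<in> A \<longleftrightarrow> g b \<in> A" using e b(1) BL unfolding R_def by auto
      ultimately show ?thesis using red[OF fg(1), of b v] red[OF fg(2), of b v] b by simp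
    qed
    then show ?thesis by (auto simp: R_def)
  qed
  have "finite ((\<lambda>f. R f \<inter> B) ` aut_lattice)"
    by (rule finite_subset[of _ "Pow B"]) (use fB in auto)
  moreover have "finite ((\<lambda>f. R f \<inter> B) ` aut_lattice) \<longleftrightarrow> finite (R ` aut_lattice)"
    by (rule card_image_eq(2)) (use inj in auto)
  ultimately show ?thesis unfolding R_def by simp
qed

section \<open>Signed permutations and colourings of the cubic lattice\<close>

text \<open>One constructor serves integral points, real coordinates and, nested three times, the
  cubes of knowledge around a point.\<close>

datatype 'a tri = Tri 'a 'a 'a

instantiation tri :: (ab_group_add) ab_group_add
begin

fun plus_tri :: "'a tri \<Rightarrow> 'a tri \<Rightarrow> 'a tri" where
  "Tri x y z + Tri x' y' z' = Tri (x + x') (y + y') (z + z')"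

fun minus_tri :: "'a tri \<Rightarrow> 'a tri \<Rightarrow> 'a tri" where
  "Tri x y z - Tri x' y' z' = Tri (x - x') (y - y') (z - z')"

fun uminus_tri :: "'a tri \<Rightarrow> 'a tri" where
  "- Tri x y z = Tri (- x) (- y) (- z)"

definition zero_tri :: "'a tri" where
  "0 = Tri 0 0 0"

instance
proof
  fix p q r :: "'a tri"
  show "p + q + r = p + (q + r)" "p + q = q + p" "0 + p = p" "- p + p = 0" "p - q = p + - q"
    by (cases p; cases q; cases r; simp add: zero_tri_def algebra_simps)+
qed

end

type_synonym pt = "int tri"

datatype perm3 = XYZ | XZY | YXZ | YZX | ZXY | ZYX

fun permute :: "perm3 \<Rightarrow> 'a tri \<Rightarrow> 'a tri" where
  "permute XYZ (Tri x y z) = Tri x y z"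
| "permute XZY (Tri x y z) = Tri x z y"
| "permute YXZ (Tri x y z) = Tri y x z"
| "permute YZX (Tri x y z) = Tri y z x"
| "permute ZXY (Tri x y z) = Tri z x y"
| "permute ZYX (Tri x y z) = Tri z y x"

definition signed :: "bool \<Rightarrow> 'a \<Rightarrow> 'a :: group_add" where
  "signed s x = (if s then - x else x)"

datatype sperm = SP perm3 bool bool bool

fun act :: "sperm \<Rightarrow> 'a tri \<Rightarrow> ('a :: group_add) tri" where
  "act (SP \<pi> s t r) p = (case permute \<pi> p of Tri x y z \<Rightarrow> Tri (signed s x) (signed t y) (signed r z))"

definition perms3 :: "perm3 list" where
  "perms3 = [XYZ, XZY, YXZ, YZX, ZXY, ZYX]"

definition sperms :: "sperm list" where
  "sperms = [SP \<pi> s t r. \<pi> \<leftarrow> perms3, s \<leftarrow> [False, True], t \<leftarrow> [False, True], r \<leftarrow> [False, True]]"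

lemma set_sperms: "set sperms = UNIV"
proof -
  have "SP \<pi> s t r \<in> set sperms" for \<pi> s t r
    unfolding sperms_def perms3_def by (cases \<pi>; cases s; cases t; cases r; simp)
  then show ?thesis by (metis UNIV_eq_I sperm.exhaust)
qed

lemma finite_sperms: "finite (UNIV :: sperm set)"
  unfolding set_sperms[symmetric] by simp

lemma card_sperms: "card (UNIV :: sperm set) = 48"
  unfolding set_sperms[symmetric] by (subst distinct_card) (code_simp, code_simp)

lemma act_add: "act L (p + q) = act L p + act L (q :: 'a :: ab_group_add tri)"
proof (cases L)
  case (SP \<pi> s t r)
  then show ?thesis by (cases \<pi>; cases p; cases q; simp add: signed_def)
qed

lemma act_zero [simp]: "act L 0 = (0 :: 'a :: ab_group_add tri)"
  using act_add[of L 0 0] by simp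

lemma act_diff: "act L (p - q) = act L p - act L (q :: 'a :: ab_group_add tri)"
  using act_add[of L "p - q" q] by (simp add: algebra_simps)

section \<open>Signed permutations and integral motions as isometries of space\<close>

definition V :: "real tri \<Rightarrow> real ^ 3" where
  "V p = (case p of Tri x y z \<Rightarrow> vector [x, y, z])"

definition U :: "real ^ 3 \<Rightarrow> real tri" where
  "U v = Tri (v $ 1) (v $ 2) (v $ 3)"

definition emb :: "pt \<Rightarrow> real ^ 3" where
  "emb p = V (map_tri of_int p)"

lemma V_nth [simp]: "V (Tri x y z) $ 1 = x" "V (Tri x y z) $ 2 = y" "V (Tri x y z) $ 3 = z"
  by (simp_all add: V_def)

lemma UV [simp]: "U (V p) = p" by (cases p) (simp add: U_def)
lemma VU [simp]: "V (U v) = v" by (simp add: U_def vec_eq_iff forall_3)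
lemma U_add: "U (v + w) = U v + U w" by (simp add: U_def)
lemma U_diff: "U (v - w) = U v - U w" by (simp add: U_def)
lemma V_add: "V (p + q) = V p + V q" by (metis UV U_add VU)
lemma V_diff: "V (p - q) = V p - V q" by (metis UV U_diff VU)
lemma V_inj: "V p = V q \<longleftrightarrow> p = q" by (metis UV)
lemma emb_add: "emb (p + q) = emb p + emb q"
  by (cases p; cases q) (simp add: emb_def flip: V_add)
lemma emb_diff: "emb (p - q) = emb p - emb q"
  by (cases p; cases q) (simp add: emb_def flip: V_diff)
lemma emb_act: "emb (act L p) = V (act L (U (emb p)))"
proof (cases L)
  case (SP \<pi> s t r)
  then show ?thesis by (cases \<pi>; cases p; simp add: signed_def emb_def)
qed
lemma emb_inj [simp]: "emb p = emb q \<longleftrightarrow> p = q"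
  by (cases p; cases q) (simp add: emb_def V_inj)
lemma emb_0: "emb 0 = 0" using emb_add[of 0 0] by simp

lemma range_emb: "range emb = integer_lattice"
proof
  have "emb (Tri x y z) \<in> integer_lattice" for x y z
    by (simp add: integer_lattice_def emb_def forall_3)
  then show "range emb \<subseteq> integer_lattice" by (metis image_subset_iff tri.exhaust)
  show "integer_lattice \<subseteq> range emb"
  proof
    fix v :: "real ^ 3" assume "v \<in> integer_lattice"
    then have "v $ 1 \<in> \<int>" "v $ 2 \<in> \<int>" "v $ 3 \<in> \<int>" by (simp_all add: integer_lattice_def)
    then obtain x y z where "v $ 1 = of_int x" "v $ 2 = of_int y" "v $ 3 = of_int z"
      by (elim Ints_cases)
    then have "v = emb (Tri x y z)" by (simp add: emb_def vec_eq_iff forall_3)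
    then show "v \<in> range emb" by blast
  qed
qed

datatype motion = Motion sperm pt

fun mov :: "motion \<Rightarrow> pt \<Rightarrow> pt" where
  "mov (Motion L t) p = act L p + t"

fun rmov :: "motion \<Rightarrow> real ^ 3 \<Rightarrow> real ^ 3" where
  "rmov (Motion L t) v = V (act L (U v)) + emb t"

lemma rmov_emb: "rmov g (emb p) = emb (mov g p)"
  by (cases g) (simp add: emb_add emb_act)

lemma norm_V: "norm (V (Tri x y z)) = sqrt (x\<^sup>2 + y\<^sup>2 + z\<^sup>2)"
  by (simp add: norm_eq_sqrt_inner inner_vec_def sum_3 power2_eq_square)

lemma norm_act: "norm (V (act L p)) = norm (V p)"
proof (cases L)
  case (SP \<pi> s t r)
  then show ?thesis by (cases \<pi>; cases p; simp add: signed_def norm_V add_ac)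
qed

lemma rmov_isometry: "isometry (rmov g)"
  unfolding isometry_def dist_norm
proof (intro allI)
  fix v w
  obtain L t where g: "g = Motion L t" by (cases g)
  have "rmov g v - rmov g w = V (act L (U (v - w)))"
    by (simp add: g U_diff act_diff V_diff)
  then show "norm (rmov g v - rmov g w) = norm (v - w)" by (simp add: norm_act)
qed

lemma act_surj: "\<exists>q. act L q = (p :: 'a :: ab_group_add tri)"
proof -
  obtain \<pi> s t r where L: "L = SP \<pi> s t r" by (cases L)
  obtain x y z where p: "p = Tri x y z" by (cases p)
  have *: "signed b (signed b u) = u" for b and u :: 'a by (simp add: signed_def)
  obtain q where "permute \<pi> q = Tri (signed s x) (signed t y) (signed r z)"
    by (cases \<pi>) (metis permute.simps)+
  then have "act L q = p" by (simp add: L p *)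
  then show ?thesis ..
qed

lemma mov_surj: "\<exists>p. mov g p = q"
proof (cases g)
  case (Motion L t)
  obtain p where "act L p = q - t" using act_surj by blast
  then show ?thesis by (intro exI[of _ p]) (simp add: Motion)
qed

lemma rmov_aut: "rmov g \<in> aut_lattice"
  unfolding aut_lattice_def range_emb[symmetric]
proof (intro CollectI conjI rmov_isometry)
  have "range (mov g) = UNIV" using mov_surj[of g] by (metis surj_def)
  moreover have "rmov g ` range emb = emb ` range (mov g)" by (simp add: image_image rmov_emb)
  ultimately show "rmov g ` range emb = range emb" by simp
qed

definition units :: "pt list" where
  "units = [Tri 1 0 0, Tri (-1) 0 0, Tri 0 1 0, Tri 0 (-1) 0, Tri 0 0 1, Tri 0 0 (-1)]"

lemma int_unit_vector:
  assumes "(x::int)\<^sup>2 + y\<^sup>2 + z\<^sup>2 = 1" shows "Tri x y z \<in> set units"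
proof -
  have "x\<^sup>2 \<le> 1" "y\<^sup>2 \<le> 1" "z\<^sup>2 \<le> 1"
    using assms zero_le_power2[of x] zero_le_power2[of y] zero_le_power2[of z] by linarith+
  then have "\<bar>x\<bar> \<le> 1" "\<bar>y\<bar> \<le> 1" "\<bar>z\<bar> \<le> 1" by (simp_all add: abs_square_le_1)
  then have "x \<in> {-1, 0, 1}" "y \<in> {-1, 0, 1}" "z \<in> {-1, 0, 1}" by fastforce+
  then show ?thesis using assms unfolding units_def by (elim insertE; simp)
qed

fun idot :: "pt \<Rightarrow> pt \<Rightarrow> int" where
  "idot (Tri x y z) (Tri u v w) = x * u + y * v + z * w"

lemma orthogonal_units:
  "\<forall>a\<in>set units. \<forall>b\<in>set units. \<forall>c\<in>set units. idot a b = 0 \<and> idot a c = 0 \<and> idot b c = 0 \<longrightarrow>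
     (\<exists>L\<in>set sperms. act L (Tri 1 0 0) = a \<and> act L (Tri 0 1 0) = b \<and> act L (Tri 0 0 1) = c)"
  by code_simp

lemma inner_emb: "emb p \<bullet> emb q = of_int (idot p q)"
  by (cases p; cases q) (simp add: emb_def inner_vec_def sum_3)

lemma V_decomp: "V (Tri x y z) = x *\<^sub>R emb (Tri 1 0 0) + y *\<^sub>R emb (Tri 0 1 0) + z *\<^sub>R emb (Tri 0 0 1)"
  by (simp add: emb_def vec_eq_iff forall_3)

text \<open>The linear part sends the three unit vectors to integral orthonormal vectors. Those are
  signed unit vectors, and each orthogonal triple of them comes from a signed permutation, which
  \<open>orthogonal_units\<close> verifies by evaluation.\<close>

lemma aut_lattice_eq: "(aut_lattice :: (real ^ 3 \<Rightarrow> real ^ 3) set) = range rmov"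
proof
  show "range rmov \<subseteq> aut_lattice" using rmov_aut by blast
  show "aut_lattice \<subseteq> range rmov"
  proof
    fix f :: "real ^ 3 \<Rightarrow> real ^ 3" assume f: "f \<in> aut_lattice"
    then obtain Q where Q: "orthogonal_transformation Q" "\<And>x. f x = Q x + f 0"
      using isometry_affine[of f] by (auto simp: aut_lattice_def)
    have lin: "linear Q" using Q(1) by (rule orthogonal_transformation_linear)
    have fl: "f (emb p) \<in> range emb" for p
      using f unfolding aut_lattice_def range_emb by (auto simp flip: range_emb)
    obtain t where t: "f 0 = emb t" using fl[of 0] by (auto simp: emb_0)
    have Qe: "Q (emb p) \<in> range emb" for p
    proof -
      have "Q (emb p) = f (emb p) - f 0" using Q(2)[of "emb p"] by simp
      then show ?thesis using fl[of p] t by (auto simp flip: emb_diff)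
    qed
    obtain a b c where abc: "Q (emb (Tri 1 0 0)) = emb a" "Q (emb (Tri 0 1 0)) = emb b" "Q (emb (Tri 0 0 1)) = emb c"
      using Qe[of "Tri 1 0 0"] Qe[of "Tri 0 1 0"] Qe[of "Tri 0 0 1"] by auto
    have Qin: "Q v \<bullet> Q w = v \<bullet> w" for v w using Q(1) by (simp add: orthogonal_transformation_def)
    have n: "idot p p = 1 \<Longrightarrow> p \<in> set units" for p
      using int_unit_vector by (cases p) (simp add: power2_eq_square)
    have "real_of_int (idot a a) = 1" "real_of_int (idot b b) = 1" "real_of_int (idot c c) = 1"
      "real_of_int (idot a b) = 0" "real_of_int (idot a c) = 0" "real_of_int (idot b c) = 0"
      unfolding inner_emb[symmetric] abc[symmetric] Qin unfolding inner_emb by auto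
    then have "a \<in> set units" "b \<in> set units" "c \<in> set units" "idot a b = 0" "idot a c = 0" "idot b c = 0"
      using n by auto
    then obtain L where L: "act L (Tri 1 0 0) = a" "act L (Tri 0 1 0) = b" "act L (Tri 0 0 1) = c"
      using orthogonal_units by blast
    define R where "R v = V (act L (U v))" for v
    have Remb: "R (emb p) = emb (act L p)" for p by (simp add: R_def emb_act)
    have sc: "act L (map_tri (times x) p) = map_tri (times x) (act L p)" for x :: real and p
    proof (cases L)
      case (SP \<pi> s t r)
      then show ?thesis by (cases \<pi>; cases p; simp add: signed_def)
    qed
    have Rlin: "linear R"
    proof (rule linearI)
      show "R (v + w) = R v + R w" for v w by (simp add: R_def U_add act_add V_add)
      have "U (x *\<^sub>R v) = map_tri (times x) (U v)" "V (map_tri (times x) p) = x *\<^sub>R V p" for x v p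
        by (simp add: U_def) (cases p; simp add: vec_eq_iff forall_3)
      then show "R (x *\<^sub>R v) = x *\<^sub>R R v" for x v
        by (simp add: R_def sc)
    qed
    have "Q v = R v" for v
    proof -
      obtain x y z where v: "v = V (Tri x y z)" by (metis VU tri.exhaust)
      show ?thesis unfolding v V_decomp
        by (simp add: linear_add[OF lin] linear_add[OF Rlin] linear_scale[OF lin] linear_scale[OF Rlin] abc Remb L)
    qed
    then have "f = rmov (Motion L t)" using Q(2) t by (auto simp: fun_eq_iff R_def)
    then show "f \<in> range rmov" by blast
  qed
qed

text \<open>The composite is obtained from closure of \<open>aut_lattice\<close> under composition,
  which replaces a multiplication table of the 48 signed permutations.\<close>

lemma mov_comp: "\<exists>k. mov k = mov g \<circ> mov h \<and> rmov k = rmov g \<circ> rmov h"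
proof -
  have "rmov g \<circ> rmov h \<in> aut_lattice" by (simp add: aut_lattice_comp rmov_aut del: o_apply)
  then obtain k where k: "rmov g \<circ> rmov h = rmov k" by (auto simp: aut_lattice_eq simp del: o_apply)
  have "emb (mov k p) = emb (mov g (mov h p))" for p
    unfolding rmov_emb[symmetric] k[symmetric] by simp
  then show ?thesis using k by (intro exI[of _ k]) (auto simp: fun_eq_iff)
qed

lemma mov_inj: "inj (mov g)"
  by (rule injI) (metis emb_inj isometry_inj rmov_emb rmov_isometry inj_def)

lemma mov_bij: "bij (mov g)"
  unfolding bij_def surj_def using mov_inj mov_surj by metis

lemma mov_inverse: "\<exists>k. (\<forall>p. mov k (mov g p) = p) \<and> (\<forall>p. mov g (mov k p) = p) \<and> rmov k = inv_into UNIV (rmov g)"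
proof -
  have "inv_into UNIV (rmov g) \<in> aut_lattice" by (simp add: aut_lattice_inv rmov_aut)
  then obtain k where k: "inv_into UNIV (rmov g) = rmov k" by (auto simp: aut_lattice_eq)
  have b: "bij (rmov g)" by (simp add: isometry_bij rmov_isometry)
  have "emb (mov k (mov g p)) = emb p" "emb (mov g (mov k p)) = emb p" for p
    unfolding rmov_emb[symmetric] k[symmetric] using b
    by (simp_all add: bij_is_inj bij_is_surj surj_f_inv_f)
  then show ?thesis using k by (intro exI[of _ k]) auto
qed

lemma act_comp: "\<exists>K. \<forall>p. act K p = act L (act L' (p :: pt))"
proof -
  obtain k where k: "mov k = mov (Motion L 0) \<circ> mov (Motion L' 0)" using mov_comp by blast
  obtain K t where K: "k = Motion K t" by (cases k)
  have "t = 0" using fun_cong[OF k, of 0] K by simp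
  then have "act K p = act L (act L' p)" for p :: pt using fun_cong[OF k, of p] K by simp
  then show ?thesis by blast
qed

lemma act_inverse: "\<exists>K. (\<forall>p. act K (act L p) = (p :: pt)) \<and> (\<forall>p. act L (act K p) = (p :: pt))"
proof -
  obtain k where k: "\<And>p. mov k (mov (Motion L 0) p) = p" "\<And>p. mov (Motion L 0) (mov k p) = p" using mov_inverse by blast
  obtain K t where K: "k = Motion K t" by (cases k)
  have "t = 0" using k(1)[of 0] K by simp
  then have 1: "act K (act L p) = p" and 2: "act L (act K p) = p" for p :: pt
    using k(1)[of p] k(2)[of p] K by simp_all
  show ?thesis by (intro exI[of _ K] conjI allI 1 2)
qed

lemma mov_translation: "mov (Motion (SP XYZ False False False) t) p = p + t"
  by (cases p) (simp add: signed_def)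

section \<open>Orbit partitions as colourings by two colours\<close>

type_synonym colouring = "pt \<Rightarrow> bool"

definition symm :: "colouring \<Rightarrow> motion set" where
  "symm c = {g. \<forall>p. c (mov g p) = c p}"

text \<open>Transitivity is demanded of the full symmetry group instead of some subgroup whose
  orbits are the colour classes; this is implied, since a larger group of symmetries has the same
  orbits.\<close>

definition two_orbit :: "colouring \<Rightarrow> bool" where
  "two_orbit c \<longleftrightarrow> (\<exists>p. c p) \<and> (\<exists>p. \<not> c p) \<and>
     (\<forall>p q. c p = c q \<longrightarrow> (\<exists>g\<in>symm c. mov g p = q))"

definition bipart :: "colouring \<Rightarrow> (real ^ 3) set set" where
  "bipart c = {emb ` {p. \<not> c p}, emb ` {p. c p}}"

definition proper :: "colouring \<Rightarrow> bool" where
  "proper c \<longleftrightarrow> (\<exists>p. c p) \<and> (\<exists>p. \<not> c p)"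

lemma two_orbit_proper: "two_orbit c \<Longrightarrow> proper c"
  by (auto simp: two_orbit_def proper_def)

lemma emb_image_eq: "emb ` A = emb ` B \<longleftrightarrow> A = B"
  by (rule inj_image_eq_iff) (simp add: inj_def)

lemma mov_image_Collect: "mov g ` {p. c p} = {p. c' p} \<longleftrightarrow> (\<forall>p. c' (mov g p) = c p)"
proof
  assume e: "mov g ` {p. c p} = {p. c' p}"
  show "\<forall>p. c' (mov g p) = c p"
  proof
    fix p
    have "mov g p \<in> mov g ` {p. c p} \<longleftrightarrow> c p" using mov_inj by (auto simp: inj_def)
    then show "c' (mov g p) = c p" unfolding e by simp
  qed
next
  assume e: "\<forall>p. c' (mov g p) = c p"
  show "mov g ` {p. c p} = {p. c' p}"
  proof (intro equalityI subsetI)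
    fix q assume "q \<in> {p. c' p}"
    moreover obtain p where "mov g p = q" using mov_surj by blast
    ultimately show "q \<in> mov g ` {p. c p}" using e by auto
  qed (use e in auto)
qed

lemma rmov_image: "rmov g ` emb ` A = emb ` mov g ` A"
  by (simp add: image_image rmov_emb)

lemma aut_partition_bipart: "aut_partition (bipart c) = rmov ` symm c"
proof -
  have "rmov g \<in> aut_partition (bipart c) \<longleftrightarrow> g \<in> symm c" for g
    using mov_image_Collect[of g c c] mov_image_Collect[of g "\<lambda>p. \<not> c p" "\<lambda>p. \<not> c p"]
    by (simp add: aut_partition_def rmov_aut bipart_def rmov_image emb_image_eq symm_def)
  moreover have "aut_partition (bipart c) \<subseteq> range rmov"
    by (auto simp: aut_partition_def aut_lattice_eq)
  ultimately show ?thesis by auto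
qed

lemma sym_comp: "g \<in> symm c \<Longrightarrow> h \<in> symm c \<Longrightarrow> \<exists>k\<in>symm c. mov k = mov g \<circ> mov h"
  using mov_comp[of g h] by (auto simp: symm_def) (metis o_apply)

lemma sym_inverse: "g \<in> symm c \<Longrightarrow> \<exists>k\<in>symm c. (\<forall>p. mov k (mov g p) = p) \<and> (\<forall>p. mov g (mov k p) = p)"
  using mov_inverse[of g] by (auto simp: symm_def) metis

text \<open>The flag \<open>s\<close> exchanges the colours, because the classes of a partition
  carry no labels.\<close>

definition equiv_col :: "colouring \<Rightarrow> colouring \<Rightarrow> bool" where
  "equiv_col c c' \<longleftrightarrow> (\<exists>g s. \<forall>p. c p = (c' (mov g p) \<noteq> s))"

lemma bipart_equiv: "(bipart c, bipart c') \<in> partition_equiv \<longleftrightarrow> equiv_col c c'"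
proof -
  have "(\<lambda>X. rmov g ` X) ` bipart c = bipart c' \<longleftrightarrow> (\<exists>s. \<forall>p. c p = (c' (mov g p) \<noteq> s))" for g
  proof -
    have 1: "mov g ` {p. \<not> c p} = - (mov g ` {p. c p})"
      unfolding Collect_neg_eq by (rule bij_image_Compl_eq[OF mov_bij])
    have "(\<lambda>X. rmov g ` X) ` bipart c = bipart c' \<longleftrightarrow>
       {emb ` mov g ` {p. \<not> c p}, emb ` mov g ` {p. c p}} = {emb ` {p. \<not> c' p}, emb ` {p. c' p}}"
      by (simp add: bipart_def rmov_image)
    also have "\<dots> \<longleftrightarrow> mov g ` {p. c p} = {p. c' p} \<or> mov g ` {p. c p} = {p. \<not> c' p}"
      unfolding doubleton_eq_iff emb_image_eq 1 by auto
    also have "\<dots> \<longleftrightarrow> (\<exists>s. \<forall>p. c p = (c' (mov g p) \<noteq> s))"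
      unfolding mov_image_Collect ex_bool_eq by auto
    finally show ?thesis .
  qed
  then show ?thesis
    unfolding partition_equiv_def equiv_col_def aut_lattice_eq by auto
qed

lemma orbit_transf: "orbit (transf H) (\<lambda>f. f) x = (\<lambda>f. f x) ` H"
  by (auto simp: orbit_def)

text \<open>Each element of \<open>H\<close> preserves both orbits, so it is a symmetry of the
  colouring that marks one of them. Two points of a class are joined through the point
  \<open>y\<close> that generates this class as an orbit.\<close>

lemma two_orbit_if_orbit_partition:
  assumes "P \<in> orbit_partitions 2"
  shows "\<exists>c. two_orbit c \<and> P = bipart c"
proof -
  obtain H where P: "partition_on integer_lattice P" "card P = 2" and H: "subgroup H (transf aut_lattice)"
    "P = orbits (transf H) integer_lattice (\<lambda>f. f)"
    using assms by (auto simp: orbit_partitions_def)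
  have HA: "H \<subseteq> range rmov" using subgroup.subset[OF H(1)] by (simp add: aut_lattice_eq)
  obtain A B where AB: "P = {A, B}" "A \<noteq> B" using P(2) by (auto simp: card_2_iff)
  have un: "A \<union> B = range emb" "A \<inter> B = {}" "A \<noteq> {}" "B \<noteq> {}"
    using P(1) AB by (auto simp: partition_on_def disjoint_def range_emb)
  define c where "c p \<longleftrightarrow> emb p \<in> B" for p
  have A: "A = emb ` {p. \<not> c p}" and B: "B = emb ` {p. c p}" 
  proof -
    have "A = range emb - B" "B \<subseteq> range emb" using un by blast+
    then show "A = emb ` {p. \<not> c p}" "B = emb ` {p. c p}" by (auto simp: c_def)
  qed
  have orb: "P = (\<lambda>x. (\<lambda>f. f x) ` H) ` range emb"
    unfolding H(2) orbits_def orbit_transf range_emb by auto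
  have inv: "f x \<in> X \<longleftrightarrow> x \<in> X" if "f \<in> H" "X \<in> P" "x \<in> range emb" for f x X
  proof -
    have idH: "id \<in> H" using subgroup.one_closed[OF H(1)] by simp
    have O: "(\<lambda>f. f x) ` H \<in> P" using orb that(3) by simp
    have "f x \<in> (\<lambda>f. f x) ` H" "x \<in> (\<lambda>f. f x) ` H"
      using that(1) idH by (simp, metis id_apply imageI)
    moreover have "X = (\<lambda>f. f x) ` H \<or> X \<inter> (\<lambda>f. f x) ` H = {}"
    proof -
      have "\<forall>a\<in>P. \<forall>b\<in>P. a \<noteq> b \<longrightarrow> a \<inter> b = {}" using P(1) by (simp add: partition_on_def disjoint_def)
      then show ?thesis using O that(2) by metis
    qed
    ultimately show ?thesis by blast
  qed
  have "\<exists>g\<in>symm c. mov g p = q" if pq: "c p = c q" for p q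
  proof -
    obtain X where X: "X \<in> P" "emb p \<in> X" "emb q \<in> X"
      using pq AB(1) unfolding A B by (cases "c p") auto
    obtain y where y: "X = (\<lambda>f. f (emb y)) ` H" using X(1) orb by blast
    obtain f h where f: "f \<in> H" "f (emb y) = emb p" and h: "h \<in> H" "h (emb y) = emb q" using X y by auto
    obtain g k where g: "f = rmov g" "h = rmov k" using f(1) h(1) HA by blast
    have gs: "k \<in> symm c" if "rmov k \<in> H" for k
      unfolding symm_def c_def using inv[OF that, of B] AB(1) by (simp flip: rmov_emb)
    have gy: "mov g y = p" "mov k y = q" using f h g by (simp_all add: rmov_emb)
    obtain g' where g': "g' \<in> symm c" "\<forall>p. mov g' (mov g p) = p"
      using sym_inverse[OF gs[of g]] f g by auto
    obtain l where "l \<in> symm c" "mov l = mov k \<circ> mov g'" using sym_comp[OF gs[of k] g'(1)] h g by auto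
    then show ?thesis using g'(2) gy by (intro bexI[of _ l]) auto
  qed
  then have "two_orbit c" using un A B unfolding two_orbit_def by blast
  then show ?thesis using AB(1) A B unfolding bipart_def by auto
qed

section \<open>Periodic colourings and the index of their symmetry groups\<close>

definition periodic :: "nat \<Rightarrow> colouring \<Rightarrow> bool" where
  "periodic m c \<longleftrightarrow> m > 0 \<and> (\<forall>x y z i j k. c (Tri (x + int m * i) (y + int m * j) (z + int m * k)) = c (Tri x y z))"

text \<open>A right coset of the symmetry group consists of the motions with the same pulled-back
  colouring, so the index is the number of different \<open>c \<circ> mov g\<close>.\<close>

lemma rcos_sym_iff:
  assumes "f = rmov g" "h = rmov k"
  shows "aut_partition (bipart c) #>\<^bsub>transf aut_lattice\<^esub> f = aut_partition (bipart c) #>\<^bsub>transf aut_lattice\<^esub> h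
    \<longleftrightarrow> c \<circ> mov g = c \<circ> mov k"
proof -
  obtain k' where k': "\<And>p. mov k' (mov k p) = p" "\<And>p. mov k (mov k' p) = p" "rmov k' = inv_into UNIV (rmov k)"
    using mov_inverse by blast
  obtain l where l: "mov l = mov g \<circ> mov k'" "rmov l = rmov g \<circ> rmov k'" using mov_comp by blast
  have "aut_partition (bipart c) #>\<^bsub>transf aut_lattice\<^esub> f = aut_partition (bipart c) #>\<^bsub>transf aut_lattice\<^esub> h
    \<longleftrightarrow> rmov l \<in> aut_partition (bipart c)"
    by (simp add: assms rcos_eq_iff aut_lattice_group aut_partition_subgroup rmov_aut aut_lattice_m_inv l k'(3) del: o_apply)
  also have "\<dots> \<longleftrightarrow> l \<in> symm c"
    using mov_image_Collect[of l c c] mov_image_Collect[of l "\<lambda>p. \<not> c p" "\<lambda>p. \<not> c p"]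
    by (simp add: aut_partition_def rmov_aut bipart_def rmov_image emb_image_eq symm_def)
  also have "\<dots> \<longleftrightarrow> c \<circ> mov g = c \<circ> mov k"
    unfolding symm_def l fun_eq_iff o_apply mem_Collect_eq using k' by metis
  finally show ?thesis .
qed

lemma aut_index_bipart: "aut_index (bipart c) = card (range (\<lambda>g. c \<circ> mov g))"
  and finite_index_bipart: "finite (rcosets\<^bsub>transf aut_lattice\<^esub> (aut_partition (bipart c))) \<longleftrightarrow> finite (range (\<lambda>g. c \<circ> mov g))"
proof -
  have "rcosets\<^bsub>transf aut_lattice\<^esub> (aut_partition (bipart c)) =
      (\<lambda>g. aut_partition (bipart c) #>\<^bsub>transf aut_lattice\<^esub> rmov g) ` UNIV"
    unfolding rcosets_image by (simp add: aut_lattice_eq image_image)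
  then show "aut_index (bipart c) = card (range (\<lambda>g. c \<circ> mov g))"
   "finite (rcosets\<^bsub>transf aut_lattice\<^esub> (aut_partition (bipart c))) \<longleftrightarrow> finite (range (\<lambda>g. c \<circ> mov g))"
    unfolding aut_index_def using card_image_eq[of UNIV "\<lambda>g. aut_partition (bipart c) #>\<^bsub>transf aut_lattice\<^esub> rmov g" "\<lambda>g. c \<circ> mov g"] rcos_sym_iff by simp_all
qed


text \<open>The witness for the subgroup is the whole group \<open>aut_partition (bipart c)\<close>;
  by \<open>two_orbit\<close> its orbits are exactly the colour classes.\<close>

lemma bipart_in_orbit_partitions:
  assumes c: "two_orbit c" and fin: "finite (range (\<lambda>g. c \<circ> mov g))"
  shows "bipart c \<in> orbit_partitions 2"
proof -
  have pr: "\<exists>p. c p" "\<exists>p. \<not> c p" using c by (auto simp: two_orbit_def)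
  have ne: "emb ` {p. \<not> c p} \<noteq> emb ` {p. c p}" unfolding emb_image_eq using pr by auto
  have part: "partition_on integer_lattice (bipart c)"
    unfolding partition_on_def disjoint_def bipart_def range_emb[symmetric] using pr by auto
  have orb: "(\<lambda>f. f (emb p)) ` rmov ` symm c = emb ` {q. c q = c p}" for p
  proof -
    have "(\<lambda>g. mov g p) ` symm c = {q. c q = c p}"
    proof (intro equalityI subsetI)
      fix q assume "q \<in> {q. c q = c p}"
      then obtain g where "g \<in> symm c" "mov g p = q" using c unfolding two_orbit_def by (metis mem_Collect_eq)
      then show "q \<in> (\<lambda>g. mov g p) ` symm c" by blast
    qed (auto simp: symm_def)
    moreover have "(\<lambda>f. f (emb p)) ` rmov ` symm c = emb ` (\<lambda>g. mov g p) ` symm c"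
      by (simp add: image_image rmov_emb)
    ultimately show ?thesis by simp
  qed
  have "orbits (transf (aut_partition (bipart c))) integer_lattice (\<lambda>f. f) =
      (\<lambda>x. (\<lambda>f. f x) ` aut_partition (bipart c)) ` range emb"
    unfolding orbits_def orbit_transf range_emb by auto
  also have "\<dots> = (\<lambda>p. emb ` {q. c q = c p}) ` UNIV"
    unfolding aut_partition_bipart image_image[of _ emb] orb ..
  also have "\<dots> = bipart c"
  proof -
    have "emb ` {q. c q = c p} = (if c p then emb ` {p. c p} else emb ` {p. \<not> c p})" for p by simp
    then show ?thesis unfolding bipart_def using pr by auto
  qed
  finally have "bipart c = orbits (transf (aut_partition (bipart c))) integer_lattice (\<lambda>f. f)" ..
  moreover have "card (bipart c) = 2" using ne by (simp add: bipart_def)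
  ultimately show ?thesis
    unfolding orbit_partitions_def using part aut_partition_subgroup fin finite_index_bipart[of c] by auto
qed

lemma finite_orbit_periodic:
  assumes "periodic m c"
  shows "finite (range (\<lambda>g. c \<circ> mov g))"
proof -
  have m: "m > 0" using assms by (simp add: periodic_def)
  have "finite ((\<lambda>f. {x \<in> integer_lattice. f x \<in> emb ` {p. c p}}) ` (aut_lattice :: (real ^ 3 \<Rightarrow> real ^ 3) set))"
  proof (rule finite_pullbacks[OF m])
    fix x v :: "real ^ 3" assume "x \<in> integer_lattice" "v \<in> integer_lattice"
    then obtain p q where pq: "x = emb p" "v = emb q" unfolding range_emb[symmetric] by auto
    obtain a b d i j k where abc: "p = Tri a b d" "q = Tri i j k" by (cases p; cases q)
    have "x + of_nat m *\<^sub>R v = emb (Tri (a + int m * i) (b + int m * j) (d + int m * k))"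
      by (simp add: pq abc emb_def vec_eq_iff forall_3)
    then show "x + of_nat m *\<^sub>R v \<in> emb ` {p. c p} \<longleftrightarrow> x \<in> emb ` {p. c p}"
      using assms by (auto simp: pq abc periodic_def inj_image_mem_iff inj_def)
  qed
  then have "finite (range (\<lambda>g. {x \<in> integer_lattice. rmov g x \<in> emb ` {p. c p}}))"
    by (simp add: aut_lattice_eq image_image)
  moreover have "{x \<in> integer_lattice. rmov g x \<in> emb ` {p. c p}} = emb ` {p. c (mov g p)}" for g
    unfolding range_emb[symmetric] by (auto simp: rmov_emb inj_image_mem_iff inj_def)
  ultimately have "finite (range (\<lambda>g. emb ` {p. c (mov g p)}))" by simp
  moreover have "emb ` {p. c (mov g p)} = emb ` {p. c (mov h p)} \<longleftrightarrow> c \<circ> mov g = c \<circ> mov h" for g h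
    unfolding emb_image_eq by (auto simp: fun_eq_iff)
  ultimately show ?thesis using card_image_eq(2)[of UNIV "\<lambda>g. emb ` {p. c (mov g p)}" "\<lambda>g. c \<circ> mov g"] by simp
qed

section \<open>The translation subgroup and the point group\<close>

abbreviation shift :: "pt \<Rightarrow> motion" where
  "shift t \<equiv> Motion (SP XYZ False False False) t"

lemma rmov_shift: "rmov (shift t) v = v + emb t"
proof -
  have "V (act (SP XYZ False False False) p) = V p" for p :: "real tri"
    by (cases p) (simp add: signed_def)
  then show ?thesis by simp
qed

lemma translation_in_aut: "aut_lattice \<inter> translation_maps = range (\<lambda>t. rmov (shift t))"
proof (intro equalityI subsetI)
  fix f assume f: "f \<in> aut_lattice \<inter> (translation_maps :: (real ^ 3 \<Rightarrow> real ^ 3) set)"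
  then obtain v where v: "f = (\<lambda>x. x + v)" by (auto simp: translation_maps_def)
  have "f (emb 0) \<in> range emb" using f unfolding range_emb aut_lattice_def by (auto simp flip: range_emb)
  then obtain t where "v = emb t" by (auto simp: v emb_0)
  then have "f = rmov (shift t)" unfolding v by (rule_tac ext) (simp add: rmov_shift del: rmov.simps)
  then show "f \<in> range (\<lambda>t. rmov (shift t))" by blast
next
  fix f assume "f \<in> range (\<lambda>t. rmov (shift t))"
  then obtain t where "f = rmov (shift t)" by blast
  moreover have "rmov (shift t) \<in> translation_maps" unfolding translation_maps_def
    by (auto simp: rmov_shift fun_eq_iff simp del: rmov.simps)
  ultimately show "f \<in> aut_lattice \<inter> translation_maps" by (simp add: rmov_aut del: rmov.simps)
qed

lemma rmov_shift_inv: "inv_into UNIV (rmov (shift t)) = rmov (shift (- t))"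
  by (rule inv_equality) (simp_all add: rmov_shift flip: emb_add add.assoc del: rmov.simps, simp_all add: add.assoc emb_0 flip: emb_add)

lemma translations_group: "group (transf (aut_lattice \<inter> translation_maps :: (real ^ 3 \<Rightarrow> real ^ 3) set))"
proof (rule transf_group)
  show "id \<in> aut_lattice \<inter> (translation_maps :: (real ^ 3 \<Rightarrow> real ^ 3) set)"
    by (auto simp: aut_lattice_id translation_maps_def fun_eq_iff intro: exI[of _ 0])
  fix f g :: "real ^ 3 \<Rightarrow> real ^ 3"
  assume f: "f \<in> aut_lattice \<inter> translation_maps"
  then show "bij f \<and> inv_into UNIV f \<in> aut_lattice \<inter> translation_maps"
    unfolding translation_in_aut by (auto simp: rmov_shift_inv isometry_bij rmov_isometry simp del: rmov.simps)
  assume "g \<in> aut_lattice \<inter> translation_maps"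
  then show "f \<circ> g \<in> aut_lattice \<inter> translation_maps"
    using f by (auto simp: aut_lattice_comp translation_maps_def fun_eq_iff add.assoc simp del: o_apply) (auto simp: add.assoc)
qed

lemma rmov_in_aut_bipart: "rmov l \<in> aut_partition (bipart c) \<longleftrightarrow> l \<in> symm c"
  using mov_image_Collect[of l c c] mov_image_Collect[of l "\<lambda>p. \<not> c p" "\<lambda>p. \<not> c p"]
  by (simp add: aut_partition_def rmov_aut bipart_def rmov_image emb_image_eq symm_def)

text \<open>The argument for the full index, repeated inside the group of translations: cosets
  correspond to the different translates of the colouring.\<close>

lemma translation_index_bipart:
  "translation_index (bipart c) = card (range (\<lambda>t. c \<circ> mov (shift t)))"
proof -
  let ?T = "aut_lattice \<inter> (translation_maps :: (real ^ 3 \<Rightarrow> real ^ 3) set)"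
  let ?H = "aut_partition (bipart c) \<inter> translation_maps"
  have HT: "?H \<subseteq> ?T" by (auto simp: aut_partition_def)
  have sub: "subgroup ?H (transf ?T)"
  proof (rule subgroup_transfI[OF translations_group HT])
    show "id \<in> ?H" using aut_partition_subgroup[of "bipart c"] subgroup.one_closed
      by (fastforce simp: translation_maps_def fun_eq_iff intro: exI[of _ 0])
    fix f g assume f: "f \<in> ?H"
    then have "f \<in> ?T" using HT by blast
    then have "inv_into UNIV f \<in> ?T" "bij f"
      using translation_in_aut by (auto simp: rmov_shift_inv isometry_bij rmov_isometry simp del: rmov.simps)
    moreover have "inv_into UNIV f \<in> aut_partition (bipart c)"
      using subgroup.m_inv_closed[OF aut_partition_subgroup, of f] f aut_lattice_m_inv[of f] by (auto simp: aut_partition_def)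
    ultimately show "bij f \<and> inv_into UNIV f \<in> ?H" by blast
    assume g: "g \<in> ?H"
    have "f \<circ> g \<in> aut_partition (bipart c)"
      using subgroup.m_closed[OF aut_partition_subgroup, of f "bipart c" g] f g by simp
    moreover have "f \<circ> g \<in> translation_maps"
      using f g by (auto simp: translation_maps_def fun_eq_iff add.assoc)
    ultimately show "f \<circ> g \<in> ?H" by blast
  qed
  have "?H #>\<^bsub>transf ?T\<^esub> rmov (shift s) = ?H #>\<^bsub>transf ?T\<^esub> rmov (shift t) \<longleftrightarrow> c \<circ> mov (shift s) = c \<circ> mov (shift t)" for s t
  proof -
    have in_T: "rmov (shift u) \<in> ?T" for u using translation_in_aut by blast
    have *: "inv\<^bsub>transf ?T\<^esub> (rmov (shift t)) = rmov (shift (- t))"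
      using transf_inv[OF translations_group in_T, of t] in_T[of "- t"]
      by (simp add: rmov_shift_inv isometry_bij rmov_isometry del: rmov.simps)
    have **: "rmov (shift s) \<circ> rmov (shift (- t)) = rmov (shift (s - t))"
    proof -
      have "emb (s - t) = emb (- t) + emb s" by (simp flip: emb_add)
      then show ?thesis by (intro ext) (simp add: rmov_shift add.assoc del: rmov.simps)
    qed
    have "?H #>\<^bsub>transf ?T\<^esub> rmov (shift s) = ?H #>\<^bsub>transf ?T\<^esub> rmov (shift t) \<longleftrightarrow> rmov (shift (s - t)) \<in> ?H"
      using rcos_eq_iff[OF translations_group sub, of "rmov (shift s)" "rmov (shift t)"] in_T * ** by (simp del: rmov.simps)
    also have "\<dots> \<longleftrightarrow> shift (s - t) \<in> symm c" using in_T by (simp add: rmov_in_aut_bipart del: rmov.simps)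
    also have "\<dots> \<longleftrightarrow> c \<circ> mov (shift s) = c \<circ> mov (shift t)"
    proof
      assume "shift (s - t) \<in> symm c"
      then have "c (p + t + (s - t)) = c (p + t)" for p
        unfolding symm_def mem_Collect_eq mov_translation by blast
      then show "c \<circ> mov (shift s) = c \<circ> mov (shift t)" unfolding fun_eq_iff o_apply mov_translation by simp
    next
      assume "c \<circ> mov (shift s) = c \<circ> mov (shift t)"
      then have "c (p - t + s) = c (p - t + t)" for p
        unfolding fun_eq_iff o_apply mov_translation by blast
      then show "shift (s - t) \<in> symm c"
        unfolding symm_def mem_Collect_eq mov_translation by (simp add: diff_add_eq add_diff_eq)
    qed
    finally show ?thesis .
  qed
  then have "card ((\<lambda>t. ?H #>\<^bsub>transf ?T\<^esub> rmov (shift t)) ` UNIV) = card (range (\<lambda>t. c \<circ> mov (shift t)))"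
    by (intro card_image_eq(1)) blast
  moreover have "Q ` ?T = (\<lambda>t. Q (rmov (shift t))) ` UNIV" for Q :: "(real ^ 3 \<Rightarrow> real ^ 3) \<Rightarrow> (real ^ 3 \<Rightarrow> real ^ 3) set"
    unfolding translation_in_aut image_image ..
  ultimately show ?thesis
    unfolding translation_index_def rcosets_image transf_simps by simp
qed

fun linear_part :: "motion \<Rightarrow> sperm" where
  "linear_part (Motion L t) = L"

text \<open>The coordinates 1, 2, 3 are nonzero and have different absolute values, so this single
  vector has 48 different images and identifies the signed permutation.\<close>

lemma act_eqD: "act L (Tri 1 2 (3::int)) = act L' (Tri 1 2 3) \<Longrightarrow> L = L'"
proof -
  assume e: "act L (Tri 1 2 (3::int)) = act L' (Tri 1 2 3)"
  obtain \<pi> s t r \<pi>' s' t' r' where L: "L = SP \<pi> s t r" "L' = SP \<pi>' s' t' r'" by (cases L; cases L')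
  show ?thesis using e unfolding L
    by (cases \<pi>; cases \<pi>'; simp add: signed_def split: if_splits)
qed

lemma aut_partition_group: "group (transf (aut_partition P))"
proof (rule transf_group)
  fix f g assume f: "f \<in> aut_partition P"
  then have fa: "f \<in> aut_lattice" by (simp add: aut_partition_def)
  then show "bij f \<and> inv_into UNIV f \<in> aut_partition P"
    using subgroup.m_inv_closed[OF aut_partition_subgroup f] by (simp add: aut_lattice_m_inv aut_lattice_bij)
  assume g: "g \<in> aut_partition P"
  show "f \<circ> g \<in> aut_partition P"
    using subgroup.m_closed[OF aut_partition_subgroup f g] by (simp del: o_apply)
next
  show "id \<in> aut_partition P" using subgroup.one_closed[OF aut_partition_subgroup] by simp
qed

lemma comp_inv_translation:
  "rmov g \<circ> inv_into UNIV (rmov h) \<in> translation_maps \<longleftrightarrow> linear_part g = linear_part h"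
proof (cases g; cases h)
  fix L s L' s' assume g: "g = Motion L s" and h: "h = Motion L' s'"
  have b: "bij (rmov h)" by (simp add: isometry_bij rmov_isometry)
  show ?thesis
  proof
    assume "linear_part g = linear_part h"
    then have "rmov g x = rmov h x + emb (s - s')" for x by (simp add: g h emb_diff)
    then have "rmov g (inv_into UNIV (rmov h) x) = x + emb (s - s')" for x
      using b by (simp add: bij_is_surj surj_f_inv_f del: rmov.simps)
    then show "rmov g \<circ> inv_into UNIV (rmov h) \<in> translation_maps"
      unfolding translation_maps_def by (auto simp: fun_eq_iff simp del: rmov.simps)
  next
    assume "rmov g \<circ> inv_into UNIV (rmov h) \<in> translation_maps"
    then obtain v where v: "\<And>x. rmov g (inv_into UNIV (rmov h) x) = x + v"
      unfolding translation_maps_def by (auto simp: fun_eq_iff simp del: rmov.simps)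
    have e: "rmov g x = rmov h x + v" for x
      using v[of "rmov h x"] b by (simp add: bij_is_inj del: rmov.simps)
    have "v = emb (s - s')" using e[of "emb 0"] unfolding rmov_emb by (simp add: g h emb_diff algebra_simps)
    then have "emb (mov g p) = emb (mov h p + (s - s'))" for p using e[of "emb p"] unfolding rmov_emb emb_add by simp
    then have "mov g p = mov h p + (s - s')" for p unfolding emb_inj .
    from this[of "Tri 1 2 3"] show "linear_part g = linear_part h" unfolding g h mov.simps linear_part.simps
      by (intro act_eqD) (simp add: algebra_simps)
  qed
qed

text \<open>Two symmetries lie in the same coset of the translation subgroup exactly when their
  linear parts coincide, so the point group is counted by linear parts.\<close>

lemma point_order_bipart:
  "order (transf (aut_partition (bipart c)) Mod (aut_partition (bipart c) \<inter> translation_maps)) =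
     card (linear_part ` symm c)"
proof -
  let ?K = "aut_partition (bipart c)"
  let ?T = "?K \<inter> translation_maps"
  have inv: "inv\<^bsub>transf ?K\<^esub> f = inv_into UNIV f" "bij f" "inv_into UNIV f \<in> ?K" if f: "f \<in> ?K" for f
  proof -
    have fa: "f \<in> aut_lattice" using f by (simp add: aut_partition_def)
    then show "bij f" by (rule aut_lattice_bij)
    show i: "inv_into UNIV f \<in> ?K"
      using subgroup.m_inv_closed[OF aut_partition_subgroup f] fa by (simp add: aut_lattice_m_inv)
    show "inv\<^bsub>transf ?K\<^esub> f = inv_into UNIV f"
      using f i fa by (intro transf_inv aut_partition_group aut_lattice_bij)
  qed
  have comp: "f \<circ> g \<in> ?K" if "f \<in> ?K" "g \<in> ?K" for f g
    using subgroup.m_closed[OF aut_partition_subgroup that] by (simp del: o_apply)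
  have sub: "subgroup ?T (transf ?K)"
  proof (rule subgroup_transfI[OF aut_partition_group])
    show "id \<in> ?T" using subgroup.one_closed[OF aut_partition_subgroup, of "bipart c"]
      by (auto simp: translation_maps_def fun_eq_iff intro: exI[of _ 0])
    fix f g assume f: "f \<in> ?T"
    then obtain v where v: "f = (\<lambda>x. x + v)" by (auto simp: translation_maps_def)
    have "inv_into UNIV f = (\<lambda>x. x + (- v))" unfolding v by (rule inv_equality) simp_all
    then have "inv_into UNIV f \<in> translation_maps" unfolding translation_maps_def by blast
    then show "bij f \<and> inv_into UNIV f \<in> ?T" using inv[of f] f by blast
    assume g: "g \<in> ?T"
    then obtain w where w: "g = (\<lambda>x. x + w)" by (auto simp: translation_maps_def)
    have "f \<circ> g = (\<lambda>x. x + (w + v))" unfolding v w by (simp add: fun_eq_iff add.assoc)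
    then have "f \<circ> g \<in> translation_maps" unfolding translation_maps_def by blast
    then show "f \<circ> g \<in> ?T" using comp f g by blast
  qed blast
  have "?T #>\<^bsub>transf ?K\<^esub> rmov g = ?T #>\<^bsub>transf ?K\<^esub> rmov h \<longleftrightarrow> linear_part g = linear_part h"
    if gh: "g \<in> symm c" "h \<in> symm c" for g h
  proof -
    have K: "rmov g \<in> ?K" "rmov h \<in> ?K" using gh rmov_in_aut_bipart by blast+
    have "?T #>\<^bsub>transf ?K\<^esub> rmov g = ?T #>\<^bsub>transf ?K\<^esub> rmov h \<longleftrightarrow> rmov g \<circ> inv_into UNIV (rmov h) \<in> ?T"
      using rcos_eq_iff[OF aut_partition_group sub, of "rmov g" "rmov h"] K inv(1)[OF K(2)]
      by (simp del: rmov.simps o_apply)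
    also have "\<dots> \<longleftrightarrow> linear_part g = linear_part h"
      using comp[OF K(1) inv(3)[OF K(2)]] comp_inv_translation by blast
    finally show ?thesis .
  qed
  then have "card ((\<lambda>g. ?T #>\<^bsub>transf ?K\<^esub> rmov g) ` symm c) = card (linear_part ` symm c)"
    by (intro card_image_eq(1)) blast
  moreover have "carrier (transf ?K Mod ?T) = (\<lambda>g. ?T #>\<^bsub>transf ?K\<^esub> rmov g) ` symm c"
  proof -
    have "Q ` ?K = (\<lambda>g. Q (rmov g)) ` symm c" for Q :: "(real ^ 3 \<Rightarrow> real ^ 3) \<Rightarrow> (real ^ 3 \<Rightarrow> real ^ 3) set"
      unfolding aut_partition_bipart image_image ..
    then show ?thesis by (simp add: FactGroup_def rcosets_image)
  qed
  ultimately show ?thesis by (simp add: order_def)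
qed

section \<open>Indices of periodic two-orbit colourings\<close>

definition md :: "nat \<Rightarrow> pt \<Rightarrow> pt" where
  "md m = map_tri (\<lambda>x. x mod int m)"

definition sc :: "nat \<Rightarrow> pt \<Rightarrow> pt" where
  "sc m = map_tri (times (int m))"

definition box :: "nat \<Rightarrow> pt set" where
  "box m = {p. md m p = p}"

lemma md_Tri [simp]: "md m (Tri x y z) = Tri (x mod int m) (y mod int m) (z mod int m)"
  and sc_Tri [simp]: "sc m (Tri x y z) = Tri (int m * x) (int m * y) (int m * z)"
  by (simp_all add: md_def sc_def)

lemma md_idem [simp]: "md m (md m p) = md m p"
  by (cases p) simp

lemma md_add_left [simp]: "md m (md m p + q) = md m (p + q)"
  and md_add_right [simp]: "md m (p + md m q) = md m (p + q)"
  by (cases p; cases q; simp add: mod_simps)+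

lemma md_in_box [simp]: "md m p \<in> box m"
  by (simp add: box_def)

lemma md_eq_iff: "md m p = md m q \<longleftrightarrow> (\<exists>v. p = q + sc m v)"
proof (cases p; cases q)
  fix x y z x' y' z' assume pq: "p = Tri x y z" "q = Tri x' y' z'"
  show ?thesis
  proof
    assume "md m p = md m q"
    then have "x mod int m = x' mod int m" "y mod int m = y' mod int m" "z mod int m = z' mod int m" by (simp_all add: pq)
    then obtain i j k where "x = x' + int m * i" "y = y' + int m * j" "z = z' + int m * k"
      by (metis mod_eqE mult.commute add.commute diff_add_cancel mult_minus_right minus_diff_eq uminus_add_conv_diff)
    then have "p = q + sc m (Tri i j k)" by (simp add: pq)
    then show "\<exists>v. p = q + sc m v" ..
  next
    assume "\<exists>v. p = q + sc m v"
    then obtain v where "p = q + sc m v" ..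
    then show "md m p = md m q" by (cases v) (simp add: pq)
  qed
qed

lemma act_sc: "act L (sc m p) = sc m (act L p)"
proof (cases L)
  case (SP \<pi> s t r)
  then show ?thesis by (cases \<pi>; cases p; simp add: signed_def)
qed

lemma md_act [simp]: "md m (act L (md m p)) = md m (act L p)"
proof -
  have "\<exists>v. md m p = p + sc m v" unfolding md_eq_iff[symmetric] by (rule md_idem)
  then obtain v where v: "md m p = p + sc m v" ..
  have "act L (md m p) = act L p + sc m (act L v)" unfolding v act_add act_sc ..
  then show ?thesis unfolding md_eq_iff by (rule exI)
qed

lemma md_add_cancel: "md m (p + r) = md m (q + r) \<Longrightarrow> md m p = md m q"
  unfolding md_eq_iff by (metis add.assoc add.commute add_left_cancel)

lemma md_shift_inj: "inj_on (\<lambda>t. md m (t + t0)) (box m)"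
proof (rule inj_onI)
  fix p q assume "p \<in> box m" "q \<in> box m" "md m (p + t0) = md m (q + t0)"
  then show "p = q" using md_add_cancel[of m p t0 q] by (simp add: box_def)
qed

lemma box_image: "box m = (\<lambda>(x, y, z). Tri (int x) (int y) (int z)) ` ({..<m} \<times> {..<m} \<times> {..<m})" if "m > 0"
proof (intro equalityI subsetI)
  fix p assume "p \<in> box m"
  moreover obtain x y z where p: "p = Tri x y z" by (cases p)
  ultimately have "x mod int m = x" "y mod int m = y" "z mod int m = z" by (simp_all add: box_def)
  then have "0 \<le> x" "x < int m" "0 \<le> y" "y < int m" "0 \<le> z" "z < int m"
    using that by (metis of_nat_0_less_iff pos_mod_sign, metis of_nat_0_less_iff pos_mod_bound)+
  then show "p \<in> (\<lambda>(x, y, z). Tri (int x) (int y) (int z)) ` ({..<m} \<times> {..<m} \<times> {..<m})"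
    by (intro image_eqI[of _ _ "(nat x, nat y, nat z)"]) (auto simp: p)
qed (use that in \<open>auto simp: box_def\<close>)

lemma finite_box: "m > 0 \<Longrightarrow> finite (box m)" and card_box: "m > 0 \<Longrightarrow> card (box m) = m ^ 3"
proof -
  assume m: "m > 0"
  show "finite (box m)" unfolding box_image[OF m] by simp
  have "card (box m) = card ({..<m} \<times> {..<m} \<times> {..<m})"
    unfolding box_image[OF m] by (rule card_image) (auto simp: inj_on_def)
  then show "card (box m) = m ^ 3" by (simp add: power3_eq_cube)
qed

lemma periodic_sc: "periodic m c \<Longrightarrow> c (p + sc m v) = c p"
  by (cases p; cases v) (simp add: periodic_def)

lemma periodic_md: "periodic m c \<Longrightarrow> c (md m p) = c p"
  using md_eq_iff[of m "md m p" p] periodic_sc[of m c p] by auto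

text \<open>Only the action of the product is ever used, and it determines the product by
  \<open>act_sperm_eqI\<close>; a choice therefore does the work of an explicit table.\<close>

definition smul :: "sperm \<Rightarrow> sperm \<Rightarrow> sperm" where
  "smul L M = (SOME K. \<forall>p :: pt. act K p = act L (act M p))"

lemma act_smul: "act (smul L M) p = act L (act M (p :: pt))"
  unfolding smul_def using someI_ex[OF act_comp[of L M]] by blast

lemma act_sperm_eqI: "(\<And>p :: pt. act L p = act M p) \<Longrightarrow> L = M"
  by (rule act_eqD) blast

lemma smul_inj_right: "smul K L = smul K' L \<Longrightarrow> K = K'"
  by (rule act_sperm_eqI) (metis act_smul act_surj)

lemma act_inj: "act L p = act L q \<Longrightarrow> p = (q :: pt)"
  using act_inverse[of L] by metis

lemma smul_inj_left: "smul K L = smul K L' \<Longrightarrow> L = L'"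
  by (rule act_sperm_eqI) (metis act_smul act_inj)

fun mcomp :: "motion \<Rightarrow> motion \<Rightarrow> motion" where
  "mcomp (Motion L t) (Motion M u) = Motion (smul L M) (act L u + t)"

lemma mov_mcomp: "mov (mcomp g h) p = mov g (mov h p)"
  by (cases g; cases h) (simp add: act_smul act_add add.assoc)

fun red :: "nat \<Rightarrow> motion \<Rightarrow> motion" where
  "red m (Motion L t) = Motion L (md m t)"

text \<open>Representatives of the motions modulo translations by \<open>m\<close> times lattice
  vectors. These translations preserve every \<open>m\<close>-periodic colouring, so all counting
  takes place among finitely many motions.\<close>

definition motions_mod :: "nat \<Rightarrow> motion set" where
  "motions_mod m = {g. red m g = g}"

lemma motions_mod_eq: "motions_mod m = (\<lambda>(L, t). Motion L t) ` (UNIV \<times> box m)"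
  by (auto simp: motions_mod_def box_def image_iff; metis red.simps motion.exhaust motion.inject)

lemma finite_motions_mod: "m > 0 \<Longrightarrow> finite (motions_mod m)"
  and card_motions_mod: "m > 0 \<Longrightarrow> card (motions_mod m) = 48 * m ^ 3"
proof -
  assume m: "m > 0"
  show "finite (motions_mod m)" unfolding motions_mod_eq using finite_sperms finite_box[OF m] by simp
  have "card (motions_mod m) = card ((UNIV :: sperm set) \<times> box m)"
    unfolding motions_mod_eq by (rule card_image) (auto simp: inj_on_def)
  then show "card (motions_mod m) = 48 * m ^ 3" by (simp add: card_cartesian_product card_sperms card_box[OF m])
qed

lemma red_in [simp]: "red m g \<in> motions_mod m"
  by (cases g) (simp add: motions_mod_def)

lemma mov_red: "\<exists>v. mov (red m g) p = mov g p + sc m v"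
proof (cases g)
  case (Motion L t)
  obtain v where "md m t = t + sc m v" using md_eq_iff[of m "md m t" t] by auto
  then show ?thesis by (auto simp: Motion add.assoc)
qed

lemma colour_red: "periodic m c \<Longrightarrow> c (mov (red m g) p) = c (mov g p)"
  using mov_red[of m g p] periodic_sc by metis

lemma mcomp_inj_on: "inj_on (\<lambda>k. red m (mcomp k g0)) (motions_mod m)"
proof (rule inj_onI)
  fix k k' assume k: "k \<in> motions_mod m" "k' \<in> motions_mod m" "red m (mcomp k g0) = red m (mcomp k' g0)"
  obtain L t L' t' M u where e: "k = Motion L t" "k' = Motion L' t'" "g0 = Motion M u" by (metis motion.exhaust)
  have L: "L = L'" using k(3) by (auto simp: e intro: smul_inj_right)
  have "md m (t + act L u) = md m (t' + act L u)" using k(3) by (simp add: e L add.commute)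
  then have "md m t = md m t'" by (rule md_add_cancel)
  then show "k = k'" using k(1,2) L by (simp add: e motions_mod_def)
qed

lemma card_fibres:
  assumes "finite A" "\<And>x. x \<in> A \<Longrightarrow> card {y \<in> A. f y = f x} = k"
  shows "card A = card (f ` A) * k"
proof -
  have "card A = (\<Sum>z\<in>f ` A. \<Sum>y\<in>{y \<in> A. f y = z}. 1)"
    using sum.image_gen[OF assms(1), of "\<lambda>_. 1 :: nat" f] by simp
  also have "\<dots> = (\<Sum>z\<in>f ` A. k)" by (rule sum.cong) (use assms(2) in auto)
  finally show ?thesis by simp
qed

lemma range_reduced:
  assumes "periodic m c" shows "range (\<lambda>g. c \<circ> mov g) = (\<lambda>g. c \<circ> mov g) ` motions_mod m"
proof -
  have "c \<circ> mov g = c \<circ> mov (red m g)" for g using colour_red[OF assms] by (auto simp: fun_eq_iff)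
  then show ?thesis using red_in[of m] by (auto simp: image_iff; metis)
qed

text \<open>Lagrange's theorem in the finite group of motions modulo \<open>m\<close>, which has
  order \<open>48 * m ^ 3\<close>: the fibres of the pulled-back colouring are cosets of the
  symmetry group and have equal size.\<close>

lemma index_mult:
  assumes m: "periodic m c"
  shows "card (range (\<lambda>g. c \<circ> mov g)) * card (motions_mod m \<inter> symm c) = 48 * m ^ 3"
proof -
  have m0: "m > 0" using m by (simp add: periodic_def)
  have "card {g \<in> motions_mod m. c \<circ> mov g = c \<circ> mov g0} = card (motions_mod m \<inter> symm c)" if "g0 \<in> motions_mod m" for g0
  proof -
    \<comment> \<open>Right multiplication by \<open>g0\<close> permutes the representatives and
      takes the symmetries onto the fibre of \<open>g0\<close>.\<close>
    let ?\<phi> = "\<lambda>k. red m (mcomp k g0)"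
    have surj: "?\<phi> ` motions_mod m = motions_mod m"
      by (rule endo_inj_surj[OF finite_motions_mod[OF m0] _ mcomp_inj_on]) auto
    have iff: "c \<circ> mov (?\<phi> k) = c \<circ> mov g0 \<longleftrightarrow> k \<in> symm c" for k
      unfolding fun_eq_iff o_apply colour_red[OF m] mov_mcomp symm_def mem_Collect_eq using mov_surj by metis
    have "{g \<in> motions_mod m. c \<circ> mov g = c \<circ> mov g0} = ?\<phi> ` (motions_mod m \<inter> symm c)"
    proof (intro equalityI subsetI)
      fix g assume g: "g \<in> {g \<in> motions_mod m. c \<circ> mov g = c \<circ> mov g0}"
      then obtain k where "k \<in> motions_mod m" "g = ?\<phi> k" using surj by blast
      then show "g \<in> ?\<phi> ` (motions_mod m \<inter> symm c)" using g iff[of k] by blast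
    qed (use iff in auto)
    then show ?thesis by (simp add: card_image inj_on_subset[OF mcomp_inj_on])
  qed
  then have "card (motions_mod m) = card ((\<lambda>g. c \<circ> mov g) ` motions_mod m) * card (motions_mod m \<inter> symm c)"
    by (rule card_fibres[OF finite_motions_mod[OF m0]])
  then show ?thesis by (simp add: card_motions_mod[OF m0] range_reduced[OF m])
qed

definition translations_mod :: "nat \<Rightarrow> colouring \<Rightarrow> pt set" where
  "translations_mod m c = {t \<in> box m. \<forall>p. c (p + t) = c p}"

lemma translation_index_mult:
  assumes m: "periodic m c"
  shows "card (range (\<lambda>t. c \<circ> mov (shift t))) * card (translations_mod m c) = m ^ 3"
proof -
  have m0: "m > 0" using m by (simp add: periodic_def)
  have mdp: "c (p + md m t) = c (p + t)" for p t
    using periodic_md[OF m, of "p + md m t"] periodic_md[OF m, of "p + t"] by simp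
  have "card {t \<in> box m. c \<circ> mov (shift t) = c \<circ> mov (shift t0)} = card (translations_mod m c)" for t0
  proof -
    let ?\<phi> = "\<lambda>t. md m (t + t0)"
    have surj: "?\<phi> ` box m = box m"
      by (rule endo_inj_surj[OF finite_box[OF m0] _ md_shift_inj]) auto
    have iff: "c \<circ> mov (shift (?\<phi> t)) = c \<circ> mov (shift t0) \<longleftrightarrow> (\<forall>p. c (p + t) = c p)" for t
    proof -
      have "c \<circ> mov (shift (?\<phi> t)) = c \<circ> mov (shift t0) \<longleftrightarrow> (\<forall>p. c (p + t0 + t) = c (p + t0))"
        unfolding fun_eq_iff o_apply mov_translation mdp by (simp add: add_ac)
      then show ?thesis by (metis diff_add_cancel)
    qed
    have "{t \<in> box m. c \<circ> mov (shift t) = c \<circ> mov (shift t0)} = ?\<phi> ` translations_mod m c"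
    proof (intro equalityI subsetI)
      fix g assume g: "g \<in> {t \<in> box m. c \<circ> mov (shift t) = c \<circ> mov (shift t0)}"
      then obtain k where "k \<in> box m" "g = ?\<phi> k" using surj by blast
      then show "g \<in> ?\<phi> ` translations_mod m c" using g iff[of k] by (auto simp: translations_mod_def)
    next
      fix g assume "g \<in> ?\<phi> ` translations_mod m c"
      then obtain t where "g = ?\<phi> t" "\<forall>p. c (p + t) = c p" by (auto simp: translations_mod_def)
      then show "g \<in> {t \<in> box m. c \<circ> mov (shift t) = c \<circ> mov (shift t0)}" using iff[of t] by simp
    qed
    then show ?thesis
      by (simp add: card_image inj_on_subset[OF md_shift_inj] translations_mod_def)
  qed
  moreover have "range (\<lambda>t. c \<circ> mov (shift t)) = (\<lambda>t. c \<circ> mov (shift t)) ` box m"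
  proof -
    have "c \<circ> mov (shift t) = c \<circ> mov (shift (md m t))" for t unfolding fun_eq_iff o_apply mov_translation mdp by simp
    then show ?thesis using md_in_box[of m] by (auto simp only: image_iff; metis rangeI)
  qed
  ultimately show ?thesis
    using card_fibres[OF finite_box[OF m0], of "\<lambda>t. c \<circ> mov (shift t)"] card_box[OF m0] by metis
qed

text \<open>Symmetries modulo \<open>m\<close> with a prescribed linear part differ by a translation
  symmetry, so every fibre of \<open>linear_part\<close> is as large as the group of translation
  symmetries modulo \<open>m\<close>.\<close>

lemma point_order_mult:
  assumes m: "periodic m c"
  shows "card (linear_part ` symm c) * card (translations_mod m c) = card (motions_mod m \<inter> symm c)"
proof -
  have m0: "m > 0" using m by (simp add: periodic_def)
  have "card {g \<in> motions_mod m \<inter> symm c. linear_part g = linear_part g0} = card (translations_mod m c)"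
    if g0: "g0 \<in> motions_mod m \<inter> symm c" for g0
  proof -
    obtain L u where Lu: "g0 = Motion L u" by (cases g0)
    let ?\<phi> = "\<lambda>t. Motion L (md m (t + u))"
    have iff: "?\<phi> t \<in> symm c \<longleftrightarrow> (\<forall>p. c (p + t) = c p)" for t
    proof -
      have "?\<phi> t \<in> symm c \<longleftrightarrow> (\<forall>p. c (mov (red m (Motion L (t + u))) p) = c p)" by (simp add: symm_def)
      also have "\<dots> \<longleftrightarrow> (\<forall>p. c (mov g0 p + t) = c (mov g0 p))"
        using g0 unfolding colour_red[OF m] by (simp add: Lu symm_def add_ac)
      also have "\<dots> \<longleftrightarrow> (\<forall>p. c (p + t) = c p)" using mov_surj by metis
      finally show ?thesis .
    qed
    have inj: "inj_on ?\<phi> (box m)" using md_shift_inj[of m u] by (auto simp: inj_on_def)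
    have "{g \<in> motions_mod m \<inter> symm c. linear_part g = linear_part g0} = ?\<phi> ` translations_mod m c"
    proof (intro equalityI subsetI)
      fix g assume g: "g \<in> {g \<in> motions_mod m \<inter> symm c. linear_part g = linear_part g0}"
      then obtain v where v: "g = Motion L v" "md m v = v" by (cases g) (auto simp: Lu motions_mod_def)
      have "g = ?\<phi> (md m (v - u))" by (simp add: v)
      moreover have "md m (v - u) \<in> translations_mod m c"
        using g iff[of "md m (v - u)"] by (auto simp: translations_mod_def v)
      ultimately show "g \<in> ?\<phi> ` translations_mod m c" by blast
    next
      fix g assume "g \<in> ?\<phi> ` translations_mod m c"
      then obtain t where "g = ?\<phi> t" "\<forall>p. c (p + t) = c p" by (auto simp: translations_mod_def)
      then show "g \<in> {g \<in> motions_mod m \<inter> symm c. linear_part g = linear_part g0}"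
        using iff[of t] by (simp add: Lu motions_mod_def)
    qed
    then show ?thesis by (simp add: card_image inj_on_subset[OF inj] translations_mod_def)
  qed
  moreover have "linear_part ` symm c = linear_part ` (motions_mod m \<inter> symm c)"
  proof -
    have "red m g \<in> motions_mod m \<inter> symm c \<and> linear_part (red m g) = linear_part g" if "g \<in> symm c" for g
      using that colour_red[OF m, of g] red_in[of m g] by (cases g) (simp add: symm_def del: mov.simps)
    then show ?thesis by (auto simp: image_iff; metis Int_iff)
  qed
  moreover have "finite (motions_mod m \<inter> symm c)" using finite_motions_mod[OF m0] by blast
  ultimately show ?thesis
    using card_fibres[of "motions_mod m \<inter> symm c" linear_part "card (translations_mod m c)"] by simp
qed

definition stab :: "colouring \<Rightarrow> pt \<Rightarrow> sperm set" where
  "stab c b = {L. \<forall>d. c (b + act L d) = c (b + d)}"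

text \<open>The translation \<open>b - act L b\<close> is the one that makes the motion with linear
  part \<open>L\<close> fix \<open>b\<close>; thus \<open>stab c b\<close> is the site symmetry
  group of \<open>b\<close>.\<close>

lemma stab_symm: "L \<in> stab c b \<longleftrightarrow> Motion L (b - act L b) \<in> symm c"
proof -
  have "mov (Motion L (b - act L b)) p = b + act L (p - b)" for p by (simp add: act_diff)
  then show ?thesis unfolding stab_def symm_def mem_Collect_eq
    by (metis add_diff_cancel_left' diff_add_cancel add.commute)
qed

text \<open>Orbit-stabiliser for the symmetries modulo \<open>m\<close> acting on residues: the
  orbit of \<open>b\<close> is its whole colour class in the box, and the stabiliser of its residue
  has the size of the site group.\<close>

lemma symm_order_mod:
  assumes m: "periodic m c" and two: "two_orbit c"
  shows "card (motions_mod m \<inter> symm c) = card {p \<in> box m. c p = c b} * card (stab c b)"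
proof -
  have m0: "m > 0" using m by (simp add: periodic_def)
  let ?K = "motions_mod m \<inter> symm c"
  let ?f = "\<lambda>g. md m (mov g b)"
  have im: "?f ` ?K = {p \<in> box m. c p = c b}"
  proof (intro equalityI subsetI)
    fix q assume q: "q \<in> {p \<in> box m. c p = c b}"
    then obtain g where g: "g \<in> symm c" "mov g b = q" using two unfolding two_orbit_def by (metis (mono_tags, lifting) mem_Collect_eq)
    have "red m g \<in> ?K" using g colour_red[OF m] by (simp add: symm_def)
    moreover have "?f (red m g) = q" using mov_red[of m g b] g q md_eq_iff[of m "mov (red m g) b" "mov g b"] by (auto simp: box_def)
    ultimately show "q \<in> ?f ` ?K" by blast
  next
    fix q assume "q \<in> ?f ` ?K"
    then obtain g where "g \<in> symm c" "q = ?f g" by blast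
    then have "c q = c b" by (simp add: periodic_md[OF m] symm_def)
    then show "q \<in> {p \<in> box m. c p = c b}" using \<open>q = ?f g\<close> by simp
  qed
  have "card {g \<in> ?K. ?f g = ?f g0} = card (stab c b)" if g0: "g0 \<in> ?K" for g0
  proof -
    obtain M u where Mu: "g0 = Motion M u" by (cases g0)
    let ?\<phi> = "\<lambda>L. red m (mcomp g0 (Motion L (b - act L b)))"
    have inj: "inj_on ?\<phi> (stab c b)" by (rule inj_onI) (auto simp: Mu intro: smul_inj_left)
    have "{g \<in> ?K. ?f g = ?f g0} = ?\<phi> ` stab c b"
    proof (intro equalityI subsetI)
      fix g assume g: "g \<in> {g \<in> ?K. ?f g = ?f g0}"
      obtain L t where Lt: "g = Motion L t" by (cases g)
      obtain v where v: "mov g b = mov g0 b + sc m v" using g md_eq_iff by blast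
      obtain M' where M': "\<And>p :: pt. act M' (act M p) = p" "\<And>p :: pt. act M (act M' p) = p" using act_inverse[of M] by metis
      \<comment> \<open>Both \<open>g\<close> and \<open>g0\<close> send \<open>b\<close> to the
        same residue, so undoing \<open>g0\<close> after \<open>g\<close> fixes \<open>b\<close> up
        to a period; \<open>?N\<close> is the linear part of that motion.\<close>
      let ?N = "smul M' L"
      have "c (b + act ?N d) = c (b + d)" for d
      proof -
        have "c (b + act ?N d) = c (mov g0 (b + act ?N d))" using g0 by (simp add: symm_def)
        also have "\<dots> = c (mov g0 b + act L d)" by (simp add: Mu act_add act_smul M' add_ac)
        also have "\<dots> = c (mov g0 b + act L d + sc m v)" by (simp add: periodic_sc[OF m])
        also have "\<dots> = c (mov g (b + d))" 
        proof -
          have "mov g (b + d) = mov g b + act L d" by (simp add: Lt act_add add_ac)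
          then show ?thesis by (simp add: v add_ac)
        qed
        also have "\<dots> = c (b + d)" using g by (simp add: symm_def)
        finally show ?thesis .
      qed
      then have N: "?N \<in> stab c b" by (simp add: stab_def)
      have 1: "smul M ?N = L" by (rule act_sperm_eqI) (simp add: act_smul M')
      have "act M (b - act ?N b) + u = mov g0 b - act L b" by (simp add: Mu act_diff act_smul M')
      also have "\<dots> = t + sc m (- v)"
      proof -
        have "sc m (- v) = - sc m v" by (cases v) simp
        then show ?thesis using v by (simp add: Lt algebra_simps)
      qed
      finally have "md m (act M (b - act ?N b) + u) = md m t" unfolding md_eq_iff by blast
      then have "?\<phi> ?N = g" using g by (simp add: Mu Lt 1 motions_mod_def)
      then show "g \<in> ?\<phi> ` stab c b" using N by blast
    next
      fix g assume "g \<in> ?\<phi> ` stab c b"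
      then obtain L where L: "L \<in> stab c b" "g = ?\<phi> L" by blast
      have s: "Motion L (b - act L b) \<in> symm c" using L stab_symm by blast
      have "g \<in> symm c" using s g0 unfolding symm_def L(2) by (simp add: colour_red[OF m] mov_mcomp del: mov.simps)
      moreover have "?f g = ?f g0"
      proof -
        have "mov (mcomp g0 (Motion L (b - act L b))) b = mov g0 b" unfolding mov_mcomp by simp
        then show ?thesis using mov_red[of m "mcomp g0 (Motion L (b - act L b))" b] md_eq_iff L(2) by metis
      qed
      ultimately show "g \<in> {g \<in> ?K. ?f g = ?f g0}" using L(2) by simp
    qed
    then show ?thesis by (simp add: card_image[OF inj])
  qed
  from card_fibres[of ?K ?f, OF _ this] show ?thesis using finite_motions_mod[OF m0] im by simp
qed

section \<open>Rigidity\<close>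

text \<open>Whenever a rotation about \<open>y\<close> matches the colours on the part of the
  neighbourhood \<open>E\<close> that also lies in the neighbourhood of an adjacent point, it matches them on
  all of \<open>E\<close>.\<close>

definition rigid_at :: "pt set \<Rightarrow> colouring \<Rightarrow> pt \<Rightarrow> bool" where
  "rigid_at E c y \<longleftrightarrow> (\<forall>L. \<forall>u\<in>set units. (\<forall>d\<in>E. d + u \<in> E \<longrightarrow> c (y + act L d) = c (y + d)) \<longrightarrow>
     (\<forall>d\<in>E. c (y + act L d) = c (y + d)))"

lemma act_units: "u \<in> set units \<Longrightarrow> act L u \<in> set units"
proof -
  assume "u \<in> set units"
  moreover have "\<forall>u\<in>set units. \<forall>L\<in>set sperms. act L u \<in> set units" by code_simp
  ultimately show ?thesis using set_sperms by blast
qed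

text \<open>A symmetry carries rigidity along, so it has to be tested at one point of each colour
  only. The neighbourhood must be invariant under all signed permutations for this.\<close>

lemma rigid_at_symm:
  assumes g: "g \<in> symm c" and r: "rigid_at E c b" and E: "\<And>L d. d \<in> E \<Longrightarrow> act L d \<in> E"
  shows "rigid_at E c (mov g b)"
  unfolding rigid_at_def
proof (intro allI ballI impI)
  fix L u d
  assume u: "u \<in> set units" and h: "\<forall>d\<in>E. d + u \<in> E \<longrightarrow> c (mov g b + act L d) = c (mov g b + d)" and d: "d \<in> E"
  obtain N t where g': "g = Motion N t" by (cases g)
  obtain N' where N': "\<And>p :: pt. act N' (act N p) = p" "\<And>p :: pt. act N (act N' p) = p" using act_inverse[of N] by metis
  have cg: "c (mov g b + e) = c (b + act N' e)" for e
  proof -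
    have "mov g (b + act N' e) = mov g b + e" by (simp add: g' act_add N' add_ac)
    then show ?thesis using g unfolding symm_def mem_Collect_eq by metis
  qed
  \<comment> \<open>The rotation \<open>L\<close> about \<open>mov g b\<close>, transported back to
    \<open>b\<close> by conjugation with the linear part of \<open>g\<close>.\<close>
  let ?M = "smul N' (smul L N)"
  have "c (b + act ?M e) = c (b + e)" if e: "e \<in> E" "e + act N' u \<in> E" for e
  proof -
    have "act N e + u \<in> E" using E[OF e(2), of N] by (simp add: act_add N')
    then have "c (mov g b + act L (act N e)) = c (mov g b + act N e)" using h E[OF e(1)] by blast
    then show ?thesis by (simp add: cg act_smul N')
  qed
  moreover have "act N' u \<in> set units" using u by (rule act_units)
  ultimately have "c (b + act ?M e) = c (b + e)" if "e \<in> E" for e using r that unfolding rigid_at_def by blast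
  from this[OF E[OF d, of N']] show "c (mov g b + act L d) = c (mov g b + d)"
    by (simp add: cg act_smul N')
qed

text \<open>Induction along unit steps: the lattice graph is connected.\<close>

lemma lattice_connected:
  assumes "P 0" "\<And>x u. P x \<Longrightarrow> u \<in> set units \<Longrightarrow> P (x + u)"
  shows "P p"
proof -
  have x: "P (q + Tri (int n) 0 0)" "P (q + Tri (- int n) 0 0)" "P (q + Tri 0 (int n) 0)" "P (q + Tri 0 (- int n) 0)"
    "P (q + Tri 0 0 (int n))" "P (q + Tri 0 0 (- int n))" if "P q" for q n
  proof (induction n)
    case (Suc n)
    {
      case 1 show ?case using assms(2)[OF Suc(1), of "Tri 1 0 0"] by (cases q) (simp add: units_def algebra_simps)
    next
      case 2 show ?case using assms(2)[OF Suc(2), of "Tri (-1) 0 0"] by (cases q) (simp add: units_def algebra_simps)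
    next
      case 3 show ?case using assms(2)[OF Suc(3), of "Tri 0 1 0"] by (cases q) (simp add: units_def algebra_simps)
    next
      case 4 show ?case using assms(2)[OF Suc(4), of "Tri 0 (-1) 0"] by (cases q) (simp add: units_def algebra_simps)
    next
      case 5 show ?case using assms(2)[OF Suc(5), of "Tri 0 0 1"] by (cases q) (simp add: units_def algebra_simps)
    next
      case 6 show ?case using assms(2)[OF Suc(6), of "Tri 0 0 (-1)"] by (cases q) (simp add: units_def algebra_simps)
    }
  qed (use that in \<open>cases q; simp\<close>)+
  obtain a b d where p: "p = Tri a b d" by (cases p)
  have X: "P (q + Tri a 0 0)" "P (q + Tri 0 a 0)" "P (q + Tri 0 0 a)" if "P q" for q a
    using x[OF that, of "nat \<bar>a\<bar>"] by (cases "a \<ge> 0"; simp)+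
  have "P (0 + Tri a 0 0 + Tri 0 b 0 + Tri 0 0 d)" by (intro X assms(1))
  then show ?thesis by (simp add: p zero_tri_def)
qed

text \<open>Agreement of \<open>f\<close> and \<open>f0\<close> spreads from \<open>x\<close> to an
  adjacent point \<open>?y\<close>. In both colourings the neighbourhood of \<open>?y\<close> is a
  rotated copy of that of a base point, where \<open>f\<close> and \<open>f0\<close> agree, so
  around \<open>?y\<close> they differ at most by a rotation. On the part shared with the
  neighbourhood of \<open>x\<close> they are already equal, so this rotation preserves the colours
  of \<open>f0\<close> there, and by rigidity it preserves them on all of \<open>E\<close>.\<close>

lemma rigid_determines:
  assumes f: "two_orbit f" and f0: "two_orbit f0"
    and E: "\<And>L d. d \<in> E \<Longrightarrow> act L d \<in> E" "0 \<in> E" "set units \<subseteq> E"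
    and rigid: "\<And>y. rigid_at E f0 y"
    and eq: "\<And>d. d \<in> E \<Longrightarrow> f d = f0 d" "\<And>d. d \<in> E \<Longrightarrow> f (e + d) = f0 (e + d)"
    and ne: "f 0 \<noteq> f e"
  shows "f = f0"
proof -
  have "\<forall>d\<in>E. f (x + d) = f0 (x + d)" for x
  proof (rule lattice_connected[of "\<lambda>x. \<forall>d\<in>E. f (x + d) = f0 (x + d)"])
    fix x u assume x: "\<forall>d\<in>E. f (x + d) = f0 (x + d)" and u: "u \<in> set units"
    let ?y = "x + u"
    have y: "f ?y = f0 ?y" using x u E(3) by blast
    \<comment> \<open>The base points \<open>0\<close> and \<open>e\<close> have different colours,
      so one of them has the colour of \<open>?y\<close>.\<close>
    obtain b where b: "f b = f ?y" "\<forall>d\<in>E. f (b + d) = f0 (b + d)"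
      using ne eq by (metis add_0)
    have "f b = f0 b" using b(2) E(2) by (metis add.right_neutral)
    obtain h where h: "h \<in> symm f" "mov h b = ?y" using f b(1) unfolding two_orbit_def by metis
    obtain k where k: "k \<in> symm f0" "mov k b = ?y" using f0 b(1) y \<open>f b = f0 b\<close> unfolding two_orbit_def by metis
    obtain M s N t where hk: "h = Motion M s" "k = Motion N t" by (metis motion.exhaust)
    have fh: "f (?y + act M d) = f (b + d)" for d
    proof -
      have "mov h (b + d) = ?y + act M d" using h(2) by (simp add: hk act_add add_ac)
      then show ?thesis using h(1) unfolding symm_def mem_Collect_eq by metis
    qed
    have fk: "f0 (?y + act N d) = f0 (b + d)" for d
    proof -
      have "mov k (b + d) = ?y + act N d" using k(2) by (simp add: hk act_add add_ac)
      then show ?thesis using k(1) unfolding symm_def mem_Collect_eq by metis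
    qed
    obtain M' where M': "\<And>p :: pt. act M' (act M p) = p" "\<And>p :: pt. act M (act M' p) = p" using act_inverse[of M] by metis
    \<comment> \<open>First back to the base point along the symmetry of \<open>f\<close>, then to
      \<open>?y\<close> along the symmetry of \<open>f0\<close>.\<close>
    let ?R = "smul N M'"
    have 1: "f0 (?y + act ?R d) = f (?y + d)" if "d \<in> E" for d
    proof -
      have "f0 (?y + act ?R d) = f0 (b + act M' d)" by (simp add: act_smul fk)
      also have "\<dots> = f (b + act M' d)" using b(2) E(1)[OF that] by simp
      also have "\<dots> = f (?y + d)" using fh[of "act M' d"] by (simp add: M')
      finally show ?thesis .
    qed
    have "f0 (?y + act ?R d) = f0 (?y + d)" if "d \<in> E" "d + u \<in> E" for d
    proof -
      have "f (?y + d) = f0 (?y + d)" using bspec[OF x that(2)] by (simp add: add_ac)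
      then show ?thesis using 1[OF that(1)] by simp
    qed
    then have "\<forall>d\<in>E. f0 (?y + act ?R d) = f0 (?y + d)" using rigid[of ?y] u unfolding rigid_at_def by blast
    then show "\<forall>d\<in>E. f (?y + d) = f0 (?y + d)" using 1 by simp
  qed (use eq in simp)
  then have "f (x + 0) = f0 (x + 0)" for x using E(2) by blast
  then show ?thesis by (simp add: fun_eq_iff)
qed

lemma equiv_col_sym: "equiv_col c c' \<Longrightarrow> equiv_col c' c"
proof -
  assume "equiv_col c c'"
  then obtain g s where g: "\<And>p. c p = (c' (mov g p) \<noteq> s)" by (auto simp: equiv_col_def)
  obtain k where "\<And>p. mov g (mov k p) = p" using mov_inverse[of g] by blast
  then have "c' p = (c (mov k p) \<noteq> s)" for p using g[of "mov k p"] by auto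
  then show ?thesis unfolding equiv_col_def by blast
qed

lemma equiv_col_trans: "equiv_col c c' \<Longrightarrow> equiv_col c' c'' \<Longrightarrow> equiv_col c c''"
proof -
  assume "equiv_col c c'" "equiv_col c' c''"
  then obtain g s h r where g: "\<And>p. c p = (c' (mov g p) \<noteq> s)" and h: "\<And>p. c' p = (c'' (mov h p) \<noteq> r)"
    unfolding equiv_col_def by metis
  obtain k where "mov k = mov h \<circ> mov g" using mov_comp by blast
  then have "c p = (c'' (mov k p) \<noteq> (s \<noteq> r))" for p using g[of p] h[of "mov g p"] by auto
  then show ?thesis unfolding equiv_col_def by blast
qed

lemma two_orbit_equiv:
  assumes e: "\<And>p. c p = (c' (mov g p) \<noteq> s)" and c': "two_orbit c'"
  shows "two_orbit c"
proof -
  obtain k where k: "\<And>p. mov k (mov g p) = p" "\<And>p. mov g (mov k p) = p" using mov_inverse[of g] by blast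
  have ex: "\<exists>p. c p = b" for b
  proof -
    obtain q where "c' q = (b \<noteq> s)" using c' unfolding two_orbit_def by (cases "b \<noteq> s") auto
    then have "c (mov k q) = b" using e[of "mov k q"] k by auto
    then show ?thesis ..
  qed
  have "\<exists>h\<in>symm c. mov h p = q" if "c p = c q" for p q
  proof -
    have "c' (mov g p) = c' (mov g q)" using that e by auto
    then obtain h where h: "h \<in> symm c'" "mov h (mov g p) = mov g q" using c' unfolding two_orbit_def by metis
    obtain l where l: "mov l = mov h \<circ> mov g" using mov_comp by blast
    obtain l' where l': "mov l' = mov k \<circ> mov l" using mov_comp by blast
    have "mov l' p = q" using l l' h k by simp
    moreover have "l' \<in> symm c" using h(1) unfolding symm_def mem_Collect_eq l l' e by (simp add: k)
    ultimately show ?thesis by blast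
  qed
  then show ?thesis unfolding two_orbit_def using ex[of True] ex[of False] by blast
qed

lemma rigid_at_equiv:
  assumes e: "\<And>p. c p = (c' (mov g p) \<noteq> s)" and r: "\<And>y. rigid_at E c' y"
    and E: "\<And>L d. d \<in> E \<Longrightarrow> act L d \<in> E"
  shows "rigid_at E c y"
  unfolding rigid_at_def
proof (intro allI ballI impI)
  fix L u d
  assume u: "u \<in> set units" and h: "\<forall>d\<in>E. d + u \<in> E \<longrightarrow> c (y + act L d) = c (y + d)" and d: "d \<in> E"
  obtain N t where g': "g = Motion N t" by (cases g)
  obtain N' where N': "\<And>p :: pt. act N' (act N p) = p" "\<And>p :: pt. act N (act N' p) = p" using act_inverse[of N] by metis
  have cg: "c (y + e) = (c' (mov g y + act N e) \<noteq> s)" for e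
    unfolding e by (simp add: g' act_add add_ac)
  let ?M = "smul N (smul L N')"
  have "c' (mov g y + act ?M e) = c' (mov g y + e)" if e: "e \<in> E" "e + act N u \<in> E" for e
  proof -
    have "act N' e + u \<in> E" using E[OF e(2), of N'] by (simp add: act_add N')
    then have "c (y + act L (act N' e)) = c (y + act N' e)" using h E[OF e(1)] by blast
    then show ?thesis by (auto simp: cg act_smul N')
  qed
  moreover have "act N u \<in> set units" using u by (rule act_units)
  ultimately have "c' (mov g y + act ?M e) = c' (mov g y + e)" if "e \<in> E" for e using r that unfolding rigid_at_def by blast
  from this[OF E[OF d, of N]] show "c (y + act L d) = c (y + d)"
    by (simp add: cg act_smul N')
qed

section \<open>Partial colourings and their local consequences\<close>

type_synonym 'a cube = "'a tri tri tri"

definition gen3 :: "(int \<Rightarrow> 'a) \<Rightarrow> 'a tri" where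
  "gen3 f = Tri (f (-1)) (f 0) (f 1)"

definition cube :: "(pt \<Rightarrow> 'a) \<Rightarrow> 'a cube" where
  "cube f = gen3 (\<lambda>i. gen3 (\<lambda>j. gen3 (\<lambda>k. f (Tri i j k))))"

text \<open>Signed permutations act on cubes by reversing and transposing nested triples, so that
  evaluation rearranges entries without touching coordinates.\<close>

fun flip3 :: "'a tri \<Rightarrow> 'a tri" where
  "flip3 (Tri a b c) = Tri c b a"

fun transp :: "'a tri tri \<Rightarrow> 'a tri tri" where
  "transp (Tri (Tri a b c) (Tri d e f) (Tri g h i)) = Tri (Tri a d g) (Tri b e h) (Tri c f i)"

definition flips :: "bool \<Rightarrow> bool \<Rightarrow> bool \<Rightarrow> 'a cube \<Rightarrow> 'a cube" where
  "flips s t r C =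
     (let A = if s then flip3 C else C; B = if t then map_tri flip3 A else A
      in if r then map_tri (map_tri flip3) B else B)"

fun turn :: "perm3 \<Rightarrow> 'a cube \<Rightarrow> 'a cube" where
  "turn XYZ C = C"
| "turn XZY C = map_tri transp C"
| "turn YXZ C = transp C"
| "turn YZX C = transp (map_tri transp C)"
| "turn ZXY C = map_tri transp (transp C)"
| "turn ZYX C = transp (map_tri transp (transp C))"

definition orients :: "'a cube \<Rightarrow> 'a cube list" where
  "orients C = concat (map (\<lambda>A. map (\<lambda>\<pi>. turn \<pi> A) perms3)
     (concat (map (\<lambda>A. [A, map_tri (map_tri flip3) A]) (concat (map (\<lambda>A. [A, map_tri flip3 A]) [C, flip3 C])))))"

lemma flips_in: "turn \<pi> (flips s t r C) \<in> set (orients C)"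
  unfolding orients_def flips_def perms3_def Let_def by (cases \<pi>; cases s; cases t; cases r; simp)

lemma cube_act: "cube (\<lambda>d. f (act (SP \<pi> s t r) d)) = turn \<pi> (flips s t r (cube f))"
  by (cases \<pi>; cases s; cases t; cases r; simp add: cube_def gen3_def flips_def signed_def)

datatype kn = Unk | Fa | Tr

fun agrees :: "kn \<Rightarrow> bool \<Rightarrow> bool" where
  "agrees Unk b = True" | "agrees Fa b = (\<not> b)" | "agrees Tr b = b"

definition kn_of :: "bool \<Rightarrow> kn" where
  "kn_of b = (if b then Tr else Fa)"

fun compat :: "kn \<Rightarrow> kn \<Rightarrow> bool" where
  "compat Fa Tr = False" | "compat Tr Fa = False" | "compat _ _ = True"

text \<open>\<open>both\<close> keeps what two alternatives have in common, whereas
  \<open>refine\<close> merges two descriptions that hold simultaneously.\<close>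

fun both :: "kn \<Rightarrow> kn \<Rightarrow> kn" where
  "both Fa Fa = Fa" | "both Tr Tr = Tr" | "both _ _ = Unk"

fun refine :: "kn \<Rightarrow> kn \<Rightarrow> kn" where
  "refine Unk x = x" | "refine Fa x = Fa" | "refine Tr x = Tr"

lemma compat_agrees: "agrees x b \<Longrightarrow> agrees y b \<Longrightarrow> compat x y"
  by (cases x; cases y; simp)

lemma both_agrees: "agrees x b \<or> agrees y b \<Longrightarrow> agrees (both x y) b"
  by (cases x; cases y; auto)

lemma refine_agrees: "agrees x b \<Longrightarrow> agrees y b \<Longrightarrow> agrees (refine x y) b"
  by (cases x; simp)

text \<open>The middle entries come first, so on a cube the central slices are compared before the
  outer ones, and the nested conditionals end the evaluation at the first failure.\<close>

fun all3 :: "('a \<Rightarrow> 'b \<Rightarrow> bool) \<Rightarrow> 'a tri \<Rightarrow> 'b tri \<Rightarrow> bool" where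
  "all3 P (Tri a b c) (Tri a' b' c') = (if P b b' then if P a a' then P c c' else False else False)"

fun zip3 :: "('a \<Rightarrow> 'b \<Rightarrow> 'c) \<Rightarrow> 'a tri \<Rightarrow> 'b tri \<Rightarrow> 'c tri" where
  "zip3 f (Tri a b c) (Tri a' b' c') = Tri (f a a') (f b b') (f c c')"

lemma all3_rel: "all3 P = rel_tri P"
proof (intro ext)
  fix x y show "all3 P x y = rel_tri P x y" by (cases x; cases y) auto
qed

abbreviation cube_rel :: "('a \<Rightarrow> 'b \<Rightarrow> bool) \<Rightarrow> 'a cube \<Rightarrow> 'b cube \<Rightarrow> bool" where
  "cube_rel P \<equiv> all3 (all3 (all3 P))"

abbreviation cube_zip :: "('a \<Rightarrow> 'b \<Rightarrow> 'c) \<Rightarrow> 'a cube \<Rightarrow> 'b cube \<Rightarrow> 'c cube" where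
  "cube_zip f \<equiv> zip3 (zip3 (zip3 f))"

lemma all3_mono: "all3 P x z \<Longrightarrow> all3 Q y z \<Longrightarrow> (\<And>a b c. P a c \<Longrightarrow> Q b c \<Longrightarrow> R a b) \<Longrightarrow> all3 R x y"
  by (cases x; cases y; cases z) (auto split: if_splits)

lemma all3_zip: "all3 P x z \<Longrightarrow> all3 Q y z \<Longrightarrow> (\<And>a b c. P a c \<Longrightarrow> Q b c \<Longrightarrow> R (f a b) c) \<Longrightarrow> all3 R (zip3 f x y) z"
  by (cases x; cases y; cases z) (auto split: if_splits)

lemma all3_zip_left: "all3 P x z \<Longrightarrow> (\<And>a b c. P a c \<Longrightarrow> P (f a b) c) \<Longrightarrow> all3 P (zip3 f x y) z"
  by (cases x; cases y; cases z) (auto split: if_splits)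

lemma all3_zip_right: "all3 P y z \<Longrightarrow> (\<And>a b c. P b c \<Longrightarrow> P (f a b) c) \<Longrightarrow> all3 P (zip3 f x y) z"
  by (cases x; cases y; cases z) (auto split: if_splits)

lemma cube_compat: "cube_rel agrees A C \<Longrightarrow> cube_rel agrees B C \<Longrightarrow> cube_rel compat A B"
  by (rule all3_mono, assumption, assumption)+ (rule compat_agrees)

lemma cube_refine: "cube_rel agrees A C \<Longrightarrow> cube_rel agrees B C \<Longrightarrow> cube_rel agrees (cube_zip refine A B) C"
  by (rule all3_zip, assumption, assumption)+ (rule refine_agrees)

lemma cube_both_left: "cube_rel agrees A C \<Longrightarrow> cube_rel agrees (cube_zip both A B) C"
  by (rule all3_zip_left, assumption)+ (simp add: both_agrees)

lemma cube_both_right: "cube_rel agrees B C \<Longrightarrow> cube_rel agrees (cube_zip both A B) C"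
  by (rule all3_zip_right, assumption)+ (simp add: both_agrees)

lemma map_tri_rel: "all3 P x y \<Longrightarrow> (\<And>a b. P a b \<Longrightarrow> Q (f a) (g b)) \<Longrightarrow> all3 Q (map_tri f x) (map_tri g y)"
  by (cases x; cases y) (auto split: if_splits)

lemma flip3_rel: "all3 P x y \<Longrightarrow> all3 P (flip3 x) (flip3 y)"
  by (cases x; cases y) (auto split: if_splits)

lemma transp_rel: "all3 (all3 P) x y \<Longrightarrow> all3 (all3 P) (transp x) (transp y)"
  unfolding all3_rel by (cases x rule: transp.cases; cases y rule: transp.cases) auto

lemma turn_rel: "cube_rel P A B \<Longrightarrow> cube_rel P (turn \<pi> A) (turn \<pi> B)"
  by (cases \<pi>) (auto intro!: transp_rel map_tri_rel)

lemma flips_rel: "cube_rel P A B \<Longrightarrow> cube_rel P (flips s t r A) (flips s t r B)"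
proof -
  assume AB: "cube_rel P A B"
  have 1: "cube_rel P (flip3 A) (flip3 B)" if "cube_rel P A B" for A B :: "_ cube" using that by (rule flip3_rel)
  have 2: "cube_rel P (map_tri flip3 A) (map_tri flip3 B)" if "cube_rel P A B" for A B :: "_ cube"
    using that by (rule map_tri_rel) (rule flip3_rel)
  have 3: "cube_rel P (map_tri (map_tri flip3) A) (map_tri (map_tri flip3) B)" if "cube_rel P A B" for A B :: "_ cube"
    using that by (rule map_tri_rel) (erule map_tri_rel, rule flip3_rel)
  show ?thesis unfolding flips_def Let_def by (cases s; cases t; cases r) (simp_all add: 1 2 3 AB)
qed

text \<open>Some symmetry carries \<open>x\<close> to \<open>y\<close>, but its linear part is
  unknown: knowledge around \<open>y\<close> holds around \<open>x\<close> in one of the 48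
  orientations.\<close>

lemma two_orbit_cube:
  assumes "two_orbit c" "c x = c y"
    and A: "cube_rel agrees A (cube (\<lambda>d. c (y + d)))"
  shows "\<exists>B\<in>set (orients A). cube_rel agrees B (cube (\<lambda>d. c (x + d)))"
proof -
  obtain g where g: "g \<in> symm c" "mov g x = y" using assms unfolding two_orbit_def by metis
  obtain L t where Lt: "g = Motion L t" by (cases g)
  have eq: "(\<lambda>d. c (x + d)) = (\<lambda>d. c (y + act L d))"
  proof
    fix d
    have "mov g (x + d) = y + act L d" using g(2) by (simp add: Lt act_add add_ac)
    then show "c (x + d) = c (y + act L d)" using g(1) unfolding symm_def mem_Collect_eq by metis
  qed
  obtain \<pi> s t r where L: "L = SP \<pi> s t r" by (cases L)
  have "cube (\<lambda>d. c (x + d)) = turn \<pi> (flips s t r (cube (\<lambda>d. c (y + d))))"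
    unfolding eq L using cube_act[of "\<lambda>d. c (y + d)"] by simp
  moreover have "cube_rel agrees (turn \<pi> (flips s t r A)) (turn \<pi> (flips s t r (cube (\<lambda>d. c (y + d)))))"
    by (intro turn_rel flips_rel A)
  ultimately show ?thesis using flips_in by metis
qed

text \<open>As it is unknown which alternative is the true one, only their common part may be
  retained; it is correct as soon as one of them is.\<close>

lemma fold_both:
  assumes "B = A \<or> B \<in> set As" "cube_rel agrees B C"
  shows "cube_rel agrees (fold (cube_zip both) As A) C"
  using assms
proof (induction As arbitrary: A)
  case (Cons D As)
  show ?case
  proof (cases "B \<in> set As")
    case True
    then show ?thesis using Cons by simp
  next
    case False
    then have "cube_rel agrees A C \<or> cube_rel agrees D C" using Cons.prems by auto
    then have 1: "cube_rel agrees (cube_zip both D A) C" using cube_both_left cube_both_right by blast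
    have "cube_rel agrees (fold (cube_zip both) As E) C" if "cube_rel agrees E C" for E
      using that cube_both_right by (induction As arbitrary: E) auto
    with 1 show ?thesis by simp
  qed
qed simp

text \<open>A window of known colours; the cell with indices \<open>i\<close>, \<open>j\<close>, \<open>k\<close> describes the point
  \<open>(i - 3, j - 3, k - 3)\<close>, so the two base points \<open>0\<close> and \<open>(1, 0, 0)\<close> are well inside.\<close>

type_synonym window = "kn list list list"

definition indexed :: "nat \<Rightarrow> (nat \<Rightarrow> 'a \<Rightarrow> bool) \<Rightarrow> 'a list \<Rightarrow> bool" where
  "indexed n P xs \<longleftrightarrow> length xs = n \<and> (\<forall>i<n. P i (xs ! i))"

definition cell :: "nat \<Rightarrow> nat \<Rightarrow> nat \<Rightarrow> pt" where
  "cell i j k = Tri (int i - 3) (int j - 3) (int k - 3)"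

definition describes :: "window \<Rightarrow> colouring \<Rightarrow> bool" where
  "describes W c \<longleftrightarrow> indexed 8 (\<lambda>i. indexed 7 (\<lambda>j. indexed 7 (\<lambda>k v. agrees v (c (cell i j k))))) W"

definition slice :: "nat \<Rightarrow> 'a list \<Rightarrow> 'a tri" where
  "slice i xs = (case drop i xs of a # b # c # _ \<Rightarrow> Tri a b c)"

fun put :: "nat \<Rightarrow> 'a tri \<Rightarrow> 'a list \<Rightarrow> 'a list" where
  "put i (Tri a b c) xs = xs[i := a, Suc i := b, Suc (Suc i) := c]"

definition get_cube :: "nat \<Rightarrow> nat \<Rightarrow> nat \<Rightarrow> 'a list list list \<Rightarrow> 'a cube" where
  "get_cube i j k W = map_tri (\<lambda>P. map_tri (slice k) (slice j P)) (slice i W)"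

definition put_cube :: "nat \<Rightarrow> nat \<Rightarrow> nat \<Rightarrow> 'a cube \<Rightarrow> 'a list list list \<Rightarrow> 'a list list list" where
  "put_cube i j k C W = put i (zip3 (\<lambda>D P. put j (zip3 (put k) D (slice j P)) P) C (slice i W)) W"

lemma slice_nth: "i + 2 < length xs \<Longrightarrow> slice i xs = Tri (xs ! i) (xs ! (i + 1)) (xs ! (i + 2))"
  using Cons_nth_drop_Suc[of i xs, symmetric] Cons_nth_drop_Suc[of "Suc i" xs, symmetric]
    Cons_nth_drop_Suc[of "Suc (Suc i)" xs, symmetric]
  by (simp add: slice_def)

lemma indexed_slice: "indexed n P xs \<Longrightarrow> i + 2 < n \<Longrightarrow> \<exists>a b c. slice i xs = Tri a b c \<and> P i a \<and> P (i + 1) b \<and> P (i + 2) c"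
  by (simp add: indexed_def slice_nth)

lemma indexed_put:
  "indexed n P xs \<Longrightarrow> i + 2 < n \<Longrightarrow> P i a \<Longrightarrow> P (i + 1) b \<Longrightarrow> P (i + 2) c \<Longrightarrow> indexed n P (put i (Tri a b c) xs)"
  by (auto simp: indexed_def nth_list_update)

lemma cube_cells:
  "cube (\<lambda>d. c (cell (i + 1) (j + 1) (k + 1) + d)) =
   Tri (Tri (Tri (c (cell i j k)) (c (cell i j (k+1))) (c (cell i j (k+2))))
            (Tri (c (cell i (j+1) k)) (c (cell i (j+1) (k+1))) (c (cell i (j+1) (k+2))))
            (Tri (c (cell i (j+2) k)) (c (cell i (j+2) (k+1))) (c (cell i (j+2) (k+2)))))
       (Tri (Tri (c (cell (i+1) j k)) (c (cell (i+1) j (k+1))) (c (cell (i+1) j (k+2))))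
            (Tri (c (cell (i+1) (j+1) k)) (c (cell (i+1) (j+1) (k+1))) (c (cell (i+1) (j+1) (k+2))))
            (Tri (c (cell (i+1) (j+2) k)) (c (cell (i+1) (j+2) (k+1))) (c (cell (i+1) (j+2) (k+2)))))
       (Tri (Tri (c (cell (i+2) j k)) (c (cell (i+2) j (k+1))) (c (cell (i+2) j (k+2))))
            (Tri (c (cell (i+2) (j+1) k)) (c (cell (i+2) (j+1) (k+1))) (c (cell (i+2) (j+1) (k+2))))
            (Tri (c (cell (i+2) (j+2) k)) (c (cell (i+2) (j+2) (k+1))) (c (cell (i+2) (j+2) (k+2)))))"
  by (simp add: cube_def gen3_def cell_def)

lemma describes_get:
  assumes "describes W c" "i < 6" "j < 5" "k < 5"
  shows "cube_rel agrees (get_cube i j k W) (cube (\<lambda>d. c (cell (i + 1) (j + 1) (k + 1) + d)))"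
proof -
  let ?R = "\<lambda>i j. indexed 7 (\<lambda>k v. agrees v (c (cell i j k)))"
  let ?row = "\<lambda>i' j'. Tri (c (cell i' j' k)) (c (cell i' j' (k+1))) (c (cell i' j' (k+2)))"
  have row: "all3 agrees (slice k r) (?row i' j')" if "?R i' j' r" for r i' j'
    using indexed_slice[OF that, of k] assms(4) by auto
  have plane: "all3 (all3 agrees) (map_tri (slice k) (slice j P)) (Tri (?row i' j) (?row i' (j+1)) (?row i' (j+2)))"
    if P: "indexed 7 (?R i') P" for P i'
  proof -
    obtain r0 r1 r2 where "slice j P = Tri r0 r1 r2" "?R i' j r0" "?R i' (j+1) r1" "?R i' (j+2) r2"
      using indexed_slice[OF P, of j] assms(3) by auto
    then show ?thesis using row by (simp only: tri.map all3.simps if_True)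
  qed
  obtain P0 P1 P2 where "slice i W = Tri P0 P1 P2" "indexed 7 (?R i) P0" "indexed 7 (?R (i+1)) P1" "indexed 7 (?R (i+2)) P2"
    using indexed_slice[of 8 "\<lambda>i. indexed 7 (?R i)" W i] assms(1,2) unfolding describes_def by auto
  then show ?thesis
    using plane[of i P0] plane[of "i+1" P1] plane[of "i+2" P2]
    unfolding get_cube_def cube_cells by (simp only: tri.map all3.simps if_True)
qed

lemma describes_put:
  assumes W: "describes W c" and b: "i < 6" "j < 5" "k < 5"
    and C: "cube_rel agrees C (cube (\<lambda>d. c (cell (i + 1) (j + 1) (k + 1) + d)))"
  shows "describes (put_cube i j k C W) c"
proof -
  let ?R = "\<lambda>i j. indexed 7 (\<lambda>k v. agrees v (c (cell i j k)))"
  have row: "?R i' j' (put k T r)"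
    if "?R i' j' r" "all3 agrees T (Tri (c (cell i' j' k)) (c (cell i' j' (k+1))) (c (cell i' j' (k+2))))" for r i' j' T
  proof (cases T)
    case (Tri x y z)
    show ?thesis unfolding Tri by (rule indexed_put) (use that b in \<open>auto simp: Tri split: if_splits\<close>)
  qed
  let ?row = "\<lambda>i' j'. Tri (c (cell i' j' k)) (c (cell i' j' (k+1))) (c (cell i' j' (k+2)))"
  have plane: "indexed 7 (?R i') (put j (zip3 (put k) D (slice j P)) P)"
    if P: "indexed 7 (?R i') P" and D: "all3 (all3 agrees) D (Tri (?row i' j) (?row i' (j+1)) (?row i' (j+2)))" for P i' D
  proof -
    obtain r0 r1 r2 where r: "slice j P = Tri r0 r1 r2" "?R i' j r0" "?R i' (j+1) r1" "?R i' (j+2) r2"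
      using indexed_slice[OF P, of j] b by auto
    obtain x y z where T: "D = Tri x y z" by (cases D)
    show ?thesis unfolding r(1) T zip3.simps
      by (rule indexed_put[OF P]) (use b r D in \<open>auto simp only: T all3.simps split: if_splits intro!: row\<close>)
  qed
  obtain P0 P1 P2 where P: "slice i W = Tri P0 P1 P2" "indexed 7 (?R i) P0" "indexed 7 (?R (i+1)) P1" "indexed 7 (?R (i+2)) P2"
    using indexed_slice[of 8 "\<lambda>i. indexed 7 (?R i)" W i] W b unfolding describes_def by auto
  obtain x y z where T: "C = Tri x y z" by (cases C)
  show ?thesis unfolding put_cube_def P(1) T zip3.simps describes_def
    by (rule indexed_put) (use W[unfolded describes_def] b P C in \<open>auto simp only: T all3.simps cube_cells split: if_splits intro!: plane\<close>)
qed

definition set_cell :: "nat \<Rightarrow> nat \<Rightarrow> nat \<Rightarrow> kn \<Rightarrow> window \<Rightarrow> window" where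
  "set_cell i j k v W = W[i := (W ! i)[j := (W ! i ! j)[k := v]]]"

text \<open>An update at an index outside the window leaves the window as it is, which the
  implications in the second assumption reflect.\<close>

lemma describes_set_cell:
  assumes "describes W c" "i < 8 \<longrightarrow> j < 7 \<longrightarrow> k < 7 \<longrightarrow> agrees v (c (cell i j k))"
  shows "describes (set_cell i j k v W) c"
  using assms unfolding describes_def indexed_def set_cell_def
  by (cases "i < 8"; cases "j < 7"; cases "k < 7") (auto simp: nth_list_update)

text \<open>Outside the window the answer is \<open>Unk\<close>; a comparison with a definite colour
  can only fail there.\<close>

definition look :: "window \<Rightarrow> pt \<Rightarrow> kn" where
  "look W p = (case p of Tri x y z \<Rightarrow>
     if -3 \<le> x \<and> x \<le> 4 \<and> -3 \<le> y \<and> y \<le> 3 \<and> -3 \<le> z \<and> z \<le> 3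
     then W ! nat (x + 3) ! nat (y + 3) ! nat (z + 3) else Unk)"

lemma describes_look: "describes W c \<Longrightarrow> agrees (look W p) (c p)"
proof (cases p)
  case (Tri x y z)
  assume W: "describes W c"
  show ?thesis
  proof (cases "-3 \<le> x \<and> x \<le> 4 \<and> -3 \<le> y \<and> y \<le> 3 \<and> -3 \<le> z \<and> z \<le> 3")
    case True
    then have "nat (x + 3) < 8" "nat (y + 3) < 7" "nat (z + 3) < 7" by auto
    then have "agrees (W ! nat (x + 3) ! nat (y + 3) ! nat (z + 3)) (c (cell (nat (x + 3)) (nat (y + 3)) (nat (z + 3))))"
      using W unfolding describes_def indexed_def by blast
    moreover have "cell (nat (x + 3)) (nat (y + 3)) (nat (z + 3)) = p" using True by (simp add: cell_def Tri)
    ultimately show ?thesis using True by (simp add: look_def Tri)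
  qed (auto simp: look_def Tri)
qed

lemma look_known: "describes W c \<Longrightarrow> look W p = kn_of b \<Longrightarrow> c p = b"
  using describes_look[of W c p] by (auto simp: kn_of_def split: if_splits)

definition blank :: window where
  "blank = replicate 8 (replicate 7 (replicate 7 Unk))"

lemma describes_blank: "describes blank c"
  by (simp add: describes_def blank_def indexed_def)

fun mark :: "pt \<Rightarrow> bool \<Rightarrow> window \<Rightarrow> window" where
  "mark (Tri x y z) v W = set_cell (nat (x + 3)) (nat (y + 3)) (nat (z + 3)) (kn_of v) W"


section \<open>Certificates\<close>

text \<open>\<open>Deduce\<close> gives the corners of two \<open>3 \<times> 3 \<times> 3\<close> cubes with centres of the same colour: some rotation
  carries the second to the first. \<open>Leaf\<close> and \<open>Refer\<close> name an entry of the list or an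
  earlier pattern, with a motion and the information whether colours are exchanged.\<close>

datatype cert =
    Split nat nat nat cert cert
  | Deduce nat nat nat nat nat nat cert
  | Leaf nat sperm pt bool
  | Refer nat sperm pt bool
  | Stuck

type_synonym pattern = "(pt \<times> bool) list"

fun centre :: "'a cube \<Rightarrow> 'a" where
  "centre (Tri p (Tri q (Tri a b c) r) s) = b"

fun same_known :: "kn \<Rightarrow> kn \<Rightarrow> bool" where
  "same_known Fa Fa = True" | "same_known Tr Tr = True" | "same_known _ _ = False"

definition leaf_ok :: "colouring \<Rightarrow> sperm \<Rightarrow> pt \<Rightarrow> bool \<Rightarrow> window \<Rightarrow> pt \<Rightarrow> bool" where
  "leaf_ok f L t s W d \<longleftrightarrow> look W d = kn_of (f (act L d + t) \<noteq> s) \<and>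
     look W (d + Tri 1 0 0) = kn_of (f (act L (d + Tri 1 0 0) + t) \<noteq> s)"

definition refer_ok :: "sperm \<Rightarrow> pt \<Rightarrow> bool \<Rightarrow> window \<Rightarrow> pt \<times> bool \<Rightarrow> bool" where
  "refer_ok L t s W pv = (case pv of (p, v) \<Rightarrow> look W (act L p + t) = kn_of (v \<noteq> s))"

text \<open>Only lower bounds occur: \<open>nat\<close> would turn a coordinate below -3 into the
  index 0 and mark a wrong cell, while an index that is too large changes nothing.\<close>

fun in_range :: "pt \<Rightarrow> bool" where
  "in_range (Tri x y z) \<longleftrightarrow> -3 \<le> x \<and> -3 \<le> y \<and> -3 \<le> z"

locale certificate =
  fixes neighbours :: "nat \<Rightarrow> pt list" and model :: "nat \<Rightarrow> colouring"
begin

text \<open>If no orientation of the second cube is compatible with the first,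
  \<open>two_orbit_cube\<close> is contradicted and the case is closed. \<open>Stuck\<close> is
  never accepted; in a valid certificate it can stand only behind a \<open>Deduce\<close> that
  closes its case, as the continuation that is not reached.\<close>

primrec check :: "pattern list \<Rightarrow> cert \<Rightarrow> window \<Rightarrow> bool" where
  "check G (Split i j k a b) W = (check G a (set_cell i j k Fa W) \<and> check G b (set_cell i j k Tr W))"
| "check G (Deduce i j k i' j' k' a) W =
     (if i < 6 \<and> j < 5 \<and> k < 5 \<and> i' < 6 \<and> j' < 5 \<and> k' < 5 then
        let A = get_cube i j k W; B = get_cube i' j' k' W in
        if same_known (centre A) (centre B) then
          (case filter (cube_rel compat A) (orients B) of
             [] \<Rightarrow> True
           | C # Cs \<Rightarrow> check G a (put_cube i j k (cube_zip refine A (fold (cube_zip both) Cs C)) W))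
        else False
      else False)"
| "check G (Leaf n L t s) W =
     (let f = model n in list_all (leaf_ok f L t s W) (neighbours n))"
| "check G (Refer n L t s) W =
     (n < length G \<and> list_all (refer_ok L t s W) (G ! n))"
| "check G Stuck W = False"

definition solved :: "nat set \<Rightarrow> colouring \<Rightarrow> bool" where
  "solved N c \<longleftrightarrow> (\<exists>n\<in>N. equiv_col c (model n))"

definition solves :: "nat set \<Rightarrow> pattern \<Rightarrow> bool" where
  "solves N P \<longleftrightarrow> (\<forall>c. two_orbit c \<longrightarrow> (\<forall>(p, v)\<in>set P. c p = v) \<longrightarrow> solved N c)"

primrec leaves :: "cert \<Rightarrow> nat set" where
  "leaves (Split i j k a b) = leaves a \<union> leaves b"
| "leaves (Deduce i j k i' j' k' a) = leaves a"
| "leaves (Leaf n L t s) = {n}"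
| "leaves (Refer n L t s) = {}"
| "leaves Stuck = {}"

lemma centre_rel: "cube_rel P A B \<Longrightarrow> P (centre A) (centre B)"
  by (cases A rule: centre.cases; cases B rule: centre.cases) (auto split: if_splits)

lemma centre_cube: "centre (cube f) = f 0"
  by (simp add: cube_def gen3_def zero_tri_def)

lemma same_known_agrees: "same_known x y \<Longrightarrow> agrees x a \<Longrightarrow> agrees y b \<Longrightarrow> a = b"
  by (cases x; cases y; simp)

text \<open>The window keeps describing \<open>c\<close>: \<open>Split\<close> follows the true
  colour of the cell, and at \<open>Deduce\<close> the orientation that really occurs is among the
  compatible ones. A \<open>Leaf\<close> shows agreement with the moved model around both base
  points, and \<open>rigid_determines\<close> turns this into equality. A \<open>Refer\<close>
  passes the question to a pattern already solved.\<close>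

lemma check_sound:
  assumes models: "\<And>n. n \<in> N \<Longrightarrow> two_orbit (model n) \<and> (\<forall>y. rigid_at (set (neighbours n)) (model n) y) \<and>
      (\<forall>L. \<forall>d\<in>set (neighbours n). act L d \<in> set (neighbours n)) \<and> 0 \<in> set (neighbours n) \<and> set units \<subseteq> set (neighbours n)"
    and G: "\<And>P. P \<in> set G \<Longrightarrow> solves N P"
    and c: "two_orbit c" "\<not> c 0" "c (Tri 1 0 0)"
  shows "leaves a \<subseteq> N \<Longrightarrow> check G a W \<Longrightarrow> describes W c \<Longrightarrow> solved N c"
proof (induction a arbitrary: W)
  case (Split i j k a b)
  show ?case
  proof (cases "c (cell i j k)")
    case True
    then show ?thesis using Split.IH(2)[of "set_cell i j k Tr W"] Split.prems by (simp add: describes_set_cell)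
  next
    case False
    then show ?thesis using Split.IH(1)[of "set_cell i j k Fa W"] Split.prems by (simp add: describes_set_cell)
  qed
next
  case (Deduce i j k i' j' k' a)
  let ?A = "get_cube i j k W" and ?B = "get_cube i' j' k' W"
  let ?x = "cell (i + 1) (j + 1) (k + 1)" and ?y = "cell (i' + 1) (j' + 1) (k' + 1)"
  have b: "i < 6" "j < 5" "k < 5" "i' < 6" "j' < 5" "k' < 5" "same_known (centre ?A) (centre ?B)"
    using Deduce.prems(2) by (auto simp: Let_def split: if_splits)
  have A: "cube_rel agrees ?A (cube (\<lambda>d. c (?x + d)))" and B: "cube_rel agrees ?B (cube (\<lambda>d. c (?y + d)))"
    by (rule describes_get[OF Deduce.prems(3) b(1-3)], rule describes_get[OF Deduce.prems(3) b(4-6)])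
  have "c ?x = c ?y"
    using same_known_agrees[OF b(7) centre_rel[OF A] centre_rel[OF B]] by (simp add: centre_cube)
  then obtain D where D: "D \<in> set (orients ?B)" "cube_rel agrees D (cube (\<lambda>d. c (?x + d)))"
    using two_orbit_cube[OF c(1) _ B] by blast
  have "cube_rel compat ?A D" using A D(2) by (rule cube_compat)
  then have "D \<in> set (filter (cube_rel compat ?A) (orients ?B))" using D(1) by simp
  then obtain C Cs where C: "filter (cube_rel compat ?A) (orients ?B) = C # Cs" "D = C \<or> D \<in> set Cs"
    by (cases "filter (cube_rel compat ?A) (orients ?B)") auto
  have "check G a (put_cube i j k (cube_zip refine ?A (fold (cube_zip both) Cs C)) W)"
    using Deduce.prems(2) b C(1) by (simp add: Let_def)
  moreover have "describes (put_cube i j k (cube_zip refine ?A (fold (cube_zip both) Cs C)) W) c"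
    by (intro describes_put Deduce.prems b cube_refine A fold_both[OF C(2) D(2)])
  ultimately show ?case using Deduce.IH Deduce.prems(1) by simp
next
  case (Leaf n L t s)
  define f where "f p = (model n (mov (Motion L t) p) \<noteq> s)" for p
  have n: "n \<in> N" using Leaf by simp
  have known: "c d = f d \<and> c (Tri 1 0 0 + d) = f (Tri 1 0 0 + d)" if "d \<in> set (neighbours n)" for d
  proof -
    have "leaf_ok (model n) L t s W d" using Leaf.prems(2) that by (simp add: list_all_iff)
    then have "look W d = kn_of (f d)" "look W (d + Tri 1 0 0) = kn_of (f (d + Tri 1 0 0))"
      unfolding f_def leaf_ok_def by simp_all
    then show ?thesis using look_known[OF Leaf.prems(3)] by (simp add: add.commute)
  qed
  have "c = f"
  \<comment> \<open>The base points \<open>0\<close> and \<open>Tri 1 0 0\<close> are the two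
    differently coloured points fixed by normalisation.\<close>
  proof (rule rigid_determines[where E = "set (neighbours n)" and e = "Tri 1 0 0"])
    show "two_orbit f" using two_orbit_equiv[of f "model n" "Motion L t" s] models[OF n] by (simp add: f_def)
    show "rigid_at (set (neighbours n)) f y" for y
      by (rule rigid_at_equiv[where c' = "model n" and g = "Motion L t" and s = s])
         (use models[OF n] in \<open>auto simp only: f_def\<close>)
  qed (use models[OF n] c known in auto)
  then show ?case using n unfolding solved_def equiv_col_def f_def by blast
next
  case (Refer n L t s)
  obtain k where k: "\<And>p. mov k (mov (Motion L t) p) = p" "\<And>p. mov (Motion L t) (mov k p) = p"
    using mov_inverse[of "Motion L t"] by metis
  \<comment> \<open>The same colouring in the coordinates of the earlier pattern, with colours
    exchanged if \<open>s\<close> holds.\<close>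
  define f where "f p = (c (mov (Motion L t) p) \<noteq> s)" for p
  have cf: "c p = (f (mov k p) \<noteq> s)" for p unfolding f_def k by auto
  have "two_orbit f" by (rule two_orbit_equiv[of f c "Motion L t" s]) (use c in \<open>auto simp: f_def\<close>)
  moreover have "f p = v" if "(p, v) \<in> set (G ! n)" for p v
  proof -
    have "look W (act L p + t) = kn_of (v \<noteq> s)" using Refer.prems(2) that by (auto simp: list_all_iff refer_ok_def)
    then have "c (act L p + t) = (v \<noteq> s)" using look_known[OF Refer.prems(3)] by blast
    then show ?thesis by (auto simp: f_def)
  qed
  moreover have "solves N (G ! n)" using Refer.prems(2) G by simp
  ultimately have f: "solved N f" unfolding solves_def by blast
  have "equiv_col c f" unfolding equiv_col_def using cf by blast
  then show ?case using f equiv_col_trans[of c f] unfolding solved_def by blast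
qed simp

definition start :: "pattern \<Rightarrow> window" where
  "start P = fold (\<lambda>(p, v). mark p v) P blank"

lemma describes_mark:
  assumes "describes W c" "c p = v" "look blank p = Unk" "case p of Tri x y z \<Rightarrow> -3 \<le> x \<and> -3 \<le> y \<and> -3 \<le> z"
  shows "describes (mark p v W) c"
proof (cases p)
  case (Tri x y z)
  then have "cell (nat (x + 3)) (nat (y + 3)) (nat (z + 3)) = p" using assms(4) by (simp add: cell_def)
  then show ?thesis unfolding Tri mark.simps
    using assms(2) by (intro describes_set_cell assms(1)) (auto simp: kn_of_def Tri)
qed

lemma describes_start:
  assumes "\<forall>(p, v)\<in>set P. in_range p \<and> c p = v"
  shows "describes (start P) c"
proof -
  have "describes W c \<Longrightarrow> describes (fold (\<lambda>(p, v). mark p v) P W) c" for W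
    using assms
  proof (induction P arbitrary: W)
    case (Cons a P)
    obtain p v where a: "a = (p, v)" by (cases a)
    have "describes (mark p v W) c"
      using Cons.prems by (intro describes_mark) (cases p; auto simp: a look_def blank_def)+
    then show ?case using Cons by (simp add: a)
  qed simp
  then show ?thesis unfolding start_def using describes_blank by blast
qed

definition verified :: "pattern list \<Rightarrow> pattern \<Rightarrow> cert \<Rightarrow> bool" where
  "verified G P a \<longleftrightarrow> list_all (\<lambda>(p, v). in_range p) P \<and> (Tri 0 0 0, False) \<in> set P \<and> (Tri 1 0 0, True) \<in> set P \<and>
     check G a (start P)"

lemma verified_solves:
  assumes models: "\<And>n. n \<in> N \<Longrightarrow> two_orbit (model n) \<and> (\<forall>y. rigid_at (set (neighbours n)) (model n) y) \<and>
      (\<forall>L. \<forall>d\<in>set (neighbours n). act L d \<in> set (neighbours n)) \<and> 0 \<in> set (neighbours n) \<and> set units \<subseteq> set (neighbours n)"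
    and G: "\<And>P. P \<in> set G \<Longrightarrow> solves N P"
    and "leaves a \<subseteq> N" "verified G P a"
  shows "solves N P"
  unfolding solves_def
proof (intro allI impI)
  fix c assume c: "two_orbit c" "\<forall>(p, v)\<in>set P. c p = v"
  then have "\<not> c 0" "c (Tri 1 0 0)" using assms(4) by (auto simp: verified_def zero_tri_def)
  moreover have "describes (start P) c"
    using c(2) assms(4) by (intro describes_start) (auto simp: verified_def list_all_iff)
  ultimately show "solved N c"
    using check_sound[where a = a and W = "start P", OF models G c(1)] assms(3,4) by (simp add: verified_def)
qed

end

text \<open>By connectedness two adjacent points differ in colour. A motion takes the pair to
  \<open>0\<close> and \<open>Tri 1 0 0\<close>, and the flag makes the colour of \<open>0\<close>
  false: the normal form in which every certificate starts.\<close>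

lemma adjacent_colours:
  assumes "proper c"
  shows "\<exists>g s. \<not> (c (mov g 0) \<noteq> s) \<and> (c (mov g (Tri 1 0 0)) \<noteq> s)"
proof -
  have "\<exists>p u. u \<in> set units \<and> c (p + u) \<noteq> c p"
  proof (rule ccontr)
    assume "\<not> ?thesis"
    then have "c p = c 0" for p using lattice_connected[of "\<lambda>p. c p = c 0"] by blast
    then show False using assms unfolding proper_def by metis
  qed
  then obtain p u where u: "u \<in> set units" "c (p + u) \<noteq> c p" by blast
  have "\<forall>u\<in>set units. \<exists>L\<in>set sperms. act L (Tri 1 0 0) = u" by code_simp
  then obtain L where "act L (Tri 1 0 0) = u" using u(1) by blast
  then show ?thesis using u(2) by (intro exI[of _ "Motion L p"] exI[of _ "c p"]) (simp add: add.commute)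
qed


declare certificate.check.simps [code] certificate.verified_def [code] certificate.start_def [code]

section \<open>Models of the 25 entries\<close>

text \<open>Every entry is realised in \<open>\<int>\<^sup>3\<close> itself (half the scale of the list) with the first listed point at
  the origin. \<open>half_origin\<close> is twice the origin of the frame, \<open>shifts\<close> starts with the basis
  \<open>a\<close>, \<open>b\<close>, \<open>c\<close>. The field \<open>routes\<close> tells which generator leads closer to one of the two
  listed points.\<close>

datatype model = Model
  (period: nat) (table: "nat list list list") (shifts: "pt list") (half_origin: pt) (second: pt)
  (generators_pt: "motion list") (reduced_basis: "int list list") (axes: "int list list")
  (routes: "nat list list list") (stabilizer_words: "(sperm \<times> nat list) list")
  (rep1: pt) (to1: motion) (dirs1: "pt list") (rep2: pt) (to2: motion) (dirs2: "pt list")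

section \<open>Executable checks of a periodic model\<close>

fun entry_at :: "nat \<Rightarrow> 'a list list list \<Rightarrow> pt \<Rightarrow> 'a" where
  "entry_at m T (Tri x y z) = T ! nat (x mod int m) ! nat (y mod int m) ! nat (z mod int m)"

definition tcol :: "nat \<Rightarrow> nat list list list \<Rightarrow> colouring" where
  "tcol m T p = (entry_at m T p = 1)"

definition mcol :: "model \<Rightarrow> colouring" where
  "mcol M = tcol (period M) (table M)"

definition all_gens :: "model \<Rightarrow> motion list" where
  "all_gens M = map shift (shifts M) @ generators_pt M"

definition grid :: "int list \<Rightarrow> int list \<Rightarrow> int list \<Rightarrow> pt list" where
  "grid xs ys zs = concat (map (\<lambda>x. concat (map (\<lambda>y. map (Tri x y) zs) ys)) xs)"

definition box_list :: "nat \<Rightarrow> pt list" where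
  "box_list m = (let xs = map int [0..<m] in grid xs xs xs)"

definition short :: "int \<Rightarrow> pt \<Rightarrow> bool" where
  "short r d = (idot d d \<le> r)"

text \<open>Squared radius 3 gives precisely the 3 by 3 by 3 cube, with corners (1,1,1); squared
  radius 6 reaches the points of type (2,1,1).\<close>

definition ball_list :: "int \<Rightarrow> pt list" where
  "ball_list r = (let xs = (if r \<le> 3 then [-1, 0, 1] else [-2, -1, 0, 1, 2]) in filter (short r) (grid xs xs xs))"

fun scale :: "int \<Rightarrow> pt \<Rightarrow> pt" where
  "scale k (Tri x y z) = Tri (k * x) (k * y) (k * z)"

fun comb :: "int list \<Rightarrow> pt list \<Rightarrow> pt" where
  "comb (k # ks) (v # vs) = (if k = 0 then comb ks vs else scale k v + comb ks vs)"
| "comb _ _ = 0"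

definition moves_ok :: "nat \<Rightarrow> nat list list list \<Rightarrow> motion \<Rightarrow> pt \<Rightarrow> bool" where
  "moves_ok m T g p = (tcol m T (mov g p) = tcol m T p)"

definition invariant :: "nat \<Rightarrow> nat list list list \<Rightarrow> pt list \<Rightarrow> motion \<Rightarrow> bool" where
  "invariant m T bx g = list_all (moves_ok m T g) bx"

text \<open>Besides the generators this tests \<open>g1\<close> and \<open>g2\<close>, the
  symmetries that carry the points \<open>y1\<close> and \<open>y2\<close> on the tabulated Wyckoff
  sets to the two listed points, which sit at \<open>0\<close> and \<open>q\<close>.\<close>

definition check_invariant :: "model \<Rightarrow> bool" where
  "check_invariant M = (case M of Model m T ts h q gs r a rt w y1 g1 d1 y2 g2 d2 \<Rightarrow>
     let bx = box_list m in m > 0 \<and> \<not> tcol m T 0 \<and> tcol m T q \<and> list_all (invariant m T bx) (map shift ts) \<and> list_all (invariant m T bx) gs \<and>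
       invariant m T bx g1 \<and> invariant m T bx g2 \<and> mov g1 y1 = 0 \<and> mov g2 y2 = q)"

text \<open>The table \<open>rt\<close> names the generator to be applied next at each residue.
  Following it to one of the two base residues proves transitivity without any search; the number
  argument bounds the length of the walk.\<close>

primrec arrives :: "nat \<Rightarrow> nat list list list \<Rightarrow> motion list \<Rightarrow> pt \<Rightarrow> nat \<Rightarrow> pt \<Rightarrow> bool" where
  "arrives m rt gs q 0 p = (p = 0 \<or> p = q)"
| "arrives m rt gs q (Suc k) p =
    (if p = 0 then True else if p = q then True else
      let i = entry_at m rt p in i < length gs \<and> arrives m rt gs q k (md m (mov (gs ! i) p)))"

text \<open>The lists \<open>a\<close> express the three period vectors through the translation
  generators, so reduction modulo \<open>m\<close> stays inside the generated group. The constant 6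
  is a bound on the lengths of the walks.\<close>

definition check_transitive :: "model \<Rightarrow> bool" where
  "check_transitive M = (case M of Model m T ts h q gs r a rt w y1 g1 d1 y2 g2 d2 \<Rightarrow>
     let all = map shift ts @ gs; q' = md m q in list_all (arrives m rt all q' 6) (box_list m) \<and>
     list_all (\<lambda>ks. length ks = length ts) a \<and>
     map (\<lambda>ks. comb ks ts) a = [Tri (int m) 0 0, Tri 0 (int m) 0, Tri 0 0 (int m)])"

text \<open>One pass over the ball decides rigidity for all directions. A mismatch at
  \<open>d\<close> strikes out every direction whose overlap contains \<open>d\<close>, as its
  premise then fails. If a direction survives to the end, its premise holds, and then there must not
  have been any mismatch at all.\<close>

fun scan :: "nat \<Rightarrow> nat list list list \<Rightarrow> int \<Rightarrow> pt \<Rightarrow> sperm \<Rightarrow> bool \<Rightarrow> pt list \<Rightarrow> (pt \<times> bool) list \<Rightarrow> bool" where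
  "scan m T r b L bad us [] = (\<not> bad)"
| "scan m T r b L bad us ((d, v) # ds) =
    (if tcol m T (b + act L d) = v then scan m T r b L bad us ds
     else (case filter (\<lambda>u. \<not> short r (d + u)) us of [] \<Rightarrow> True | u # us' \<Rightarrow> scan m T r b L True (u # us') ds))"

definition with_colour :: "nat \<Rightarrow> nat list list list \<Rightarrow> pt \<Rightarrow> pt \<Rightarrow> pt \<times> bool" where
  "with_colour m T b d = (d, tcol m T (b + d))"

definition scan_all :: "nat \<Rightarrow> nat list list list \<Rightarrow> int \<Rightarrow> pt \<Rightarrow> (pt \<times> bool) list \<Rightarrow> sperm \<Rightarrow> bool" where
  "scan_all m T r b ds L = scan m T r b L False units ds"

definition check_rigid :: "int \<Rightarrow> model \<Rightarrow> bool" where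
  "check_rigid r M = (case M of Model m T ts h q gs rb a rt w y1 g1 d1 y2 g2 d2 \<Rightarrow>
     let ds = ball_list r in list_all (scan_all m T r 0 (map (with_colour m T 0) ds)) sperms \<and>
       list_all (scan_all m T r q (map (with_colour m T q) ds)) sperms)"

fun mismatch :: "nat \<Rightarrow> nat list list list \<Rightarrow> pt \<Rightarrow> sperm \<Rightarrow> (pt \<times> bool) list \<Rightarrow> bool" where
  "mismatch m T b L [] = False"
| "mismatch m T b L ((d, v) # ds) = (if tcol m T (b + act L d) = v then mismatch m T b L ds else True)"

definition word :: "motion list \<Rightarrow> nat list \<Rightarrow> pt \<Rightarrow> pt" where
  "word gs is = foldr (\<lambda>i. mov (gs ! i)) is"

text \<open>A motion is known from the images of \<open>0\<close> and the three unit vectors. Its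
  translation has to vanish only modulo \<open>m\<close>, because the remainder is a generated
  period.\<close>

definition word_ok :: "nat \<Rightarrow> motion list \<Rightarrow> sperm \<times> nat list \<Rightarrow> bool" where
  "word_ok m gs Lw = (case Lw of (L, w) \<Rightarrow> let o' = word gs w 0 in
     list_all (\<lambda>i. i < length gs) w \<and> md m o' = 0 \<and> word gs w (Tri 1 0 0) = act L (Tri 1 0 0) + o' \<and>
     word gs w (Tri 0 1 0) = act L (Tri 0 1 0) + o' \<and> word gs w (Tri 0 0 1) = act L (Tri 0 0 1) + o')"

definition excluded :: "nat \<Rightarrow> nat list list list \<Rightarrow> (pt \<times> bool) list \<Rightarrow> sperm list \<Rightarrow> sperm \<Rightarrow> bool" where
  "excluded m T ds Ls L = (if L \<in> set Ls then True else mismatch m T 0 L ds)"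

text \<open>Both inclusions for the site group of \<open>0\<close>: the listed rotations are words
  in the generators, and each of the others is refuted by a point of the ball of squared radius
  6.\<close>

definition check_stabilizer :: "model \<Rightarrow> bool" where
  "check_stabilizer M = (case M of Model m T ts h q gs rb a rt w y1 g1 d1 y2 g2 d2 \<Rightarrow>
     let all = map shift ts @ gs; Ls = map fst w; ds = map (with_colour m T 0) (ball_list 6) in
     distinct Ls \<and> list_all (word_ok m all) w \<and> list_all (excluded m T ds Ls) sperms)"

text \<open>\<open>hs\<close> is intended as a triangular (Hermite) basis with diagonal
  \<open>d1\<close>, \<open>d2\<close>, \<open>d3\<close>; multiples below \<open>m\<close> divided
  by the diagonal entry then run through the residues of the lattice once each.\<close>

definition lattice_list :: "nat \<Rightarrow> pt list \<Rightarrow> pt list" where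
  "lattice_list m hs = (case hs of [h1, h2, h3] \<Rightarrow>
     (case h1 of Tri d1 _ _ \<Rightarrow> case h2 of Tri _ d2 _ \<Rightarrow> case h3 of Tri _ _ d3 \<Rightarrow>
       map (\<lambda>v. case v of Tri i j k \<Rightarrow> md m (scale i h1 + scale j h2 + scale k h3))
         (grid (map int [0..<m div nat d1]) (map int [0..<m div nat d2]) (map int [0..<m div nat d3])))
     | _ \<Rightarrow> [])"

definition shift_differs :: "nat \<Rightarrow> nat list list list \<Rightarrow> pt \<Rightarrow> pt \<Rightarrow> bool" where
  "shift_differs m T t p = (tcol m T (p + t) \<noteq> tcol m T p)"

definition no_translation :: "nat \<Rightarrow> nat list list list \<Rightarrow> pt list \<Rightarrow> pt list \<Rightarrow> pt \<Rightarrow> bool" where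
  "no_translation m T bx ls t = (if t \<in> set ls then True else list_ex (shift_differs m T t) bx)"

definition lattice_of :: "model \<Rightarrow> pt list" where
  "lattice_of M = (case M of Model m T ts h q gs rb a rt w y1 g1 d1 y2 g2 d2 \<Rightarrow>
     lattice_list m (map (\<lambda>ks. comb ks ts) rb))"

text \<open>The listed vectors are combinations of translation generators by construction, so it
  remains to see that they are distinct and that every other shift in the box changes some
  colour.\<close>

definition check_translations :: "model \<Rightarrow> bool" where
  "check_translations M = (case M of Model m T ts h q gs rb a rt w y1 g1 d1 y2 g2 d2 \<Rightarrow>
     let bx = box_list m; ls = lattice_list m (map (\<lambda>ks. comb ks ts) rb) in
     list_all (\<lambda>ks. length ks = length ts) rb \<and>
     distinct ls \<and> list_all (no_translation m T bx ls) bx)"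

definition is_false :: "nat \<Rightarrow> nat list list list \<Rightarrow> pt \<Rightarrow> bool" where
  "is_false m T p = (\<not> tcol m T p)"

text \<open>In the second equation the number of false cells times the order of the site group is
  the order of the symmetry group modulo \<open>m\<close>, which times the index has to be
  \<open>48 * m ^ 3\<close>.\<close>

definition check_index :: "nat \<Rightarrow> nat \<Rightarrow> model \<Rightarrow> bool" where
  "check_index it ik M = (case M of Model m T ts h q gs rb a rt w y1 g1 d1 y2 g2 d2 \<Rightarrow>
     length (lattice_of M) * it = m ^ 3 \<and>
     length (filter (is_false m T) (box_list m)) * length w * (it * ik) = 48 * m ^ 3)"

definition degree :: "colouring \<Rightarrow> pt \<Rightarrow> nat" where
  "degree c p = length (filter (\<lambda>u. c (p + u) \<noteq> c p) units)"

definition degrees :: "model \<Rightarrow> nat \<times> nat" where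
  "degrees M = (case M of Model m T ts h q gs rb a rt w y1 g1 d1 y2 g2 d2 \<Rightarrow>
     (degree (tcol m T) 0, degree (tcol m T) q))"

text \<open>A rotation about \<open>y\<close> that fixes the directions of a Wyckoff set through
  \<open>y\<close> fixes this set pointwise; every other one must fail to be a symmetry. Then the
  site group of \<open>y\<close> is that of a generic point of the set.\<close>

definition fixes_or_mismatch :: "nat \<Rightarrow> nat list list list \<Rightarrow> pt list \<Rightarrow> pt \<Rightarrow> (pt \<times> bool) list \<Rightarrow> sperm \<Rightarrow> bool" where
  "fixes_or_mismatch m T Ds y ds L = (if list_all (\<lambda>D. act L D = D) Ds then True else mismatch m T y L ds)"

definition direction :: "pt list \<Rightarrow> pt \<Rightarrow> pt" where
  "direction ts d = (case d of Tri x y z \<Rightarrow> comb [x, y, z] (take 3 ts))"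

definition check_sites :: "model \<Rightarrow> bool" where
  "check_sites M = (case M of Model m T ts h q gs rb a rt w y1 g1 d1 y2 g2 d2 \<Rightarrow>
     let bl = ball_list 3 in
     list_all (fixes_or_mismatch m T (map (direction ts) d1) y1 (map (with_colour m T y1) bl)) sperms \<and>
     list_all (fixes_or_mismatch m T (map (direction ts) d2) y2 (map (with_colour m T y2) bl)) sperms)"

text \<open>In entry 18, around the listed point of the larger class, the reflection in the first
  coordinate respects the layers with second coordinate -1 and 0 but not the one with 1. In entry 23
  the exchange of the first two coordinates does the same for the layers along the third. Hence the
  cube is not rigid for these two perfect codes.\<close>

definition nbrs :: "nat \<Rightarrow> pt list" where
  "nbrs n = ball_list (if n = 18 \<or> n = 23 then 6 else 3)"

section \<open>The colourings that realise the 25 entries\<close>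

definition model1 :: model where
  "model1 = Model 4
    [[[0,1,0,1],[1,0,1,0],[0,1,0,1],[1,0,1,0]],[[1,0,1,0],[0,1,0,1],[1,0,1,0],[0,1,0,1]],[[0,1,0,1],[1,0,1,0],
    [0,1,0,1],[1,0,1,0]],[[1,0,1,0],[0,1,0,1],[1,0,1,0],[0,1,0,1]]]
    [Tri 0 0 2, Tri 2 0 0, Tri 0 2 0, Tri 1 1 0, Tri 0 1 1]
    (Tri 0 0 0)
    (Tri 0 1 0)
    [Motion (SP XYZ True False True) (Tri 0 0 0), Motion (SP XYZ False True True) (Tri 0 0 0),
    Motion (SP ZXY False False False) (Tri 0 0 0), Motion (SP ZYX False True False) (Tri 0 0 0),
    Motion (SP XYZ True True True) (Tri 0 0 0)]
    [[0, 0, (-1), 1, 1], [0, 0, 0, 0, 1], [1, 0, 0, 0, 0]]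
    [[0, 2, 0, 0, 0], [0, 0, 2, 0, 0], [2, 0, 0, 0, 0]]
    [[[0,4,0,4],[0,6,0,4],[2,4,2,4],[2,4,2,4]],[[7,5,7,7],[9,9,9,4],[7,5,7,4],[3,4,3,4]],[[1,4,1,4],[1,6,1,8],
    [2,4,2,4],[8,4,2,4]],[[3,7,3,7],[3,6,3,4],[3,4,3,4],[3,4,3,4]]]
    [(SP XYZ False False False, []), (SP XYZ True False True, [5]), (SP XYZ False True True, [6]),
    (SP ZXY False False False, [7]), (SP ZYX False True False, [8]), (SP XYZ True True True, [9]),
    (SP XYZ True True False, [6, 5]), (SP ZXY True True False, [7, 5]), (SP ZYX True True True, [8, 5]),
    (SP XYZ False True False, [9, 5]), (SP ZXY True False True, [7, 6]), (SP ZYX True False False, [8, 6]),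
    (SP XYZ True False False, [9, 6]), (SP ZXY False True True, [6, 7]), (SP YZX False False False, [7, 7]),
    (SP YXZ False True False, [8, 7]), (SP ZXY True True True, [9, 7]), (SP ZYX False False True, [6, 8]),
    (SP XZY False False True, [7, 8]), (SP ZYX True False True, [9, 8]), (SP XYZ False False True, [9, 6, 5]),
    (SP YZX False True True, [7, 7, 5]), (SP YXZ False False True, [8, 7, 5]), (SP ZXY False False True, [9, 7,
    5]), (SP XZY True True True, [7, 8, 5]), (SP ZYX False False False, [9, 8, 5]), (SP YZX True True False, [7,
    7, 6]), (SP YXZ True True True, [8, 7, 6]), (SP ZXY False True False, [9, 7, 6]), (SP XZY False True False,
    [7, 8, 6]), (SP ZYX False True True, [9, 8, 6]), (SP YZX True False True, [7, 6, 7]),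
    (SP YXZ True False False, [8, 6, 7]), (SP ZXY True False False, [9, 6, 7]), (SP YZX True True True, [9, 7,
    7]), (SP YXZ True False True, [9, 8, 7]), (SP XZY True False False, [7, 6, 8]), (SP ZYX True True False, [9,
    6, 8]), (SP XZY True True False, [9, 7, 8]), (SP YZX True False False, [9, 7, 7, 5]), (SP YXZ True True False,
    [9, 8, 7, 5]), (SP XZY False False False, [9, 7, 8, 5]), (SP YZX False False True, [9, 7, 7, 6]),
    (SP YXZ False False False, [9, 8, 7, 6]), (SP XZY True False True, [9, 7, 8, 6]), (SP YZX False True False,
    [9, 7, 6, 7]), (SP YXZ False True True, [9, 8, 6, 7]), (SP XZY False True True, [9, 7, 6, 8])]
    (Tri 0 0 0)
    (Motion (SP XYZ False False False) (Tri 0 0 0))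
    []
    (Tri 1 1 1)
    (Motion (SP ZXY True False True) (Tri 1 0 1))
    []"

definition model2 :: model where
  "model2 = Model 4
    [[[0,1,0,1],[1,1,1,1],[0,1,0,1],[1,1,1,1]],[[1,1,1,1],[1,0,1,0],[1,1,1,1],[1,0,1,0]],[[0,1,0,1],[1,1,1,1],
    [0,1,0,1],[1,1,1,1]],[[1,1,1,1],[1,0,1,0],[1,1,1,1],[1,0,1,0]]]
    [Tri 0 0 2, Tri 2 0 0, Tri 0 2 0, Tri 1 1 1]
    (Tri 0 0 0)
    (Tri 0 1 0)
    [Motion (SP XYZ True False True) (Tri 0 0 0), Motion (SP XYZ False True True) (Tri 0 0 0),
    Motion (SP ZXY False False False) (Tri 0 0 0), Motion (SP ZYX False True False) (Tri 0 0 0),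
    Motion (SP XYZ True True True) (Tri 0 0 0)]
    [[0, 0, 0, 1], [0, 0, 1, 0], [1, 0, 0, 0]]
    [[0, 2, 0, 0], [0, 0, 2, 0], [2, 0, 0, 0]]
    [[[0,6,0,6],[0,6,0,6],[2,7,2,7],[2,6,2,6]],[[6,4,6,3],[7,8,7,7],[6,4,6,3],[6,4,6,3]],[[1,6,1,6],[1,6,1,6],
    [2,6,3,6],[7,6,3,6]],[[6,3,6,3],[7,5,7,3],[6,3,6,3],[6,3,6,3]]]
    [(SP XYZ False False False, []), (SP XYZ True False True, [4]), (SP XYZ False True True, [5]),
    (SP ZXY False False False, [6]), (SP ZYX False True False, [7]), (SP XYZ True True True, [8]),
    (SP XYZ True True False, [5, 4]), (SP ZXY True True False, [6, 4]), (SP ZYX True True True, [7, 4]),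
    (SP XYZ False True False, [8, 4]), (SP ZXY True False True, [6, 5]), (SP ZYX True False False, [7, 5]),
    (SP XYZ True False False, [8, 5]), (SP ZXY False True True, [5, 6]), (SP YZX False False False, [6, 6]),
    (SP YXZ False True False, [7, 6]), (SP ZXY True True True, [8, 6]), (SP ZYX False False True, [5, 7]),
    (SP XZY False False True, [6, 7]), (SP ZYX True False True, [8, 7]), (SP XYZ False False True, [8, 5, 4]),
    (SP YZX False True True, [6, 6, 4]), (SP YXZ False False True, [7, 6, 4]), (SP ZXY False False True, [8, 6,
    4]), (SP XZY True True True, [6, 7, 4]), (SP ZYX False False False, [8, 7, 4]), (SP YZX True True False, [6,
    6, 5]), (SP YXZ True True True, [7, 6, 5]), (SP ZXY False True False, [8, 6, 5]), (SP XZY False True False,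
    [6, 7, 5]), (SP ZYX False True True, [8, 7, 5]), (SP YZX True False True, [6, 5, 6]),
    (SP YXZ True False False, [7, 5, 6]), (SP ZXY True False False, [8, 5, 6]), (SP YZX True True True, [8, 6,
    6]), (SP YXZ True False True, [8, 7, 6]), (SP XZY True False False, [6, 5, 7]), (SP ZYX True True False, [8,
    5, 7]), (SP XZY True True False, [8, 6, 7]), (SP YZX True False False, [8, 6, 6, 4]), (SP YXZ True True False,
    [8, 7, 6, 4]), (SP XZY False False False, [8, 6, 7, 4]), (SP YZX False False True, [8, 6, 6, 5]),
    (SP YXZ False False False, [8, 7, 6, 5]), (SP XZY True False True, [8, 6, 7, 5]), (SP YZX False True False,
    [8, 6, 5, 6]), (SP YXZ False True True, [8, 7, 5, 6]), (SP XZY False True True, [8, 6, 5, 7])]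
    (Tri 0 0 0)
    (Motion (SP XYZ False False False) (Tri 0 0 0))
    []
    (Tri 1 1 0)
    (Motion (SP XZY False False True) (Tri (-1) 1 1))
    []"

definition model3 :: model where
  "model3 = Model 4
    [[[0,0,0,0],[1,1,1,1],[0,0,0,0],[1,1,1,1]],[[0,0,0,0],[1,1,1,1],[0,0,0,0],[1,1,1,1]],[[0,0,0,0],[1,1,1,1],
    [0,0,0,0],[1,1,1,1]],[[0,0,0,0],[1,1,1,1],[0,0,0,0],[1,1,1,1]]]
    [Tri (-1) 0 0, Tri 0 0 1, Tri 0 2 0]
    (Tri 1 0 (-1))
    (Tri 0 1 0)
    [Motion (SP XYZ True False True) (Tri 1 0 (-1)), Motion (SP ZYX False False True) (Tri 1 0 0),
    Motion (SP XYZ True True False) (Tri 1 0 0), Motion (SP XYZ True True True) (Tri 1 0 (-1))]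
    [[(-1), 0, 0], [0, 0, 1], [0, 1, 0]]
    [[(-4), 0, 0], [0, 0, 2], [0, 4, 0]]
    [[[0,4,1,1],[0,4,1,1],[2,4,2,2],[2,6,1,6]],[[0,3,1,3],[0,3,1,3],[2,3,1,3],[5,6,1,6]],[[0,0,1,0],[0,0,1,0],
    [2,0,1,0],[0,0,1,0]],[[0,3,1,3],[0,3,1,3],[2,3,1,3],[5,6,1,6]]]
    [(SP XYZ False False False, []), (SP XYZ False True False, [6, 3]), (SP ZYX False False True, [0, 4]),
    (SP ZYX True True True, [5, 4]), (SP XYZ True True False, [0, 5]), (SP XYZ True False True, [1, 0, 3]),
    (SP ZYX True False False, [4, 0, 3]), (SP XYZ False True True, [5, 1, 3]), (SP ZYX True True False, [1, 6,
    4]), (SP ZYX True False True, [6, 4, 5]), (SP XYZ False False True, [1, 6, 5]), (SP XYZ True True True, [1, 0,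
    6]), (SP XYZ True False False, [6, 5, 0, 3]), (SP ZYX False True True, [6, 4, 1, 3]),
    (SP ZYX False True False, [0, 4, 0, 5]), (SP ZYX False False False, [1, 6, 5, 0, 4])]
    (Tri 0 0 0)
    (Motion (SP XYZ False False False) (Tri 0 0 0))
    []
    (Tri 0 1 0)
    (Motion (SP XYZ False False False) (Tri 0 0 0))
    []"

definition model4 :: model where
  "model4 = Model 4
    [[[0,0,0,0],[1,1,1,1],[0,0,0,0],[1,1,1,1]],[[1,1,1,1],[0,0,0,0],[1,1,1,1],[0,0,0,0]],[[0,0,0,0],[1,1,1,1],
    [0,0,0,0],[1,1,1,1]],[[1,1,1,1],[0,0,0,0],[1,1,1,1],[0,0,0,0]]]
    [Tri (-1) 1 0, Tri 1 1 0, Tri 0 0 (-1)]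
    (Tri 0 0 1)
    (Tri 0 1 0)
    [Motion (SP XYZ True True False) (Tri 0 0 0), Motion (SP YXZ False True False) (Tri 0 0 0),
    Motion (SP YXZ False False True) (Tri 0 0 1), Motion (SP XYZ True True True) (Tri 0 0 1)]
    [[0, 1, 0], [1, 1, 0], [0, 0, (-1)]]
    [[(-2), 2, 0], [2, 2, 0], [0, 0, (-4)]]
    [[[0,2,2,2],[0,2,2,2],[1,2,2,2],[3,6,2,6]],[[0,5,2,5],[4,6,2,6],[0,0,2,0],[0,2,2,2]],[[4,5,2,5],[3,6,2,6],
    [0,2,2,2],[0,0,2,0]],[[1,6,2,6],[3,5,2,5],[1,1,2,1],[1,2,2,2]]]
    [(SP XYZ False False False, []), (SP XYZ True True False, [3]), (SP YXZ False True False, [4]),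
    (SP YXZ True False False, [4, 3]), (SP YXZ False False True, [2, 5]), (SP YXZ True True False, [6, 5]),
    (SP XYZ True True True, [2, 6]), (SP YXZ True True True, [2, 5, 3]), (SP YXZ False False False, [6, 5, 3]),
    (SP XYZ False False True, [2, 6, 3]), (SP XYZ True False True, [2, 5, 4]), (SP XYZ False True False, [6, 5,
    4]), (SP YXZ True False True, [2, 6, 4]), (SP XYZ False True True, [4, 2, 5]), (SP XYZ True False False, [6,
    4, 5]), (SP YXZ False True True, [2, 6, 4, 3])]
    (Tri 0 0 0)
    (Motion (SP XYZ False False False) (Tri 0 0 0))
    []
    (Tri 0 1 0)
    (Motion (SP XYZ False False False) (Tri 0 0 0))
    []"

definition model5 :: model where
  "model5 = Model 3
    [[[0,0,0],[1,1,1],[1,1,1]],[[0,0,0],[1,1,1],[1,1,1]],[[0,0,0],[1,1,1],[1,1,1]]]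
    [Tri (-1) 0 0, Tri 0 0 1, Tri 0 3 0]
    (Tri 1 0 (-1))
    (Tri 0 1 0)
    [Motion (SP XYZ True False True) (Tri 1 0 (-1)), Motion (SP ZYX False False True) (Tri 1 0 0),
    Motion (SP XYZ True True False) (Tri 1 0 0), Motion (SP XYZ True True True) (Tri 1 0 (-1))]
    [[(-1), 0, 0], [0, 0, 1], [0, 1, 0]]
    [[(-3), 0, 0], [0, 0, 1], [0, 3, 0]]
    [[[0,1,1],[0,1,1],[5,1,6]],[[0,1,3],[0,1,3],[5,1,6]],[[0,1,0],[0,1,0],[0,1,0]]]
    [(SP XYZ False False False, []), (SP XYZ False True False, [6, 3]), (SP ZYX False False True, [0, 4]),
    (SP ZYX True True True, [5, 4]), (SP XYZ True True False, [0, 5]), (SP XYZ True False True, [1, 0, 3]),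
    (SP ZYX True False False, [4, 0, 3]), (SP XYZ False True True, [5, 1, 3]), (SP ZYX True True False, [1, 6,
    4]), (SP ZYX True False True, [6, 4, 5]), (SP XYZ False False True, [1, 6, 5]), (SP XYZ True True True, [1, 0,
    6]), (SP XYZ True False False, [6, 5, 0, 3]), (SP ZYX False True True, [6, 4, 1, 3]),
    (SP ZYX False True False, [0, 4, 0, 5]), (SP ZYX False False False, [1, 6, 5, 0, 4])]
    (Tri 0 0 0)
    (Motion (SP XYZ False False False) (Tri 0 0 0))
    []
    (Tri 0 1 0)
    (Motion (SP XYZ False False False) (Tri 0 0 0))
    [Tri 0 0 1]"

definition model6 :: model where
  "model6 = Model 4
    [[[0,0,0,0],[0,0,0,0],[0,0,0,0],[0,0,0,0]],[[1,1,1,1],[1,1,1,1],[1,1,1,1],[1,1,1,1]],[[1,1,1,1],[1,1,1,1],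
    [1,1,1,1],[1,1,1,1]],[[0,0,0,0],[0,0,0,0],[0,0,0,0],[0,0,0,0]]]
    [Tri 0 0 1, Tri 0 1 0, Tri (-4) 0 0]
    (Tri 7 0 0)
    (Tri 2 0 0)
    [Motion (SP XYZ False True True) (Tri 0 0 0), Motion (SP XZY False False True) (Tri 0 0 0),
    Motion (SP XYZ True False True) (Tri 7 0 0), Motion (SP XYZ True True True) (Tri 7 0 0)]
    [[0, 0, (-1)], [0, 1, 0], [1, 0, 0]]
    [[0, 0, (-1)], [0, 4, 0], [4, 0, 0]]
    [[[0,3,0,0],[4,3,3,4],[1,3,1,1],[1,1,1,1]],[[5,5,5,0],[6,6,6,0],[5,5,5,0],[5,5,5,0]],[[0,3,0,0],[4,3,3,4],
    [1,3,1,1],[1,1,1,1]],[[5,5,5,0],[6,6,6,0],[5,5,5,0],[5,5,5,0]]]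
    [(SP XYZ False False False, []), (SP XYZ False True True, [3]), (SP XZY False False True, [4]),
    (SP XZY False True False, [4, 3]), (SP XYZ False True False, [6, 5]), (SP XYZ False False True, [6, 5, 3]),
    (SP XZY False True True, [6, 5, 4]), (SP XZY False False False, [6, 4, 5])]
    (Tri 0 0 0)
    (Motion (SP XYZ False False False) (Tri 0 0 0))
    [Tri 0 0 1]
    (Tri 2 0 0)
    (Motion (SP XYZ False False False) (Tri 0 0 0))
    [Tri 0 0 1]"

definition model7 :: model where
  "model7 = Model 4
    [[[0,1,1,0],[1,0,0,1],[0,1,1,0],[1,0,0,1]],[[1,0,0,1],[0,1,1,0],[1,0,0,1],[0,1,1,0]],[[0,1,1,0],[1,0,0,1],
    [0,1,1,0],[1,0,0,1]],[[1,0,0,1],[0,1,1,0],[1,0,0,1],[0,1,1,0]]]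
    [Tri (-1) (-1) 0, Tri (-1) 1 0, Tri 0 0 (-4), Tri (-1) 0 (-2)]
    (Tri 2 0 3)
    (Tri 1 0 0)
    [Motion (SP XYZ True True False) (Tri 2 0 0), Motion (SP YXZ False True False) (Tri 1 1 0),
    Motion (SP YXZ True True True) (Tri 1 1 3), Motion (SP XYZ True True True) (Tri 2 0 3)]
    [[0, 0, 0, (-1)], [0, 1, 0, (-1)], [0, 0, (-1), 0]]
    [[(-2), (-2), 0, 0], [(-2), 2, 0, 0], [0, 0, (-1), 0]]
    [[[0,7,4,6],[5,7,5,7],[4,6,3,7],[4,6,4,6]],[[0,6,3,6],[0,3,5,6],[5,6,5,6],[1,6,3,7]],[[4,3,3,7],[0,3,3,0],
    [0,6,5,0],[1,3,3,6]],[[1,3,3,7],[0,7,3,0],[0,3,3,6],[1,7,3,1]]]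
    [(SP XYZ False False False, []), (SP YXZ False True False, [0, 5]), (SP XYZ True True False, [4, 1, 0]),
    (SP YXZ True False False, [5, 0, 4]), (SP XYZ False True False, [7, 5, 6]), (SP YXZ False False False, [1, 7,
    6]), (SP YXZ True True False, [7, 6, 0, 4]), (SP XYZ True False False, [7, 6, 5, 1, 0])]
    (Tri 1 0 2)
    (Motion (SP XYZ False False False) (Tri (-1) 0 (-2)))
    [Tri 0 0 1]
    (Tri 1 0 0)
    (Motion (SP XYZ False False False) (Tri 0 0 0))
    [Tri 0 0 1]"

definition model8 :: model where
  "model8 = Model 3
    [[[0,0,1],[1,0,0],[0,1,0]],[[0,1,0],[0,0,1],[1,0,0]],[[1,0,0],[0,1,0],[0,0,1]]]
    [Tri (-1) 0 1, Tri 0 (-1) (-1), Tri 1 (-1) 1]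
    (Tri 0 2 0)
    (Tri 0 1 0)
    [Motion (SP YZX True True False) (Tri 1 1 0), Motion (SP YXZ False False True) (Tri (-1) 1 0),
    Motion (SP XYZ True True True) (Tri 0 2 0)]
    [[0, (-1), 1], [0, (-1), 0], [1, (-1), 1]]
    [[(-2), (-1), 1], [(-1), (-2), (-1)], [1, (-1), 1]]
    [[[0,4,1],[0,1,4],[5,1,1]],[[2,2,0],[1,5,0],[1,2,2]],[[3,0,2],[4,0,2],[2,4,2]]]
    [(SP XYZ False False False, []), (SP YZX True True False, [0, 3, 0]), (SP ZXY False True True, [3, 0, 3]),
    (SP ZYX False False False, [5, 4, 3]), (SP YXZ True True False, [5, 2, 4, 0]), (SP XZY False True True, [1, 5,
    3, 4])]
    (Tri 0 0 0)
    (Motion (SP XYZ False False False) (Tri 0 0 0))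
    [Tri 0 0 1]
    (Tri 0 1 0)
    (Motion (SP XYZ False False False) (Tri 0 0 0))
    []"

definition model9 :: model where
  "model9 = Model 4
    [[[0,1,1,0],[1,0,0,1],[1,0,0,1],[0,1,1,0]],[[1,0,0,1],[0,1,1,0],[0,1,1,0],[1,0,0,1]],[[1,0,0,1],[0,1,1,0],
    [0,1,1,0],[1,0,0,1]],[[0,1,1,0],[1,0,0,1],[1,0,0,1],[0,1,1,0]]]
    [Tri (-4) 0 0, Tri 0 0 (-4), Tri 0 (-4) 0, Tri 0 (-2) (-2), Tri (-2) (-2) 0]
    (Tri 3 7 3)
    (Tri 0 2 0)
    [Motion (SP XYZ True False True) (Tri 3 0 3), Motion (SP XYZ True True False) (Tri 3 7 0),
    Motion (SP YZX False False False) (Tri (-2) 2 0), Motion (SP ZYX False True False) (Tri 0 7 0),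
    Motion (SP XYZ True True True) (Tri 3 7 3)]
    [[(-1), 0, 0, (-1), 1], [0, 0, 0, (-1), 0], [0, (-1), 0, 0, 0]]
    [[(-1), 0, 0, 0, 0], [0, 0, (-1), 0, 0], [0, (-1), 0, 0, 0]]
    [[[0,9,3,8],[8,7,8,6],[0,7,3,8],[8,6,8,6]],[[6,5,6,5],[6,9,6,9],[6,5,6,5],[6,9,6,9]],[[4,4,4,8],[8,7,8,7],
    [4,7,4,8],[8,4,8,6]],[[6,5,6,5],[6,9,6,9],[6,5,6,5],[6,9,6,9]]]
    [(SP XYZ False False False, []), (SP YZX False False False, [7, 3]), (SP ZXY False False False, [7, 7, 4]),
    (SP ZYX False False False, [9, 8, 5]), (SP XZY False False False, [9, 8, 7, 6, 3]), (SP YXZ False False False,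
    [9, 7, 8, 5, 4])]
    (Tri 2 4 2)
    (Motion (SP XYZ False False False) (Tri (-2) (-4) (-2)))
    [Tri 1 1 1]
    (Tri 0 2 0)
    (Motion (SP XYZ False False False) (Tri 0 0 0))
    [Tri 1 1 1]"

definition model10 :: model where
  "model10 = Model 4
    [[[0,1,1,0],[1,1,0,0],[1,0,0,1],[0,0,1,1]],[[1,1,0,0],[1,0,0,1],[0,0,1,1],[0,1,1,0]],[[1,0,0,1],[0,0,1,1],
    [0,1,1,0],[1,1,0,0]],[[0,0,1,1],[0,1,1,0],[1,1,0,0],[1,0,0,1]]]
    [Tri (-1) 0 1, Tri 1 (-1) 0, Tri 4 4 4, Tri 1 1 2]
    (Tri (-3) (-3) (-3))
    (Tri 2 2 2)
    [Motion (SP ZXY False False False) (Tri 0 0 0), Motion (SP XZY True True True) (Tri (-3) (-3) (-3)),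
    Motion (SP XYZ True True True) (Tri (-3) (-3) (-3))]
    [[1, 1, 0, 1], [1, 0, 0, 1], [2, 1, 0, 1]]
    [[(-2), 1, 0, 1], [0, (-2), 1, (-2)], [2, 1, 0, 1]]
    [[[0,6,1,3],[5,1,6,1],[0,5,4,6],[4,3,5,3]],[[1,4,6,0],[3,5,1,5],[5,5,3,0],[3,6,1,3]],[[4,6,0,5],[5,3,4,3],
    [1,3,0,6],[6,1,5,1]],[[3,0,5,5],[1,3,3,6],[6,0,1,4],[1,5,3,5]]]
    [(SP XYZ False False False, []), (SP ZXY False False False, [4]), (SP YZX False False False, [4, 4]),
    (SP XZY False False False, [6, 5]), (SP ZYX False False False, [6, 5, 4]), (SP YXZ False False False, [6, 4,
    5])]
    (Tri 0 0 0)
    (Motion (SP XYZ False False False) (Tri 0 0 0))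
    [Tri 0 0 1]
    (Tri 2 2 2)
    (Motion (SP XYZ False False False) (Tri 0 0 0))
    [Tri 0 0 1]"

definition model11 :: model where
  "model11 = Model 3
    [[[0,0,0],[1,1,1],[1,1,1]],[[1,1,1],[1,1,1],[0,0,0]],[[1,1,1],[0,0,0],[1,1,1]]]
    [Tri 3 3 0, Tri (-1) 1 0, Tri 0 0 1, Tri 1 2 0]
    (Tri 1 (-1) 0)
    (Tri 1 0 0)
    [Motion (SP XYZ True True False) (Tri 1 (-1) 0), Motion (SP YXZ True True True) (Tri 0 0 0),
    Motion (SP XYZ True True True) (Tri 1 (-1) 0)]
    [[0, 0, 0, 1], [0, 1, 0, 1], [0, 0, 1, 0]]
    [[0, (-2), 0, 1], [0, 1, 0, 1], [0, 0, 3, 0]]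
    [[[0,2,2],[3,3,3],[4,5,4]],[[0,2,2],[5,5,2],[1,6,2]],[[4,6,4],[3,3,3],[1,2,2]]]
    [(SP XYZ False False False, []), (SP YXZ True True True, [5]), (SP XYZ True True False, [4, 3]),
    (SP XYZ True True True, [6, 3]), (SP XYZ False False True, [6, 4]), (SP YXZ False False True, [5, 4, 3]),
    (SP YXZ False False False, [6, 5, 3]), (SP YXZ True True False, [6, 5, 4])]
    (Tri 2 1 0)
    (Motion (SP XYZ False False False) (Tri (-2) (-1) 0))
    []
    (Tri 1 0 0)
    (Motion (SP XYZ False False False) (Tri 0 0 0))
    [Tri 1 0 0]"

definition model12 :: model where
  "model12 = Model 4
    [[[0,0,0,0],[1,1,1,1],[1,1,1,1],[0,0,0,0]],[[0,0,0,0],[1,1,1,1],[1,1,1,1],[0,0,0,0]],[[1,1,1,1],[0,0,0,0],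
    [0,0,0,0],[1,1,1,1]],[[1,1,1,1],[0,0,0,0],[0,0,0,0],[1,1,1,1]]]
    [Tri 2 (-2) 0, Tri 2 2 0, Tri 0 0 1]
    (Tri (-3) 3 0)
    (Tri 0 2 0)
    [Motion (SP XYZ True True False) (Tri (-3) 3 0), Motion (SP YXZ True False False) (Tri 0 3 0),
    Motion (SP YXZ False False True) (Tri (-3) 3 0), Motion (SP XYZ True True True) (Tri (-3) 3 0)]
    [[0, 1, 0], [(-1), 1, 0], [0, 0, 1]]
    [[1, 1, 0], [(-1), 1, 0], [0, 0, 4]]
    [[[0,2,2,2],[4,4,4,4],[0,2,2,2],[4,6,4,4]],[[4,5,4,4],[3,6,3,3],[4,5,4,4],[3,5,3,3]],[[0,5,2,2],[4,6,4,4],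
    [0,2,2,2],[4,6,4,4]],[[4,5,4,4],[3,5,3,3],[4,5,4,4],[5,5,5,2]]]
    [(SP XYZ False False False, []), (SP YXZ True True True, [5, 3]), (SP XYZ False False True, [6, 3]),
    (SP YXZ True True False, [6, 5])]
    (Tri 0 0 0)
    (Motion (SP XYZ False False False) (Tri 0 0 0))
    [Tri 1 0 0]
    (Tri 0 2 0)
    (Motion (SP XYZ False False False) (Tri 0 0 0))
    [Tri 1 0 0]"

definition model13 :: model where
  "model13 = Model 4
    [[[0,0,1,1],[1,1,0,0],[1,1,0,0],[0,0,1,1]],[[1,1,0,0],[0,0,1,1],[0,0,1,1],[1,1,0,0]],[[0,0,1,1],[1,1,0,0],
    [1,1,0,0],[0,0,1,1]],[[1,1,0,0],[0,0,1,1],[0,0,1,1],[1,1,0,0]]]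
    [Tri 0 2 2, Tri 0 (-2) 2, Tri 2 0 0, Tri 1 0 2]
    (Tri 0 3 (-3))
    (Tri 1 0 0)
    [Motion (SP XYZ False True True) (Tri 0 3 (-3)), Motion (SP XZY False True False) (Tri 0 0 (-3)),
    Motion (SP XZY True True True) (Tri 0 0 0), Motion (SP XYZ True True True) (Tri 0 3 (-3))]
    [[0, 0, 0, 1], [1, 0, 0, 0], [1, 1, 0, 0]]
    [[0, 0, 2, 0], [1, (-1), 0, 0], [1, 1, 0, 0]]
    [[[0,5,3,6],[5,4,5,4],[3,5,0,5],[5,4,3,4]],[[0,5,3,6],[5,7,5,4],[6,7,0,5],[5,4,3,7]],[[2,5,3,3],[5,3,5,4],
    [3,5,2,5],[5,4,3,3]],[[2,6,3,3],[5,4,5,7],[3,5,2,6],[5,7,3,4]]]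
    [(SP XYZ False False False, []), (SP XZY True True True, [6]), (SP XYZ True False False, [7, 4]),
    (SP XZY False True True, [7, 6, 4])]
    (Tri 0 3 0)
    (Motion (SP XZY False True False) (Tri 0 0 (-3)))
    [Tri 1 0 0]
    (Tri 0 1 0)
    (Motion (SP XZY False True False) (Tri 1 0 (-1)))
    [Tri 1 0 0]"

definition model14 :: model where
  "model14 = Model 4
    [[[0,0,0,0],[1,1,1,1],[0,0,0,0],[1,1,1,1]],[[1,1,1,1],[0,0,0,0],[1,1,1,1],[0,0,0,0]],[[1,1,1,1],[0,0,0,0],
    [1,1,1,1],[0,0,0,0]],[[0,0,0,0],[1,1,1,1],[0,0,0,0],[1,1,1,1]]]
    [Tri (-4) 0 0, Tri 0 (-2) 0, Tri 0 0 1, Tri (-2) (-1) 0]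
    (Tri 3 2 (-1))
    (Tri 0 1 0)
    [Motion (SP XYZ True True False) (Tri 3 2 0), Motion (SP XYZ True False True) (Tri 3 0 (-1)),
    Motion (SP XYZ True True True) (Tri 3 2 (-1))]
    [[0, 0, 0, (-1)], [0, (-1), 0, 0], [0, 0, 1, 0]]
    [[(-1), 0, 0, 0], [0, (-2), 0, 0], [0, 0, 4, 0]]
    [[[0,2,2,2],[0,2,2,2],[1,6,2,2],[1,2,2,2]],[[4,6,2,6],[4,5,2,5],[3,5,2,5],[3,3,3,3]],[[3,6,3,3],[3,3,3,3],
    [3,3,3,3],[3,3,3,3]],[[4,5,2,5],[4,5,2,5],[4,6,2,6],[4,5,2,5]]]
    [(SP XYZ False False False, []), (SP XYZ False True False, [6, 5, 1]), (SP XYZ False False True, [2, 6, 4]),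
    (SP XYZ False True True, [2, 5, 4, 1])]
    (Tri 2 1 0)
    (Motion (SP XYZ False False False) (Tri (-2) (-1) 0))
    [Tri 1 0 0]
    (Tri 0 1 0)
    (Motion (SP XYZ False False False) (Tri 0 0 0))
    [Tri 1 0 0]"

definition model15 :: model where
  "model15 = Model 4
    [[[0,0,0,0],[1,1,1,1],[1,1,1,1],[0,0,0,0]],[[1,1,1,1],[1,1,1,1],[0,0,0,0],[0,0,0,0]],[[1,1,1,1],[0,0,0,0],
    [0,0,0,0],[1,1,1,1]],[[0,0,0,0],[0,0,0,0],[1,1,1,1],[1,1,1,1]]]
    [Tri 1 (-1) 0, Tri 0 0 1, Tri (-2) (-2) 0]
    (Tri 3 4 0)
    (Tri 1 1 0)
    [Motion (SP YXZ False False True) (Tri 0 0 0), Motion (SP XYZ True True False) (Tri 3 4 0),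
    Motion (SP XYZ True True True) (Tri 3 4 0)]
    [[(-1), 0, (-1)], [(-2), 0, (-1)], [0, 1, 0]]
    [[2, 0, (-1)], [(-2), 0, (-1)], [0, 4, 0]]
    [[[0,3,1,1],[4,5,4,4],[0,0,1,1],[4,5,4,4]],[[0,0,0,0],[0,3,1,1],[4,5,4,4],[2,3,2,2]],[[2,3,2,2],[0,0,0,0],
    [2,3,2,2],[4,5,4,4]],[[4,5,4,4],[0,0,1,1],[4,5,4,4],[2,3,2,2]]]
    [(SP XYZ False False False, []), (SP YXZ False False True, [3]), (SP XYZ False False True, [5, 4]),
    (SP YXZ False False False, [5, 4, 3])]
    (Tri 0 0 0)
    (Motion (SP XYZ False False False) (Tri 0 0 0))
    [Tri 0 0 1]
    (Tri 1 1 0)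
    (Motion (SP XYZ False False False) (Tri 0 0 0))
    [Tri 0 0 1]"

definition model16 :: model where
  "model16 = Model 4
    [[[0,0,1,1],[1,0,0,1],[1,1,0,0],[0,1,1,0]],[[1,1,0,0],[0,1,1,0],[0,0,1,1],[1,0,0,1]],[[0,0,1,1],[1,0,0,1],
    [1,1,0,0],[0,1,1,0]],[[1,1,0,0],[0,1,1,0],[0,0,1,1],[1,0,0,1]]]
    [Tri (-2) 0 0, Tri 0 (-2) 2, Tri 0 1 1, Tri (-1) (-1) 1]
    (Tri 2 0 (-3))
    (Tri 1 0 0)
    [Motion (SP XZY True False False) (Tri 2 2 (-1)), Motion (SP XZY True True True) (Tri 2 (-1) (-1)),
    Motion (SP XYZ True True True) (Tri 2 0 (-3))]
    [[(-1), 0, 1, 1], [0, 0, 1, 0], [0, 1, 2, 0]]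
    [[(-2), 0, 0, 0], [0, (-1), 2, 0], [0, 1, 2, 0]]
    [[[0,6,5,4],[3,2,4,3],[5,3,1,5],[4,3,6,2]],[[0,6,3,4],[3,2,4,3],[3,3,1,6],[4,3,6,2]],[[0,6,3,4],[3,5,4,3],
    [3,3,1,6],[4,3,6,5]],[[0,6,3,4],[3,2,4,3],[3,3,1,6],[4,3,6,2]]]
    [(SP XYZ False False False, []), (SP XZY True True True, [2, 5, 0]), (SP XZY False True True, [6, 4, 1]),
    (SP XYZ True False False, [6, 5, 4, 0])]
    (Tri 1 0 (-1))
    (Motion (SP XZY True False False) (Tri 1 1 0))
    [Tri 0 1 0]
    (Tri 1 1 (-2))
    (Motion (SP XZY True False False) (Tri 2 2 (-1)))
    [Tri 0 1 0]"

definition model17 :: model where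
  "model17 = Model 4
    [[[0,0,1,1],[0,1,1,0],[0,0,1,1],[0,1,1,0]],[[1,0,0,1],[1,1,0,0],[1,0,0,1],[1,1,0,0]],[[0,0,1,1],[0,1,1,0],
    [0,0,1,1],[0,1,1,0]],[[1,0,0,1],[1,1,0,0],[1,0,0,1],[1,1,0,0]]]
    [Tri (-2) 0 0, Tri 0 (-2) 0, Tri 0 0 4, Tri (-1) (-1) 2]
    (Tri 2 1 0)
    (Tri 1 0 0)
    [Motion (SP XYZ True True False) (Tri 1 1 2), Motion (SP YXZ True False False) (Tri 1 (-2) 1),
    Motion (SP XYZ True False True) (Tri 1 0 2), Motion (SP XYZ True True True) (Tri 2 1 0)]
    [[0, 0, 1, (-1)], [0, (-1), 0, 0], [0, 0, 1, 0]]
    [[(-2), 0, 0, 0], [0, (-2), 0, 0], [0, 0, 1, 0]]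
    [[[0,7,6,5],[7,7,4,5],[1,7,6,5],[7,7,4,5]],[[0,5,6,6],[7,5,3,6],[1,3,6,3],[7,5,3,5]],[[0,5,6,5],[7,5,3,5],
    [1,5,3,5],[7,5,3,5]],[[0,5,6,6],[7,5,3,6],[1,3,3,6],[7,5,5,5]]]
    [(SP XYZ False False False, []), (SP XYZ True True False, [3, 4]), (SP XYZ True False False, [6, 7, 4]),
    (SP XYZ False True False, [3, 7, 6])]
    (Tri 1 0 2)
    (Motion (SP XYZ True False True) (Tri 1 0 2))
    [Tri 0 0 1]
    (Tri 1 0 0)
    (Motion (SP XYZ False False False) (Tri 0 0 0))
    [Tri 0 0 1]"

definition model18 :: model where
  "model18 = Model 5
    [[[0,0,0,0,0],[0,0,0,0,0],[0,0,0,0,0],[0,0,0,0,0],[1,1,1,1,1]],[[0,0,0,0,0],[1,1,1,1,1],[0,0,0,0,0],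
    [0,0,0,0,0],[0,0,0,0,0]],[[0,0,0,0,0],[0,0,0,0,0],[0,0,0,0,0],[1,1,1,1,1],[0,0,0,0,0]],[[1,1,1,1,1],
    [0,0,0,0,0],[0,0,0,0,0],[0,0,0,0,0],[0,0,0,0,0]],[[0,0,0,0,0],[0,0,0,0,0],[1,1,1,1,1],[0,0,0,0,0],
    [0,0,0,0,0]]]
    [Tri (-2) 1 0, Tri (-1) (-2) 0, Tri 0 0 1]
    (Tri 2 2 0)
    (Tri 1 1 0)
    [Motion (SP XYZ True True False) (Tri 2 2 0), Motion (SP YXZ True False False) (Tri 2 0 0),
    Motion (SP XYZ True True True) (Tri 2 2 0)]
    [[0, (-1), 0], [1, (-2), 0], [0, 0, 1]]
    [[(-2), (-1), 0], [1, (-2), 0], [0, 0, 5]]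
    [[[0,5,2,2,2],[4,5,5,4,4],[4,5,4,4,4],[3,5,5,3,3],[0,5,5,2,2]],[[3,5,5,3,3],[0,5,2,2,2],[1,5,2,2,2],
    [4,5,5,4,4],[1,5,1,1,1]],[[4,5,5,4,4],[4,5,4,4,4],[3,5,5,3,3],[1,1,2,2,2],[0,5,2,2,2]],[[0,0,2,2,2],
    [1,5,2,2,2],[4,5,5,4,4],[4,5,4,4,4],[1,1,1,1,1]],[[4,5,4,4,4],[0,0,0,0,0],[1,5,5,2,2],[0,5,2,2,2],
    [4,0,0,4,4]]]
    [(SP XYZ False False False, []), (SP XYZ False False True, [5, 3])]
    (Tri 0 0 0)
    (Motion (SP XYZ False False False) (Tri 0 0 0))
    [Tri 1 0 0, Tri 0 1 0]
    (Tri 1 1 0)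
    (Motion (SP XYZ False False False) (Tri 0 0 0))
    []"

definition model19 :: model where
  "model19 = Model 4
    [[[0,0,1,1],[1,1,1,1],[1,1,1,1],[0,0,1,1]],[[1,1,1,1],[1,1,0,0],[1,1,0,0],[1,1,1,1]],[[1,1,1,1],[1,1,0,0],
    [1,1,0,0],[1,1,1,1]],[[0,0,1,1],[1,1,1,1],[1,1,1,1],[0,0,1,1]]]
    [Tri (-4) 0 0, Tri 0 (-4) 0, Tri 0 0 4, Tri (-2) (-2) 2]
    (Tri 3 3 (-3))
    (Tri 0 0 2)
    [Motion (SP XYZ True True False) (Tri 3 3 0), Motion (SP XYZ True False True) (Tri 3 0 (-3)),
    Motion (SP ZXY True False True) (Tri 0 0 0), Motion (SP YXZ False False True) (Tri 0 0 (-3)),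
    Motion (SP XYZ True True True) (Tri 3 3 (-3))]
    [[0, 0, 1, (-1)], [0, (-1), 0, 0], [0, 0, 1, 0]]
    [[(-1), 0, 0, 0], [0, (-1), 0, 0], [0, 0, 1, 0]]
    [[[0,7,0,7],[6,6,7,6],[6,8,6,7],[7,5,7,5]],[[7,6,8,6],[4,8,4,8],[5,5,5,5],[6,7,4,8]],[[6,7,6,8],[7,5,7,5],
    [3,7,3,7],[7,6,6,6]],[[5,5,5,5],[4,8,6,7],[8,6,7,6],[4,8,4,8]]]
    [(SP XYZ False False False, []), (SP ZXY True False True, [6]), (SP YZX False True True, [6, 6]),
    (SP YXZ False False False, [8, 7, 4]), (SP ZYX True False True, [8, 6, 7, 4]), (SP XZY False True True, [8, 7,
    6, 5])]
    (Tri 0 0 0)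
    (Motion (SP XYZ False False False) (Tri 0 0 0))
    [Tri 1 1 1]
    (Tri 0 0 2)
    (Motion (SP XYZ False False False) (Tri 0 0 0))
    [Tri 1 1 0, Tri 0 0 1]"

definition model20 :: model where
  "model20 = Model 4
    [[[0,1,1,1],[1,0,1,1],[1,1,1,0],[1,1,0,1]],[[1,1,1,0],[1,1,0,1],[0,1,1,1],[1,0,1,1]],[[1,0,1,1],[0,1,1,1],
    [1,1,0,1],[1,1,1,0]],[[1,1,0,1],[1,1,1,0],[1,0,1,1],[0,1,1,1]]]
    [Tri (-4) 0 0, Tri 0 (-4) 0, Tri 0 0 4, Tri (-2) (-2) 2]
    (Tri 3 5 (-1))
    (Tri 0 0 1)
    [Motion (SP XYZ True True False) (Tri 1 5 2), Motion (SP XYZ True False True) (Tri 3 (-2) 1),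
    Motion (SP ZXY True False True) (Tri 1 1 2), Motion (SP YXZ False False True) (Tri (-4) 0 0),
    Motion (SP XYZ True True True) (Tri 3 5 (-1))]
    [[0, 0, 1, (-1)], [0, (-1), 0, 0], [0, 0, 1, 0]]
    [[(-1), 0, 0, 0], [0, (-1), 0, 0], [0, 0, 1, 0]]
    [[[0,0,8,7],[5,5,6,8],[7,4,8,8],[6,8,8,8]],[[5,8,5,5],[8,7,4,4],[8,8,6,8],[8,8,7,6]],[[8,8,8,4],[8,8,6,5],
    [8,7,3,3],[7,8,5,5]],[[6,7,7,8],[8,6,8,8],[5,5,5,8],[4,4,8,7]]]
    [(SP XYZ False False False, []), (SP YXZ False False True, [7]), (SP ZXY False True True, [6, 5]),
    (SP YZX True True False, [6, 6, 4]), (SP XZY True False False, [7, 6, 5]), (SP ZYX True True True, [6, 5, 7])]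
    (Tri 1 2 0)
    (Motion (SP ZYX True True False) (Tri 0 2 (-1)))
    []
    (Tri 1 5 3)
    (Motion (SP XYZ True True False) (Tri 1 5 (-2)))
    [Tri 0 1 (-1)]"

definition model21 :: model where
  "model21 = Model 4
    [[[0,1,1,0],[1,1,0,0],[1,0,0,1],[0,0,1,1]],[[1,0,0,1],[0,0,1,1],[0,1,1,0],[1,1,0,0]],[[1,0,0,1],[0,0,1,1],
    [0,1,1,0],[1,1,0,0]],[[0,1,1,0],[1,1,0,0],[1,0,0,1],[0,0,1,1]]]
    [Tri (-4) 0 0, Tri 0 2 2, Tri 0 1 (-1), Tri (-2) 1 1]
    (Tri 3 (-2) 1)
    (Tri 0 1 1)
    [Motion (SP XZY True True True) (Tri 3 0 (-1)), Motion (SP XZY True False False) (Tri 3 (-1) 1),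
    Motion (SP XYZ True True True) (Tri 3 (-2) 1)]
    [[(-1), 0, (-1), 1], [0, 1, (-1), 0], [0, 1, (-2), 0]]
    [[(-1), 0, 0, 0], [0, 1, 2, 0], [0, 1, (-2), 0]]
    [[[0,5,2,5],[4,0,5,2],[2,4,1,5],[5,2,5,1]],[[5,4,5,3],[3,2,3,5],[5,6,2,3],[4,5,6,5]],[[3,5,3,5],[5,3,5,3],
    [3,4,3,5],[5,3,4,3]],[[5,4,5,6],[6,5,4,5],[5,6,2,4],[4,5,6,2]]]
    [(SP XYZ False False False, []), (SP XZY False False False, [6, 4, 1])]
    (Tri 3 (-1) 0)
    (Motion (SP XZY True True True) (Tri 3 0 (-1)))
    [Tri 1 0 0, Tri 0 1 0]
    (Tri 3 (-2) (-1))
    (Motion (SP XZY True True True) (Tri 3 0 (-1)))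
    [Tri 1 0 0, Tri 0 1 0]"

definition model22 :: model where
  "model22 = Model 4
    [[[0,0,1,1],[0,1,1,0],[1,1,0,0],[1,0,0,1]],[[0,0,1,1],[1,0,0,1],[1,1,0,0],[0,1,1,0]],[[1,1,0,0],[1,0,0,1],
    [0,0,1,1],[0,1,1,0]],[[1,1,0,0],[0,1,1,0],[0,0,1,1],[1,0,0,1]]]
    [Tri (-2) 0 2, Tri 2 0 2, Tri 0 4 0, Tri 0 2 2]
    (Tri 0 (-3) 0)
    (Tri 0 2 0)
    [Motion (SP XYZ True False True) (Tri (-1) 2 1), Motion (SP ZYX False False True) (Tri 1 1 2),
    Motion (SP ZYX False True False) (Tri (-1) (-1) 1), Motion (SP XYZ True True True) (Tri 0 (-3) 0)]
    [[0, 1, 0, 0], [0, 0, 0, 1], [1, 1, 0, 0]]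
    [[(-1), 1, 0, 0], [0, 0, 1, 0], [1, 1, 0, 0]]
    [[[0,6,3,7],[7,5,7,5],[0,6,3,7],[7,5,7,5]],[[5,4,5,4],[3,6,5,6],[5,4,5,4],[3,6,5,6]],[[3,7,0,6],[7,3,7,5],
    [3,7,0,6],[7,3,7,5]],[[5,4,7,4],[5,6,5,3],[5,4,7,4],[5,6,5,3]]]
    [(SP XYZ False False False, []), (SP ZYX False False False, [7, 6, 4])]
    (Tri 0 0 0)
    (Motion (SP XYZ False False False) (Tri 0 0 0))
    [Tri 0 1 0, Tri 0 0 1]
    (Tri 0 2 0)
    (Motion (SP XYZ False False False) (Tri 0 0 0))
    [Tri 0 1 0, Tri 0 0 1]"

definition model23 :: model where
  "model23 = Model 7
    [[[0,1,1,1,1,1,1],[1,1,1,0,1,1,1],[1,1,1,1,1,1,0],[1,1,0,1,1,1,1],[1,1,1,1,1,0,1],[1,0,1,1,1,1,1],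
    [1,1,1,1,0,1,1]],[[1,1,1,1,1,0,1],[1,0,1,1,1,1,1],[1,1,1,1,0,1,1],[0,1,1,1,1,1,1],[1,1,1,0,1,1,1],
    [1,1,1,1,1,1,0],[1,1,0,1,1,1,1]],[[1,1,1,0,1,1,1],[1,1,1,1,1,1,0],[1,1,0,1,1,1,1],[1,1,1,1,1,0,1],
    [1,0,1,1,1,1,1],[1,1,1,1,0,1,1],[0,1,1,1,1,1,1]],[[1,0,1,1,1,1,1],[1,1,1,1,0,1,1],[0,1,1,1,1,1,1],
    [1,1,1,0,1,1,1],[1,1,1,1,1,1,0],[1,1,0,1,1,1,1],[1,1,1,1,1,0,1]],[[1,1,1,1,1,1,0],[1,1,0,1,1,1,1],
    [1,1,1,1,1,0,1],[1,0,1,1,1,1,1],[1,1,1,1,0,1,1],[0,1,1,1,1,1,1],[1,1,1,0,1,1,1]],[[1,1,1,1,0,1,1],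
    [0,1,1,1,1,1,1],[1,1,1,0,1,1,1],[1,1,1,1,1,1,0],[1,1,0,1,1,1,1],[1,1,1,1,1,0,1],[1,0,1,1,1,1,1]],
    [[1,1,0,1,1,1,1],[1,1,1,1,1,0,1],[1,0,1,1,1,1,1],[1,1,1,1,0,1,1],[0,1,1,1,1,1,1],[1,1,1,0,1,1,1],
    [1,1,1,1,1,1,0]]]
    [Tri (-3) 1 2, Tri 2 (-3) 1, Tri 1 1 1, Tri (-1) 0 2]
    (Tri 0 0 0)
    (Tri 0 0 1)
    [Motion (SP ZXY False False False) (Tri 0 0 0), Motion (SP XYZ True True True) (Tri 0 0 0)]
    [[1, 1, 2, 0], [0, 0, 1, 1], [1, 1, 2, 1]]
    [[(-2), 0, 2, 1], [(-1), (-2), 2, 1], [1, 1, 2, 1]]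
    [[[0,0,5,2,3,3,5],[4,5,5,2,2,3,5],[2,4,4,1,5,5,5],[2,2,3,3,3,5,5],[4,4,4,5,5,5,3],[3,4,3,4,4,3,2],
    [5,4,4,3,3,3,4]],[[4,5,3,3,3,3,3],[5,5,5,4,5,3,3],[5,5,4,5,1,1,5],[2,2,4,5,1,5,2],[4,5,5,2,2,3,3],
    [3,4,4,4,2,2,3],[5,0,3,3,3,3,3]],[[1,5,3,3,3,3,3],[5,5,3,3,5,3,3],[4,5,3,3,4,5,4],[4,5,4,4,5,5,3],
    [5,5,0,4,2,4,3],[5,4,5,2,2,2,3],[0,5,3,3,4,0,0]],[[2,2,3,3,5,4,0],[3,1,5,5,5,2,4],[3,3,4,3,1,2,3],
    [4,5,5,2,2,4,3],[3,4,5,3,3,3,4],[5,5,3,3,4,0,4],[5,2,3,4,0,0,0]],[[5,4,5,3,5,0,0],[4,5,5,1,4,2,1],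
    [4,5,1,5,2,2,2],[1,1,2,3,4,1,1],[5,4,4,3,2,2,4],[3,3,4,4,3,0,3],[3,2,3,3,3,4,0]],[[3,3,5,5,5,5,4],
    [3,3,4,5,4,2,3],[1,4,5,5,3,4,1],[1,4,4,4,4,1,1],[1,2,2,2,3,1,1],[4,2,4,4,2,2,2],[2,3,3,4,5,4,2]],
    [[5,5,5,5,3,2,4],[4,5,5,2,3,4,3],[3,3,3,3,3,4,5],[1,4,4,3,3,3,4],[4,3,4,4,4,5,1],[4,4,5,0,0,4,2],
    [2,4,5,4,4,2,2]]]
    [(SP XYZ False False False, []), (SP ZXY False False False, [4]), (SP XYZ True True True, [5]),
    (SP YZX False False False, [4, 4]), (SP ZXY True True True, [5, 4]), (SP YZX True True True, [5, 4, 4])]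
    (Tri 0 0 0)
    (Motion (SP XYZ False False False) (Tri 0 0 0))
    []
    (Tri 0 0 1)
    (Motion (SP XYZ False False False) (Tri 0 0 0))
    [Tri 1 0 0, Tri 0 1 0, Tri 0 0 1]"

definition model24 :: model where
  "model24 = Model 4
    [[[0,0,1,1],[0,1,1,0],[0,1,1,0],[0,0,1,1]],[[1,0,0,1],[1,1,0,0],[1,1,0,0],[1,0,0,1]],[[1,0,0,1],[1,1,0,0],
    [1,1,0,0],[1,0,0,1]],[[0,0,1,1],[0,1,1,0],[0,1,1,0],[0,0,1,1]]]
    [Tri (-4) 0 0, Tri 0 (-4) 0, Tri 0 0 4, Tri (-2) (-2) 2]
    (Tri 3 1 0)
    (Tri 0 0 2)
    [Motion (SP XYZ True True False) (Tri 1 1 2), Motion (SP YXZ True False False) (Tri 1 (-4) 1),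
    Motion (SP XYZ True False True) (Tri 1 0 2), Motion (SP XYZ True True True) (Tri 3 1 0)]
    [[0, 0, 1, (-1)], [0, (-1), 0, 0], [0, 0, 1, 0]]
    [[(-1), 0, 0, 0], [0, (-1), 0, 0], [0, 0, 1, 0]]
    [[[0,5,0,5],[6,5,6,5],[7,6,7,6],[7,5,7,5]],[[6,5,6,5],[4,6,4,6],[7,5,7,5],[7,5,7,5]],[[7,7,7,7],[7,7,7,7],
    [3,5,3,5],[6,5,6,5]],[[7,7,7,7],[7,7,7,7],[6,5,6,5],[4,6,4,6]]]
    [(SP XYZ False False False, [])]
    (Tri 0 0 0)
    (Motion (SP XYZ False False False) (Tri 0 0 0))
    [Tri 1 0 0, Tri 0 1 0, Tri 0 0 1]
    (Tri 0 0 2)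
    (Motion (SP XYZ False False False) (Tri 0 0 0))
    [Tri 1 0 0, Tri 0 1 0, Tri 0 0 1]"

definition model25 :: model where
  "model25 = Model 4
    [[[0,0,1,1],[1,1,0,0],[0,1,1,0],[1,0,0,1]],[[1,1,0,0],[0,0,1,1],[1,0,0,1],[0,1,1,0]],[[1,0,0,1],[0,1,1,0],
    [1,1,0,0],[0,0,1,1]],[[0,1,1,0],[1,0,0,1],[0,0,1,1],[1,1,0,0]]]
    [Tri (-4) 0 0, Tri 0 (-4) 0, Tri 0 0 4, Tri (-2) (-2) 2]
    (Tri 1 3 0)
    (Tri 0 0 2)
    [Motion (SP XYZ True True False) (Tri (-1) 3 2), Motion (SP YXZ True False False) (Tri 1 (-2) 1),
    Motion (SP XYZ True False True) (Tri (-1) 0 0), Motion (SP XYZ True True True) (Tri 1 3 0)]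
    [[0, 0, 1, (-1)], [0, (-1), 0, 0], [0, 0, 1, 0]]
    [[(-1), 0, 0, 0], [0, (-1), 0, 0], [0, 0, 1, 0]]
    [[[0,5,0,5],[7,7,7,7],[7,7,7,7],[6,5,6,5]],[[7,5,7,5],[4,6,4,6],[6,5,6,5],[7,5,7,5]],[[7,6,7,6],[6,5,6,5],
    [3,5,3,5],[7,5,7,5]],[[6,5,6,5],[7,7,7,7],[7,7,7,7],[4,6,4,6]]]
    [(SP XYZ False False False, [])]
    (Tri 0 0 0)
    (Motion (SP XYZ False False False) (Tri 0 0 0))
    [Tri 1 0 0, Tri 0 1 0, Tri 0 0 1]
    (Tri 0 0 2)
    (Motion (SP XYZ False False False) (Tri 0 0 0))
    [Tri 1 0 0, Tri 0 1 0, Tri 0 0 1]"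

definition models :: "model list" where
  "models = [model1, model2, model3, model4, model5, model6, model7, model8, model9, model10, model11, model12, model13, model14, model15, model16, model17, model18, model19, model20, model21, model22, model23, model24, model25]"
text \<open>Situations shared by several branches of the case analysis, up to motions and exchange
  of colours. The order is such that each certificate refers to earlier patterns only; the last
  pattern is the normal form of \<open>adjacent_colours\<close>.\<close>

definition patterns :: "pattern list" where
  "patterns = [[(Tri 0 0 0, False), (Tri 1 0 0, True), (Tri (-1) (-2) 0, False), (Tri (-1) (-1) (-2), False), (Tri (-1) (-1) 2,
    False), (Tri (-1) 0 (-2), False), (Tri (-1) 0 0, False), (Tri (-1) 0 2, False), (Tri (-1) 1 0, False), (Tri (-1) 2
    (-1), False), (Tri (-1) 2 0, False), (Tri (-1) 2 1, False), (Tri 0 (-1) 0, False), (Tri 0 0 (-1), False), (Tri 0 0 1,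
    False), (Tri 0 1 (-1), False), (Tri 0 1 0, False), (Tri 0 1 1, False), (Tri 1 (-2) 0, False), (Tri 1 (-1) (-1),
    False), (Tri 1 (-1) 0, False), (Tri 1 (-1) 1, False), (Tri 1 0 (-2), False), (Tri 1 0 (-1), False), (Tri 1 0 1,
    False), (Tri 1 0 2, False), (Tri 1 1 (-1), False), (Tri 1 1 0, False), (Tri 1 1 1, False), (Tri 1 2 0, False), (Tri 2
    (-1) 0, False), (Tri 2 0 (-1), False), (Tri 2 0 0, False), (Tri 2 0 1, False), (Tri 2 1 0, False), (Tri 3 0 0, False)],
    [(Tri 0 0 0, False), (Tri 1 0 0, True), (Tri (-1) (-1) 2, False), (Tri 2 2 2, False), (Tri 1 2 0, False), (Tri (-1) 2
    (-1), False), (Tri 2 1 0, False), (Tri 1 1 (-1), False), (Tri 1 1 0, False), (Tri 1 1 1, False), (Tri 0 1 (-1),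
    False), (Tri 0 1 0, False), (Tri 0 1 1, False), (Tri 3 0 0, False), (Tri 2 0 (-1), False), (Tri 2 0 0, False), (Tri 2
    0 1, False), (Tri 1 0 (-2), False), (Tri 1 0 (-1), False), (Tri 1 0 1, False), (Tri 1 0 2, False), (Tri 0 0 (-1),
    False), (Tri 0 0 1, False), (Tri (-1) 0 0, False), (Tri 2 (-1) 0, False), (Tri 1 (-1) (-1), False), (Tri 1 (-1) 0,
    False), (Tri 1 (-1) 1, False), (Tri 0 (-1) 0, False), (Tri 1 (-2) 0, False)],
    [(Tri 0 0 0, False), (Tri 1 0 0, True), (Tri 1 1 (-1), False), (Tri 2 1 0, False), (Tri 1 0 (-1), False), (Tri 2 0 1,
    False), (Tri 2 0 0, False), (Tri 2 0 (-1), False), (Tri 1 (-1) 0, False), (Tri 1 (-1) (-1), False), (Tri 2 (-1) 0,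
    False), (Tri 0 (-1) 0, False), (Tri 0 0 (-1), False), (Tri 1 (-1) 1, False), (Tri 0 1 0, False), (Tri 1 0 1, False),
    (Tri 0 0 1, False), (Tri 1 1 0, False), (Tri 1 1 1, False), (Tri 0 1 1, False)],
    [(Tri 0 0 0, False), (Tri 1 0 0, True), (Tri 0 0 (-1), False), (Tri 0 0 1, False), (Tri 0 1 0, False), (Tri 1 (-1) 0,
    False), (Tri 1 0 (-1), False), (Tri 1 0 1, False), (Tri 1 1 0, False), (Tri 2 0 0, False)],
    [(Tri 0 0 0, False), (Tri 1 0 0, True), (Tri 0 0 1, False), (Tri 0 1 0, False), (Tri 1 (-1) 0, False), (Tri 1 0 (-1),
    False), (Tri 1 0 1, False), (Tri 1 1 0, False), (Tri 2 0 0, False)],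
    [(Tri 0 0 0, False), (Tri 1 0 0, True), (Tri 0 1 0, False), (Tri 1 (-1) 0, False), (Tri 1 0 1, False), (Tri 1 0 (-1),
    False), (Tri 1 1 0, False), (Tri 2 0 0, False)],
    [(Tri 0 0 0, False), (Tri 1 0 0, True), (Tri 1 (-1) 0, False), (Tri 1 0 (-1), False), (Tri 1 0 1, False), (Tri 1 1 0,
    False)],
    [(Tri 0 0 0, False), (Tri 1 0 0, True), (Tri 1 (-1) 0, True), (Tri 1 1 0, False), (Tri 1 (-1) 1, False), (Tri 0 (-1)
    0, False), (Tri 1 0 (-1), False), (Tri 2 0 0, True), (Tri 1 0 1, False)],
    [(Tri 0 0 0, False), (Tri 1 0 0, True), (Tri 1 0 (-1), False), (Tri 1 0 1, False), (Tri 1 1 0, False)],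
    [(Tri 0 0 0, False), (Tri 1 0 0, True), (Tri 1 0 (-2), False), (Tri 3 0 0, False), (Tri 1 (-2) 0, False), (Tri 0 0
    (-1), False), (Tri 1 (-1) 0, True), (Tri 1 0 (-1), True), (Tri 1 0 1, False), (Tri 1 1 0, False), (Tri 2 0 0, True)],
    [(Tri 0 0 0, False), (Tri 1 0 0, True), (Tri 1 0 1, False), (Tri 1 1 0, False)],
    [(Tri 0 0 0, False), (Tri 1 0 0, True), (Tri 1 1 0, False), (Tri 1 0 (-1), True), (Tri 1 0 1, True), (Tri 0 0 1,
    False), (Tri 2 0 0, True), (Tri 0 1 0, False), (Tri 1 (-1) 0, False)],
    [(Tri 0 0 0, False), (Tri 1 0 0, True), (Tri 0 1 0, False), (Tri 1 (-1) 0, False), (Tri 1 0 (-1), True), (Tri 1 0 1,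
    True), (Tri 1 1 0, False)],
    [(Tri 0 0 0, False), (Tri 1 0 0, True), (Tri 1 0 1, True), (Tri 1 (-1) 0, True), (Tri 0 0 1, False), (Tri 2 0 0,
    True), (Tri 0 1 0, False), (Tri 1 1 0, False), (Tri 1 0 (-1), True)],
    [(Tri 0 0 0, False), (Tri 1 0 0, True), (Tri 1 0 (-1), True), (Tri 1 1 0, False), (Tri 1 0 1, True), (Tri 0 1 0,
    False)],
    [(Tri 0 0 0, False), (Tri 1 0 0, True), (Tri 1 0 2, True), (Tri 0 0 (-1), False), (Tri 0 0 1, False), (Tri 0 1 (-1),
    True), (Tri 0 1 0, True), (Tri 0 1 1, True), (Tri 1 (-1) 1, False), (Tri 1 0 (-1), True), (Tri 1 0 1, True), (Tri 1 1
    (-1), False), (Tri 1 1 0, False), (Tri 1 1 1, False)],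
    [(Tri 0 0 0, False), (Tri 1 0 0, True), (Tri 1 1 0, False)],
    [(Tri 0 0 0, False), (Tri 1 0 0, True)]]"

definition certs :: "cert list" where
  "certs = [Deduce 2 3 2 2 2 2 (Deduce 3 3 1 2 2 2 (Deduce 2 3 3 2 2 2 (Deduce 2 2 3 2 2 2 (Deduce 2 3 1 2 2 2 (Deduce 2 2 1 2 2 2
    (Deduce 3 3 3 2 2 2 (Deduce 1 1 2 2 2 2 (Split 3 2 4 (Deduce 2 2 3 2 2 2 (Deduce 2 2 2 2 3 2 (Deduce 2 2 2 2 3 2
    (Deduce 3 2 1 2 2 2 (Deduce 3 3 2 2 2 2 (Deduce 3 2 3 2 2 2 (Deduce 2 1 2 2 2 2 (Deduce 3 1 2 2 2 2 (Deduce 1 2 2 2 2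
    2 (Deduce 4 3 2 2 2 2 (Deduce 4 2 2 2 2 2 (Leaf 23 (SP XZY False False False) (Tri 0 0 5) True)))))))))))) (Deduce 2 2
    2 3 3 2 (Deduce 3 1 2 2 2 2 (Deduce 2 3 2 2 2 2 (Deduce 3 2 3 2 2 2 (Deduce 3 2 1 2 2 2 (Deduce 2 1 2 2 2 2 (Deduce 3
    1 2 2 2 2 (Deduce 1 2 2 2 2 2 (Deduce 4 3 2 2 2 2 (Deduce 4 2 2 2 2 2 (Leaf 23 (SP XZY False True False) (Tri 0 0 5)
    True))))))))))))))))))),
    Deduce 2 3 2 2 2 2 (Deduce 2 2 3 2 2 2 (Deduce 2 2 1 2 2 2 (Deduce 2 1 2 2 2 2 (Deduce 3 3 3 2 2 2 (Deduce 3 3 1 2 2 2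
    (Deduce 4 3 2 2 2 2 (Split 2 4 3 (Refer 0 (SP XYZ False False False) (Tri 0 0 0) False) (Deduce 2 3 2 2 2 2 (Refer 0
    (SP YXZ True True False) (Tri 1 1 0) False))))))))),
    Deduce 2 3 2 2 2 2 (Deduce 2 2 2 2 3 2 (Deduce 3 3 2 2 2 2 (Deduce 3 2 3 2 2 2 (Deduce 3 2 1 2 2 2 (Deduce 3 1 2 2 2 2
    (Deduce 2 2 3 2 2 2 (Deduce 4 2 2 2 2 2 (Deduce 3 3 3 2 2 2 (Split 3 4 2 (Refer 1 (SP XYZ False False False) (Tri 0 0
    0) False) (Deduce 2 3 2 2 2 2 (Split 3 2 4 (Deduce 3 3 2 2 2 2 (Deduce 3 2 3 2 2 2 (Deduce 2 2 3 2 2 2 (Deduce 3 1 2 2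
    2 2 (Deduce 2 1 2 2 2 2 (Deduce 3 1 3 2 2 2 (Refer 1 (SP XYZ False True False) (Tri 0 0 0) False))))))) (Deduce 2 2 3
    2 2 2 (Deduce 2 3 3 2 2 2 Stuck))))))))))))),
    Split 3 2 3 (Deduce 3 3 2 2 2 2 (Deduce 3 2 3 2 2 2 (Deduce 3 2 1 2 2 2 (Deduce 3 1 2 2 2 2 (Split 3 4 4 (Refer 2 (SP
    XYZ False False False) (Tri 0 0 0) False) (Deduce 2 3 3 3 2 2 (Split 3 4 2 (Refer 2 (SP XYZ False False True) (Tri 0 0
    0) False) (Deduce 2 2 2 2 3 2 (Deduce 2 2 3 2 2 2 (Deduce 2 2 1 2 2 2 (Deduce 3 2 3 2 2 2 (Deduce 3 2 1 2 2 2 (Deduce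
    2 1 2 2 2 2 (Deduce 2 1 2 2 2 2 (Deduce 2 3 2 2 2 2 (Leaf 2 (SP XYZ False False False) (Tri 0 1 1)
    True)))))))))))))))) (Deduce 2 1 2 3 2 2 (Deduce 2 2 2 2 2 3 (Deduce 3 1 2 2 2 2 (Deduce 3 2 3 2 2 2 (Deduce 3 2 1 2 2
    2 (Deduce 4 3 2 2 2 2 (Deduce 2 2 2 4 3 2 (Deduce 2 2 3 2 2 2 (Deduce 3 1 3 2 2 2 (Deduce 3 4 2 2 2 2 (Deduce 3 2 4 2
    2 2 (Split 4 4 4 (Deduce 3 2 3 2 2 2 (Deduce 2 2 2 3 2 3 (Deduce 2 3 2 2 2 2 (Deduce 3 2 1 2 2 2 (Leaf 20 (SP XYZ
    False False False) (Tri 1 0 1) True))))) (Deduce 2 2 2 3 2 3 (Deduce 3 2 1 2 2 2 (Deduce 2 3 2 2 2 2 (Deduce 3 2 3 2 2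
    2 (Leaf 20 (SP XYZ False False False) (Tri 1 2 2) True))))))))))))))))),
    Split 3 3 2 (Refer 3 (SP XYZ False False False) (Tri 0 0 0) False) (Deduce 2 2 1 3 2 2 (Deduce 2 2 2 2 3 2 (Deduce 2 3
    1 2 2 2 (Split 3 2 3 (Refer 3 (SP XZY False False False) (Tri 0 0 0) False) (Deduce 2 3 2 2 2 2 (Deduce 3 3 2 2 2 2
    (Deduce 3 2 3 2 2 2 (Deduce 3 1 2 2 2 2 (Deduce 2 2 2 2 3 2 (Deduce 3 2 1 2 2 2 (Deduce 2 2 1 3 2 2 (Deduce 2 2 2 2 3
    2 (Deduce 3 3 2 2 2 2 (Deduce 2 2 2 2 3 2 (Leaf 8 (SP XYZ False False True) (Tri 0 0 1) False))))))))))))))),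
    Split 3 3 4 (Refer 4 (SP XYZ False False False) (Tri 0 0 0) False) (Deduce 2 2 3 3 2 2 (Deduce 2 2 2 2 3 2 (Refer 4
    (SP XYZ False False True) (Tri 0 0 0) False))),
    Split 5 3 3 (Split 3 4 3 (Refer 5 (SP XYZ False False False) (Tri 0 0 0) False) (Deduce 2 3 2 3 2 2 (Split 3 2 3
    (Refer 5 (SP XYZ False True False) (Tri 0 0 0) False) (Deduce 2 1 2 3 2 2 (Split 4 4 4 (Deduce 3 3 3 2 2 2 Stuck)
    (Split 2 3 3 (Deduce 1 2 2 2 2 2 (Deduce 3 3 2 2 2 2 Stuck)) (Deduce 1 2 2 3 2 2 (Split 3 3 4 (Deduce 2 2 3 2 2 2
    Stuck) (Split 3 3 2 (Deduce 2 2 1 2 2 2 Stuck) (Deduce 3 3 2 2 2 2 (Deduce 3 2 3 2 2 2 (Deduce 3 2 1 2 2 2 (Deduce 3 1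
    2 2 2 2 (Deduce 2 2 3 3 2 2 (Deduce 2 2 1 3 2 2 (Leaf 1 (SP XYZ False False False) (Tri 0 0 0) False))))))))))))))))
    (Deduce 4 2 2 3 2 2 (Split 3 4 3 (Split 3 3 4 (Split 3 3 2 (Split 3 2 3 (Deduce 2 2 2 3 3 2 (Deduce 3 2 3 2 2 2
    (Deduce 3 2 1 2 2 2 (Deduce 3 3 2 2 2 2 (Deduce 2 2 2 2 3 2 (Deduce 3 3 2 2 2 2 Stuck)))))) (Deduce 2 2 2 3 3 2
    (Deduce 3 1 2 2 2 2 (Deduce 2 2 2 3 1 2 (Deduce 3 2 3 2 2 2 Stuck))))) (Deduce 2 2 2 3 2 3 (Deduce 3 2 1 2 2 2 (Deduce
    2 2 2 3 2 1 (Deduce 3 3 2 2 2 2 Stuck))))) (Deduce 2 2 2 3 3 2 (Deduce 3 2 3 2 2 2 (Deduce 3 3 2 2 2 2 (Deduce 2 2 2 3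
    2 3 (Deduce 2 2 2 3 3 2 (Deduce 2 2 2 3 2 3 (Deduce 3 2 1 2 2 2 Stuck)))))))) (Split 3 3 4 (Deduce 2 2 2 3 2 3 (Deduce
    3 3 2 2 2 2 (Deduce 3 2 3 2 2 2 (Deduce 2 2 2 3 3 2 (Deduce 2 2 2 3 2 3 (Deduce 2 2 2 3 3 2 (Deduce 2 2 2 3 2 3
    (Deduce 3 2 1 2 2 2 Stuck)))))))) (Deduce 3 2 1 2 2 2 (Deduce 3 1 2 2 2 2 (Deduce 3 3 2 2 2 2 (Deduce 2 3 2 3 2 2
    (Deduce 2 2 3 3 2 2 (Deduce 2 2 1 3 2 2 (Deduce 2 1 2 3 2 2 (Deduce 3 2 3 2 2 2 (Deduce 3 2 1 2 2 2 (Leaf 7 (SP YZX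
    False False False) (Tri 0 0 0) False))))))))))))),
    Split 4 2 2 (Deduce 3 1 2 3 2 2 (Deduce 4 2 2 3 2 2 (Split 3 4 3 (Split 3 3 4 (Split 3 3 2 (Deduce 2 2 2 3 2 3 (Deduce
    3 3 2 2 2 2 (Deduce 3 1 2 3 2 2 (Deduce 2 3 2 2 2 2 Stuck)))) (Deduce 3 2 1 2 2 2 (Deduce 2 2 1 3 2 2 (Deduce 3 3 2 2
    2 2 (Deduce 2 2 2 2 3 2 (Deduce 3 3 2 2 2 2 Stuck)))))) (Deduce 3 2 3 2 2 2 (Deduce 3 3 2 2 2 2 (Deduce 3 2 1 2 2 2
    (Deduce 2 2 3 3 2 2 (Deduce 3 3 2 2 2 2 (Deduce 2 2 2 2 3 2 (Deduce 3 3 2 2 2 2 Stuck)))))))) (Split 3 3 4 (Deduce 3 2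
    3 2 2 2 (Deduce 2 2 2 3 2 3 (Deduce 3 3 2 2 2 2 Stuck))) (Deduce 3 2 1 2 2 2 (Deduce 3 1 2 3 2 2 (Deduce 2 3 2 3 2 2
    (Deduce 3 2 3 2 2 2 (Deduce 3 2 1 2 2 2 (Deduce 2 2 3 3 2 2 (Deduce 2 2 1 3 2 2 (Leaf 13 (SP ZXY False False False)
    (Tri 0 0 1) False)))))))))))) (Deduce 3 1 2 3 2 2 (Deduce 3 1 1 3 2 2 (Split 3 3 2 (Deduce 2 2 2 3 2 1 (Deduce 2 2 1 2
    2 2 (Deduce 3 2 2 3 1 2 (Deduce 4 2 2 3 2 2 (Deduce 4 2 2 3 2 2 (Deduce 2 2 2 3 2 3 (Deduce 3 3 2 2 2 2 (Deduce 2 2 2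
    3 2 3 (Deduce 3 3 2 2 2 2 (Deduce 3 1 2 3 2 2 Stuck)))))))))) (Deduce 2 2 2 3 2 1 (Deduce 3 2 3 2 2 2 (Split 4 4 2
    (Deduce 2 2 2 3 2 1 (Deduce 2 3 2 3 2 2 (Deduce 2 2 1 3 2 2 (Deduce 3 2 2 2 2 1 (Deduce 3 3 2 2 2 2 (Deduce 2 2 2 3 2
    3 (Deduce 3 3 2 2 2 2 (Deduce 2 2 2 3 3 2 (Deduce 3 2 1 2 2 2 (Deduce 2 2 2 3 2 1 (Deduce 3 2 3 2 2 2 (Leaf 25 (SP XZY
    False False False) (Tri 0 2 0) False)))))))))))) (Deduce 2 2 2 3 2 1 (Deduce 2 2 1 3 2 2 (Deduce 3 2 1 2 2 2 (Deduce 3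
    2 2 2 2 1 (Deduce 2 2 2 3 2 3 (Deduce 2 2 2 3 2 1 (Deduce 3 2 3 2 2 2 Stuck))))))))))))),
    Split 4 2 3 (Refer 6 (SP XYZ False False False) (Tri 0 0 0) False) (Split 5 3 3 (Refer 6 (SP YXZ False True False)
    (Tri 1 1 0) False) (Split 3 2 3 (Split 4 2 4 (Refer 7 (SP XYZ False False False) (Tri 0 0 0) False) (Deduce 3 1 2 3 2
    2 (Refer 7 (SP XYZ False False True) (Tri 0 0 0) False))) (Deduce 3 1 2 3 2 2 (Deduce 2 1 2 3 2 2 (Split 3 4 3 (Split
    4 4 4 (Deduce 2 2 2 3 2 3 (Deduce 3 2 3 2 2 2 (Deduce 2 2 2 3 2 3 (Deduce 3 3 2 2 2 2 Stuck)))) (Split 3 3 4 (Deduce 2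
    2 2 2 2 3 (Deduce 3 3 2 2 2 2 (Deduce 3 2 3 2 2 2 Stuck))) (Deduce 3 2 1 2 2 2 (Deduce 2 2 2 2 3 2 (Deduce 2 2 2 3 3 2
    (Deduce 3 2 3 2 2 2 (Deduce 3 2 1 2 2 2 (Deduce 2 2 2 2 3 2 (Deduce 3 3 2 2 2 2 (Deduce 2 2 2 2 3 2 (Leaf 16 (SP ZXY
    False False False) (Tri 0 0 0) False))))))))))) (Split 3 3 4 (Deduce 2 2 3 2 2 2 (Deduce 3 2 3 2 2 2 (Deduce 2 2 2 3 2
    3 (Deduce 3 2 1 2 2 2 (Deduce 2 2 2 3 2 1 (Leaf 25 (SP YZX False False False) (Tri 0 1 1) True)))))) (Deduce 2 1 2 3 2
    2 (Deduce 3 2 3 2 2 2 (Deduce 3 2 2 2 2 3 (Deduce 3 2 1 2 2 2 (Deduce 2 2 2 3 2 1 (Deduce 2 2 2 3 2 1 (Deduce 3 2 3 2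
    2 2 (Deduce 2 2 2 3 2 3 (Leaf 25 (SP YZX False False False) (Tri 0 0 1) False))))))))))))))),
    Deduce 3 2 1 3 2 2 (Split 3 2 3 (Deduce 3 1 2 3 2 2 (Deduce 4 2 2 3 2 2 (Split 4 4 2 (Deduce 3 2 1 3 2 2 (Deduce 3 1 2
    3 2 2 (Deduce 3 1 2 3 2 2 (Deduce 3 2 1 3 2 2 (Split 3 4 4 (Split 3 4 3 (Deduce 2 2 2 2 3 2 (Deduce 3 2 3 2 2 2
    (Deduce 2 2 2 3 2 3 (Deduce 3 3 2 2 2 2 (Deduce 2 3 2 2 2 2 (Deduce 2 2 3 2 2 2 (Deduce 3 3 3 2 2 2 (Deduce 2 3 3 2 2
    2 Stuck)))))))) (Deduce 2 3 2 3 2 2 (Deduce 2 2 2 3 2 3 (Deduce 3 3 2 2 2 2 (Deduce 2 2 3 3 2 2 (Deduce 3 3 2 2 2 2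
    (Deduce 2 2 1 2 2 2 (Leaf 9 (SP XYZ False False False) (Tri 0 0 0) False)))))))) (Split 2 3 3 (Deduce 3 3 2 2 2 2
    (Deduce 3 2 3 2 2 2 (Deduce 2 2 1 2 2 2 (Deduce 2 1 2 2 2 2 (Deduce 3 3 1 2 2 2 (Deduce 3 2 2 2 3 3 (Deduce 2 2 2 2 3
    2 (Deduce 2 2 1 2 2 2 (Leaf 19 (SP XYZ False False False) (Tri 0 2 3) True))))))))) (Deduce 3 3 2 2 2 2 (Deduce 3 2 3
    2 2 2 (Deduce 3 2 2 2 3 3 (Deduce 3 2 1 3 2 2 Stuck)))))))))) (Deduce 3 2 1 3 2 2 (Deduce 3 1 2 3 2 2 (Deduce 2 2 2 3
    3 2 (Deduce 2 2 1 2 2 2 (Deduce 3 3 2 2 2 2 (Deduce 2 2 2 3 2 3 (Deduce 2 3 2 3 2 2 (Deduce 2 2 3 3 2 2 (Deduce 2 2 1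
    2 2 2 (Deduce 3 3 2 2 2 2 (Leaf 21 (SP XYZ False False False) (Tri 0 0 0) False)))))))))))))) (Deduce 3 1 2 3 2 2
    (Deduce 2 1 2 3 2 2 (Deduce 4 2 2 3 2 2 (Split 4 4 2 (Deduce 3 2 1 3 2 2 (Deduce 3 1 2 3 2 2 (Deduce 2 1 2 3 2 2
    (Deduce 3 2 3 2 2 2 (Deduce 2 2 2 3 2 3 (Deduce 3 2 1 3 2 2 (Deduce 2 3 2 2 2 2 (Deduce 2 3 2 2 2 2 (Deduce 3 2 3 2 2
    2 (Leaf 21 (SP ZXY False False True) (Tri 0 0 0) False)))))))))) (Deduce 3 2 1 3 2 2 (Deduce 3 1 2 3 2 2 (Deduce 3 2 1
    3 2 2 (Deduce 2 2 2 3 3 2 (Deduce 2 3 2 2 2 2 (Deduce 3 2 3 2 2 2 (Deduce 2 2 2 3 3 2 (Deduce 2 3 2 2 2 2 (Leaf 22 (SP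
    XYZ False False False) (Tri 1 0 1) False)))))))))))))),
    Split 4 3 2 (Refer 8 (SP XYZ False False False) (Tri 0 0 0) False) (Deduce 3 2 1 3 2 2 (Split 4 2 3 (Refer 8 (SP XZY
    False False False) (Tri 0 0 0) False) (Deduce 3 1 2 3 2 2 (Split 5 3 3 (Refer 8 (SP ZXY False True False) (Tri 1 1 0)
    False) (Deduce 4 2 2 3 2 2 (Split 3 3 2 (Refer 9 (SP XYZ False False False) (Tri 0 0 0) False) (Deduce 3 2 1 3 2 2
    (Deduce 2 2 1 3 2 2 (Deduce 4 2 2 3 2 2 (Split 3 2 3 (Refer 9 (SP XZY False False False) (Tri 0 0 0) False) (Deduce 3
    1 2 3 2 2 (Deduce 2 1 2 3 2 2 (Deduce 4 2 2 3 2 2 (Split 4 4 2 (Deduce 3 2 1 3 2 2 (Deduce 3 3 2 2 2 2 (Deduce 3 3 2 2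
    2 2 (Deduce 3 2 3 2 2 2 (Deduce 3 2 1 3 2 2 (Deduce 3 1 2 3 2 2 (Deduce 3 3 2 2 2 2 (Deduce 2 2 2 2 3 2 (Leaf 22 (SP
    YXZ False False False) (Tri 1 1 1) False))))))))) (Deduce 3 2 1 3 2 2 (Deduce 3 2 1 3 2 2 (Deduce 3 1 2 3 2 2 (Deduce
    3 3 2 2 2 2 (Deduce 2 2 1 3 2 2 (Split 3 4 3 (Deduce 3 2 2 3 2 1 (Deduce 2 2 2 2 3 2 (Leaf 10 (SP XYZ False True True)
    (Tri 0 0 0) False))) (Deduce 3 2 2 3 2 1 (Deduce 2 3 2 3 2 2 (Deduce 2 2 3 3 2 2 (Leaf 8 (SP XYZ False False True)
    (Tri 0 0 2) True)))))))))))))))))))))))),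
    Split 3 3 2 (Deduce 2 2 2 3 3 2 (Deduce 2 3 2 2 2 2 (Deduce 3 3 2 2 2 2 (Deduce 3 2 3 3 2 2 (Deduce 3 1 2 2 2 2
    Stuck))))) (Deduce 3 2 1 3 2 2 (Split 3 4 4 (Deduce 2 2 2 2 3 2 (Deduce 3 3 2 2 2 2 (Deduce 2 3 2 2 2 2 (Deduce 2 2 3
    2 2 2 (Deduce 3 2 3 3 2 2 (Deduce 2 2 3 2 2 2 (Deduce 2 2 2 2 2 3 (Deduce 3 1 2 2 2 2 Stuck)))))))) (Deduce 2 3 3 3 2
    2 (Deduce 3 3 2 2 2 2 (Deduce 3 2 3 3 2 2 (Deduce 2 2 2 3 3 2 (Deduce 3 1 2 2 2 2 Stuck))))))),
    Split 5 3 3 (Deduce 3 2 1 3 2 2 (Deduce 3 2 3 3 2 2 (Deduce 2 2 2 2 3 2 (Deduce 3 3 2 2 2 2 (Deduce 2 3 2 2 2 2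
    (Deduce 2 2 3 2 2 2 (Deduce 2 2 1 2 2 2 (Split 3 2 3 (Deduce 3 3 2 2 2 2 (Deduce 3 1 2 2 2 2 (Deduce 3 2 3 3 2 2
    (Deduce 3 2 1 3 2 2 (Deduce 3 2 1 3 2 2 (Deduce 3 2 3 3 2 2 (Split 2 4 3 (Deduce 2 3 2 2 2 2 (Deduce 2 2 2 2 3 2
    (Deduce 3 3 2 2 2 2 (Deduce 2 2 3 2 2 2 (Deduce 2 2 1 2 2 2 (Deduce 2 1 2 2 2 2 (Deduce 3 1 2 2 2 2 (Deduce 1 2 2 2 2
    2 (Deduce 4 3 2 2 2 2 (Deduce 4 2 2 2 2 2 (Leaf 18 (SP XYZ False True False) (Tri 0 1 0) False))))))))))) (Deduce 2 3
    2 2 2 2 (Deduce 2 2 2 2 3 2 (Deduce 3 3 2 2 2 2 (Deduce 2 2 3 2 2 2 (Deduce 2 2 1 2 2 2 (Deduce 2 1 2 2 2 2 (Deduce 3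
    1 2 2 2 2 (Deduce 1 2 2 2 2 2 (Deduce 4 3 2 2 2 2 (Deduce 4 2 2 2 2 2 (Leaf 18 (SP XYZ False False False) (Tri 0 1 0)
    False)))))))))))))))))) (Deduce 3 3 2 2 2 2 (Deduce 3 2 3 3 2 2 (Deduce 3 2 1 3 2 2 (Deduce 3 1 2 2 2 2 (Deduce 2 2 2
    2 3 2 (Leaf 11 (SP XYZ False True False) (Tri 0 2 0) True)))))))))))))) (Split 3 3 4 (Refer 11 (SP XYZ False False
    False) (Tri 0 0 0) False) (Deduce 3 2 3 3 2 2 (Split 3 3 2 (Refer 11 (SP XYZ False False True) (Tri 0 0 0) False)
    (Deduce 3 2 1 3 2 2 (Deduce 3 3 2 2 2 2 (Deduce 2 2 2 3 3 2 (Deduce 3 1 2 2 2 2 (Deduce 3 2 3 3 2 2 (Deduce 3 2 1 3 2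
    2 (Deduce 3 3 2 2 2 2 (Deduce 2 2 2 2 3 2 (Leaf 17 (SP YZX False False False) (Tri 0 0 1) False)))))))))))),
    Split 4 4 4 (Deduce 3 2 3 3 2 2 (Deduce 2 2 2 2 3 2 (Deduce 3 3 2 2 2 2 (Deduce 2 2 3 2 2 2 (Deduce 3 3 3 2 2 2 (Split
    3 3 2 (Deduce 2 2 1 2 2 2 (Split 4 4 2 (Deduce 2 2 2 2 3 2 (Deduce 3 3 2 2 2 2 (Deduce 2 2 2 2 3 2 (Deduce 3 3 2 2 2 2
    (Deduce 3 1 2 3 2 2 (Leaf 15 (SP XYZ False True False) (Tri 0 0 0) False)))))) (Deduce 3 3 2 2 2 2 (Deduce 2 2 2 3 3 2
    (Deduce 3 2 1 3 2 2 (Deduce 3 2 3 3 2 2 (Deduce 2 3 2 2 2 2 (Leaf 24 (SP XZY False False False) (Tri 0 3 0)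
    False)))))))) (Deduce 2 3 2 2 2 2 (Deduce 2 2 2 2 3 2 (Deduce 3 2 3 3 2 2 (Deduce 2 2 3 2 2 2 (Deduce 2 2 2 2 3 2
    (Deduce 3 3 2 2 2 2 (Deduce 2 2 2 2 3 2 (Deduce 2 2 1 3 2 2 (Deduce 3 2 2 2 2 1 (Deduce 2 2 2 3 3 2 (Deduce 3 2 2 3 2
    1 (Leaf 24 (SP YZX False False False) (Tri 0 3 1) False)))))))))))))))))) (Split 4 4 2 (Deduce 3 2 3 3 2 2 (Deduce 3 2
    1 3 2 2 (Deduce 3 3 3 3 2 2 (Deduce 2 2 2 3 3 2 (Deduce 3 2 2 3 2 3 (Deduce 3 1 2 3 2 2 (Deduce 2 2 2 2 3 2 (Deduce 2
    2 3 2 2 2 (Deduce 2 2 3 2 2 2 (Deduce 2 2 2 2 3 2 (Deduce 2 2 2 3 3 2 (Deduce 3 2 2 3 2 1 (Deduce 3 1 2 3 2 2 (Deduce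
    3 2 1 3 2 2 (Deduce 3 3 2 2 2 2 (Deduce 3 2 3 3 2 2 (Deduce 3 2 1 3 2 2 (Deduce 2 2 2 3 3 2 (Deduce 2 3 2 2 2 2 (Leaf
    24 (SP XZY False False False) (Tri 0 0 0) False)))))))))))))))))))) (Deduce 2 2 2 3 3 2 (Deduce 2 3 2 2 2 2 (Deduce 3
    3 1 3 2 2 (Deduce 2 3 3 3 2 2 (Deduce 2 2 3 2 2 2 (Deduce 2 3 1 3 2 2 (Deduce 2 3 2 2 2 2 (Deduce 2 3 1 3 2 2 (Deduce
    2 2 2 3 3 2 (Deduce 3 2 1 3 2 2 Stuck))))))))))),
    Split 4 2 3 (Refer 12 (SP XYZ False False False) (Tri 0 0 0) False) (Split 5 3 3 (Refer 12 (SP YXZ True True False)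
    (Tri 1 1 0) False) (Split 3 3 4 (Refer 13 (SP XYZ False False False) (Tri 0 0 0) False) (Split 3 3 2 (Refer 13 (SP XYZ
    False False True) (Tri 0 0 0) False) (Deduce 2 3 2 2 2 2 (Deduce 2 2 2 2 3 2 (Deduce 2 2 3 3 2 2 (Deduce 2 2 1 3 2 2
    (Deduce 1 2 2 2 2 2 (Deduce 1 1 2 3 2 2 (Refer 12 (SP XZY True False False) (Tri 1 0 0) True)))))))))),
    Split 3 2 4 (Refer 14 (SP XYZ False True False) (Tri 0 0 1) False) (Deduce 3 1 3 2 2 2 (Deduce 2 1 3 3 2 2 (Deduce 3 1
    2 2 2 2 (Split 5 3 3 (Deduce 3 2 3 3 2 2 (Deduce 3 2 1 3 2 2 (Deduce 2 1 2 3 2 2 (Split 2 3 3 (Deduce 2 3 2 3 2 2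
    (Deduce 3 3 2 2 2 2 (Deduce 2 1 2 3 2 2 (Deduce 3 1 2 2 2 2 (Deduce 4 2 2 2 2 2 Stuck))))) (Deduce 3 3 2 2 2 2 (Deduce
    3 1 2 2 2 2 (Deduce 3 2 3 3 2 2 (Deduce 3 2 1 3 2 2 (Deduce 2 3 2 3 2 2 (Leaf 4 (SP XYZ False False False) (Tri 0 0 0)
    False)))))))))) (Deduce 3 3 2 2 2 2 (Deduce 3 2 3 3 2 2 (Deduce 3 2 1 3 2 2 (Deduce 3 1 2 2 2 2 (Deduce 2 3 2 3 2 2
    (Deduce 2 1 2 3 2 2 (Deduce 4 2 2 3 2 2 (Deduce 2 2 2 3 3 2 (Leaf 14 (SP XYZ False False False) (Tri 0 0 0)
    False))))))))))))),
    Split 4 3 4 (Refer 10 (SP XYZ False False False) (Tri 0 0 0) False) (Split 4 3 2 (Refer 10 (SP XYZ False False True)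
    (Tri 0 0 0) False) (Split 3 4 3 (Refer 14 (SP XYZ False False False) (Tri 0 0 0) False) (Deduce 2 3 2 3 2 2 (Split 3 3
    4 (Split 3 3 2 (Deduce 3 3 2 2 2 2 (Deduce 3 2 3 3 2 2 (Deduce 2 2 3 2 2 2 (Split 4 2 4 (Refer 15 (SP XYZ False False
    False) (Tri 0 0 0) False) (Split 3 2 4 (Deduce 3 1 3 3 2 2 (Deduce 2 1 3 2 2 2 (Deduce 2 1 2 2 2 2 (Split 5 3 3
    (Deduce 2 2 2 3 3 2 (Deduce 4 2 2 2 2 2 (Deduce 2 2 2 3 3 2 (Deduce 2 1 2 2 2 2 (Leaf 14 (SP YXZ False False False)
    (Tri 0 0 0) False))))) (Deduce 3 2 3 3 2 2 (Deduce 3 2 1 3 2 2 (Deduce 3 1 2 3 2 2 (Deduce 4 2 2 3 2 2 (Deduce 2 3 2 3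
    2 2 (Deduce 2 1 2 2 2 2 (Leaf 12 (SP XYZ False False False) (Tri 1 0 0) False))))))))))) (Refer 15 (SP XYZ True False
    False) (Tri 1 0 0) True)))))) (Refer 10 (SP XYZ True False True) (Tri 1 0 0) True)) (Refer 10 (SP XYZ True False
    False) (Tri 1 0 0) True))))),
    Split 4 4 3 (Refer 16 (SP XYZ False False False) (Tri 0 0 0) False) (Split 4 3 4 (Refer 16 (SP XZY False False False)
    (Tri 0 0 0) False) (Split 4 3 2 (Refer 16 (SP XZY False False True) (Tri 0 0 0) False) (Split 4 2 3 (Refer 16 (SP XYZ
    False True False) (Tri 0 0 0) False) (Split 3 4 3 (Split 3 2 3 (Split 3 3 4 (Split 5 3 3 (Deduce 3 3 2 3 2 2 (Deduce 3
    2 3 3 2 2 (Deduce 3 2 1 3 2 2 (Deduce 3 1 2 3 2 2 (Deduce 3 1 2 3 2 2 (Deduce 3 3 2 3 2 2 (Split 2 3 3 (Deduce 2 3 2 2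
    2 2 (Deduce 2 2 3 2 2 2 (Deduce 2 2 1 2 2 2 (Deduce 2 1 2 2 2 2 (Deduce 2 1 2 2 2 2 (Deduce 2 3 2 2 2 2 (Leaf 5 (SP
    YXZ False False False) (Tri 0 2 0) True))))))) (Deduce 2 3 2 2 2 2 (Deduce 2 2 3 2 2 2 (Deduce 2 2 1 2 2 2 (Deduce 2 1
    2 2 2 2 (Deduce 2 1 2 2 2 2 (Deduce 2 3 2 2 2 2 (Leaf 3 (SP YXZ False False False) (Tri 0 0 0) False))))))))))))))
    (Deduce 3 3 2 3 2 2 (Deduce 3 2 3 3 2 2 (Deduce 3 1 2 3 2 2 (Deduce 3 2 2 4 2 2 (Deduce 3 2 1 3 2 2 (Deduce 3 2 3 3 2
    2 (Split 2 3 3 (Deduce 2 3 2 2 2 2 (Deduce 2 2 3 2 2 2 (Deduce 2 2 1 2 2 2 (Deduce 2 1 2 2 2 2 (Deduce 2 1 2 2 2 2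
    (Deduce 2 3 2 2 2 2 (Leaf 6 (SP XYZ False False False) (Tri 0 0 0) False))))))) (Deduce 2 3 2 2 2 2 (Deduce 2 2 3 2 2
    2 (Deduce 2 2 1 2 2 2 (Deduce 2 1 2 2 2 2 (Deduce 2 1 2 2 2 2 (Deduce 2 3 2 2 2 2 (Leaf 5 (SP YXZ False False False)
    (Tri 0 0 0) False))))))))))))))) (Refer 16 (SP XZY True False False) (Tri 1 0 0) True)) (Refer 16 (SP XYZ True True
    False) (Tri 1 0 0) True)) (Refer 16 (SP XYZ True False False) (Tri 1 0 0) True)))))]"

definition model_of :: "nat \<Rightarrow> colouring" where
  "model_of n = mcol (models ! (n - 1))"

text \<open>\<open>take i patterns\<close> restricts references to smaller numbers and thereby
  excludes circular reasoning.\<close>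

definition verified_cert :: "nat \<Rightarrow> bool" where
  "verified_cert i = certificate.verified nbrs model_of (take i patterns) (patterns ! i) (certs ! i)"

section \<open>Soundness of the checks\<close>

lemma tcol_periodic: "m > 0 \<Longrightarrow> periodic m (tcol m T)"
  by (simp add: periodic_def tcol_def)

lemma set_grid: "set (grid xs ys zs) = {Tri x y z |x y z. x \<in> set xs \<and> y \<in> set ys \<and> z \<in> set zs}"
  by (auto simp: grid_def)

lemma distinct_grid: "distinct xs \<Longrightarrow> distinct ys \<Longrightarrow> distinct zs \<Longrightarrow> distinct (grid xs ys zs)"
proof -
  assume d: "distinct xs" "distinct ys" "distinct zs"
  have "grid xs ys zs = map (\<lambda>(x, y, z). Tri x y z) (List.product xs (List.product ys zs))"
    unfolding grid_def product_concat_map by (simp add: map_concat o_def)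
  then show ?thesis using d by (auto simp: distinct_map distinct_product inj_on_def)
qed

lemma set_box_list: "m > 0 \<Longrightarrow> set (box_list m) = box m"
  unfolding box_list_def Let_def set_grid by (subst box_image) (auto simp: image_iff)

lemma distinct_box_list: "distinct (box_list m)"
  unfolding box_list_def Let_def by (intro distinct_grid) (auto simp: distinct_map)

text \<open>A motion maps vectors of the period lattice to such vectors, so preserving the colours
  of one box is enough.\<close>

lemma invariant_symm:
  assumes m: "m > 0" and i: "invariant m T (box_list m) g"
  shows "g \<in> symm (tcol m T)"
proof -
  let ?c = "tcol m T"
  have per: "periodic m ?c" by (rule tcol_periodic[OF m])
  have "?c (mov g p) = ?c p" for p
  proof -
    obtain L t where g: "g = Motion L t" by (cases g)
    have "\<exists>v. md m p = p + sc m v" unfolding md_eq_iff[symmetric] by (rule md_idem)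
    then obtain v where v: "md m p = p + sc m v" ..
    have "mov g (md m p) = mov g p + sc m (act L v)" by (simp add: g v act_add act_sc add_ac)
    then have "?c (mov g p) = ?c (mov g (md m p))" using periodic_sc[OF per] by simp
    also have "\<dots> = ?c (md m p)"
      using i md_in_box[of m p] unfolding invariant_def list_all_iff set_box_list[OF m] moves_ok_def by blast
    also have "\<dots> = ?c p" by (rule periodic_md[OF per])
    finally show ?thesis .
  qed
  then show ?thesis by (simp add: symm_def)
qed

section \<open>Groups generated by motions\<close>

definition bij_group :: "('a \<Rightarrow> 'a) monoid" where
  "bij_group = transf {f. bij f}"

lemma bij_group_group: "group bij_group"
  unfolding bij_group_def by (rule transf_group) (auto simp: bij_comp bij_imp_bij_inv)

lemma bij_group_inv: "bij f \<Longrightarrow> inv\<^bsub>bij_group\<^esub> f = inv_into UNIV f"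
  using bij_group_group unfolding bij_group_def by (intro transf_inv) (auto simp: bij_imp_bij_inv)

lemma bij_group_simps [simp]: "carrier bij_group = {f. bij f}" "mult bij_group = (\<circ>)" "one bij_group = id"
  by (simp_all add: bij_group_def)

lemma mov_eqI: "(\<And>p. mov g p = mov h p) \<Longrightarrow> g = h"
proof -
  assume e: "\<And>p. mov g p = mov h p"
  obtain L s M t where gh: "g = Motion L s" "h = Motion M t" by (metis motion.exhaust)
  have st: "s = t" using e[of 0] by (simp add: gh)
  then have "act L p = act M p" for p :: pt using e[of p] by (simp add: gh)
  then show ?thesis using act_sperm_eqI st gh by metis
qed

lemma rmov_comp: "(\<And>p. mov k p = mov g (mov h p)) \<Longrightarrow> rmov k = rmov g \<circ> rmov h"
proof -
  assume k: "\<And>p. mov k p = mov g (mov h p)"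
  obtain k' where k': "mov k' = mov g \<circ> mov h" "rmov k' = rmov g \<circ> rmov h" using mov_comp by blast
  then have "k = k'" using k by (intro mov_eqI) simp
  then show ?thesis using k' by simp
qed

lemma rmov_inverse: "(\<And>p. mov k (mov g p) = p) \<Longrightarrow> rmov k = inv_into UNIV (rmov g)"
proof -
  assume k: "\<And>p. mov k (mov g p) = p"
  obtain k' where k': "\<And>p. mov g (mov k' p) = p" "rmov k' = inv_into UNIV (rmov g)" using mov_inverse[of g] by metis
  then have "k = k'" using k by (intro mov_eqI) metis
  then show ?thesis using k' by simp
qed

lemma rmov_bij: "bij (rmov g)"
  by (simp add: isometry_bij rmov_isometry)

text \<open>Generation is carried out among bijections of real space, the setting in which
  \<open>coordinate_group\<close> and \<open>space_group\<close> can be compared with it, and pulled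
  back to motions.\<close>

definition gen_set :: "motion list \<Rightarrow> motion set" where
  "gen_set gs = {g. rmov g \<in> generate bij_group (rmov ` set gs)}"

lemma gen_subset: "rmov ` A \<subseteq> carrier bij_group"
  by (auto simp: rmov_bij)

lemma gen_set_gen: "g \<in> set gs \<Longrightarrow> g \<in> gen_set gs"
  by (simp add: gen_set_def generate.incl)

lemma gen_set_comp:
  assumes "g \<in> gen_set gs" "h \<in> gen_set gs" "\<And>p. mov k p = mov g (mov h p)"
  shows "k \<in> gen_set gs"
  using generate.eng[of "rmov g" bij_group "rmov ` set gs" "rmov h"] assms(1,2) rmov_comp[of k g h, OF assms(3)]
  by (simp add: gen_set_def)

lemma gen_set_inverse:
  assumes "g \<in> gen_set gs" "\<And>p. mov k (mov g p) = p"
  shows "k \<in> gen_set gs"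
  using group.generate_m_inv_closed[OF bij_group_group gen_subset, of "rmov g" "set gs"] assms(1) rmov_inverse[of k g, OF assms(2)]
  by (simp add: gen_set_def bij_group_inv rmov_bij)

lemma rmov_shift_0: "rmov (shift 0) = id"
  by (auto simp: fun_eq_iff rmov_shift emb_0 simp del: rmov.simps)

lemma gen_set_id: "shift 0 \<in> gen_set gs"
  using generate.one[of bij_group "rmov ` set gs"] unfolding gen_set_def mem_Collect_eq rmov_shift_0 by simp

lemma gen_set_shift_add: "shift s \<in> gen_set gs \<Longrightarrow> shift t \<in> gen_set gs \<Longrightarrow> shift (s + t) \<in> gen_set gs"
  by (rule gen_set_comp[of "shift s" gs "shift t"]) (simp_all only: mov_translation add_ac)

lemma gen_set_shift_minus: "shift s \<in> gen_set gs \<Longrightarrow> shift (- s) \<in> gen_set gs"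
  by (rule gen_set_inverse[of "shift s"]) (simp_all only: mov_translation add.assoc add.right_inverse add_0_right)

lemma scale_simps: "scale 0 p = 0" "scale (k + 1) p = scale k p + p" "scale (k - 1) p = scale k p - p"
  by (cases p; simp add: zero_tri_def algebra_simps)+

lemma gen_set_scale:
  assumes s: "shift s \<in> gen_set gs" shows "shift (scale k s) \<in> gen_set gs"
proof (induction k rule: int_induct[of _ 0])
  case base
  then show ?case using gen_set_id by (simp add: scale_simps)
next
  case (step1 i)
  then show ?case unfolding scale_simps using s by (intro gen_set_shift_add) simp_all
next
  case (step2 i)
  then have "shift (scale i s + (- s)) \<in> gen_set gs" using s by (intro gen_set_shift_add gen_set_shift_minus) simp_all
  then show ?case unfolding scale_simps by simp
qed

lemma gen_set_comb: "(\<And>v. v \<in> set vs \<Longrightarrow> shift v \<in> gen_set gs) \<Longrightarrow> shift (comb ks vs) \<in> gen_set gs"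
proof (induction ks vs rule: comb.induct)
  case (1 k ks v vs)
  have "shift (comb ks vs) \<in> gen_set gs" using 1 by (cases "k = 0") simp_all
  moreover have "shift (scale k v) \<in> gen_set gs" using 1 by (intro gen_set_scale) simp
  ultimately show ?case using gen_set_shift_add by simp
qed (simp_all add: gen_set_id)

lemma word_gen_set: "list_all (\<lambda>i. i < length gs) w \<Longrightarrow> \<exists>g\<in>gen_set gs. mov g = word gs w"
proof (induction w)
  case Nil
  show ?case by (rule bexI[OF _ gen_set_id]) (simp add: word_def fun_eq_iff mov_translation del: mov.simps)
next
  case (Cons i w)
  then obtain g where g: "g \<in> gen_set gs" "mov g = word gs w" by auto
  obtain k where k: "mov k = mov (gs ! i) \<circ> mov g" using mov_comp by blast
  have "gs ! i \<in> gen_set gs" using Cons by (intro gen_set_gen) simp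
  then have "k \<in> gen_set gs" using g(1) by (rule gen_set_comp) (simp add: k)
  then show ?case using k g(2) by (intro bexI[of _ k]) (simp_all add: word_def fun_eq_iff)
qed

lemma symm_subgroup: "subgroup (rmov ` symm c) bij_group"
proof -
  have s: "subgroup (aut_partition (bipart c)) (transf aut_lattice)" by (rule aut_partition_subgroup)
  have c: "f \<in> rmov ` symm c \<Longrightarrow> f \<in> aut_lattice" for f by (auto simp: rmov_aut)
  show ?thesis
    unfolding bij_group_def
  proof (rule subgroup_transfI)
    show "group (transf {f. bij f})" using bij_group_group by (simp add: bij_group_def)
    show "id \<in> rmov ` symm c" using subgroup.one_closed[OF s] by (simp add: aut_partition_bipart)
    fix f g assume f: "f \<in> rmov ` symm c"
    show "bij f \<and> inv_into UNIV f \<in> rmov ` symm c"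
      using subgroup.m_inv_closed[OF s, of f] f aut_lattice_m_inv[OF c[OF f]] aut_lattice_bij[OF c[OF f]]
      by (simp add: aut_partition_bipart)
    assume g: "g \<in> rmov ` symm c"
    show "f \<circ> g \<in> rmov ` symm c" using subgroup.m_closed[OF s, of f g] f g by (simp add: aut_partition_bipart)
  qed (use c aut_lattice_bij in auto)
qed

lemma gen_set_symm:
  assumes "\<And>g. g \<in> set gs \<Longrightarrow> g \<in> symm c" shows "gen_set gs \<subseteq> symm c"
proof
  fix g assume "g \<in> gen_set gs"
  moreover have "generate bij_group (rmov ` set gs) \<subseteq> rmov ` symm c"
    using assms by (intro group.generate_subgroup_incl[OF bij_group_group _ symm_subgroup]) auto
  ultimately obtain h where "h \<in> symm c" "rmov g = rmov h" unfolding gen_set_def by blast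
  moreover have "g = h" by (rule mov_eqI) (metis \<open>rmov g = rmov h\<close> emb_inj rmov_emb)
  ultimately show "g \<in> symm c" by simp
qed

lemma mismatch_iff: "mismatch m T b L (map (with_colour m T b) ds) \<longleftrightarrow> (\<exists>d\<in>set ds. tcol m T (b + act L d) \<noteq> tcol m T (b + d))"
  by (induction ds) (auto simp: with_colour_def)

lemma map_with_colour:
  "map (with_colour m T b) (d # ds) = (d, tcol m T (b + d)) # map (with_colour m T b) ds"
  by (simp add: with_colour_def)

text \<open>The second alternative says that for every remaining direction a mismatch lies inside
  its overlap, so that the premise of rigidity fails for it.\<close>

lemma scan_sound:
  assumes "scan m T r b L bad us (map (with_colour m T b) ds)"
  shows "(\<not> bad \<and> (\<forall>d\<in>set ds. tcol m T (b + act L d) = tcol m T (b + d))) \<or>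
    (\<forall>u\<in>set us. \<exists>d\<in>set ds. short r (d + u) \<and> tcol m T (b + act L d) \<noteq> tcol m T (b + d))"
  using assms
proof (induction ds arbitrary: bad us)
  case (Cons d ds)
  note prems = Cons.prems[unfolded map_with_colour scan.simps] and IH = Cons.IH
  show ?case
  proof (cases "tcol m T (b + act L d) = tcol m T (b + d)")
    case True
    then have "scan m T r b L bad us (map (with_colour m T b) ds)" using prems by simp
    then show ?thesis using IH[of bad us] True by auto
  next
    case False
    show ?thesis
    proof (cases "filter (\<lambda>u. \<not> short r (d + u)) us")
      case Nil
      then have "\<forall>u\<in>set us. short r (d + u)" by (simp add: filter_empty_conv)
      then show ?thesis using False by auto
    next
      case us': (Cons u us')
      then have "scan m T r b L True (u # us') (map (with_colour m T b) ds)"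
        using prems False by simp
      \<comment> \<open>With \<open>bad\<close> set, the first alternative of the induction
        hypothesis is impossible.\<close>
      then have "\<forall>v\<in>set (u # us'). \<exists>d\<in>set ds. short r (d + v) \<and> tcol m T (b + act L d) \<noteq> tcol m T (b + d)"
        using IH[of True "u # us'"] by blast
      then have *: "\<forall>v\<in>set us. \<not> short r (d + v) \<longrightarrow> (\<exists>d\<in>set ds. short r (d + v) \<and> tcol m T (b + act L d) \<noteq> tcol m T (b + d))"
        unfolding us'[symmetric] by simp
      have "\<forall>v\<in>set us. \<exists>d'\<in>set (d # ds). short r (d' + v) \<and> tcol m T (b + act L d') \<noteq> tcol m T (b + d')"
      proof
        fix v assume v: "v \<in> set us"
        show "\<exists>d'\<in>set (d # ds). short r (d' + v) \<and> tcol m T (b + act L d') \<noteq> tcol m T (b + d')"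
        proof (cases "short r (d + v)")
          case True
          then show ?thesis using False by (intro bexI[of _ d]) auto
        next
          case False
          then show ?thesis using * v by (auto simp del: act.simps)
        qed
      qed
      then show ?thesis by blast
    qed
  qed
qed simp

lemma act_short: "short r (act L d) = short r d"
proof (cases L)
  case (SP \<pi> s t u)
  then show ?thesis by (cases \<pi>; cases d; simp add: short_def signed_def add_ac)
qed

text \<open>A coordinate outside the enumerated range has square at least 4 or 9, respectively,
  which exceeds 3 or 6.\<close>

lemma set_ball_list: "r = 3 \<or> r = 6 \<Longrightarrow> set (ball_list r) = {d. short r d}"
proof -
  assume r: "r = 3 \<or> r = 6"
  have b: "\<bar>x\<bar> \<le> (if r = 3 then 1 else 2)" if "x * x + y * y + z * z \<le> r" for x y z :: int
  proof (rule ccontr)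
    assume "\<not> ?thesis"
    then have "(if r = 3 then 2 else 3) \<le> \<bar>x\<bar>" by auto
    then have "(if r = 3 then 2 else 3) * (if r = 3 then 2 else 3) \<le> \<bar>x\<bar> * \<bar>x\<bar>" by (intro mult_mono) auto
    then have "(r = 3 \<and> 4 \<le> x * x) \<or> (r = 6 \<and> 9 \<le> x * x)" using r by auto
    then show False using that zero_le_square[of y] zero_le_square[of z] by (elim disjE conjE; linarith)
  qed
  have "d \<in> set (ball_list r)" if "short r d" for d
  proof (cases d)
    case (Tri x y z)
    have s: "x * x + y * y + z * z \<le> r" using that by (simp add: short_def Tri)
    have "\<bar>x\<bar> \<le> (if r = 3 then 1 else 2)" "\<bar>y\<bar> \<le> (if r = 3 then 1 else 2)" "\<bar>z\<bar> \<le> (if r = 3 then 1 else 2)"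
      using b[of x y z] b[of y x z] b[of z x y] s by (simp_all add: add_ac)
    moreover have "w \<in> set (if r \<le> 3 then [-1, 0, 1] else [-2, -1, 0, 1, 2])"
      if "\<bar>w\<bar> \<le> (if r = 3 then 1 else 2)" for w :: int using that r by auto
    ultimately have "x \<in> set (if r \<le> 3 then [-1, 0, 1] else [-2, -1, 0, 1, 2])"
      "y \<in> set (if r \<le> 3 then [-1, 0, 1] else [-2, -1, 0, 1, 2])"
      "z \<in> set (if r \<le> 3 then [-1, 0, 1] else [-2, -1, 0, 1, 2])" by blast+
    then show ?thesis using that unfolding ball_list_def Let_def set_filter set_grid Tri by blast
  qed
  then show ?thesis by (auto simp: ball_list_def Let_def)
qed

lemma scan_rigid:
  assumes r: "r = 3 \<or> r = 6" and s: "list_all (scan_all m T r b (map (with_colour m T b) (ball_list r))) sperms"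
  shows "rigid_at {d. short r d} (tcol m T) b"
  unfolding rigid_at_def
proof (intro allI ballI impI)
  fix L u d assume u: "u \<in> set units" and h: "\<forall>d\<in>{d. short r d}. d + u \<in> {d. short r d} \<longrightarrow> tcol m T (b + act L d) = tcol m T (b + d)"
    and d: "d \<in> {d. short r d}"
  have "scan m T r b L False units (map (with_colour m T b) (ball_list r))"
    using s set_sperms by (auto simp: list_all_iff scan_all_def)
  from scan_sound[OF this] show "tcol m T (b + act L d) = tcol m T (b + d)"
    using u h d unfolding set_ball_list[OF r] by blast
qed

section \<open>The symmetry group of a model that passes the checks\<close>

locale checked_model =
  fixes M m T ts half q gs rb ax rt w y1 g1 d1 y2 g2 d2 it ik
  assumes M: "M = Model m T ts half q gs rb ax rt w y1 g1 d1 y2 g2 d2"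
    and ci: "check_invariant M" and ct: "check_transitive M" and cs: "check_stabilizer M"
    and cl: "check_translations M" and cx: "check_index it ik M" and cw: "check_sites M"
begin

abbreviation "c \<equiv> tcol m T"

definition "ag = map shift ts @ gs"

lemma m: "m > 0" and c0: "\<not> c 0" and cq: "c q" and symm_gens: "g \<in> set ag \<Longrightarrow> g \<in> symm c"
  and g1: "g1 \<in> symm c" "mov g1 y1 = 0" and g2: "g2 \<in> symm c" "mov g2 y2 = q"
  using ci unfolding M check_invariant_def model.case Let_def ag_def
  by (auto simp: list_all_iff invariant_symm simp del: mov.simps)

lemma per: "periodic m c" by (rule tcol_periodic[OF m])

lemma Gsymm: "gen_set ag \<subseteq> symm c"
  using gen_set_symm symm_gens by blast

lemma shift_ts: "v \<in> set ts \<Longrightarrow> shift v \<in> gen_set ag"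
  by (rule gen_set_gen) (simp add: ag_def)

text \<open>Period translations belong to the generated group, so a walk through residues lifts to a
  walk through points.\<close>

lemma shift_sc: "shift (sc m v) \<in> gen_set ag"
proof -
  have "[Tri (int m) 0 0, Tri 0 (int m) 0, Tri 0 0 (int m)] = map (\<lambda>ks. comb ks ts) ax"
    using ct unfolding M check_transitive_def model.case Let_def by simp
  then have "set [Tri (int m) 0 0, Tri 0 (int m) 0, Tri 0 0 (int m)] \<subseteq> range (\<lambda>ks. comb ks ts)" by (auto simp del: set_simps)
  then have "shift (Tri (int m) 0 0) \<in> gen_set ag" "shift (Tri 0 (int m) 0) \<in> gen_set ag" "shift (Tri 0 0 (int m)) \<in> gen_set ag"
    using gen_set_comb[OF shift_ts] by auto
  moreover obtain i j k where v: "v = Tri i j k" by (cases v)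
  ultimately have "shift (scale i (Tri (int m) 0 0) + scale j (Tri 0 (int m) 0) + scale k (Tri 0 0 (int m))) \<in> gen_set ag"
    by (intro gen_set_shift_add gen_set_scale)
  then show ?thesis by (simp add: v mult.commute)
qed

definition "to_base p \<longleftrightarrow> (\<exists>g\<in>gen_set ag. mov g p = 0 \<or> mov g p = q)"

lemma to_base_move:
  assumes "g \<in> gen_set ag" "to_base (mov g p)" shows "to_base p"
proof -
  obtain h where h: "h \<in> gen_set ag" "mov h (mov g p) = 0 \<or> mov h (mov g p) = q" using assms unfolding to_base_def by blast
  obtain k where k: "mov k = mov h \<circ> mov g" using mov_comp by blast
  have "k \<in> gen_set ag" using h(1) assms(1) by (rule gen_set_comp) (simp add: k)
  then show ?thesis using h(2) k unfolding to_base_def by (intro bexI[of _ k]) auto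
qed

lemma to_base_md: "to_base (md m p) \<Longrightarrow> to_base p"
proof -
  assume b: "to_base (md m p)"
  have "\<exists>v. md m p = p + sc m v" unfolding md_eq_iff[symmetric] by (rule md_idem)
  then obtain v where "mov (shift (sc m v)) p = md m p" unfolding mov_translation by auto
  then show ?thesis using to_base_move[OF shift_sc] b by metis
qed

lemma to_base_base: "to_base 0" "to_base (md m q)"
proof -
  show "to_base 0" unfolding to_base_def by (rule bexI[OF _ gen_set_id]) (simp add: mov_translation del: mov.simps)
  have "\<exists>v. q = md m q + sc m v" unfolding md_eq_iff[symmetric] by (rule md_idem[symmetric])
  then obtain v where v: "q = md m q + sc m v" ..
  have "mov (shift (sc m v)) (md m q) = q" unfolding mov_translation by (rule v[symmetric])
  then show "to_base (md m q)" unfolding to_base_def using shift_sc by blast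
qed

lemma arrives_to_base: "arrives m rt ag (md m q) k p \<Longrightarrow> to_base p"
proof (induction k arbitrary: p)
  case 0
  then show ?case using to_base_base by auto
next
  case (Suc k)
  show ?case
  proof (cases "p = 0 \<or> p = md m q")
    case False
    then have i: "entry_at m rt p < length ag" "arrives m rt ag (md m q) k (md m (mov (ag ! entry_at m rt p) p))"
      using Suc.prems by (auto simp: Let_def)
    then have "to_base (mov (ag ! entry_at m rt p) p)" using Suc.IH to_base_md by blast
    then show ?thesis using to_base_move[OF gen_set_gen] i(1) nth_mem by blast
  qed (use to_base_base in auto)
qed

lemma to_base: "to_base p"
proof -
  have "list_all (arrives m rt ag (md m q) 6) (box_list m)"
    using ct unfolding M check_transitive_def model.case Let_def ag_def by simp
  then have "arrives m rt ag (md m q) 6 (md m p)"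
    using md_in_box[of m p] unfolding list_all_iff set_box_list[OF m] by blast
  then show ?thesis using arrives_to_base to_base_md by blast
qed

text \<open>Both points are walked to a base point. The two base points differ in colour, so points
  of equal colour end at the same one.\<close>

lemma gen_transitive: "c p = c p' \<Longrightarrow> \<exists>g\<in>gen_set ag. mov g p = p'"
proof -
  assume e: "c p = c p'"
  obtain g where g: "g \<in> gen_set ag" "mov g p = 0 \<or> mov g p = q" using to_base unfolding to_base_def by blast
  obtain h where h: "h \<in> gen_set ag" "mov h p' = 0 \<or> mov h p' = q" using to_base unfolding to_base_def by blast
  have "c (mov g p) = c p" "c (mov h p') = c p'" using g(1) h(1) Gsymm by (auto simp: symm_def)
  then have gh: "mov g p = mov h p'" using g(2) h(2) e c0 cq by auto
  obtain k where k: "\<And>p. mov k (mov h p) = p" using mov_inverse by metis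
  obtain l where l: "mov l = mov k \<circ> mov g" using mov_comp by blast
  have "k \<in> gen_set ag" using h(1) k by (rule gen_set_inverse)
  then have "l \<in> gen_set ag" using g(1) by (rule gen_set_comp) (simp add: l)
  then show ?thesis using l gh k by (intro bexI[of _ l]) auto
qed

lemma two_orbit: "two_orbit c"
  unfolding two_orbit_def using c0 cq gen_transitive Gsymm by blast

text \<open>The words show that the listed rotations are generated; the mismatches show that there
  are no others.\<close>

lemma stab_words: "stab c 0 = set (map fst w)" and words_distinct: "distinct (map fst w)"
  and word_motion: "L \<in> set (map fst w) \<Longrightarrow> Motion L 0 \<in> gen_set ag"
proof -
  have ok: "list_all (word_ok m ag) w" and ex: "list_all (excluded m T (map (with_colour m T 0) (ball_list 6)) (map fst w)) sperms"
    and d: "distinct (map fst w)"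
    using cs unfolding M check_stabilizer_def model.case Let_def ag_def by simp_all
  show "distinct (map fst w)" by (rule d)
  show in_gen: "Motion L 0 \<in> gen_set ag" if L: "L \<in> set (map fst w)" for L
  proof -
    obtain ws where "(L, ws) \<in> set w" using L by auto
    then have ws: "word_ok m ag (L, ws)" using ok unfolding list_all_iff by blast
    define o' where "o' = word ag ws 0"
    obtain g where g: "g \<in> gen_set ag" "mov g = word ag ws" using ws word_gen_set by (auto simp: word_ok_def Let_def)
    obtain N t where Nt: "g = Motion N t" by (cases g)
    have t: "t = o'" using fun_cong[OF g(2), of 0] by (simp add: Nt o'_def)
    have n: "act L e = act N e" if "word ag ws e = act L e + o'" for e
      using fun_cong[OF g(2), of e] that by (simp add: Nt t)
    have w: "word ag ws (Tri 1 0 0) = act L (Tri 1 0 0) + o'" "word ag ws (Tri 0 1 0) = act L (Tri 0 1 0) + o'"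
      "word ag ws (Tri 0 0 1) = act L (Tri 0 0 1) + o'"
      using ws unfolding word_ok_def o'_def by (simp_all add: Let_def)
    \<comment> \<open>The separating vector of \<open>act_eqD\<close>, written as a sum of unit
      vectors because the word is evaluated only on these and on \<open>0\<close>.\<close>
    have e: "Tri 1 2 (3::int) = Tri 1 0 0 + (Tri 0 1 0 + Tri 0 1 0) + (Tri 0 0 1 + (Tri 0 0 1 + Tri 0 0 1))" by simp
    have LN: "L = N" by (rule act_eqD) (simp only: e act_add n[OF w(1)] n[OF w(2)] n[OF w(3)])
    have "\<exists>v. o' = 0 + sc m v" unfolding md_eq_iff[symmetric]
    proof -
      have "md m 0 = 0" by (simp add: zero_tri_def)
      moreover have "md m o' = 0" using ws by (simp add: word_ok_def Let_def o'_def del: md_Tri)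
      ultimately show "md m o' = md m 0" by simp
    qed
    then obtain v where "o' = sc m v" by auto
    then have "shift (- o') \<in> gen_set ag" using gen_set_shift_minus[OF shift_sc] by simp
    then show ?thesis using g(1) by (rule gen_set_comp) (simp add: Nt LN t mov_translation del: mov.simps, simp)
  qed
  have "L \<in> set (map fst w)" if "L \<in> stab c 0" for L
  proof -
    have "excluded m T (map (with_colour m T 0) (ball_list 6)) (map fst w) L" using ex set_sperms by (auto simp: list_all_iff)
    moreover have "\<not> mismatch m T 0 L (map (with_colour m T 0) (ball_list 6))"
      unfolding mismatch_iff using that by (simp add: stab_def)
    ultimately show ?thesis unfolding excluded_def by (simp split: if_splits)
  qed
  moreover have "L \<in> stab c 0" if "L \<in> set (map fst w)" for L
    using in_gen[OF that] Gsymm stab_symm[of L c 0] by auto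
  ultimately show "stab c 0 = set (map fst w)" by blast
qed

text \<open>Transitivity of the generated group moves the image of \<open>0\<close> under a symmetry
  back to \<open>0\<close>. What is left lies in the site group of \<open>0\<close>, whose elements
  are generated words, so the generators yield every symmetry.\<close>

lemma symm_eq_gen: "symm c = gen_set ag"
proof
  show "symm c \<subseteq> gen_set ag"
  proof
    fix g assume g: "g \<in> symm c"
    have "c (mov g 0) = c 0" using g by (simp add: symm_def)
    then obtain h where h: "h \<in> gen_set ag" "mov h (mov g 0) = 0" using gen_transitive by metis
    obtain k where k: "mov k = mov h \<circ> mov g" using mov_comp by blast
    obtain L t where Lt: "k = Motion L t" by (cases k)
    have t: "t = 0" using fun_cong[OF k, of 0] h(2) by (simp add: Lt)
    have "k \<in> symm c" using g h(1) Gsymm unfolding symm_def mem_Collect_eq k by auto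
    then have "L \<in> stab c 0" using stab_symm[of L c 0] by (simp add: Lt t)
    then have "k \<in> gen_set ag" using stab_words word_motion by (simp add: Lt t)
    moreover obtain h' where h': "\<And>p. mov h' (mov h p) = p" using mov_inverse by metis
    moreover have "h' \<in> gen_set ag" using h(1) h' by (rule gen_set_inverse)
    ultimately show "g \<in> gen_set ag" using gen_set_comp[of h' ag k g] by (simp add: k)
  qed
qed (rule Gsymm)

text \<open>Every point is the image of \<open>0\<close> or \<open>q\<close> under a symmetry, so
  the scans at these two points settle rigidity everywhere.\<close>

lemma rigid:
  assumes "check_rigid r M" "r = 3 \<or> r = 6"
  shows "rigid_at (set (ball_list r)) c y"
proof -
  have E: "act L d \<in> {d. short r d}" if "d \<in> {d. short r d}" for L d using that by (simp add: act_short)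
  have "rigid_at {d. short r d} c 0" "rigid_at {d. short r d} c q"
    using assms(1) scan_rigid[OF assms(2)] unfolding M check_rigid_def model.case Let_def by simp_all
  moreover have "\<exists>g\<in>symm c. mov g 0 = y \<or> mov g q = y"
    using gen_transitive[of 0 y] gen_transitive[of q y] c0 cq Gsymm by (cases "c y") auto
  ultimately show ?thesis unfolding set_ball_list[OF assms(2)] using rigid_at_symm[OF _ _ E] by blast
qed

lemma translation_set: "translations_mod m c = set (lattice_of M)" and translation_set_distinct: "distinct (lattice_of M)"
proof -
  have rb: "distinct (lattice_of M)" "list_all (no_translation m T (box_list m) (lattice_of M)) (box_list m)"
    using cl unfolding M check_translations_def lattice_of_def model.case Let_def by simp_all
  show "distinct (lattice_of M)" by (rule rb)
  have sh: "(\<forall>p. c (p + t) = c p) \<longleftrightarrow> shift t \<in> symm c" for t unfolding symm_def mem_Collect_eq mov_translation ..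
  have "t \<in> set (lattice_of M)" if "t \<in> translations_mod m c" for t
  proof -
    have t: "t \<in> box m" "\<forall>p. c (p + t) = c p" using that by (auto simp: translations_mod_def)
    then have "no_translation m T (box_list m) (lattice_of M) t" using rb(2) unfolding list_all_iff set_box_list[OF m] by blast
    then show ?thesis using t(2) unfolding no_translation_def by (auto simp: list_ex_iff shift_differs_def split: if_splits)
  qed
  moreover have "t \<in> translations_mod m c" if "t \<in> set (lattice_of M)" for t
  proof -
    have "\<exists>h1 h2 h3. set [h1, h2, h3] \<subseteq> (\<lambda>ks. comb ks ts) ` set rb \<and> (\<exists>i j k. t = md m (scale i h1 + scale j h2 + scale k h3))"
      using that unfolding lattice_of_def M model.case lattice_list_def
      by (auto split: list.splits tri.splits simp: set_grid) (metis image_eqI list.set_intros set_map)+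
    then obtain h1 h2 h3 i j k where hh: "set [h1, h2, h3] \<subseteq> range (\<lambda>ks. comb ks ts)" "t = md m (scale i h1 + scale j h2 + scale k h3)" by blast
    have "shift v \<in> gen_set ag" if "v \<in> set [h1, h2, h3]" for v using hh(1) that gen_set_comb[OF shift_ts] by blast
    then have "shift (scale i h1 + scale j h2 + scale k h3) \<in> gen_set ag"
      by (intro gen_set_shift_add gen_set_scale) simp_all
    moreover obtain v where "t = (scale i h1 + scale j h2 + scale k h3) + sc m v"
      using hh(2) md_eq_iff[of m t "scale i h1 + scale j h2 + scale k h3"] by auto
    ultimately have "shift t \<in> gen_set ag" using gen_set_shift_add shift_sc by blast
    then show ?thesis using Gsymm sh hh(2) by (auto simp: translations_mod_def)
  qed
  ultimately show "translations_mod m c = set (lattice_of M)" by blast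
qed

lemma index_translation: "card (range (\<lambda>t. c \<circ> mov (shift t))) = it"
  and index_aut: "card (range (\<lambda>g. c \<circ> mov g)) = it * ik"
proof -
  have x: "length (lattice_of M) * it = m ^ 3" "length (filter (is_false m T) (box_list m)) * length w * (it * ik) = 48 * m ^ 3"
    using cx unfolding M check_index_def model.case by simp_all
  have NT: "card (translations_mod m c) * it = m ^ 3"
    using x(1) by (simp add: translation_set distinct_card[OF translation_set_distinct])
  have "card {p \<in> box m. c p = c 0} = length (filter (is_false m T) (box_list m))"
  proof -
    have "{p \<in> box m. c p = c 0} = set (filter (is_false m T) (box_list m))"
      using c0 by (auto simp: set_box_list[OF m] is_false_def)
    then show ?thesis using distinct_box_list by (simp add: distinct_card del: set_filter)
  qed
  moreover have "card (stab c 0) = length w"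
    using words_distinct stab_words by (metis distinct_card length_map)
  ultimately have K: "card (motions_mod m \<inter> symm c) * (it * ik) = 48 * m ^ 3"
    using symm_order_mod[OF per two_orbit, of 0] x(2) by simp
  have m3: "m ^ 3 > 0" using m by simp
  have N0: "card (translations_mod m c) > 0" "card (motions_mod m \<inter> symm c) > 0" using NT K m3 by (auto intro: Nat.gr0I)
  have "card (range (\<lambda>t. c \<circ> mov (shift t))) * card (translations_mod m c) = it * card (translations_mod m c)"
    using translation_index_mult[OF per] NT by (simp add: mult.commute)
  then show "card (range (\<lambda>t. c \<circ> mov (shift t))) = it" using N0 by simp
  have "card (range (\<lambda>g. c \<circ> mov g)) * card (motions_mod m \<inter> symm c) = it * ik * card (motions_mod m \<inter> symm c)"
    using index_mult[OF per] K by (simp add: mult.commute)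
  then show "card (range (\<lambda>g. c \<circ> mov g)) = it * ik" using N0 by simp
qed

lemma site:
  "\<forall>L\<in>stab c y1. \<forall>D\<in>set d1. act L (direction ts D) = direction ts D"
  "\<forall>L\<in>stab c y2. \<forall>D\<in>set d2. act L (direction ts D) = direction ts D"
proof -
  have "act L (direction ts D) = direction ts D"
    if a: "list_all (fixes_or_mismatch m T (map (direction ts) ds) y (map (with_colour m T y) (ball_list 3))) sperms"
    and L: "L \<in> stab c y" and D: "D \<in> set ds" for L D y ds
  proof -
    have "fixes_or_mismatch m T (map (direction ts) ds) y (map (with_colour m T y) (ball_list 3)) L"
      using a set_sperms by (auto simp: list_all_iff)
    moreover have "\<not> mismatch m T y L (map (with_colour m T y) (ball_list 3))"
      unfolding mismatch_iff using L by (simp add: stab_def)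
    ultimately show ?thesis using D by (auto simp: fixes_or_mismatch_def list_all_iff split: if_splits)
  qed
  moreover have "list_all (fixes_or_mismatch m T (map (direction ts) d1) y1 (map (with_colour m T y1) (ball_list 3))) sperms"
    "list_all (fixes_or_mismatch m T (map (direction ts) d2) y2 (map (with_colour m T y2) (ball_list 3))) sperms"
    using cw unfolding M check_sites_def model.case Let_def by simp_all
  ultimately show "\<forall>L\<in>stab c y1. \<forall>D\<in>set d1. act L (direction ts D) = direction ts D"
    "\<forall>L\<in>stab c y2. \<forall>D\<in>set d2. act L (direction ts D) = direction ts D" by blast+
qed

end

section \<open>Change of frame\<close>

definition conj_by :: "('a \<Rightarrow> 'b) \<Rightarrow> ('a \<Rightarrow> 'a) \<Rightarrow> 'b \<Rightarrow> 'b" where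
  "conj_by s g = s \<circ> g \<circ> inv_into UNIV s"

text \<open>For a bijective frame the relation \<open>g \<circ> F = F \<circ> h\<close> can be
  solved for \<open>g\<close>, which makes the space group an image under conjugation.\<close>

lemma space_group_conj:
  assumes "bij F" shows "space_group T F = conj_by F ` coordinate_group T"
proof (intro equalityI subsetI)
  fix g assume "g \<in> space_group T F"
  then obtain h where h: "h \<in> coordinate_group T" "g \<circ> F = F \<circ> h" by (auto simp: space_group_def)
  have "g = g \<circ> F \<circ> inv_into UNIV F" using assms by (auto simp: fun_eq_iff bij_is_surj surj_f_inv_f)
  then have "g = conj_by F h" unfolding conj_by_def h(2) by simp
  then show "g \<in> conj_by F ` coordinate_group T" using h by blast
next
  fix g assume "g \<in> conj_by F ` coordinate_group T"
  then obtain h where h: "h \<in> coordinate_group T" "g = conj_by F h" by blast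
  have "g \<circ> F = F \<circ> h" using assms by (auto simp: h(2) conj_by_def fun_eq_iff bij_is_inj)
  then show "g \<in> space_group T F" using h by (auto simp: space_group_def)
qed

lemma conj_by_comp:
  assumes "bij s" shows "conj_by s (g \<circ> h) = conj_by s g \<circ> conj_by s h"
  using assms by (auto simp: conj_by_def fun_eq_iff bij_is_inj)

lemma conj_by_conj_by:
  assumes "bij s" "bij t" shows "conj_by s (conj_by t g) = conj_by (s \<circ> t) g"
  using assms by (simp add: conj_by_def o_inv_distrib fun_eq_iff)

lemma conj_by_bij: "bij s \<Longrightarrow> bij g \<Longrightarrow> bij (conj_by s g)"
  unfolding conj_by_def by (intro bij_comp bij_imp_bij_inv)

lemma conj_by_apply: "bij s \<Longrightarrow> conj_by s g (s x) = s (g x)"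
  by (simp add: conj_by_def bij_is_inj)

lemma space_group_comp:
  assumes "bij F" "bij s" shows "space_group T (s \<circ> F) = conj_by s ` space_group T F"
  using assms by (simp add: space_group_conj bij_comp image_image conj_by_conj_by)

text \<open>Conjugation is a homomorphism, so it commutes with generation and only the generators
  have to be compared.\<close>

lemma space_group_generate:
  assumes F: "bij F" and S: "\<And>h. h \<in> S \<Longrightarrow> bij h"
    and T: "coordinate_group T = generate (transf {f. bij f}) S"
  shows "space_group T F = generate bij_group (conj_by F ` S)"
proof -
  have "group_hom (transf {f. bij f}) bij_group (conj_by F)"
    unfolding group_hom_def group_hom_axioms_def hom_def
    using bij_group_group[where 'a = coords] bij_group_group conj_by_comp[OF F] conj_by_bij[OF F]
    by (auto simp: bij_group_def)
  then have "generate bij_group (conj_by F ` S) = conj_by F ` generate (transf {f. bij f}) S"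
    by (rule group_hom.generate_img) (use S in auto)
  then show ?thesis by (simp add: space_group_conj[OF F] T)
qed

lemma entry_orbit_comp:
  assumes "bij F" "bij s"
  shows "entry_orbit1 e (s \<circ> F) = s ` entry_orbit1 e F" "entry_orbit2 e (s \<circ> F) = s ` entry_orbit2 e F"
  using assms by (auto simp: entry_orbit1_def entry_orbit2_def entry_group_def orbit_transf space_group_comp image_image conj_by_apply)

text \<open>Site groups, pointwise stabilisers and the conjugating element are all transported by
  conjugation with \<open>s\<close>.\<close>

lemma wyckoff_comp:
  assumes F: "bij F" and s: "bij s"
    and bij: "\<And>g. g \<in> space_group T F \<Longrightarrow> bij g"
    and x: "x \<in> wyckoff_position T F l"
  shows "s x \<in> wyckoff_position T (s \<circ> F) l"
proof -
  let ?L = "F ` the (map_of wyckoff_representatives (T, l))"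
  let ?G = "space_group T F"
  obtain g where g: "g \<in> ?G" "{h \<in> ?G. h x = x} = conj_by g ` {h \<in> ?G. \<forall>y\<in>?L. h y = y}"
    using x by (auto simp: wyckoff_position_def Let_def stabilizer_def conj_by_def)
  have st: "{h \<in> conj_by s ` ?G. h (s z) = s z} = conj_by s ` {h \<in> ?G. h z = z}" for z
    using s by (auto simp: conj_by_apply bij_is_inj inj_eq)
  have sl: "{h \<in> conj_by s ` ?G. \<forall>y\<in>s ` ?L. h y = y} = conj_by s ` {h \<in> ?G. \<forall>y\<in>?L. h y = y}"
    using s by (auto simp: conj_by_apply bij_is_inj inj_eq)
  have cc: "conj_by s (conj_by g h) = conj_by (conj_by s g) (conj_by s h)" for h
  proof -
    have "inv_into UNIV (conj_by s g) = conj_by s (inv_into UNIV g)"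
      using s bij[OF g(1)] by (intro inv_equality) (auto simp: conj_by_def bij_is_inj bij_is_surj surj_f_inv_f)
    then show ?thesis unfolding conj_by_def[of g] conj_by_def[of "conj_by s g"] using s by (simp add: conj_by_comp)
  qed
  have "{h \<in> conj_by s ` ?G. h (s x) = s x} = conj_by s ` conj_by g ` {h \<in> ?G. \<forall>y\<in>?L. h y = y}"
    by (simp only: st g(2))
  also have "\<dots> = conj_by (conj_by s g) ` conj_by s ` {h \<in> ?G. \<forall>y\<in>?L. h y = y}"
    by (simp only: image_image cc)
  also have "\<dots> = conj_by (conj_by s g) ` {h \<in> conj_by s ` ?G. \<forall>y\<in>s ` ?L. h y = y}"
    by (simp only: sl)
  finally have e: "{h \<in> conj_by s ` ?G. h (s x) = s x} = conj_by (conj_by s g) ` {h \<in> conj_by s ` ?G. \<forall>y\<in>s ` ?L. h y = y}" .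
  have cb: "conj_by (conj_by s g) = (\<lambda>h. conj_by s g \<circ> h \<circ> inv_into UNIV (conj_by s g))"
    by (rule ext) (rule conj_by_def)
  show ?thesis
    unfolding wyckoff_position_def Let_def mem_Collect_eq stabilizer_def transf_simps space_group_comp[OF F s] image_comp[symmetric]
    by (rule bexI[of _ "conj_by s g"], rule e[unfolded cb], rule imageI, rule g(1))
qed

lemma multiplicity_comp:
  assumes "bij s" shows "multiplicity_in_cell (s \<circ> F) (s ` X) = multiplicity_in_cell F X"
proof -
  have "s ` X \<inter> (s \<circ> F) ` C = s ` (X \<inter> F ` C)" for C :: "coords set"
    by (simp only: image_comp[symmetric] image_Int[OF bij_is_inj[OF assms]])
  then show ?thesis
    using assms by (simp add: multiplicity_in_cell_def card_image inj_on_subset[OF bij_is_inj])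
qed

text \<open>The form of the frame map depends only on the Gram matrix of the basis up to an isometry.\<close>

lemma frame_dist:
  "(dist (frame p a b c (x, y, z)) (frame p a b c (x', y', z')))\<^sup>2 =
   (x - x')\<^sup>2 * (norm a)\<^sup>2 + (y - y')\<^sup>2 * (norm b)\<^sup>2 + (z - z')\<^sup>2 * (norm c)\<^sup>2 +
   2 * (x - x') * (y - y') * (a \<bullet> b) + 2 * (x - x') * (z - z') * (a \<bullet> c) + 2 * (y - y') * (z - z') * (b \<bullet> c)"
proof -
  have "frame p a b c (x, y, z) - frame p a b c (x', y', z') = (x - x') *\<^sub>R a + (y - y') *\<^sub>R b + (z - z') *\<^sub>R c"
    by (simp add: frame_def algebra_simps)
  then have "(dist (frame p a b c (x, y, z)) (frame p a b c (x', y', z')))\<^sup>2 =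
    ((x - x') *\<^sub>R a + (y - y') *\<^sub>R b + (z - z') *\<^sub>R c) \<bullet> ((x - x') *\<^sub>R a + (y - y') *\<^sub>R b + (z - z') *\<^sub>R c)"
    by (simp add: dist_norm power2_norm_eq_inner)
  also have "\<dots> = (x - x')\<^sup>2 * (a \<bullet> a) + (y - y')\<^sup>2 * (b \<bullet> b) + (z - z')\<^sup>2 * (c \<bullet> c) +
   2 * (x - x') * (y - y') * (a \<bullet> b) + 2 * (x - x') * (z - z') * (a \<bullet> c) + 2 * (y - y') * (z - z') * (b \<bullet> c)"
    by (simp add: inner_add_left inner_add_right inner_commute[of b a] inner_commute[of c a] inner_commute[of c b] power2_eq_square algebra_simps)
  finally show ?thesis by (simp add: power2_norm_eq_inner)
qed

lemma frame_bij:
  assumes "right_handed a b c" shows "bij (frame p a b c)"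
proof -
  define A :: "real ^ 3 ^ 3" where "A = transpose (vector [a, b, c])"
  have "det A \<noteq> 0" using assms by (simp add: A_def right_handed_def det_transpose)
  then have inv: "invertible A" by (simp add: invertible_det_nz)
  have f: "frame p a b c = (\<lambda>v. p + v) \<circ> (\<lambda>v. A *v v) \<circ> (\<lambda>(x, y, z). vector [x, y, z])"
    by (auto simp: fun_eq_iff frame_def A_def vec_eq_iff matrix_vector_mult_def transpose_def sum_3 algebra_simps)
  have "bij (\<lambda>v. A *v v)"
    using inv by (metis bij_def invertible_eq_bij)
  moreover have "bij (\<lambda>v. p + v)" by (rule bij_plus)
  moreover have "bij (\<lambda>(x, y, z). vector [x, y, z] :: real ^ 3)"
    by (rule o_bij[of "\<lambda>v. (v $ 1, v $ 2, v $ 3)"]) (auto simp: fun_eq_iff vec_eq_iff forall_3)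
  ultimately show ?thesis unfolding f by (intro bij_comp)
qed

text \<open>The Gram matrices of the two bases are proportional with factor 4, so matching the
  frames is a similarity of ratio 2. It therefore suffices to study one frame per entry; the factor
  is the ratio between the spacing in the list and the unit spacing of the models.\<close>

lemma conventional_frames:
  assumes F: "conventional_basis T (4 * qa, 4 * qb, 4 * qc) a b c" and F0: "conventional_basis T (qa, qb, qc) a0 b0 c0"
  obtains s where "bij s" "\<And>v w. dist (s v) (s w) = 2 * dist v w" "frame p a b c = s \<circ> frame p0 a0 b0 c0"
proof -
  let ?F = "frame p a b c" and ?G = "frame p0 a0 b0 c0"
  define s where "s = ?F \<circ> inv_into UNIV ?G"
  have b0: "bij ?G" and b: "bij ?F" using F F0 by (auto simp: conventional_basis_def frame_bij)
  have 1: "bij s" unfolding s_def using b b0 by (intro bij_comp bij_imp_bij_inv)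
  have 3: "?F = s \<circ> ?G" using b0 by (auto simp: s_def fun_eq_iff bij_is_inj)
  have n: "(norm a)\<^sup>2 = 4 * (norm a0)\<^sup>2" "(norm b)\<^sup>2 = 4 * (norm b0)\<^sup>2" "(norm c)\<^sup>2 = 4 * (norm c0)\<^sup>2"
    using F F0 by (auto simp: conventional_basis_def)
  then have n': "norm a = 2 * norm a0" "norm b = 2 * norm b0"
    using power2_eq_iff_nonneg[of "norm a" "2 * norm a0"] power2_eq_iff_nonneg[of "norm b" "2 * norm b0"]
    by (auto simp: power_mult_distrib)
  have d: "a \<bullet> b = 4 * (a0 \<bullet> b0)" "a \<bullet> c = 4 * (a0 \<bullet> c0)" "b \<bullet> c = 4 * (b0 \<bullet> c0)"
    using F F0 by (auto simp: conventional_basis_def n')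
  have "dist (?F u) (?F v) = 2 * dist (?G u) (?G v)" for u v
  proof (rule power2_eq_imp_eq)
    obtain x y z x' y' z' where uv: "u = (x, y, z)" "v = (x', y', z')" by (metis prod_cases3)
    show "(dist (?F u) (?F v))\<^sup>2 = (2 * dist (?G u) (?G v))\<^sup>2"
    proof -
      have "(2 * dist (?G u) (?G v))\<^sup>2 = 4 * (dist (?G u) (?G v))\<^sup>2" by (simp add: power_mult_distrib)
      then show ?thesis unfolding uv frame_dist n d by algebra
    qed
  qed auto
  then have 2: "dist (s v) (s w) = 2 * dist v w" for v w
    using b0 by (metis (no_types, lifting) bij_is_surj comp_apply s_def surj_f_inv_f)
  show ?thesis using that[of s] 1 2 3 by blast
qed

definition real_pt :: "pt \<Rightarrow> coords" where
  "real_pt p = (case p of Tri x y z \<Rightarrow> (of_int x, of_int y, of_int z))"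

fun vec_at :: "pt list \<Rightarrow> nat \<Rightarrow> pt" where
  "vec_at ts i = (if i < length ts then ts ! i else 0)"

definition model_frame :: "model \<Rightarrow> coords \<Rightarrow> real ^ 3" where
  "model_frame M = frame ((1/2) *\<^sub>R emb (half_origin M)) (emb (shifts M ! 0)) (emb (shifts M ! 1)) (emb (shifts M ! 2))"

definition entry_gens :: "space_group_type \<Rightarrow> (coords \<Rightarrow> coords) set" where
  "entry_gens T = {\<lambda>(x,y,z). (x + 1, y, z), \<lambda>(x,y,z). (x, y + 1, z), \<lambda>(x,y,z). (x, y, z + 1)} \<union> generators T"

text \<open>The squared lengths are divided by 4 since the model has half the scale of the list.
  \<open>gens\<close> and \<open>gens'\<close> identify the generating sets of the space group and
  of the model; \<open>w1\<close> and \<open>w2\<close> place \<open>y1\<close> and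
  \<open>y2\<close> on the tabulated Wyckoff sets, whose differences are spanned by the directions
  that were tested for the site groups.\<close>

locale entry_model = checked_model +
  fixes e :: entry and A B C :: "real ^ 3" and p0 :: "real ^ 3" and F0 :: "coords \<Rightarrow> real ^ 3"
  assumes F0: "F0 = frame p0 A B C"
    and basis: "conventional_basis (sg e) (fst (sq_lengths e) / 4, fst (snd (sq_lengths e)) / 4, snd (snd (sq_lengths e)) / 4) A B C"
    and gens: "\<And>h. h \<in> entry_gens (sg e) \<Longrightarrow> \<exists>g\<in>set ag. \<forall>u. F0 (h u) = rmov g (F0 u)"
    and gens': "\<And>g. g \<in> set ag \<Longrightarrow> \<exists>h\<in>entry_gens (sg e). \<forall>u. F0 (h u) = rmov g (F0 u)"
    and pt1: "F0 (point1 e) = 0" and pt2: "F0 (point2 e) = emb q"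
    and it: "it = idx_t e" and ik: "ik = idx_k e"
    and w1: "emb y1 \<in> F0 ` the (map_of wyckoff_representatives (sg e, snd (wyck1 e)))"
      "\<And>u v. u \<in> the (map_of wyckoff_representatives (sg e, snd (wyck1 e))) \<Longrightarrow>
         v \<in> the (map_of wyckoff_representatives (sg e, snd (wyck1 e))) \<Longrightarrow> u - v \<in> span (real_pt ` set d1)"
    and w2: "emb y2 \<in> F0 ` the (map_of wyckoff_representatives (sg e, snd (wyck2 e)))"
      "\<And>u v. u \<in> the (map_of wyckoff_representatives (sg e, snd (wyck2 e))) \<Longrightarrow>
         v \<in> the (map_of wyckoff_representatives (sg e, snd (wyck2 e))) \<Longrightarrow> u - v \<in> span (real_pt ` set d2)"
    and ts3: "length ts \<ge> 3" "A = emb (ts ! 0)" "B = emb (ts ! 1)" "C = emb (ts ! 2)"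
begin

lemma bij_F0: "bij F0"
  using basis unfolding F0 conventional_basis_def by (intro frame_bij) simp

lemma gen_maps: "h \<in> entry_gens (sg e) \<Longrightarrow> \<exists>g\<in>set ag. h = inv_into UNIV F0 \<circ> rmov g \<circ> F0"
proof -
  assume "h \<in> entry_gens (sg e)"
  then obtain g where g: "g \<in> set ag" "\<And>u. F0 (h u) = rmov g (F0 u)" using gens by blast
  have "h u = inv_into UNIV F0 (rmov g (F0 u))" for u unfolding g(2)[symmetric] by (simp add: bij_F0 bij_is_inj)
  then show ?thesis using g(1) by (intro bexI[of _ g]) (auto simp: fun_eq_iff)
qed

text \<open>Conjugation by the frame turns the tabulated generators into those of the model, and by
  \<open>symm_eq_gen\<close> the latter generate the full symmetry group.\<close>

lemma group_eq: "space_group (sg e) F0 = rmov ` symm c"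
proof -
  have bij: "bij h" if "h \<in> entry_gens (sg e)" for h
    using gen_maps[OF that] bij_F0 by (auto intro!: bij_comp bij_imp_bij_inv rmov_bij)
  have "space_group (sg e) F0 = generate bij_group (conj_by F0 ` entry_gens (sg e))"
    by (rule space_group_generate[OF bij_F0 bij]) (simp_all add: coordinate_group_def entry_gens_def)
  also have "conj_by F0 ` entry_gens (sg e) = rmov ` set ag"
  proof -
    have *: "conj_by F0 h = rmov g" if "\<forall>u. F0 (h u) = rmov g (F0 u)" for h g
    proof
      fix v
      have "F0 (h (inv_into UNIV F0 v)) = rmov g (F0 (inv_into UNIV F0 v))" by (rule spec[OF that])
      then show "conj_by F0 h v = rmov g v"
        using bij_F0 by (simp add: conj_by_def bij_is_surj surj_f_inv_f del: rmov.simps)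
    qed
    show ?thesis
    proof (intro equalityI subsetI)
      fix f assume "f \<in> conj_by F0 ` entry_gens (sg e)"
      then obtain h where h: "h \<in> entry_gens (sg e)" "f = conj_by F0 h" by blast
      then show "f \<in> rmov ` set ag" using gens[OF h(1)] * by blast
    next
      fix f assume "f \<in> rmov ` set ag"
      then obtain g where g: "g \<in> set ag" "f = rmov g" by blast
      then show "f \<in> conj_by F0 ` entry_gens (sg e)" using gens'[OF g(1)] * by (metis imageI)
    qed
  qed
  also have "generate bij_group (rmov ` set ag) = rmov ` gen_set ag"
  proof (intro equalityI subsetI)
    fix f assume f: "f \<in> generate bij_group (rmov ` set ag)"
    moreover have "generate bij_group (rmov ` set ag) \<subseteq> rmov ` symm c"
      by (rule group.generate_subgroup_incl[OF bij_group_group _ symm_subgroup]) (use symm_gens in auto)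
    ultimately obtain g where "f = rmov g" by blast
    then show "f \<in> rmov ` gen_set ag" using f by (auto simp: gen_set_def)
  qed (auto simp: gen_set_def)
  finally show ?thesis by (simp add: symm_eq_gen)
qed

lemma orbits0: "entry_orbit1 e F0 = emb ` {p. \<not> c p}" "entry_orbit2 e F0 = emb ` {p. c p}"
proof -
  have orb: "(\<lambda>f. f (emb b)) ` rmov ` symm c = emb ` {p. c p = c b}" for b
  proof -
    have "(\<lambda>g. mov g b) ` symm c = {p. c p = c b}"
    proof (intro equalityI subsetI)
      fix p assume "p \<in> {p. c p = c b}"
      then obtain g where "g \<in> gen_set ag" "mov g b = p" using gen_transitive[of b p] by auto
      then show "p \<in> (\<lambda>g. mov g b) ` symm c" using Gsymm by blast
    qed (auto simp: symm_def)
    then have "emb ` (\<lambda>g. mov g b) ` symm c = emb ` {p. c p = c b}" by simp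
    then show ?thesis by (simp add: image_image rmov_emb)
  qed
  show "entry_orbit1 e F0 = emb ` {p. \<not> c p}"
    unfolding entry_orbit1_def entry_group_def orbit_transf group_eq pt1 emb_0[symmetric] orb using c0 by simp
  show "entry_orbit2 e F0 = emb ` {p. c p}"
    unfolding entry_orbit2_def entry_group_def orbit_transf group_eq pt2 orb using cq by simp
qed

text \<open>Every site symmetry of a point \<open>y\<close> on the tabulated set fixes the
  directions of the set, hence the whole set. So the site group of \<open>y\<close> equals the
  pointwise stabiliser of the set, and conjugation by the symmetry \<open>g\<close> moves the
  statement from \<open>y\<close> to the listed point.\<close>

lemma site_positions:
  "F0 (point1 e) \<in> wyckoff_position (sg e) F0 (snd (wyck1 e))"
  "F0 (point2 e) \<in> wyckoff_position (sg e) F0 (snd (wyck2 e))"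
proof -
  have key: "emb x \<in> wyckoff_position (sg e) F0 l"
    if L: "W = the (map_of wyckoff_representatives (sg e, l))" and y: "emb y \<in> F0 ` W"
      and dir: "\<And>u v. u \<in> W \<Longrightarrow> v \<in> W \<Longrightarrow> u - v \<in> span (real_pt ` set ds)"
      and g: "g \<in> symm c" "mov g y = x"
      and st: "\<forall>L\<in>stab c y. \<forall>D\<in>set ds. act L (direction ts D) = direction ts D" for x l W y ds g
  proof -
    have fixed: "h v = v" if h: "h \<in> rmov ` symm c" "h (emb y) = emb y" and v: "v \<in> F0 ` W" for h v
    proof -
      obtain k where k: "k \<in> symm c" "h = rmov k" using h by blast
      obtain N t where Nt: "k = Motion N t" by (cases k)
      have "mov k y = y" using h(2) unfolding k rmov_emb by simp
      then have t: "t = y - act N y" by (simp add: Nt algebra_simps)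
      have N: "N \<in> stab c y" using k stab_symm[of N c y] by (simp add: Nt t)
      obtain u0 u where u: "emb y = F0 u0" "u0 \<in> W" "v = F0 u" "u \<in> W" using y v by blast
      define Q where "Q w = V (act N (U w))" for w
      have sc: "act N (map_tri (times x) p) = map_tri (times x) (act N p)" for x :: real and p
      proof (cases N)
        case (SP \<pi> s t r)
        then show ?thesis by (cases \<pi>; cases p; simp add: signed_def)
      qed
      have lin: "linear Q"
      proof (rule linearI)
        show "Q (v + w) = Q v + Q w" for v w by (simp add: Q_def U_add act_add V_add)
        have "U (x *\<^sub>R v) = map_tri (times x) (U v)" "V (map_tri (times x) p) = x *\<^sub>R V p" for x v p
          by (simp add: U_def) (cases p; simp add: vec_eq_iff forall_3)
        then show "Q (x *\<^sub>R v) = x *\<^sub>R Q v" for x v by (simp add: Q_def sc)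
      qed
      \<comment> \<open>The linear part of the frame, which converts differences of fractional
        coordinates into vectors.\<close>
      define P where "P d = (case d of (x, y, z) \<Rightarrow> x *\<^sub>R A + y *\<^sub>R B + z *\<^sub>R C)" for d :: coords
      have Plin: "linear P"
        by (rule linearI) (auto simp: P_def algebra_simps split: prod.splits)
      have Pd: "P (real_pt D) = emb (direction ts D)" for D
      proof (cases D)
        case (Tri i j k)
        obtain a b c' ts' where ts: "ts = a # b # c' # ts'" using ts3(1) by (cases ts; cases "tl ts"; cases "tl (tl ts)") auto
        have es: "emb (scale i v) = of_int i *\<^sub>R emb v" for i v
          by (cases v) (simp add: emb_def vec_eq_iff forall_3)
        have "emb (comb (i # ks) (v # vs)) = of_int i *\<^sub>R emb v + emb (comb ks vs)" for i ks v vs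
          by (simp add: emb_add es)
        then show ?thesis by (simp add: P_def real_pt_def Tri direction_def ts ts3 emb_0 del: comb.simps(1))
      qed
      have gen: "(Q \<circ> P) x = P x" if x: "x \<in> real_pt ` set ds" for x
      proof -
        obtain D where D: "D \<in> set ds" "x = real_pt D" using x by blast
        have "Q (emb (direction ts D)) = emb (act N (direction ts D))" by (simp add: Q_def emb_act)
        then show ?thesis using st N D by (simp add: Pd)
      qed
      \<comment> \<open>Consequently the linear part of a site symmetry fixes all differences within
        \<open>W\<close>; as \<open>emb y\<close> is fixed too, so is each point of the set.\<close>
      have "(Q \<circ> P) d = P d" if d: "d \<in> span (real_pt ` set ds)" for d
        by (rule linear_eq_on[OF linear_compose[OF Plin lin] Plin d gen])
      then have "Q (P d) = P d" if "d \<in> span (real_pt ` set ds)" for d using that by simp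
      moreover have "v - emb y = P (u - u0)"
        by (cases u; cases u0) (simp add: u(1,3) F0 frame_def P_def algebra_simps)
      ultimately have "Q (v - emb y) = v - emb y" using dir[OF u(4) u(2)] by simp
      moreover have "h v = Q v + emb t" by (simp add: k(2) Nt Q_def)
      moreover have "emb y = Q (emb y) + emb t" using h(2) by (simp add: k(2) Nt Q_def)
      ultimately have "Q v - Q (emb y) = v - emb y" "h v = Q v + emb t" "emb t = emb y - Q (emb y)"
        by (simp_all add: linear_diff[OF lin] algebra_simps)
      then show ?thesis by (simp add: algebra_simps)
    qed
    have eq: "{h \<in> rmov ` symm c. h (emb x) = emb x} = (\<lambda>h. rmov g \<circ> h \<circ> inv_into UNIV (rmov g)) ` {h \<in> rmov ` symm c. \<forall>v\<in>F0 ` W. h v = v}"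
    proof (intro equalityI subsetI)
      obtain k where k: "k \<in> symm c" "\<And>p. mov k (mov g p) = p" "\<And>p. mov g (mov k p) = p" using sym_inverse[OF g(1)] by metis
      have ki: "rmov k = inv_into UNIV (rmov g)" using k(2) by (rule rmov_inverse)
      {
        fix h assume h: "h \<in> {h \<in> rmov ` symm c. h (emb x) = emb x}"
        define h' where "h' = rmov k \<circ> h \<circ> rmov g"
        have "h' \<in> rmov ` symm c"
          unfolding h'_def using h k(1) g(1) subgroup.m_closed[OF symm_subgroup] by (metis (no_types, lifting) bij_group_simps(2) imageI mem_Collect_eq)
        moreover have "h' (emb y) = emb y"
        proof -
          have "rmov g (emb y) = emb x" "rmov k (emb x) = emb y" using g(2) k(2)[of y] by (simp_all add: rmov_emb)
          then show ?thesis using h by (simp add: h'_def del: rmov.simps)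
        qed
        ultimately have "h' \<in> {h \<in> rmov ` symm c. \<forall>v\<in>F0 ` W. h v = v}" using fixed by blast
        moreover have "h = rmov g \<circ> h' \<circ> inv_into UNIV (rmov g)"
          using rmov_bij[of g] by (auto simp: h'_def ki fun_eq_iff bij_is_surj surj_f_inv_f simp del: rmov.simps)
        ultimately show "h \<in> (\<lambda>h. rmov g \<circ> h \<circ> inv_into UNIV (rmov g)) ` {h \<in> rmov ` symm c. \<forall>v\<in>F0 ` W. h v = v}" by blast
      }
      fix h assume "h \<in> (\<lambda>h. rmov g \<circ> h \<circ> inv_into UNIV (rmov g)) ` {h \<in> rmov ` symm c. \<forall>v\<in>F0 ` W. h v = v}"
      then obtain h' where h': "h' \<in> rmov ` symm c" "\<forall>v\<in>F0 ` W. h' v = v" "h = rmov g \<circ> h' \<circ> rmov k" unfolding ki by blast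
      have "h \<in> rmov ` symm c"
        unfolding h'(3) using h'(1) k(1) g(1) subgroup.m_closed[OF symm_subgroup] by (metis (no_types, lifting) bij_group_simps(2) imageI)
      moreover have "rmov g (emb y) = emb x" "rmov k (emb x) = emb y" using g(2) k(2)[of y] by (simp_all add: rmov_emb)
      moreover have "h' (emb y) = emb y" by (rule bspec[OF h'(2) y])
      ultimately show "h \<in> {h \<in> rmov ` symm c. h (emb x) = emb x}" by (simp add: h'(3) del: rmov.simps)
    qed
    show ?thesis
      unfolding wyckoff_position_def Let_def mem_Collect_eq stabilizer_def transf_simps group_eq L[symmetric]
      by (rule bexI[of _ "rmov g"], rule eq, rule imageI, rule g(1))
  qed
  show "F0 (point1 e) \<in> wyckoff_position (sg e) F0 (snd (wyck1 e))"
    unfolding pt1 emb_0[symmetric] by (rule key[OF refl w1 g1 site(1)])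
  show "F0 (point2 e) \<in> wyckoff_position (sg e) F0 (snd (wyck2 e))"
    unfolding pt2 by (rule key[OF refl w2 g2 site(2)])
qed

end

lemma lattice_dist_ge_1: "v \<in> range emb \<Longrightarrow> w \<in> range emb \<Longrightarrow> v \<noteq> w \<Longrightarrow> dist v w \<ge> 1"
proof -
  assume "v \<in> range emb" "w \<in> range emb" and ne: "v \<noteq> w"
  then obtain p q where pq: "v = emb p" "w = emb q" by blast
  obtain x y z where d: "p - q = Tri x y z" by (cases "p - q")
  have "p - q \<noteq> 0" using ne pq by auto
  then have "(x, y, z) \<noteq> (0, 0, 0)" using d by (auto simp: zero_tri_def)
  then have "x\<^sup>2 + y\<^sup>2 + z\<^sup>2 > 0"
    by (metis add_nonneg_eq_0_iff add_nonneg_nonneg order_le_less power_eq_0_iff zero_le_power2 zero_neq_numeral)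
  then have "real_of_int (x\<^sup>2 + y\<^sup>2 + z\<^sup>2) \<ge> 1" by linarith
  moreover have "dist v w = sqrt (real_of_int (x\<^sup>2 + y\<^sup>2 + z\<^sup>2))"
    unfolding pq dist_norm emb_diff[symmetric] d by (simp add: emb_def norm_V)
  ultimately show ?thesis by simp
qed

text \<open>The smallest distance in the lattice is 1. The image of a unit step forces the ratio to
  be at least 1, and the preimage of a unit step forces it to be at most 1.\<close>

lemma similarity_lattice:
  fixes g :: "real ^ 3 \<Rightarrow> real ^ 3"
  assumes r: "r > 0" "\<And>x y. dist (g x) (g y) = r * dist x y" and im: "g ` range emb = range emb"
  shows "g \<in> aut_lattice"
proof -
  have d1: "dist (emb 0) (emb (Tri 1 0 0)) = 1"
    unfolding dist_norm emb_diff[symmetric] by (simp add: emb_def norm_V zero_tri_def)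
  have "r \<ge> 1"
  proof -
    have "g (emb 0) \<noteq> g (emb (Tri 1 0 0))" using r(2)[of "emb 0" "emb (Tri 1 0 0)"] r(1) d1 by auto
    then have "dist (g (emb 0)) (g (emb (Tri 1 0 0))) \<ge> 1" using im by (intro lattice_dist_ge_1) auto
    then show ?thesis using r(2) d1 by simp
  qed
  moreover have "r \<le> 1"
  proof -
    have "emb 0 \<in> g ` range emb" "emb (Tri 1 0 0) \<in> g ` range emb" unfolding im by blast+
    then obtain v w where vw: "v \<in> range emb" "w \<in> range emb" "emb 0 = g v" "emb (Tri 1 0 0) = g w"
      by blast
    then have "v \<noteq> w" using d1 by auto
    then have "dist v w \<ge> 1" using vw lattice_dist_ge_1 by blast
    moreover have "r * dist v w = 1" using r(2)[of v w] vw d1 by simp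
    ultimately show ?thesis using r(1) by (metis mult_left_mono mult.right_neutral order_less_imp_le)
  qed
  ultimately have "r = 1" by simp
  then show ?thesis using r(2) im by (simp add: aut_lattice_def isometry_def range_emb)
qed

lemma image_partition: "(\<lambda>X. rmov g ` X) ` bipart c = bipart (\<lambda>p. c (mov k p))"
  if k: "\<And>p. mov k (mov g p) = p" "\<And>p. mov g (mov k p) = p"
proof -
  have "mov g ` {p. c p} = {p. c (mov k p)}" for c unfolding mov_image_Collect using k by simp
  from this[of c] this[of "\<lambda>p. \<not> c p"] show ?thesis by (simp add: bipart_def rmov_image)
qed

lemma aut_partition_image:
  assumes g: "g \<in> aut_lattice"
  shows "aut_partition ((\<lambda>X. g ` X) ` P) = conj_by g ` aut_partition P"
proof (intro equalityI subsetI)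
  have b: "bij g" using g by (rule aut_lattice_bij)
  have gi: "inv_into UNIV g \<in> aut_lattice" using g by (rule aut_lattice_inv)
  {
    fix f assume f: "f \<in> aut_partition ((\<lambda>X. g ` X) ` P)"
    define h where "h = inv_into UNIV g \<circ> f \<circ> g"
    have "h \<in> aut_lattice" unfolding h_def using f g gi by (intro aut_lattice_comp) (auto simp: aut_partition_def)
    moreover have "h ` X = X" if "X \<in> P" for X
    proof -
      have "f ` g ` X = g ` X" using f that by (simp add: aut_partition_def)
      moreover have "h ` X = inv_into UNIV g ` f ` g ` X" by (simp add: h_def image_image)
      ultimately have "h ` X = inv_into UNIV g ` g ` X" by simp
      then show ?thesis using b by (simp add: bij_is_inj image_inv_f_f)
    qed
    ultimately have "h \<in> aut_partition P" by (simp add: aut_partition_def)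
    moreover have "f = conj_by g h"
      using b by (auto simp: h_def conj_by_def fun_eq_iff bij_is_surj surj_f_inv_f)
    ultimately show "f \<in> conj_by g ` aut_partition P" by blast
  }
  fix f assume "f \<in> conj_by g ` aut_partition P"
  then obtain h where h: "h \<in> aut_partition P" "f = conj_by g h" by blast
  have "f \<in> aut_lattice" unfolding h(2) conj_by_def using h g gi by (intro aut_lattice_comp) (auto simp: aut_partition_def)
  moreover have "f ` g ` X = g ` X" if "X \<in> P" for X
  proof -
    have "f ` g ` X = g ` h ` X" using b by (auto simp: h(2) conj_by_def image_image bij_is_inj)
    then show ?thesis using h that by (simp add: aut_partition_def)
  qed
  ultimately show "f \<in> aut_partition ((\<lambda>X. g ` X) ` P)" by (simp add: aut_partition_def)
qed

text \<open>Composing with a fixed motion permutes the pulled-back colourings; for translates it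
  merely replaces \<open>t\<close> by its image under the linear part.\<close>

lemma index_relabel:
  assumes m: "periodic m c"
  shows "card (range (\<lambda>g. (\<lambda>p. c (mov k p)) \<circ> mov g)) = card (range (\<lambda>g. c \<circ> mov g))"
    and "card (range (\<lambda>t. (\<lambda>p. c (mov k p)) \<circ> mov (shift t))) = card (range (\<lambda>t. c \<circ> mov (shift t)))"
    and "periodic m (\<lambda>p. c (mov k p))"
proof -
  obtain k' where k': "\<And>p. mov k' (mov k p) = p" "\<And>p. mov k (mov k' p) = p" using mov_inverse[of k] by blast
  have "range (\<lambda>g. (\<lambda>p. c (mov k p)) \<circ> mov g) = range (\<lambda>g. c \<circ> mov g)"
  proof (intro equalityI subsetI)
    fix f assume "f \<in> range (\<lambda>g. (\<lambda>p. c (mov k p)) \<circ> mov g)"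
    then obtain g where f: "f = (\<lambda>p. c (mov k p)) \<circ> mov g" by blast
    obtain l where "mov l = mov k \<circ> mov g" using mov_comp by blast
    then have "f = c \<circ> mov l" unfolding f by (simp add: fun_eq_iff)
    then show "f \<in> range (\<lambda>g. c \<circ> mov g)" by blast
  next
    fix f assume "f \<in> range (\<lambda>g. c \<circ> mov g)"
    then obtain g where f: "f = c \<circ> mov g" by blast
    obtain l where "mov l = mov k' \<circ> mov g" using mov_comp by blast
    then have "f = (\<lambda>p. c (mov k p)) \<circ> mov l" unfolding f by (simp add: fun_eq_iff k')
    then show "f \<in> range (\<lambda>g. (\<lambda>p. c (mov k p)) \<circ> mov g)" by blast
  qed
  then show "card (range (\<lambda>g. (\<lambda>p. c (mov k p)) \<circ> mov g)) = card (range (\<lambda>g. c \<circ> mov g))" by simp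
  obtain L t0 where Lt: "k = Motion L t0" by (cases k)
  have kt: "mov k (p + t) = mov k p + act L t" for p t by (simp add: Lt act_add add_ac)
  have "range (\<lambda>t. (\<lambda>p. c (mov k p)) \<circ> mov (shift t)) = (\<lambda>f. f \<circ> mov k) ` range (\<lambda>t. c \<circ> mov (shift t))"
  proof -
    have 1: "(\<lambda>p. c (mov k p)) \<circ> mov (shift t) = (c \<circ> mov (shift (act L t))) \<circ> mov k" for t
      unfolding fun_eq_iff o_apply mov_translation kt by simp
    have 2: "range (act L) = (UNIV :: pt set)" using act_surj[of L] by (metis surjI surj_def)
    have "range (\<lambda>t. (\<lambda>p. c (mov k p)) \<circ> mov (shift t)) = (\<lambda>s. (c \<circ> mov (shift s)) \<circ> mov k) ` range (act L)"
      unfolding 1 image_image ..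
    then show ?thesis unfolding 2 image_image .
  qed
  moreover have "inj_on (\<lambda>f. f \<circ> mov k) A" for A :: "colouring set"
  proof (rule inj_onI)
    fix f g :: colouring assume "f \<circ> mov k = g \<circ> mov k"
    then have "f (mov k (mov k' p)) = g (mov k (mov k' p))" for p by (metis o_apply)
    then show "f = g" by (simp add: k' fun_eq_iff)
  qed
  ultimately show "card (range (\<lambda>t. (\<lambda>p. c (mov k p)) \<circ> mov (shift t))) = card (range (\<lambda>t. c \<circ> mov (shift t)))"
    by (simp add: card_image)
  have "c (mov k (Tri (x + int m * i) (y + int m * j) (z + int m * l))) = c (mov k (Tri x y z))" for x y z i j l
  proof -
    have "Tri (x + int m * i) (y + int m * j) (z + int m * l) = Tri x y z + sc m (Tri i j l)" by simp
    then show ?thesis unfolding kt act_sc by (simp only: kt act_sc periodic_sc[OF m])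
  qed
  then show "periodic m (\<lambda>p. c (mov k p))" using m by (simp add: periodic_def)
qed

text \<open>Dividing the count of all motions by the count of translations leaves order of the point
  group times \<open>ik\<close> equal to 48.\<close>

lemma order_point_from_indices:
  assumes m: "periodic m c" and t: "card (range (\<lambda>t. c \<circ> mov (shift t))) = it"
    and a: "card (range (\<lambda>g. c \<circ> mov g)) = it * ik"
  shows "card (linear_part ` symm c) * ik = 48"
proof -
  have m3: "m ^ 3 > 0" using m by (simp add: periodic_def)
  have NT: "it * card (translations_mod m c) = m ^ 3" using translation_index_mult[OF m] t by simp
  have K: "it * ik * card (motions_mod m \<inter> symm c) = 48 * m ^ 3" using index_mult[OF m] a by simp
  have "(card (linear_part ` symm c) * ik) * (it * card (translations_mod m c)) = 48 * m ^ 3"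
    using point_order_mult[OF m] K by (metis (no_types, lifting) mult.assoc mult.commute)
  then show ?thesis using NT m3 by simp
qed

lemma partition_equivI: "g \<in> aut_lattice \<Longrightarrow> (P, (\<lambda>X. g ` X) ` P) \<in> partition_equiv"
  unfolding partition_equiv_def by blast

lemma partition_equiv_trans: "(P, Q) \<in> partition_equiv \<Longrightarrow> (Q, R) \<in> partition_equiv \<Longrightarrow> (P, R) \<in> partition_equiv"
proof -
  assume "(P, Q) \<in> partition_equiv" "(Q, R) \<in> partition_equiv"
  then obtain g h where g: "g \<in> aut_lattice" "(\<lambda>X. g ` X) ` P = Q" and h: "h \<in> aut_lattice" "(\<lambda>X. h ` X) ` Q = R"
    by (auto simp: partition_equiv_def)
  have "(\<lambda>X. (h \<circ> g) ` X) ` P = R" unfolding g(2)[symmetric] h(2)[symmetric] by (simp add: image_image)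
  then show ?thesis using aut_lattice_comp[OF h(1) g(1)] by (unfold partition_equiv_def mem_Collect_eq prod.case, blast)
qed

lemma partition_equiv_sym: "(P, Q) \<in> partition_equiv \<Longrightarrow> (Q, P) \<in> partition_equiv"
proof -
  assume "(P, Q) \<in> partition_equiv"
  then obtain g where g: "g \<in> aut_lattice" "(\<lambda>X. g ` X) ` P = Q" by (auto simp: partition_equiv_def)
  have "(\<lambda>X. inv_into UNIV g ` X) ` Q = P"
    unfolding g(2)[symmetric] using bij_is_inj[OF aut_lattice_bij[OF g(1)]] by (simp add: image_image)
  then show ?thesis using aut_lattice_inv[OF g(1)] by (auto simp: partition_equiv_def)
qed

lemma partition_equiv_refl: "(P, P) \<in> partition_equiv"
  unfolding partition_equiv_def using aut_lattice_id by (auto intro!: bexI[of _ id])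

text \<open>In all fourteen settings the origin is a centre of symmetry. This is what allows a
  left-handed frame to be replaced by a right-handed one.\<close>

lemma neg_coords_in_group: "(\<lambda>(x, y, z). (- x, - y, - z)) \<in> coordinate_group T"
  unfolding coordinate_group_def by (rule generate.incl) (cases T; simp)

lemma coordinate_group_subgroup:
  assumes "\<And>h. h \<in> entry_gens T \<Longrightarrow> bij h"
  shows "subgroup (coordinate_group T) bij_group"
  unfolding coordinate_group_def bij_group_def entry_gens_def[symmetric]
  using assms bij_group_group by (intro group.generate_is_subgroup) (auto simp: bij_group_def)

lemma conj_self:
  assumes G: "subgroup G bij_group" and n: "n \<in> G"
  shows "conj_by n ` G = G"
proof -
  have b: "bij g" if "g \<in> G" for g using subgroup.mem_carrier[OF G that] by simp
  have i: "inv_into UNIV g \<in> G" if "g \<in> G" for g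
    using subgroup.m_inv_closed[OF G that] bij_group_inv[OF b[OF that]] by simp
  have m: "g \<circ> h \<in> G" if "g \<in> G" "h \<in> G" for g h using subgroup.m_closed[OF G that] by simp
  show ?thesis
  proof (intro equalityI subsetI)
    fix f assume "f \<in> conj_by n ` G"
    then show "f \<in> G" unfolding conj_by_def using m i n by auto
  next
    fix f assume f: "f \<in> G"
    have "inv_into UNIV n \<circ> f \<circ> n \<in> G" using m i n f by simp
    moreover have "conj_by n (inv_into UNIV n \<circ> f \<circ> n) = f"
      using b[OF n] by (auto simp: conj_by_def fun_eq_iff bij_is_surj surj_f_inv_f)
    ultimately show "f \<in> conj_by n ` G" by (metis imageI)
  qed
qed

lemma det_image:
  fixes a b c :: "real ^ 3"
  assumes Q: "orthogonal_transformation Q" and abc: "det (vector [a, b, c] :: real ^ 3 ^ 3) \<noteq> 0"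
  shows "det (vector [Q a, Q b, Q c] :: real ^ 3 ^ 3) \<noteq> 0"
proof -
  have Qv: "Q v = matrix Q *v v" for v using Q by (simp add: orthogonal_transformation_linear)
  have "vector [M *v a, M *v b, M *v c] = (vector [a, b, c] :: real ^ 3 ^ 3) ** transpose M" for M
    by (simp add: vec_eq_iff forall_3 matrix_matrix_mult_def matrix_vector_mult_def transpose_def sum_3 mult.commute)
  then have "(vector [Q a, Q b, Q c] :: real ^ 3 ^ 3) = vector [a, b, c] ** transpose (matrix Q)"
    using Qv[of a] Qv[of b] Qv[of c] by metis
  moreover have "det (matrix Q) \<noteq> 0"
    using Q orthogonal_transformation_matrix[of Q] det_orthogonal_matrix[of "matrix Q"] by auto
  ultimately show ?thesis using abc by (simp add: det_mul det_transpose)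
qed

section \<open>The partitions represented by an entry\<close>

context entry_model
begin

lemma gens_bij: "h \<in> entry_gens (sg e) \<Longrightarrow> bij h"
  using gen_maps bij_F0 by (auto intro!: bij_comp bij_imp_bij_inv rmov_bij)

lemma frames:
  assumes "entry_frame e F"
  obtains s where "bij s" "\<And>v w. dist (s v) (s w) = 2 * dist v w" "F = s \<circ> F0"
proof -
  obtain p a b c' where F: "conventional_basis (sg e) (sq_lengths e) a b c'" "F = frame p a b c'"
    using assms by (auto simp: entry_frame_def)
  obtain x y z where sq: "sq_lengths e = (x, y, z)" by (metis prod_cases3)
  have "conventional_basis (sg e) (4 * (x / 4), 4 * (y / 4), 4 * (z / 4)) a b c'" using F(1) sq by simp
  moreover have "conventional_basis (sg e) (x / 4, y / 4, z / 4) A B C" using basis sq by simp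
  ultimately show ?thesis using conventional_frames[of "sg e" "x / 4" "y / 4" "z / 4" a b c' A B C p p0] that
    unfolding F(2) F0 by blast
qed

definition "double = (\<lambda>v :: real ^ 3. 2 *\<^sub>R v)"

lemma double_bij: "bij double"
  by (rule o_bij[of "\<lambda>v. (1/2) *\<^sub>R v"]) (auto simp: double_def fun_eq_iff)

text \<open>The model frame enlarged to the scale of the list shows that frames of the entry
  exist.\<close>

lemma double_frame: "entry_frame e (double \<circ> F0)"
proof -
  have sc: "det (vector [2 *\<^sub>R A, 2 *\<^sub>R B, 2 *\<^sub>R C] :: real ^ 3 ^ 3) = 8 * det (vector [A, B, C] :: real ^ 3 ^ 3)"
    by (simp add: det_3)
  have "conventional_basis (sg e) (sq_lengths e) (2 *\<^sub>R A) (2 *\<^sub>R B) (2 *\<^sub>R C)"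
    using basis unfolding conventional_basis_def right_handed_def sc
    by (cases "sq_lengths e") (auto simp: power_mult_distrib)
  moreover have "double \<circ> F0 = frame (2 *\<^sub>R p0) (2 *\<^sub>R A) (2 *\<^sub>R B) (2 *\<^sub>R C)"
    by (auto simp: double_def F0 frame_def fun_eq_iff algebra_simps)
  ultimately show ?thesis unfolding entry_frame_def by blast
qed

lemma union_orbits: "{p. \<not> c p} \<union> {p. c p} = UNIV"
  by auto

text \<open>All frames arise from the model frame by a similarity \<open>s0\<close>, and
  \<open>s \<circ> s0\<close> is a similarity that maps the lattice onto itself, hence one of its
  automorphisms.\<close>

lemma similarity_motion:
  assumes F: "bij s0" "\<And>v w. dist (s0 v) (s0 w) = 2 * dist v w" "F = s0 \<circ> F0" and s: "entry_similarity e F s"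
  shows "s \<circ> s0 \<in> aut_lattice" "entry_partition e F s = (\<lambda>X. (s \<circ> s0) ` X) ` bipart c" "bij s"
proof -
  have orb: "entry_orbit1 e F = s0 ` emb ` {p. \<not> c p}" "entry_orbit2 e F = s0 ` emb ` {p. c p}"
    unfolding F(3) entry_orbit_comp[OF bij_F0 F(1)] orbits0 by simp_all
  obtain r where r: "r > 0" "\<And>x y. dist (s x) (s y) = r * dist x y" and im: "s ` (entry_orbit1 e F \<union> entry_orbit2 e F) = range emb"
    using s by (auto simp: entry_similarity_def similarity_def range_emb)
  have "s ` s0 ` range emb = range emb"
    using im unfolding orb image_Un[symmetric] union_orbits .
  then have "(s \<circ> s0) ` range emb = range emb" by (simp add: image_comp)
  then show 1: "s \<circ> s0 \<in> aut_lattice"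
    by (rule similarity_lattice[of "r * 2", rotated -1]) (use r F(2) in auto)
  show "entry_partition e F s = (\<lambda>X. (s \<circ> s0) ` X) ` bipart c"
    by (simp add: entry_partition_def orb bipart_def image_comp)
  have "(s \<circ> s0) \<circ> inv_into UNIV s0 = s" using F(1) by (auto simp: fun_eq_iff bij_is_surj surj_f_inv_f)
  moreover have "bij ((s \<circ> s0) \<circ> inv_into UNIV s0)" using bij_comp[OF bij_imp_bij_inv[OF F(1)] aut_lattice_bij[OF 1]] .
  ultimately show "bij s" by (simp only:)
qed

text \<open>Different frames and similarities change the result only by a lattice automorphism;
  conversely each automorphism occurs already with the doubled model frame.\<close>

lemma represented: "represented_partitions e = partition_equiv `` {bipart c}"
proof (intro equalityI subsetI)
  fix P assume "P \<in> represented_partitions e"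
  then obtain F s where Fs: "P = entry_partition e F s" "entry_frame e F" "entry_similarity e F s"
    by (auto simp: represented_partitions_def)
  obtain s0 where s0: "bij s0" "\<And>v w. dist (s0 v) (s0 w) = 2 * dist v w" "F = s0 \<circ> F0" using frames[OF Fs(2)] by blast
  show "P \<in> partition_equiv `` {bipart c}"
    unfolding Fs(1) similarity_motion(2)[OF s0 Fs(3)] Image_singleton_iff
    by (rule partition_equivI[OF similarity_motion(1)[OF s0 Fs(3)]])
next
  fix P assume "P \<in> partition_equiv `` {bipart c}"
  then obtain g where g: "g \<in> aut_lattice" "P = (\<lambda>X. g ` X) ` bipart c" by (auto simp: partition_equiv_def)
  \<comment> \<open>Halving undoes the enlargement of the frame before \<open>g\<close> is
    applied.\<close>
  define s where "s = g \<circ> (\<lambda>v. (1/2) *\<^sub>R v)"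
  have orb: "entry_orbit1 e (double \<circ> F0) = double ` emb ` {p. \<not> c p}" "entry_orbit2 e (double \<circ> F0) = double ` emb ` {p. c p}"
    unfolding entry_orbit_comp[OF bij_F0 double_bij] orbits0 by simp_all
  have sd: "s ` double ` X = g ` X" for X by (auto simp: s_def double_def image_image)
  have "similarity s" unfolding similarity_def
    using g(1) by (intro exI[of _ "1/2"]) (auto simp: s_def aut_lattice_def isometry_def dist_norm simp flip: scaleR_diff_right)
  moreover have "s ` (entry_orbit1 e (double \<circ> F0) \<union> entry_orbit2 e (double \<circ> F0)) = integer_lattice"
    unfolding orb image_Un sd unfolding image_Un[symmetric] union_orbits using g(1) by (simp add: aut_lattice_def range_emb)
  ultimately have "entry_similarity e (double \<circ> F0) s" by (simp add: entry_similarity_def)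
  moreover have "P = entry_partition e (double \<circ> F0) s"
    unfolding g(2) entry_partition_def orb sd bipart_def by simp
  ultimately show "P \<in> represented_partitions e" using double_frame unfolding represented_partitions_def by blast
qed

lemma entry_facts:
  assumes F: "entry_frame e F"
  shows "\<exists>f :: real ^ 3 \<Rightarrow> real ^ 3. isometry f \<and> f ` (entry_orbit1 e F \<union> entry_orbit2 e F) = (\<lambda>x. 2 *\<^sub>R x) ` integer_lattice"
    and "F (point1 e) \<in> wyckoff_position (sg e) F (snd (wyck1 e))"
    and "multiplicity_in_cell F (entry_orbit1 e F) = multiplicity_in_cell F0 (emb ` {p. \<not> c p})"
    and "F (point2 e) \<in> wyckoff_position (sg e) F (snd (wyck2 e))"
    and "multiplicity_in_cell F (entry_orbit2 e F) = multiplicity_in_cell F0 (emb ` {p. c p})"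
    and "entry_similarity e F s \<Longrightarrow> aut_partition (entry_partition e F s) = (\<lambda>g. s \<circ> g \<circ> inv_into UNIV s) ` entry_group e F"
proof -
  obtain s0 where s0: "bij s0" "\<And>v w. dist (s0 v) (s0 w) = 2 * dist v w" "F = s0 \<circ> F0" using frames[OF F] by blast
  have orb: "entry_orbit1 e F = s0 ` emb ` {p. \<not> c p}" "entry_orbit2 e F = s0 ` emb ` {p. c p}"
    unfolding s0(3) entry_orbit_comp[OF bij_F0 s0(1)] orbits0 by simp_all
  have s0i: "dist (inv_into UNIV s0 v) (inv_into UNIV s0 w) = dist v w / 2" for v w
    using s0(2)[of "inv_into UNIV s0 v" "inv_into UNIV s0 w"] s0(1) by (simp add: bij_is_surj surj_f_inv_f)
  show "\<exists>f :: real ^ 3 \<Rightarrow> real ^ 3. isometry f \<and> f ` (entry_orbit1 e F \<union> entry_orbit2 e F) = (\<lambda>x. 2 *\<^sub>R x) ` integer_lattice"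
  proof (intro exI[of _ "double \<circ> inv_into UNIV s0"] conjI)
    show "isometry (double \<circ> inv_into UNIV s0)" 
    proof -
      have "dist (2 *\<^sub>R u) (2 *\<^sub>R v) = 2 * dist u v" for u v :: "real ^ 3"
        by (simp add: dist_norm flip: scaleR_diff_right)
      then show ?thesis by (simp add: isometry_def double_def s0i)
    qed
    have "(double \<circ> inv_into UNIV s0) ` s0 ` X = double ` X" for X
      unfolding image_comp[symmetric] using s0(1) by (simp add: image_inv_f_f bij_is_inj del: image_comp)
    then show "(double \<circ> inv_into UNIV s0) ` (entry_orbit1 e F \<union> entry_orbit2 e F) = (\<lambda>x. 2 *\<^sub>R x) ` integer_lattice"
      unfolding orb image_Un[symmetric] union_orbits by (simp add: double_def range_emb)
  qed
  have bg: "bij g" if "g \<in> space_group (sg e) F0" for g using that unfolding group_eq by (auto simp: rmov_bij)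
  show "F (point1 e) \<in> wyckoff_position (sg e) F (snd (wyck1 e))" "F (point2 e) \<in> wyckoff_position (sg e) F (snd (wyck2 e))"
    using wyckoff_comp[OF bij_F0 s0(1) bg site_positions(1)] wyckoff_comp[OF bij_F0 s0(1) bg site_positions(2)]
    unfolding s0(3) by simp_all
  show "multiplicity_in_cell F (entry_orbit1 e F) = multiplicity_in_cell F0 (emb ` {p. \<not> c p})"
    "multiplicity_in_cell F (entry_orbit2 e F) = multiplicity_in_cell F0 (emb ` {p. c p})"
    unfolding orb unfolding s0(3) by (rule multiplicity_comp[OF s0(1)])+
  assume s: "entry_similarity e F s"
  note sm = similarity_motion[OF s0 s]
  have "aut_partition (entry_partition e F s) = conj_by (s \<circ> s0) ` space_group (sg e) F0"
    unfolding sm(2) aut_partition_image[OF sm(1)] group_eq aut_partition_bipart ..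
  also have "\<dots> = conj_by s ` entry_group e F"
    unfolding entry_group_def s0(3) space_group_comp[OF bij_F0 s0(1)] image_image conj_by_conj_by[OF sm(3) s0(1)] ..
  finally show "aut_partition (entry_partition e F s) = (\<lambda>g. s \<circ> g \<circ> inv_into UNIV s) ` entry_group e F"
    by (simp add: conj_by_def[abs_def])
qed

lemma relabelled:
  assumes "P \<in> represented_partitions e"
  obtains k g where "P = bipart (\<lambda>p. c (mov k p))" "P = (\<lambda>X. rmov g ` X) ` bipart c"
proof -
  obtain g where g: "P = (\<lambda>X. rmov g ` X) ` bipart c"
    using assms unfolding represented by (auto simp: partition_equiv_def aut_lattice_eq)
  obtain k where "\<And>p. mov k (mov g p) = p" "\<And>p. mov g (mov k p) = p" using mov_inverse[of g] by blast
  then show ?thesis using that[of k g] g image_partition by metis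
qed

lemma indices:
  assumes "P \<in> represented_partitions e"
  shows "translation_index P = idx_t e" "point_index P = real (idx_k e)" "aut_index P = idx_t e * idx_k e"
proof -
  obtain k where P: "P = bipart (\<lambda>p. c (mov k p))" using relabelled[OF assms] by metis
  have t: "card (range (\<lambda>t. (\<lambda>p. c (mov k p)) \<circ> mov (shift t))) = it"
    and a: "card (range (\<lambda>g. (\<lambda>p. c (mov k p)) \<circ> mov g)) = it * ik"
    using index_relabel[OF per, of k] index_translation index_aut by simp_all
  show "translation_index P = idx_t e" unfolding P translation_index_bipart t it ..
  show "aut_index P = idx_t e * idx_k e" unfolding P aut_index_bipart a it ik ..
  have "card (linear_part ` symm (\<lambda>p. c (mov k p))) * ik = 48"
    by (rule order_point_from_indices[OF index_relabel(3)[OF per] t a])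
  then have "real (card (linear_part ` symm (\<lambda>p. c (mov k p)))) * real ik = 48" by (metis of_nat_mult of_nat_numeral)
  then show "point_index P = real (idx_k e)"
    unfolding P point_index_def point_order_bipart ik[symmetric] by (simp add: field_simps)
      (metis mult_zero_left zero_neq_numeral nonzero_eq_divide_eq mult.commute)
qed

text \<open>A motion \<open>g\<close> with negative determinant makes the transported basis
  left-handed. Precomposing the frame with the inversion negates the basis vectors and restores the
  orientation, and the space group stays the same because the inversion belongs to the coordinate
  group.\<close>

lemma group_type:
  assumes "P \<in> represented_partitions e"
  shows "has_space_group_type (aut_partition P) (sg e)"
proof -
  obtain g where P: "P = (\<lambda>X. rmov g ` X) ` bipart c" using relabelled[OF assms] by metis
  have bg: "bij (rmov g)" by (rule rmov_bij)
  have aut: "aut_partition P = space_group (sg e) (rmov g \<circ> F0)"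
    unfolding P aut_partition_image[OF rmov_aut] space_group_comp[OF bij_F0 bg] group_eq aut_partition_bipart ..
  obtain Q where Q: "orthogonal_transformation Q" "\<And>x. rmov g x = Q x + rmov g 0"
    using isometry_affine[OF rmov_isometry[of g]] by blast
  have lin: "linear Q" using Q(1) by (rule orthogonal_transformation_linear)
  have fr: "rmov g \<circ> F0 = frame (rmov g p0) (Q A) (Q B) (Q C)"
    by (auto simp: fun_eq_iff F0 frame_def Q(2)[of "_ + _"] Q(2)[of p0] linear_add[OF lin] linear_scale[OF lin] simp del: rmov.simps)
  have det: "det (vector [Q A, Q B, Q C] :: real ^ 3 ^ 3) \<noteq> 0"
  proof (rule det_image[OF Q(1)])
    show "det (vector [A, B, C] :: real ^ 3 ^ 3) \<noteq> 0" using basis by (simp add: conventional_basis_def right_handed_def)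
  qed
  show ?thesis
  proof (cases "right_handed (Q A) (Q B) (Q C)")
    case True
    show ?thesis unfolding has_space_group_type_def aut fr by (intro exI conjI) (rule True, rule refl)
  next
    case False
    let ?n = "\<lambda>(x, y, z). (- x, - y, - z) :: coords"
    have n: "bij ?n" by (rule o_bij[of ?n]) (auto simp: fun_eq_iff)
    have neg: "det (vector [- a, - b, - c'] :: real ^ 3 ^ 3) = - det (vector [a, b, c'] :: real ^ 3 ^ 3)" for a b c' :: "real ^ 3"
      by (simp add: det_3)
    have rh: "right_handed (- Q A) (- Q B) (- Q C)" using False det neg[of "Q A" "Q B" "Q C"] unfolding right_handed_def by linarith
    have fn: "frame (rmov g p0) (- Q A) (- Q B) (- Q C) = (rmov g \<circ> F0) \<circ> ?n"
      unfolding fr by (auto simp: fun_eq_iff frame_def)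
    have bF: "bij (rmov g \<circ> F0)" using bij_F0 bg by (rule bij_comp)
    have "space_group (sg e) ((rmov g \<circ> F0) \<circ> ?n) = conj_by (rmov g \<circ> F0) ` conj_by ?n ` coordinate_group (sg e)"
      using bF n by (simp add: space_group_conj bij_comp image_image conj_by_conj_by)
    also have "conj_by ?n ` coordinate_group (sg e) = coordinate_group (sg e)"
    proof (rule conj_self)
      show "subgroup (coordinate_group (sg e)) bij_group" using gens_bij by (rule coordinate_group_subgroup)
      show "?n \<in> coordinate_group (sg e)" by (rule neg_coords_in_group)
    qed
    also have "conj_by (rmov g \<circ> F0) ` coordinate_group (sg e) = aut_partition P"
      unfolding aut space_group_conj[OF bF] ..
    finally have "space_group (sg e) (frame (rmov g p0) (- Q A) (- Q B) (- Q C)) = aut_partition P"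
      unfolding fn .
    then show ?thesis unfolding has_space_group_type_def by (intro exI conjI) (rule rh, rule sym)
  qed
qed

lemma in_orbit_partitions: "bipart c \<in> orbit_partitions 2"
  using bipart_in_orbit_partitions[OF two_orbit] finite_orbit_periodic[OF per] by blast

end

section \<open>Direct superpositions\<close>

text \<open>The coset of \<open>a\<close> is the fibre of the pullback of \<open>A\<close>. With
  \<open>a\<close> the identity this also gives a criterion for membership in the group
  itself.\<close>

lemma rcos_pullback:
  fixes A :: "(real ^ 'n) set"
  assumes A: "A \<subseteq> integer_lattice" and a: "a \<in> aut_lattice"
  shows "aut_partition {A, integer_lattice - A} #>\<^bsub>transf aut_lattice\<^esub> a =
    {f \<in> aut_lattice. {x \<in> integer_lattice. f x \<in> A} = {x \<in> integer_lattice. a x \<in> A}}"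
proof -
  let ?H = "aut_partition {A, integer_lattice - A}"
  have H: "h \<in> ?H \<longleftrightarrow> h \<in> aut_lattice \<and> (\<forall>x\<in>integer_lattice. h x \<in> A \<longleftrightarrow> x \<in> A)" for h
  proof -
    have "h ` A = A \<and> h ` (integer_lattice - A) = integer_lattice - A \<longleftrightarrow> (\<forall>x\<in>integer_lattice. h x \<in> A \<longleftrightarrow> x \<in> A)"
      if h: "h \<in> aut_lattice"
    proof -
      have inj: "inj h" using aut_lattice_bij[OF h] by (rule bij_is_inj)
      have im: "h ` integer_lattice = integer_lattice" using h by (simp add: aut_lattice_def)
      have 1: "h ` (integer_lattice - A) = integer_lattice - h ` A" using image_set_diff[OF inj] im by metis
      have "h ` A = A \<longleftrightarrow> (\<forall>x\<in>integer_lattice. h x \<in> A \<longleftrightarrow> x \<in> A)"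
      proof
        assume hA: "h ` A = A"
        show "\<forall>x\<in>integer_lattice. h x \<in> A \<longleftrightarrow> x \<in> A"
        proof
          fix x
          show "h x \<in> A \<longleftrightarrow> x \<in> A" using inj_image_mem_iff[OF inj, of x A] unfolding hA .
        qed
      next
        assume *: "\<forall>x\<in>integer_lattice. h x \<in> A \<longleftrightarrow> x \<in> A"
        show "h ` A = A"
        proof (intro equalityI subsetI)
          fix y assume "y \<in> h ` A" then show "y \<in> A" using * A by auto
        next
          fix y assume y: "y \<in> A"
          then have "y \<in> h ` integer_lattice" using A im by auto
          then obtain x where "x \<in> integer_lattice" "y = h x" by blast
          then show "y \<in> h ` A" using y * by auto
        qed
      qed
      then show ?thesis using 1 by auto
    qed
    then show ?thesis by (auto simp: aut_partition_def)
  qed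
  have b: "bij a" using a by (rule aut_lattice_bij)
  have lat: "f x \<in> integer_lattice" if "f \<in> aut_lattice" "x \<in> integer_lattice" for f x
    using that by (auto simp: aut_lattice_def)
  show ?thesis
  proof (intro equalityI subsetI)
    fix f assume "f \<in> ?H #>\<^bsub>transf aut_lattice\<^esub> a"
    then obtain h where h: "h \<in> ?H" "f = h \<circ> a" by (auto simp: r_coset_def)
    then show "f \<in> {f \<in> aut_lattice. {x \<in> integer_lattice. f x \<in> A} = {x \<in> integer_lattice. a x \<in> A}}"
      using H[of h] a lat[OF a] aut_lattice_comp by auto
  next
    fix f assume f: "f \<in> {f \<in> aut_lattice. {x \<in> integer_lattice. f x \<in> A} = {x \<in> integer_lattice. a x \<in> A}}"
    define h where "h = f \<circ> inv_into UNIV a"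
    have fa: "f = h \<circ> a" using b by (auto simp: h_def fun_eq_iff bij_is_inj)
    have "h \<in> aut_lattice" unfolding h_def using f aut_lattice_inv[OF a] aut_lattice_comp by blast
    moreover have "h y \<in> A \<longleftrightarrow> y \<in> A" if y: "y \<in> integer_lattice" for y
    proof -
      have "y \<in> a ` integer_lattice" using a y by (simp add: aut_lattice_def)
      then obtain x where x: "x \<in> integer_lattice" "y = a x" by blast
      have "h y = f x" using x(2) fa by simp
      moreover have "f x \<in> A \<longleftrightarrow> a x \<in> A" using f x(1) by blast
      ultimately show ?thesis using x(2) by simp
    qed
    ultimately have "h \<in> ?H" using H by blast
    then show "f \<in> ?H #>\<^bsub>transf aut_lattice\<^esub> a" using fa by (auto simp: r_coset_def)
  qed
qed

lemma finite_index_pullbacks: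
  fixes A :: "(real ^ 'n) set"
  assumes A: "A \<subseteq> integer_lattice" and fin: "finite ((\<lambda>f. {x \<in> integer_lattice. f x \<in> A}) ` aut_lattice)"
  shows "finite (rcosets\<^bsub>transf aut_lattice\<^esub> (aut_partition {A, integer_lattice - A}))"
proof (rule finite_subset)
  show "rcosets\<^bsub>transf aut_lattice\<^esub> (aut_partition {A, integer_lattice - A}) \<subseteq>
    (\<lambda>X. {f \<in> aut_lattice. {x \<in> integer_lattice. f x \<in> A} = X}) ` (\<lambda>f. {x \<in> integer_lattice. f x \<in> A}) ` aut_lattice"
    unfolding rcosets_image transf_simps using rcos_pullback[OF A] by auto
qed (use fin in simp)

lemma bipartition_in_orbit_partitions:
  fixes A :: "(real ^ 'n) set"
  assumes A: "A \<subseteq> integer_lattice" "A \<noteq> {}" "integer_lattice - A \<noteq> {}"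
    and fin: "finite ((\<lambda>f. {x \<in> integer_lattice. f x \<in> A}) ` aut_lattice)"
    and trans: "\<And>x y. x \<in> integer_lattice \<Longrightarrow> y \<in> integer_lattice \<Longrightarrow> (x \<in> A \<longleftrightarrow> y \<in> A) \<Longrightarrow>
      \<exists>f\<in>aut_partition {A, integer_lattice - A}. f x = y"
  shows "{A, integer_lattice - A} \<in> orbit_partitions 2"
proof -
  let ?P = "{A, integer_lattice - A}"
  let ?H = "aut_partition ?P"
  have orb: "orbit (transf ?H) (\<lambda>f. f) x = (if x \<in> A then A else integer_lattice - A)" if x: "x \<in> integer_lattice" for x
  proof -
    have o: "orbit (transf ?H) (\<lambda>f. f) x = (\<lambda>f. f x) ` ?H" by (rule orbit_transf)
    have "f x \<in> A" if "x \<in> A" "f \<in> ?H" for f using that by (auto simp: aut_partition_def)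
    moreover have "f x \<in> integer_lattice - A" if "x \<notin> A" "f \<in> ?H" for f
    proof -
      have "f ` (integer_lattice - A) = integer_lattice - A" using that by (simp add: aut_partition_def)
      then show ?thesis using x that(1) by blast
    qed
    moreover have "y \<in> (\<lambda>f. f x) ` ?H" if "y \<in> integer_lattice" "x \<in> A \<longleftrightarrow> y \<in> A" for y
      using trans[OF x that] by blast
    ultimately show ?thesis unfolding o using A(1) by (auto simp del: insert_iff)
  qed
  have "orbits (transf ?H) integer_lattice (\<lambda>f. f) = ?P"
  proof -
    have "orbits (transf ?H) integer_lattice (\<lambda>f. f) = (\<lambda>x. if x \<in> A then A else integer_lattice - A) ` integer_lattice"
    proof -
      have "orbits (transf ?H) integer_lattice (\<lambda>f. f) = orbit (transf ?H) (\<lambda>f. f) ` integer_lattice"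
        by (auto simp: orbits_def)
      then show ?thesis by (rule HOL.trans) (rule image_cong[OF refl orb])
    qed
    also have "\<dots> = ?P" using A by auto
    finally show ?thesis .
  qed
  moreover have "partition_on integer_lattice ?P"
    using A by (auto simp: partition_on_def disjoint_def)
  moreover have "card ?P = 2"
  proof -
    have "A \<noteq> integer_lattice - A" using A(2) by blast
    then show ?thesis by simp
  qed
  ultimately show ?thesis unfolding orbit_partitions_def mem_Collect_eq
    using aut_partition_subgroup finite_index_pullbacks[OF A(1) fin] by metis
qed

lemma direct_superposition_trans:
  "(P, Q) \<in> partition_equiv \<Longrightarrow> direct_superposition P \<Longrightarrow> direct_superposition Q"
  unfolding direct_superposition_def using partition_equiv_trans by blast

text \<open>A cylinder is invariant under the third unit translation; the equivalence turns it into
  some unit translation. This is the condition by which the other entries are excluded.\<close>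

lemma direct_superposition_shift:
  assumes "direct_superposition (bipart c)"
  shows "\<exists>u\<in>set units. \<forall>p. c (p + u) = c p"
proof -
  obtain A B where AB: "({cylinder A, cylinder B}, bipart c) \<in> partition_equiv"
    using assms by (auto simp: direct_superposition_def)
  obtain g where g: "(\<lambda>X. rmov g ` X) ` {cylinder A, cylinder B} = bipart c"
    using AB by (auto simp: partition_equiv_def aut_lattice_eq simp del: rmov.simps)
  obtain L t where Lt: "g = Motion L t" by (cases g)
  let ?e = "Tri 0 0 1 :: pt"
  have cyl: "v + emb ?e \<in> cylinder X \<longleftrightarrow> v \<in> cylinder X" for v X
  proof -
    have "(v + emb ?e) $ 1 = v $ 1" "(v + emb ?e) $ 2 = v $ 2" "(v + emb ?e) $ 3 = v $ 3 + 1" by (simp_all add: emb_def)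
    then show ?thesis by (simp add: cylinder_def)
  qed
  have inj: "inj (rmov g)" using rmov_bij by (rule bij_is_inj)
  have sh: "rmov g v + emb (act L ?e) = rmov g (v + emb ?e)" for v
    by (simp add: Lt U_add act_add V_add emb_act add_ac)
  have *: "v + emb (act L ?e) \<in> Y \<longleftrightarrow> v \<in> Y" if Y: "Y \<in> bipart c" for v Y
  proof -
    obtain X where X: "Y = rmov g ` cylinder X" using Y g by blast
    obtain w where w: "v = rmov g w" using rmov_bij by (metis bij_pointE)
    show ?thesis unfolding X w sh inj_image_mem_iff[OF inj] by (rule cyl)
  qed
  have "c (p + act L ?e) = c p" for p
  proof -
    have "emb ` {p. c p} \<in> bipart c" by (simp add: bipart_def)
    from *[OF this, of "emb p"] show ?thesis by (simp add: image_iff flip: emb_add)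
  qed
  moreover have "act L ?e \<in> set units" by (rule act_units) (simp add: units_def)
  ultimately show ?thesis by blast
qed

fun third :: "'a tri \<Rightarrow> 'a" where
  "third (Tri x y z) = z"

text \<open>Motions that map the plane of vanishing third coordinate into itself and therefore
  induce motions of the plane lattice.\<close>

definition planar :: "motion \<Rightarrow> bool" where
  "planar g \<longleftrightarrow> (\<forall>x y. third (mov g (Tri x y 0)) = 0)"

lemma planar_cases:
  assumes "planar g"
  obtains s t r a b where "g = Motion (SP XYZ s t r) (Tri a b 0)" | s t r a b where "g = Motion (SP YXZ s t r) (Tri a b 0)"
proof -
  obtain \<pi> s t r a b c where g: "g = Motion (SP \<pi> s t r) (Tri a b c)"
    by (cases g; cases "linear_part g"; cases "mov g 0") (metis motion.exhaust sperm.exhaust tri.exhaust)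
  have *: "third (mov g (Tri x y 0)) = 0" for x y using assms by (simp add: planar_def)
  have c: "c = 0" using *[of 0 0] by (cases \<pi>; cases r) (auto simp: g signed_def)
  have "\<pi> = XYZ \<or> \<pi> = YXZ" using *[of 1 0] *[of 0 1] by (cases \<pi>) (auto simp: g c signed_def split: if_splits)
  then show thesis using that g c by blast
qed

lemma planar_inverse:
  assumes g: "planar g" and k: "\<And>p. mov k (mov g p) = p"
  shows "planar k"
proof -
  have "\<exists>x' y'. mov g (Tri x' y' 0) = Tri x y 0" for x y
    using g
  proof (cases rule: planar_cases)
    case (1 s t r a b)
    then show ?thesis by (intro exI[of _ "signed s (x - a)"] exI[of _ "signed t (y - b)"]) (simp add: signed_def)
  next
    case (2 s t r a b)
    then show ?thesis by (intro exI[of _ "signed t (y - b)"] exI[of _ "signed s (x - a)"]) (simp add: signed_def)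
  qed
  then show ?thesis unfolding planar_def using k by (metis third.simps)
qed

lemma planar_comp:
  assumes g: "planar g" and h: "planar h" and k: "mov k = mov g \<circ> mov h"
  shows "planar k"
proof -
  have "third (mov g (mov h (Tri x y 0))) = 0" for x y
  proof -
    have "third (mov h (Tri x y 0)) = 0" using h by (simp add: planar_def)
    then obtain x' y' where "mov h (Tri x y 0) = Tri x' y' 0" by (cases "mov h (Tri x y 0)") simp
    then show ?thesis using g by (simp add: planar_def)
  qed
  then show ?thesis using k by (simp add: planar_def)
qed

definition emb2 :: "int \<Rightarrow> int \<Rightarrow> real ^ 2" where
  "emb2 x y = vector [of_int x, of_int y]"

lemma emb2_nth [simp]: "emb2 x y $ 1 = of_int x" "emb2 x y $ 2 = of_int y"
  by (simp_all add: emb2_def)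

lemma emb2_eq [simp]: "emb2 x y = emb2 x' y' \<longleftrightarrow> x = x' \<and> y = y'"
  by (auto simp: vec_eq_iff forall_2)

lemma lattice2: "v \<in> integer_lattice \<longleftrightarrow> (\<exists>x y. v = emb2 x y)"
proof
  assume "v \<in> integer_lattice"
  then obtain x y where "v $ 1 = of_int x" "v $ 2 = of_int y" unfolding integer_lattice_def Ints_def by (auto simp: forall_2)
  then have "v = emb2 x y" by (simp add: vec_eq_iff forall_2)
  then show "\<exists>x y. v = emb2 x y" by blast
qed (auto simp: integer_lattice_def forall_2)

lemma planar_descends:
  assumes "planar g"
  obtains f where "f \<in> aut_lattice" "\<And>x y x' y'. mov g (Tri x y 0) = Tri x' y' 0 \<Longrightarrow> f (emb2 x y) = emb2 x' y'"
proof -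
  have aut: "f \<in> aut_lattice" if iso: "isometry f" and into: "\<And>x y. \<exists>x' y'. f (emb2 x y) = emb2 x' y'"
    and onto: "\<And>x y. \<exists>x' y'. f (emb2 x' y') = emb2 x y" for f :: "real ^ 2 \<Rightarrow> real ^ 2"
  proof -
    have "f ` integer_lattice = integer_lattice"
    proof (intro equalityI subsetI)
      fix v assume "v \<in> f ` integer_lattice" then show "v \<in> integer_lattice" using into lattice2 by (metis imageE)
    next
      fix v :: "real ^ 2" assume "v \<in> integer_lattice" then show "v \<in> f ` integer_lattice" using onto lattice2 by (metis imageI)
    qed
    then show ?thesis using iso by (simp add: aut_lattice_def)
  qed
  have nrm: "norm v = sqrt ((v $ 1)\<^sup>2 + (v $ 2)\<^sup>2)" for v :: "real ^ 2"
    by (simp add: norm_vec_def L2_set_def sum_2)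
  have sq: "(signed s x - signed s y)\<^sup>2 = (x - y)\<^sup>2" for s and x y :: real
    by (simp add: signed_def power2_commute)
  show thesis using assms
  proof (cases rule: planar_cases)
    case (1 s t r a b)
    define f :: "real ^ 2 \<Rightarrow> real ^ 2" where "f v = vector [signed s (v $ 1) + of_int a, signed t (v $ 2) + of_int b]" for v
    have f: "f (emb2 x y) = emb2 (signed s x + a) (signed t y + b)" for x y
      by (simp add: f_def vec_eq_iff forall_2 signed_def)
    have "isometry f" by (simp add: isometry_def dist_norm nrm f_def sq)
    moreover have "\<exists>x' y'. f (emb2 x' y') = emb2 x y" for x y
      unfolding f by (intro exI[of _ "signed s (x - a)"] exI[of _ "signed t (y - b)"]) (simp add: signed_def)
    ultimately have "f \<in> aut_lattice" using f by (intro aut) blast+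
    then show thesis using that f 1 by simp
  next
    case (2 s t r a b)
    define f :: "real ^ 2 \<Rightarrow> real ^ 2" where "f v = vector [signed s (v $ 2) + of_int a, signed t (v $ 1) + of_int b]" for v
    have f: "f (emb2 x y) = emb2 (signed s y + a) (signed t x + b)" for x y
      by (simp add: f_def vec_eq_iff forall_2 signed_def)
    have "isometry f" by (simp add: isometry_def dist_norm nrm f_def sq add.commute)
    moreover have "\<exists>x' y'. f (emb2 x' y') = emb2 x y" for x y
      unfolding f by (intro exI[of _ "signed t (y - b)"] exI[of _ "signed s (x - a)"]) (simp add: signed_def)
    ultimately have "f \<in> aut_lattice" using f by (intro aut) blast+
    then show thesis using that f 2 by simp
  qed
qed

text \<open>Invariance along the third axis alone only makes the classes cylinders. Their sections
  form an orbit partition of the plane because the symmetries provided by \<open>reach\<close>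
  preserve the plane and descend to it.\<close>

lemma direct_superpositionI:
  assumes per: "periodic m c" and pr: "proper c" and up: "\<And>x y z. c (Tri x y z) = c (Tri x y 0)"
    and reach: "\<And>x y x' y'. c (Tri x y 0) = c (Tri x' y' 0) \<Longrightarrow> \<exists>g\<in>symm c. planar g \<and> mov g (Tri x y 0) = Tri x' y' 0"
  shows "direct_superposition (bipart c)"
proof -
  define A where "A = {emb2 x y |x y. \<not> c (Tri x y 0)}"
  have memA: "emb2 x y \<in> A \<longleftrightarrow> \<not> c (Tri x y 0)" for x y by (auto simp: A_def)
  have AZ: "A \<subseteq> integer_lattice" by (auto simp: A_def lattice2)
  have "{A, integer_lattice - A} \<in> orbit_partitions 2"
  proof (rule bipartition_in_orbit_partitions[OF AZ])
    have ex: "\<exists>x y. c (Tri x y 0) = b" for b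
    proof -
      obtain p where p: "c p = b" using pr by (cases b) (auto simp: proper_def)
      obtain x y z where "p = Tri x y z" by (cases p)
      then show ?thesis using p up by blast
    qed
    show "A \<noteq> {}" using ex[of False] memA by blast
    show "integer_lattice - A \<noteq> {}" using ex[of True] memA lattice2 by blast
    have m: "m > 0" using per by (simp add: periodic_def)
    show "finite ((\<lambda>f. {x \<in> integer_lattice. f x \<in> A}) ` aut_lattice)"
    proof (rule finite_pullbacks[OF m])
      fix x v :: "real ^ 2" assume "x \<in> integer_lattice" "v \<in> integer_lattice"
      then obtain i j k l where xv: "x = emb2 i j" "v = emb2 k l" by (auto simp: lattice2)
      have "x + of_nat m *\<^sub>R v = emb2 (i + int m * k) (j + int m * l)" by (simp add: xv vec_eq_iff forall_2)
      moreover have "c (Tri (i + int m * k) (j + int m * l) 0) = c (Tri i j 0)"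
      proof -
        have "c (Tri (i + int m * k) (j + int m * l) (0 + int m * 0)) = c (Tri i j 0)"
          using per unfolding periodic_def by blast
        then show ?thesis by simp
      qed
      ultimately show "x + of_nat m *\<^sub>R v \<in> A \<longleftrightarrow> x \<in> A" using memA by (simp add: xv)
    qed
  next
    fix v w :: "real ^ 2"
    assume "v \<in> integer_lattice" "w \<in> integer_lattice" and same: "v \<in> A \<longleftrightarrow> w \<in> A"
    then obtain x y x' y' where vw: "v = emb2 x y" "w = emb2 x' y'" by (auto simp: lattice2)
    have "c (Tri x y 0) = c (Tri x' y' 0)" using same by (simp add: vw memA)
    then obtain g where g: "g \<in> symm c" "planar g" "mov g (Tri x y 0) = Tri x' y' 0" using reach by blast
    obtain f where f: "f \<in> aut_lattice" "\<And>x y x' y'. mov g (Tri x y 0) = Tri x' y' 0 \<Longrightarrow> f (emb2 x y) = emb2 x' y'"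
      using planar_descends[OF g(2)] by blast
    have pres: "f u \<in> A \<longleftrightarrow> u \<in> A" if uz: "u \<in> integer_lattice" for u
    proof -
      obtain i j where u: "u = emb2 i j" using uz by (auto simp: lattice2)
      have "third (mov g (Tri i j 0)) = 0" using g(2) by (simp add: planar_def)
      then obtain k l where kl: "mov g (Tri i j 0) = Tri k l 0" by (cases "mov g (Tri i j 0)") simp
      have "c (mov g (Tri i j 0)) = c (Tri i j 0)" using g(1) unfolding symm_def mem_Collect_eq by (rule spec)
      then have "c (Tri k l 0) = c (Tri i j 0)" unfolding kl .
      then show ?thesis using f(2)[OF kl] by (simp add: u memA)
    qed
    \<comment> \<open>The coset of the identity is the group itself, so preserving membership in
      \<open>A\<close> is enough.\<close>
    have "f \<in> aut_partition {A, integer_lattice - A} #>\<^bsub>transf aut_lattice\<^esub> id"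
      unfolding rcos_pullback[OF AZ aut_lattice_id] using f(1) pres by auto
    then have "f \<in> aut_partition {A, integer_lattice - A}" by (auto simp: r_coset_def)
    then show "\<exists>f\<in>aut_partition {A, integer_lattice - A}. f v = w" using f(2)[OF g(3)] vw by auto
  qed
  moreover have "{cylinder A, cylinder (integer_lattice - A)} = bipart c"
  proof -
    have lat3: "(\<exists>p. v = emb p) \<longleftrightarrow> vector [v $ 1, v $ 2] \<in> (integer_lattice :: (real ^ 2) set) \<and> v $ 3 \<in> \<int>" for v
    proof -
      have "(\<exists>p. v = emb p) \<longleftrightarrow> v \<in> integer_lattice" using range_emb by blast
      then show ?thesis by (simp add: integer_lattice_def forall_3 forall_2)
    qed
    have e: "vector [emb (Tri x y z) $ 1, emb (Tri x y z) $ 2] = emb2 x y" for x y z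
      by (simp add: emb_def vec_eq_iff forall_2)
    have "v \<in> cylinder A \<longleftrightarrow> v \<in> emb ` {p. \<not> c p}" "v \<in> cylinder (integer_lattice - A) \<longleftrightarrow> v \<in> emb ` {p. c p}" for v
    proof -
      have "(v \<in> cylinder A \<longleftrightarrow> v \<in> emb ` {p. \<not> c p}) \<and> (v \<in> cylinder (integer_lattice - A) \<longleftrightarrow> v \<in> emb ` {p. c p})"
      proof (cases "\<exists>p. v = emb p")
        case True
        then obtain x y z where v: "v = emb (Tri x y z)" by (metis tri.exhaust)
        have "emb (Tri x y z) $ 3 \<in> \<int>" by (simp add: emb_def)
        moreover have "emb2 x y \<in> integer_lattice" by (auto simp: lattice2)
        moreover have "emb (Tri x y z) \<in> emb ` {p. Q p} \<longleftrightarrow> Q (Tri x y z)" for Q by auto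
        ultimately show ?thesis unfolding v cylinder_def mem_Collect_eq e using memA[of x y] up[of x y z] by simp
      next
        case False
        then have "vector [v $ 1, v $ 2] \<notin> (integer_lattice :: (real ^ 2) set) \<or> v $ 3 \<notin> \<int>" using lat3 by blast
        then show ?thesis using False AZ unfolding cylinder_def by auto
      qed
      then show "v \<in> cylinder A \<longleftrightarrow> v \<in> emb ` {p. \<not> c p}" "v \<in> cylinder (integer_lattice - A) \<longleftrightarrow> v \<in> emb ` {p. c p}" by simp_all
    qed
    then have "cylinder A = emb ` {p. \<not> c p}" "cylinder (integer_lattice - A) = emb ` {p. c p}" by blast+
    then show ?thesis by (simp add: bipart_def)
  qed
  ultimately show ?thesis unfolding direct_superposition_def using partition_equiv_refl by metis
qed

section \<open>The evaluated test for direct superpositions\<close>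

definition plane_list :: "nat \<Rightarrow> pt list" where
  "plane_list m = grid (map int [0..<m]) (map int [0..<m]) [0]"

definition level :: "pt \<Rightarrow> pt" where
  "level p = (case p of Tri x y z \<Rightarrow> Tri x y 0)"

text \<open>The third coordinate keeps its sign; for a colouring that is constant along the third
  axis this sign does not influence the colours.\<close>

definition planar_sperms :: "sperm list" where
  "planar_sperms = [SP \<pi> s t False. \<pi> \<leftarrow> [XYZ, YXZ], s \<leftarrow> [False, True], t \<leftarrow> [False, True]]"

definition carries :: "nat \<Rightarrow> nat list list list \<Rightarrow> pt list \<Rightarrow> pt \<Rightarrow> pt \<Rightarrow> sperm \<Rightarrow> bool" where
  "carries m T bx b p L = list_all (moves_ok m T (Motion L (p - act L b))) bx"

definition reached :: "nat \<Rightarrow> nat list list list \<Rightarrow> pt list \<Rightarrow> pt list \<Rightarrow> pt \<Rightarrow> bool" where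
  "reached m T bx bs p = list_ex (\<lambda>b. list_ex (carries m T bx b p) planar_sperms) bs"

text \<open>The models of superpositions are placed so that the third axis is a direction of
  invariance. One plane then carries all information, and the base point \<open>q\<close> is
  projected to it by \<open>level\<close>.\<close>

definition check_superposition :: "model \<Rightarrow> bool" where
  "check_superposition M = (case M of Model m T ts h q gs rb a rt w y1 g1 d1 y2 g2 d2 \<Rightarrow>
     let bx = plane_list m in list_all (moves_ok m T (shift (Tri 0 0 1))) (box_list m) \<and>
     list_all (reached m T bx [0, level q]) bx)"

definition moved_by :: "nat \<Rightarrow> nat list list list \<Rightarrow> pt list \<Rightarrow> pt \<Rightarrow> bool" where
  "moved_by m T bx u = list_ex (shift_differs m T u) bx"

definition check_no_superposition :: "model \<Rightarrow> bool" where
  "check_no_superposition M = (case M of Model m T ts h q gs rb a rt w y1 g1 d1 y2 g2 d2 \<Rightarrow>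
     list_all (moved_by m T (box_list m)) units)"

context checked_model
begin

lemma no_superposition: "check_no_superposition M \<Longrightarrow> \<not> direct_superposition (bipart c)"
proof
  assume n: "check_no_superposition M" and d: "direct_superposition (bipart c)"
  obtain u where u: "u \<in> set units" "\<forall>p. c (p + u) = c p" using direct_superposition_shift[OF d] by blast
  have "moved_by m T (box_list m) u" using n u(1) by (simp add: M check_no_superposition_def list_all_iff)
  then show False using u(2) by (auto simp: moved_by_def list_ex_iff shift_differs_def)
qed

text \<open>The planar symmetries \<open>P\<close> are closed under composition and inversion. Each
  point of the plane is reached from \<open>0\<close> or \<open>level q\<close>, and the colours of
  these two decide which one.\<close>

lemma superposition:
  assumes s: "check_superposition M"
  shows "direct_superposition (bipart c)"
proof (rule direct_superpositionI[OF per two_orbit_proper[OF two_orbit]])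
  have sh: "list_all (moves_ok m T (shift (Tri 0 0 1))) (box_list m)"
    and re: "list_all (reached m T (plane_list m) [0, level q]) (plane_list m)"
    using s by (simp_all add: M check_superposition_def Let_def)
  have "shift (Tri 0 0 1) \<in> symm c" by (rule invariant_symm[OF m]) (use sh in \<open>simp add: invariant_def\<close>)
  then have one: "c (p + Tri 0 0 1) = c p" for p unfolding symm_def mem_Collect_eq mov_translation by blast
  show up: "c (Tri x y z) = c (Tri x y 0)" for x y z
  proof (induction z rule: int_induct[where k = 0])
    case (step1 i) then show ?case using one[of "Tri x y i"] by simp
  next
    case (step2 i) then show ?case using one[of "Tri x y (i - 1)"] by simp
  qed simp
  define P where "P = {g \<in> symm c. planar g}"
  have Pinv: "\<exists>k\<in>P. mov k y = x" if "g \<in> P" "mov g x = y" for g x y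
    using that sym_inverse[of g c] planar_inverse[of g] unfolding P_def by (metis (no_types, lifting) mem_Collect_eq)
  have Pcomp: "\<exists>k\<in>P. mov k x = z" if "g \<in> P" "mov g x = y" "h \<in> P" "mov h y = z" for g h x y z
  proof -
    obtain k where k: "mov k = mov h \<circ> mov g" using mov_comp by blast
    then have "k \<in> P" using that planar_comp[of h g k] by (auto simp: P_def symm_def simp del: mov.simps)
    moreover have "mov k x = z" unfolding k o_apply that(2) by (rule that(4))
    ultimately show ?thesis by blast
  qed
  have Pc: "c (mov g p) = c p" if "g \<in> P" for g p
    using that unfolding P_def symm_def mem_Collect_eq by blast
  have base: "\<exists>g\<in>P. \<exists>b\<in>{0, level q}. mov g b = Tri x y 0" for x y
  proof -
    let ?p = "Tri (x mod int m) (y mod int m) 0"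
    have pl: "set (plane_list m) = {Tri i j 0 |i j. i \<in> {0..<int m} \<and> j \<in> {0..<int m}}"
      by (auto simp: plane_list_def set_grid image_int_atLeastLessThan)
    have "?p \<in> set (plane_list m)" using m by (auto simp: pl)
    then have "reached m T (plane_list m) [0, level q] ?p" using re by (simp add: list_all_iff)
    then obtain b L where b: "b \<in> {0, level q}" and L: "L \<in> set planar_sperms" "carries m T (plane_list m) b ?p L"
      by (auto simp: reached_def list_ex_iff)
    define g where "g = Motion L (?p - act L b)"
    obtain b1 b2 where b12: "b = Tri b1 b2 0" using b by (cases q) (auto simp: level_def zero_tri_def)
    obtain t1 t2 where t: "?p - act L b = Tri t1 t2 0"
      using L(1) b12 by (auto simp: planar_sperms_def signed_def)
    have lin: "third (act L (Tri i j k)) = k \<and> level (act L (Tri i j k)) = act L (Tri i j 0)" for i j k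
      using L(1) by (auto simp: planar_sperms_def signed_def level_def)
    have pg: "planar g"
    proof -
      have "third (act L (Tri i j 0) + Tri t1 t2 0) = 0" for i j
        using lin[of i j 0] by (cases "act L (Tri i j 0)") simp
      then show ?thesis unfolding planar_def g_def t by simp
    qed
    have cl: "c p = c (level p)" for p
    proof (cases p)
      case (Tri i j k)
      show ?thesis unfolding Tri level_def tri.case by (rule up)
    qed
    have "c (mov g p) = c p" for p
    proof -
      obtain i j k where p: "p = Tri i j k" by (cases p)
      let ?r = "Tri (i mod int m) (j mod int m) 0"
      have "?r \<in> set (plane_list m)" using m by (auto simp: pl)
      then have r: "c (mov g ?r) = c ?r" using L(2) by (simp add: carries_def list_all_iff moves_ok_def g_def)
      have d: "Tri i j 0 = ?r + sc m (Tri (i div int m) (j div int m) 0)" by simp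
      have "mov g (Tri i j 0) = mov g ?r + sc m (act L (Tri (i div int m) (j div int m) 0))"
        unfolding d g_def mov.simps act_add act_sc by (simp only: add_ac)
      then have 1: "c (mov g (Tri i j 0)) = c ?r" using r periodic_sc[OF per] by simp
      have 2: "c (Tri i j 0) = c ?r" unfolding d by (rule periodic_sc[OF per])
      have "level (mov g p) = mov g (Tri i j 0)"
      proof -
        obtain i' j' where "act L (Tri i j k) = Tri i' j' k" "act L (Tri i j 0) = Tri i' j' 0"
          using lin[of i j k] by (cases "act L (Tri i j k)") (auto simp: level_def)
        then show ?thesis unfolding p g_def t by (simp add: level_def)
      qed
      then have "c (mov g p) = c (mov g (Tri i j 0))" using cl by metis
      then have "c (mov g p) = c ?r" using 1 by (rule trans)
      moreover have "c p = c ?r" unfolding p up[of i j k] by (rule 2)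
      ultimately show ?thesis by (simp only:)
    qed
    then have gP: "g \<in> P" using pg by (simp add: P_def symm_def del: mov.simps)
    have gb: "mov g b = ?p" by (simp add: g_def)
    define h where "h = shift (sc m (Tri (x div int m) (y div int m) 0))"
    have "c (mov h p) = c p" for p unfolding h_def mov_translation by (rule periodic_sc[OF per])
    moreover have "planar h" unfolding planar_def h_def mov_translation by (simp add: sc_def)
    ultimately have hP: "h \<in> P" by (simp add: P_def symm_def del: mov.simps)
    have "mov h ?p = Tri x y 0" unfolding h_def mov_translation by simp
    then show ?thesis using Pcomp[OF gP gb hP] b by blast
  qed
  fix x y x' y' assume same: "c (Tri x y 0) = c (Tri x' y' 0)"
  obtain g b where g: "g \<in> P" "b \<in> {0, level q}" "mov g b = Tri x y 0" using base by blast
  obtain h b' where h: "h \<in> P" "b' \<in> {0, level q}" "mov h b' = Tri x' y' 0" using base by blast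
  have cb: "c b = c (Tri x y 0)" "c b' = c (Tri x' y' 0)" using Pc[OF g(1), of b] Pc[OF h(1), of b'] unfolding g(3) h(3) by simp_all
  \<comment> \<open>Projection along the third axis preserves the colour of \<open>q\<close>, so the
    two bases are differently coloured.\<close>
  have "c (level q)" using cq up by (cases q) (simp add: level_def, metis)
  then have "b = b'" using cb same g(2) h(2) c0 by auto
  moreover obtain k where "k \<in> P" "mov k (Tri x y 0) = b" using Pinv[OF g(1,3)] by blast
  ultimately obtain l where "l \<in> P" "mov l (Tri x y 0) = Tri x' y' 0" using Pcomp h(1,3) by metis
  then show "\<exists>g\<in>symm c. planar g \<and> mov g (Tri x y 0) = Tri x' y' 0" by (auto simp: P_def)
qed

end

section \<open>Invariants that separate the models\<close>

lemma distinct_units: "distinct units"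
  by (simp add: units_def)

lemma degree_card: "degree c p = card {u \<in> set units. c (p + u) \<noteq> c p}"
  unfolding degree_def using distinct_card[OF distinct_filter[OF distinct_units]] by (metis set_filter)

text \<open>The linear part permutes the six unit vectors, and exchanging the colours does not
  affect whether two of them differ.\<close>

lemma degree_equiv:
  assumes e: "\<And>p. c p = (c' (mov g p) \<noteq> s)"
  shows "degree c p = degree c' (mov g p)"
proof -
  obtain L t where g: "g = Motion L t" by (cases g)
  have "{u \<in> set units. c' (mov g p + u) \<noteq> c' (mov g p)} = act L ` {u \<in> set units. c (p + u) \<noteq> c p}"
  proof -
    have *: "c (p + u) \<noteq> c p \<longleftrightarrow> c' (mov g p + act L u) \<noteq> c' (mov g p)" for u
    proof -
      have "mov g (p + u) = mov g p + act L u" by (simp add: g act_add add_ac)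
      then show ?thesis unfolding e[of "p + u"] e[of p] by auto
    qed
    show ?thesis
    proof (intro equalityI subsetI)
      fix v assume v: "v \<in> {u \<in> set units. c' (mov g p + u) \<noteq> c' (mov g p)}"
      obtain K where K: "\<And>p. act L (act K p) = (p :: pt)" using act_inverse[of L] by blast
      have "act K v \<in> set units" using v by (simp add: act_units)
      moreover have "c (p + act K v) \<noteq> c p" unfolding * K using v by blast
      ultimately show "v \<in> act L ` {u \<in> set units. c (p + u) \<noteq> c p}" by (intro image_eqI[of _ _ "act K v"]) (simp_all add: K)
    next
      fix v assume "v \<in> act L ` {u \<in> set units. c (p + u) \<noteq> c p}"
      then obtain u where "u \<in> set units" "c (p + u) \<noteq> c p" "v = act L u" by blast
      then show "v \<in> {u \<in> set units. c' (mov g p + u) \<noteq> c' (mov g p)}" using *[of u] act_units by blast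
    qed
  qed
  moreover have "inj_on (act L) A" for A :: "pt set" by (rule inj_onI) (rule act_inj)
  ultimately show ?thesis unfolding degree_card by (simp only: card_image)
qed

lemma degree_range: "equiv_col c c' \<Longrightarrow> range (degree c) = range (degree c')"
proof -
  assume "equiv_col c c'"
  then obtain g s where e: "\<And>p. c p = (c' (mov g p) \<noteq> s)" unfolding equiv_col_def by blast
  have "range (degree c) = degree c' ` range (mov g)" 
  proof -
    have "degree c = degree c' \<circ> mov g" using degree_equiv[of c c' g s] e by (simp add: fun_eq_iff)
    then show ?thesis by (simp only: image_comp)
  qed
  also have "range (mov g) = UNIV" using mov_bij by (rule bij_is_surj)
  finally show ?thesis .
qed

text \<open>Exchanging the two colours is injective on colourings, so it preserves every count of
  translates or images.\<close>

lemma card_range_swap: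
  fixes d :: colouring
  shows "card (range (\<lambda>x. ((\<lambda>b. b \<noteq> s) \<circ> d) \<circ> mov (h x))) = card (range (\<lambda>x. d \<circ> mov (h x)))"
proof -
  have inj: "inj_on (\<lambda>f. (\<lambda>b. b \<noteq> s) \<circ> f) A" for A :: "colouring set"
    by (rule inj_onI) (auto simp: fun_eq_iff)
  have "range (\<lambda>x. ((\<lambda>b. b \<noteq> s) \<circ> d) \<circ> mov (h x)) = (\<lambda>f. (\<lambda>b. b \<noteq> s) \<circ> f) ` range (\<lambda>x. d \<circ> mov (h x))"
    unfolding image_image comp_assoc ..
  then show ?thesis by (simp only: card_image[OF inj])
qed

lemma index_equiv:
  assumes m: "periodic m c'" and e: "equiv_col c c'"
  shows "card (range (\<lambda>g. c \<circ> mov g)) = card (range (\<lambda>g. c' \<circ> mov g))"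
    and "card (range (\<lambda>t. c \<circ> mov (shift t))) = card (range (\<lambda>t. c' \<circ> mov (shift t)))"
proof -
  obtain k s where k: "\<And>p. c p = (c' (mov k p) \<noteq> s)" using e unfolding equiv_col_def by blast
  define d where "d p = c' (mov k p)" for p
  have c: "c = (\<lambda>b. b \<noteq> s) \<circ> d" using k by (auto simp: d_def fun_eq_iff)
  show "card (range (\<lambda>g. c \<circ> mov g)) = card (range (\<lambda>g. c' \<circ> mov g))"
    using card_range_swap[of s d "\<lambda>g. g"] index_relabel(1)[OF m, of k] unfolding c d_def by (simp only:)
  show "card (range (\<lambda>t. c \<circ> mov (shift t))) = card (range (\<lambda>t. c' \<circ> mov (shift t)))"
    using card_range_swap[of s d shift] index_relabel(2)[OF m, of k] unfolding c d_def by (simp only:)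
qed

section \<open>Points in the conventional cell\<close>

fun cross :: "pt \<Rightarrow> pt \<Rightarrow> pt" where
  "cross (Tri x y z) (Tri x' y' z') = Tri (y * z' - z * y') (z * x' - x * z') (x * y' - y * x')"

text \<open>Cramer's rule without division: pairing \<open>p + p - h\<close> with
  \<open>cross b c\<close> gives the first fractional coordinate times \<open>D\<close>, twice the
  determinant of the basis. Doubling clears the denominator of the origin.\<close>

definition in_cell :: "pt \<Rightarrow> pt \<Rightarrow> pt \<Rightarrow> pt \<Rightarrow> pt \<Rightarrow> bool" where
  "in_cell h a b c p = (let D = 2 * idot a (cross b c); v = p + p - h in
     list_all (\<lambda>r. 0 \<le> idot r v \<and> idot r v < D) [cross b c, cross c a, cross a b])"

text \<open>Each basis vector contributes between \<open>min 0 a\<close> and \<open>max 0 a\<close>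
  to a coordinate of a point in the cell; the summand 2 leaves room for rounding half the
  origin.\<close>

fun cell_range :: "int \<Rightarrow> int \<Rightarrow> int \<Rightarrow> int \<Rightarrow> int list" where
  "cell_range h a b c = map (\<lambda>i. int i + (h div 2 + min 0 a + min 0 b + min 0 c))
     [0..<nat (2 + \<bar>a\<bar> + \<bar>b\<bar> + \<bar>c\<bar>)]"

fun cell_list :: "pt \<Rightarrow> pt \<Rightarrow> pt \<Rightarrow> pt \<Rightarrow> pt list" where
  "cell_list (Tri h1 h2 h3) (Tri a1 a2 a3) (Tri b1 b2 b3) (Tri c1 c2 c3) =
     filter (in_cell (Tri h1 h2 h3) (Tri a1 a2 a3) (Tri b1 b2 b3) (Tri c1 c2 c3))
       (grid (cell_range h1 a1 b1 c1) (cell_range h2 a2 b2 c2) (cell_range h3 a3 b3 c3))"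

definition check_multiplicities :: "nat \<Rightarrow> nat \<Rightarrow> model \<Rightarrow> bool" where
  "check_multiplicities k1 k2 M = (case M of Model m T ts h q gs rb a rt w y1 g1 d1 y2 g2 d2 \<Rightarrow>
     case ts of u # v # w # _ \<Rightarrow> let ps = cell_list h u v w in
       length (filter (is_false m T) ps) = k1 \<and> length (filter (tcol m T) ps) = k2 | _ \<Rightarrow> False)"

lemma cell_range_bounds:
  fixes x y z :: real
  assumes p: "of_int p = of_int h / 2 + x * of_int a + y * of_int b + z * of_int c"
    and u: "0 \<le> x" "x < 1" "0 \<le> y" "y < 1" "0 \<le> z" "z < 1"
  shows "p \<in> set (cell_range h a b c)"
proof -
  have s: "of_int (min 0 d) \<le> t * of_int d \<and> t * of_int d \<le> of_int (max 0 d)" if "0 \<le> t" "t < 1" for t :: real and d :: int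
  proof (cases "0 \<le> d")
    case True
    then show ?thesis using that mult_right_mono[of t 1 "of_int d"] by (simp add: min_def max_def)
  next
    case False
    then have d: "of_int d \<le> (0 :: real)" by simp
    have "1 * of_int d \<le> t * of_int d" using that d by (intro mult_right_mono_neg) auto
    moreover have "t * of_int d \<le> 0" using that d by (simp add: mult_nonneg_nonpos)
    ultimately show ?thesis using False by (simp add: min_def max_def)
  qed
  define l where "l = h div 2 + min 0 a + min 0 b + min 0 c"
  have h: "of_int (h div 2) \<le> of_int h / (2 :: real)" "of_int h / (2 :: real) \<le> of_int (h div 2) + 1 / 2"
    by linarith+
  have sum: "max 0 d - min 0 d = \<bar>d\<bar>" for d :: int by simp
  have "of_int l \<le> (of_int p :: real)" unfolding l_def p using s[OF u(1,2), of a] s[OF u(3,4), of b] s[OF u(5,6), of c] h by simp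
  then have 1: "l \<le> p" by simp
  have "(of_int p :: real) < of_int (h div 2 + 1 + max 0 a + max 0 b + max 0 c)"
    unfolding p using s[OF u(1,2), of a] s[OF u(3,4), of b] s[OF u(5,6), of c] h by simp
  then have 2: "p < h div 2 + 1 + max 0 a + max 0 b + max 0 c" by linarith
  have "p - l < 2 + \<bar>a\<bar> + \<bar>b\<bar> + \<bar>c\<bar>" using 2 sum[of a] sum[of b] sum[of c] unfolding l_def by linarith
  then have "nat (p - l) \<in> set [0..<nat (2 + \<bar>a\<bar> + \<bar>b\<bar> + \<bar>c\<bar>)]" using 1 by simp
  moreover have "p = int (nat (p - l)) + l" using 1 by simp
  ultimately show ?thesis unfolding cell_range.simps l_def[symmetric] set_map by blast
qed

text \<open>Positivity of the determinant turns the bounds 0 and 1 for the fractional coordinates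
  into the integral inequalities of \<open>in_cell\<close>, and Cramer's rule gives the
  converse.\<close>

lemma frame_emb:
  assumes F: "F = frame ((1/2) *\<^sub>R emb h) (emb a) (emb b) (emb c)" and D: "idot a (cross b c) > 0"
  shows "emb p \<in> F ` ({0..<1} \<times> {0..<1} \<times> {0..<1}) \<longleftrightarrow> p \<in> set (cell_list h a b c)"
proof -
  obtain h1 h2 h3 where h: "h = Tri h1 h2 h3" by (cases h)
  obtain a1 a2 a3 where a: "a = Tri a1 a2 a3" by (cases a)
  obtain b1 b2 b3 where b: "b = Tri b1 b2 b3" by (cases b)
  obtain c1 c2 c3 where c: "c = Tri c1 c2 c3" by (cases c)
  obtain p1 p2 p3 where p: "p = Tri p1 p2 p3" by (cases p)
  note ex = h a b c p
  define d where "d = idot a (cross b c)"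
  define r where "r = [idot (cross b c) (p + p - h), idot (cross c a) (p + p - h), idot (cross a b) (p + p - h)]"
  have cell: "in_cell h a b c p \<longleftrightarrow> (\<forall>x\<in>set r. 0 \<le> x \<and> x < 2 * d)"
    by (simp add: in_cell_def Let_def r_def d_def)
  have coord: "emb p = F (x, y, z) \<longleftrightarrow>
      of_int p1 = of_int h1 / 2 + x * of_int a1 + y * of_int b1 + z * of_int c1 \<and>
      of_int p2 = of_int h2 / 2 + x * of_int a2 + y * of_int b2 + z * of_int c2 \<and>
      of_int p3 = of_int h3 / 2 + x * of_int a3 + y * of_int b3 + z * of_int c3" for x y z
    by (simp add: F frame_def ex emb_def vec_eq_iff forall_3)
  show ?thesis
  proof
    assume "emb p \<in> F ` ({0..<1} \<times> {0..<1} \<times> {0..<1})"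
    then obtain x y z where e: "emb p = F (x, y, z)" and u: "0 \<le> x" "x < 1" "0 \<le> y" "y < 1" "0 \<le> z" "z < 1" by auto
    note q = coord[THEN iffD1, OF e]
    have "p \<in> set (grid (cell_range h1 a1 b1 c1) (cell_range h2 a2 b2 c2) (cell_range h3 a3 b3 c3))"
      unfolding set_grid p using q cell_range_bounds[OF _ u] by blast
    moreover have "in_cell h a b c p"
    proof -
      have v: "of_int (p1 + p1 - h1) = 2 * (x * of_int a1 + y * of_int b1 + z * of_int c1)"
        "of_int (p2 + p2 - h2) = 2 * (x * of_int a2 + y * of_int b2 + z * of_int c2)"
        "of_int (p3 + p3 - h3) = 2 * (x * of_int a3 + y * of_int b3 + z * of_int c3)"
        using q by simp_all
      have dot: "idot s (p + p - h) = fst3 * (p1 + p1 - h1) + snd3 * (p2 + p2 - h2) + trd3 * (p3 + p3 - h3)" if "s = Tri fst3 snd3 trd3"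
        for s fst3 snd3 trd3 using that by (simp add: ex)
      have key: "0 \<le> k \<and> k < 2 * d" if t: "0 \<le> t" "t < 1" "of_int k = 2 * t * of_int d" for t :: real and k
      proof -
        have d0: "of_int d > (0 :: real)" using D by (simp add: d_def)
        have "(0 :: real) \<le> of_int k" using t d0 by simp
        moreover have "(of_int k :: real) < of_int (2 * d)" using t(2) d0 unfolding t(3) by simp
        ultimately show ?thesis unfolding of_int_0_le_iff of_int_less_iff by blast
      qed
      have R: "of_int (idot (cross b c) (p + p - h)) = 2 * x * of_int d" "of_int (idot (cross c a) (p + p - h)) = 2 * y * of_int d"
        "of_int (idot (cross a b) (p + p - h)) = 2 * z * of_int d"
        unfolding d_def
        by (subst dot, simp add: ex, simp only: of_int_add of_int_mult v, simp add: ex, algebra)+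
      show ?thesis unfolding cell r_def using key[OF u(1,2) R(1)] key[OF u(3,4) R(2)] key[OF u(5,6) R(3)] by simp
    qed
    ultimately show "p \<in> set (cell_list h a b c)" by (simp add: ex del: cell_range.simps)
  next
    assume "p \<in> set (cell_list h a b c)"
    then have "in_cell h a b c p" by (simp add: ex del: cell_range.simps)
    then have R: "0 \<le> x \<and> x < 2 * d" if "x \<in> set r" for x using that unfolding cell by blast
    define x y z where "x = of_int (r ! 0) / (2 * of_int d :: real)" and "y = of_int (r ! 1) / (2 * of_int d :: real)"
      and "z = of_int (r ! 2) / (2 * of_int d :: real)"
    have d0: "of_int d > (0 :: real)" using D by (simp add: d_def)
    have unit: "0 \<le> of_int k / (2 * of_int d :: real) \<and> of_int k / (2 * of_int d :: real) < 1" if "k \<in> set r" for k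
    proof -
      have "0 \<le> k" "k < 2 * d" using R[OF that] by simp_all
      then have "(0 :: real) \<le> of_int k" "(of_int k :: real) < 2 * of_int d" by linarith+
      then show ?thesis using d0 by simp
    qed
    have u: "x \<in> {0..<1}" "y \<in> {0..<1}" "z \<in> {0..<1}"
      unfolding x_def y_def z_def using unit by (simp_all add: r_def)
    have xyz: "2 * of_int d * x = of_int (idot (cross b c) (p + p - h))" "2 * of_int d * y = of_int (idot (cross c a) (p + p - h))"
      "2 * of_int d * z = of_int (idot (cross a b) (p + p - h))"
      using d0 by (simp_all add: x_def y_def z_def r_def)
    \<comment> \<open>The vector identity behind Cramer's rule, coordinate by coordinate: the basis
      vectors, weighted with the pairings with the cross products, add up to \<open>d\<close> times
      \<open>p + p - h\<close>.\<close>
    have cramer: "idot (cross b c) (p + p - h) * a1 + idot (cross c a) (p + p - h) * b1 + idot (cross a b) (p + p - h) * c1 = d * (p1 + p1 - h1)"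
      "idot (cross b c) (p + p - h) * a2 + idot (cross c a) (p + p - h) * b2 + idot (cross a b) (p + p - h) * c2 = d * (p2 + p2 - h2)"
      "idot (cross b c) (p + p - h) * a3 + idot (cross c a) (p + p - h) * b3 + idot (cross a b) (p + p - h) * c3 = d * (p3 + p3 - h3)"
      unfolding d_def by (simp add: ex, algebra)+
    have solve: "of_int k = of_int l / 2 + x * of_int a' + y * of_int b' + z * of_int c'"
      if "idot (cross b c) (p + p - h) * a' + idot (cross c a) (p + p - h) * b' + idot (cross a b) (p + p - h) * c' = d * (k + k - l)" for a' b' c' k l
    proof -
      have "of_int d * of_int (k + k - l) = of_int (d * (k + k - l))" by simp
      also have "\<dots> = 2 * of_int d * x * of_int a' + 2 * of_int d * y * of_int b' + 2 * of_int d * z * of_int c'"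
        unfolding xyz that[symmetric] by simp
      also have "\<dots> = of_int d * (2 * (x * of_int a' + y * of_int b' + z * of_int c'))" by algebra
      finally have "of_int (k + k - l) = 2 * (x * of_int a' + y * of_int b' + z * of_int c')" using d0 by simp
      then show ?thesis by simp
    qed
    have "emb p = F (x, y, z)" unfolding coord using solve[OF cramer(1)] solve[OF cramer(2)] solve[OF cramer(3)] by blast
    then show "emb p \<in> F ` ({0..<1} \<times> {0..<1} \<times> {0..<1})" using u by blast
  qed
qed

lemma distinct_cell_list: "distinct (cell_list h a b c)"
proof -
  have "distinct (cell_range h a b c)" for h a b c by (simp add: distinct_map inj_on_def)
  then show ?thesis by (cases h; cases a; cases b; cases c) (simp add: distinct_grid del: cell_range.simps)
qed

lemma right_handed_emb: "right_handed (emb a) (emb b) (emb c) \<longleftrightarrow> idot a (cross b c) > 0"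
proof -
  have "det (vector [emb a, emb b, emb c] :: real ^ 3 ^ 3) = of_int (idot a (cross b c))"
    by (cases a; cases b; cases c) (simp add: det_3 emb_def algebra_simps)
  then show ?thesis by (simp add: right_handed_def)
qed

lemma multiplicity_count:
  assumes F: "F = frame ((1/2) *\<^sub>R emb h) (emb a) (emb b) (emb c)" and D: "right_handed (emb a) (emb b) (emb c)"
  shows "multiplicity_in_cell F (emb ` {p. Q p}) = length (filter Q (cell_list h a b c))"
proof -
  have "emb ` {p. Q p} \<inter> F ` ({0..<1} \<times> {0..<1} \<times> {0..<1}) = emb ` set (filter Q (cell_list h a b c))"
    using frame_emb[OF F D[unfolded right_handed_emb]] by auto
  moreover have "inj emb" by (simp add: inj_def)
  ultimately show ?thesis unfolding multiplicity_in_cell_def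
    using distinct_card[OF distinct_filter[OF distinct_cell_list]] by (metis card_image inj_on_subset subset_UNIV)
qed

section \<open>Classification\<close>

lemma ball_list_act: "r = 3 \<or> r = 6 \<Longrightarrow> d \<in> set (ball_list r) \<Longrightarrow> act L d \<in> set (ball_list r)"
  by (simp add: set_ball_list act_short)

lemma ball_list_units: "r = 3 \<or> r = 6 \<Longrightarrow> 0 \<in> set (ball_list r) \<and> set units \<subseteq> set (ball_list r)"
  by (auto simp: set_ball_list short_def units_def zero_tri_def)

text \<open>Strong induction over the patterns, as certificates refer to smaller numbers only. The
  last pattern covers every colouring after normalisation, which is undone by transitivity of
  equivalence.\<close>

theorem classification:
  assumes models: "\<And>n. n \<in> N \<Longrightarrow> two_orbit (model_of n) \<and> (\<forall>y. rigid_at (set (nbrs n)) (model_of n) y)"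
    and N: "\<And>i. i < length patterns \<Longrightarrow> certificate.leaves (certs ! i) \<subseteq> N"
    and certs: "\<And>i. i < length patterns \<Longrightarrow> verified_cert i"
    and last: "patterns \<noteq> []" "last patterns = [(0, False), (Tri 1 0 0, True)]"
    and c: "two_orbit c"
  shows "\<exists>n\<in>N. equiv_col c (model_of n)"
proof -
  interpret certificate nbrs model_of .
  have m: "two_orbit (model_of n) \<and> (\<forall>y. rigid_at (set (nbrs n)) (model_of n) y) \<and>
      (\<forall>L. \<forall>d\<in>set (nbrs n). act L d \<in> set (nbrs n)) \<and> 0 \<in> set (nbrs n) \<and> set units \<subseteq> set (nbrs n)" if "n \<in> N" for n
  proof -
    obtain r :: int where "r = 3 \<or> r = 6" "nbrs n = ball_list r" unfolding nbrs_def by (cases "n = 18 \<or> n = 23") auto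
    then show ?thesis using models[OF that] ball_list_act[of r] ball_list_units[of r] by auto
  qed
  have all: "solves N (patterns ! i)" if "i < length patterns" for i
    using that
  proof (induction i rule: less_induct)
    case (less i)
    have G: "solves N P" if P: "P \<in> set (take i patterns)" for P
    proof -
      obtain j where "j < i" "j < length patterns" "P = patterns ! j"
        using P by (auto simp: in_set_conv_nth)
      then show ?thesis using less.IH by blast
    qed
    show ?case by (rule verified_solves[OF m G N[OF less.prems] certs[OF less.prems, unfolded verified_cert_def]])
  qed
  have "solves N (last patterns)" using all[of "length patterns - 1"] last(1) by (simp add: last_conv_nth)
  then have base: "\<And>c. two_orbit c \<Longrightarrow> \<not> c 0 \<Longrightarrow> c (Tri 1 0 0) \<Longrightarrow> solved N c"
    unfolding last(2) solves_def by simp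
  obtain g s where gs: "\<not> (c (mov g 0) \<noteq> s)" "c (mov g (Tri 1 0 0)) \<noteq> s"
    using adjacent_colours[OF two_orbit_proper[OF c]] by blast
  define f where "f p = (c (mov g p) \<noteq> s)" for p
  have f: "equiv_col f c" unfolding equiv_col_def f_def by blast
  have "two_orbit f" by (rule two_orbit_equiv[OF f_def c])
  then have "solved N f" using base gs by (simp add: f_def)
  then show ?thesis unfolding solved_def using equiv_col_trans[OF equiv_col_sym[OF f]] by blast
qed

section \<open>Consequences for one entry\<close>

text \<open>One bundle of everything required of an entry, so that all entries are treated alike:
  \<open>m\<close> is the period, \<open>r\<close> the squared radius for rigidity and
  \<open>s\<close> tells whether the entry is a superposition.\<close>

definition realised_by :: "nat \<Rightarrow> int \<Rightarrow> bool \<Rightarrow> entry \<Rightarrow> model \<Rightarrow> bool" where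
  "realised_by m r s e M \<longleftrightarrow> two_orbit (mcol M) \<and> (\<forall>y. rigid_at (set (ball_list r)) (mcol M) y) \<and>
     represented_partitions e = partition_equiv `` {bipart (mcol M)} \<and> bipart (mcol M) \<in> orbit_partitions 2 \<and>
     periodic m (mcol M) \<and>
     card (range (\<lambda>t. mcol M \<circ> mov (shift t))) = idx_t e \<and> card (range (\<lambda>g. mcol M \<circ> mov g)) = idx_t e * idx_k e \<and>
     range (degree (mcol M)) = {fst (degrees M), snd (degrees M)} \<and>
     (\<forall>F. entry_frame e F \<longrightarrow>
        (\<exists>f :: real ^ 3 \<Rightarrow> real ^ 3. isometry f \<and> f ` (entry_orbit1 e F \<union> entry_orbit2 e F) = (\<lambda>x. 2 *\<^sub>R x) ` integer_lattice)
      \<and> F (point1 e) \<in> wyckoff_position (sg e) F (snd (wyck1 e))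
      \<and> multiplicity_in_cell F (entry_orbit1 e F) = fst (wyck1 e)
      \<and> F (point2 e) \<in> wyckoff_position (sg e) F (snd (wyck2 e))
      \<and> multiplicity_in_cell F (entry_orbit2 e F) = fst (wyck2 e)
      \<and> (\<forall>s. entry_similarity e F s \<longrightarrow>
           aut_partition (entry_partition e F s) = (\<lambda>g. s \<circ> g \<circ> inv_into UNIV s) ` entry_group e F)) \<and>
     (\<forall>P\<in>represented_partitions e. has_space_group_type (aut_partition P) (sg e) \<and> translation_index P = idx_t e \<and>
        point_index P = real (idx_k e) \<and> aut_index P = idx_t e * idx_k e \<and> (direct_superposition P \<longleftrightarrow> s))"

lemma realised_byD:
  assumes "realised_by m r s e M"
  shows "two_orbit (mcol M)" "rigid_at (set (ball_list r)) (mcol M) y"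
    "represented_partitions e = partition_equiv `` {bipart (mcol M)}" "bipart (mcol M) \<in> orbit_partitions 2" "periodic m (mcol M)"
    "card (range (\<lambda>t. mcol M \<circ> mov (shift t))) = idx_t e" "card (range (\<lambda>g. mcol M \<circ> mov g)) = idx_t e * idx_k e"
    "range (degree (mcol M)) = {fst (degrees M), snd (degrees M)}"
  using assms unfolding realised_by_def by blast+

lemma realised_by_frames:
  "realised_by m r s e M \<Longrightarrow>
     \<forall>F. entry_frame e F \<longrightarrow>
        (\<exists>f :: real ^ 3 \<Rightarrow> real ^ 3. isometry f \<and> f ` (entry_orbit1 e F \<union> entry_orbit2 e F) = (\<lambda>x. 2 *\<^sub>R x) ` integer_lattice)
      \<and> F (point1 e) \<in> wyckoff_position (sg e) F (snd (wyck1 e))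
      \<and> multiplicity_in_cell F (entry_orbit1 e F) = fst (wyck1 e)
      \<and> F (point2 e) \<in> wyckoff_position (sg e) F (snd (wyck2 e))
      \<and> multiplicity_in_cell F (entry_orbit2 e F) = fst (wyck2 e)
      \<and> (\<forall>s. entry_similarity e F s \<longrightarrow>
           aut_partition (entry_partition e F s) = (\<lambda>g. s \<circ> g \<circ> inv_into UNIV s) ` entry_group e F)"
  unfolding realised_by_def by (elim conjE)

lemma realised_by_partitions:
  "realised_by m r s e M \<Longrightarrow> P \<in> represented_partitions e \<Longrightarrow>
     has_space_group_type (aut_partition P) (sg e) \<and> translation_index P = idx_t e \<and>
        point_index P = real (idx_k e) \<and> aut_index P = idx_t e * idx_k e \<and> (direct_superposition P \<longleftrightarrow> s)"
  unfolding realised_by_def by (elim conjE) (drule (1) bspec)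

definition check_direct :: "bool \<Rightarrow> model \<Rightarrow> bool" where
  "check_direct s M = (if s then check_superposition M else check_no_superposition M)"

context entry_model
begin

text \<open>The degree is constant on each colour class since symmetries preserve it, so two
  evaluations describe it completely.\<close>

lemma degree_values: "range (degree c) = {degree c 0, degree c q}"
proof -
  have "degree c p \<in> {degree c 0, degree c q}" for p
  proof -
    have "\<exists>g\<in>symm c. mov g p = 0 \<or> mov g p = q"
      using gen_transitive[of p 0] gen_transitive[of p q] c0 cq Gsymm by (cases "c p") auto
    then obtain g where g: "g \<in> symm c" "mov g p = 0 \<or> mov g p = q" by blast
    have "c p = (c (mov g p) \<noteq> False)" for p using g(1) by (simp add: symm_def del: mov.simps)
    then have "degree c p = degree c (mov g p)" by (rule degree_equiv)
    then show ?thesis using g(2) by auto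
  qed
  then show ?thesis by blast
qed

lemma realised:
  assumes r: "check_rigid r M" "r = 3 \<or> r = 6" and k: "check_multiplicities (fst (wyck1 e)) (fst (wyck2 e)) M"
    and s: "check_direct s M" and p0: "p0 = (1/2) *\<^sub>R emb half"
  shows "realised_by m r s e M"
proof -
  have cM: "mcol M = c" by (simp add: mcol_def M)
  obtain u v w' ts' where ts: "ts = u # v # w' # ts'"
    using ts3(1) by (cases ts; cases "tl ts"; cases "tl (tl ts)") auto
  have rh: "right_handed (emb u) (emb v) (emb w')" and F: "F0 = frame ((1/2) *\<^sub>R emb half) (emb u) (emb v) (emb w')"
    using basis ts3 unfolding F0 p0 ts conventional_basis_def by simp_all
  have k: "length (filter (\<lambda>p. \<not> c p) (cell_list half u v w')) = fst (wyck1 e)" "length (filter c (cell_list half u v w')) = fst (wyck2 e)"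
    using k unfolding check_multiplicities_def M ts is_false_def by (simp_all add: Let_def)
  have mult: "multiplicity_in_cell F0 (emb ` {p. \<not> c p}) = fst (wyck1 e)" "multiplicity_in_cell F0 (emb ` {p. c p}) = fst (wyck2 e)"
    unfolding multiplicity_count[OF F rh] k by simp_all
  have eqv: "(bipart c, P) \<in> partition_equiv" if "P \<in> represented_partitions e" for P
    using that unfolding represented by blast
  have deg: "degrees M = (degree c 0, degree c q)" by (simp add: degrees_def M)
  show ?thesis unfolding realised_by_def cM deg fst_conv snd_conv
  proof (intro conjI allI ballI impI)
    fix F assume "entry_frame e F"
    note ef = entry_facts[OF this]
    show "multiplicity_in_cell F (entry_orbit1 e F) = fst (wyck1 e)" "multiplicity_in_cell F (entry_orbit2 e F) = fst (wyck2 e)"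
      unfolding ef(3,5) mult by simp_all
    show "F (point1 e) \<in> wyckoff_position (sg e) F (snd (wyck1 e))" "F (point2 e) \<in> wyckoff_position (sg e) F (snd (wyck2 e))"
      by (rule ef)+
    show "\<exists>f :: real ^ 3 \<Rightarrow> real ^ 3. isometry f \<and> f ` (entry_orbit1 e F \<union> entry_orbit2 e F) = (\<lambda>x. 2 *\<^sub>R x) ` integer_lattice" by (rule ef)
    show "aut_partition (entry_partition e F s) = (\<lambda>g. s \<circ> g \<circ> inv_into UNIV s) ` entry_group e F" if "entry_similarity e F s" for s
      using that by (rule ef(6))
  next
    fix P assume "P \<in> represented_partitions e"
    from eqv[OF this] have "direct_superposition P \<longleftrightarrow> direct_superposition (bipart c)"
      using direct_superposition_trans partition_equiv_sym by blast
    then show "direct_superposition P \<longleftrightarrow> s"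
      using s superposition no_superposition unfolding check_direct_def by (cases s) auto
  qed (use two_orbit rigid[OF r] represented in_orbit_partitions per index_translation index_aut it ik degree_values
      group_type indices in simp_all)
qed

end

section \<open>Assembling the list\<close>

text \<open>Minimum and maximum make the pair of degrees unordered, because an equivalence may
  exchange the colours.\<close>

definition entry_invariants :: "nat \<Rightarrow> nat \<times> nat \<times> nat \<times> nat" where
  "entry_invariants n = (case degrees (models ! (n - 1)) of (d, d') \<Rightarrow>
     (idx_t (entry n), idx_t (entry n) * idx_k (entry n), min d d', max d d'))"

text \<open>Equivalent models share both indices and the set of degrees, so separated invariants
  give injectivity; surjectivity is the classification.\<close>

lemma bijection_of_classes:
  assumes real: "\<And>n. n \<in> {1..25} \<Longrightarrow> \<exists>m r s. realised_by m r s (entry n) (models ! (n - 1))"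
    and cls: "\<And>c. two_orbit c \<Longrightarrow> \<exists>n\<in>{1..25}. equiv_col c (model_of n)"
    and inj: "inj_on entry_invariants {1..25}"
  shows "bij_betw (\<lambda>n. represented_partitions (entry n)) {1..25} (orbit_partitions 2 // partition_equiv)"
proof -
  have rep: "represented_partitions (entry n) = partition_equiv `` {bipart (model_of n)}"
    and mem: "bipart (model_of n) \<in> orbit_partitions 2" if "n \<in> {1..25}" for n
    using real[OF that] realised_byD(3,4) unfolding model_of_def by blast+
  show ?thesis
  proof (rule bij_betw_imageI)
    show "inj_on (\<lambda>n. represented_partitions (entry n)) {1..25}"
    proof (rule inj_onI)
      fix n n' :: nat assume n: "n \<in> {1..25}" "n' \<in> {1..25}" and eq: "represented_partitions (entry n) = represented_partitions (entry n')"
      have "bipart (model_of n') \<in> partition_equiv `` {bipart (model_of n)}"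
        using eq partition_equiv_refl unfolding rep[OF n(1)] rep[OF n(2)] by blast
      then have e: "equiv_col (model_of n) (model_of n')" by (simp add: bipart_equiv)
      obtain m r s where R: "realised_by m r s (entry n) (models ! (n - 1))" using real[OF n(1)] by blast
      obtain m' r' s' where R': "realised_by m' r' s' (entry n') (models ! (n' - 1))" using real[OF n(2)] by blast
      note R = realised_byD[OF R, folded model_of_def] and R' = realised_byD[OF R', folded model_of_def]
      have "idx_t (entry n) = idx_t (entry n')" "idx_t (entry n) * idx_k (entry n) = idx_t (entry n') * idx_k (entry n')"
        using index_equiv[OF R'(5) e] unfolding R(6,7) R'(6,7) by simp_all
      moreover have "{fst (degrees (models ! (n - 1))), snd (degrees (models ! (n - 1)))} = {fst (degrees (models ! (n' - 1))), snd (degrees (models ! (n' - 1)))}"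
        using degree_range[OF e] unfolding R(8) R'(8) .
      ultimately have "entry_invariants n = entry_invariants n'"
        by (auto simp: entry_invariants_def Let_def doubleton_eq_iff min_def max_def split: prod.splits)
      then show "n = n'" using inj n by (simp add: inj_on_def)
    qed
    show "(\<lambda>n. represented_partitions (entry n)) ` {1..25} = orbit_partitions 2 // partition_equiv"
    proof (intro equalityI subsetI)
      fix X assume "X \<in> (\<lambda>n. represented_partitions (entry n)) ` {1..25}"
      then show "X \<in> orbit_partitions 2 // partition_equiv" using rep mem by (auto simp: quotient_def)
    next
      fix X :: "(real ^ 3) set set set" assume "X \<in> orbit_partitions 2 // partition_equiv"
      then obtain P where P: "P \<in> orbit_partitions 2" "X = partition_equiv `` {P}" by (auto simp: quotient_def)
      obtain c where c: "two_orbit c" "P = bipart c" using two_orbit_if_orbit_partition[OF P(1)] by blast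
      obtain n where n: "n \<in> {1..25}" "equiv_col c (model_of n)" using cls[OF c(1)] by blast
      have "(P, bipart (model_of n)) \<in> partition_equiv" using n(2) c(2) by (simp add: bipart_equiv)
      then have "X = represented_partitions (entry n)"
        unfolding P(2) rep[OF n(1)] using partition_equiv_trans partition_equiv_sym by blast
      then show "X \<in> (\<lambda>n. represented_partitions (entry n)) ` {1..25}" using n(1) by blast
    qed
  qed
qed

section \<open>The 25 entries\<close>

text \<open>A fixed order lets coordinate maps and motions of a model be paired one by one, without
  deciding equality of functions.\<close>

fun generator_list :: "space_group_type \<Rightarrow> (coords \<Rightarrow> coords) list" where
    "generator_list P4_m = [\<lambda>(x,y,z). (-x, -y, z), \<lambda>(x,y,z). (-y, x, z), \<lambda>(x,y,z). (-x, -y, -z)]"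
| "generator_list P4_mmm = [\<lambda>(x,y,z). (-x, -y, z), \<lambda>(x,y,z). (-y, x, z), \<lambda>(x,y,z). (-x, y, -z),
     \<lambda>(x,y,z). (-x, -y, -z)]"
| "generator_list I4_mmm = [\<lambda>(x,y,z). (x + 1/2, y + 1/2, z + 1/2),
     \<lambda>(x,y,z). (-x, -y, z), \<lambda>(x,y,z). (-y, x, z), \<lambda>(x,y,z). (-x, y, -z),
     \<lambda>(x,y,z). (-x, -y, -z)]"
| "generator_list I4_1_amd = [\<lambda>(x,y,z). (x + 1/2, y + 1/2, z + 1/2),
     \<lambda>(x,y,z). (-x + 1/2, -y, z + 1/2), \<lambda>(x,y,z). (-y + 1/4, x + 3/4, z + 1/4),
     \<lambda>(x,y,z). (-x + 1/2, y, -z + 1/2), \<lambda>(x,y,z). (-x, -y, -z)]"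
| "generator_list I4_1_acd = [\<lambda>(x,y,z). (x + 1/2, y + 1/2, z + 1/2),
     \<lambda>(x,y,z). (-x + 1/2, -y, z + 1/2), \<lambda>(x,y,z). (-y + 1/4, x + 3/4, z + 1/4),
     \<lambda>(x,y,z). (-x + 1/2, y, -z), \<lambda>(x,y,z). (-x, -y, -z)]"
| "generator_list Pmma = [\<lambda>(x,y,z). (-x + 1/2, -y, z), \<lambda>(x,y,z). (-x, y, -z),
     \<lambda>(x,y,z). (-x, -y, -z)]"
| "generator_list Cmcm = [\<lambda>(x,y,z). (x + 1/2, y + 1/2, z),
     \<lambda>(x,y,z). (-x, -y, z + 1/2), \<lambda>(x,y,z). (-x, y, -z + 1/2), \<lambda>(x,y,z). (-x, -y, -z)]"
| "generator_list Cmmm = [\<lambda>(x,y,z). (x + 1/2, y + 1/2, z),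
     \<lambda>(x,y,z). (-x, -y, z), \<lambda>(x,y,z). (-x, y, -z), \<lambda>(x,y,z). (-x, -y, -z)]"
| "generator_list R_3 = [\<lambda>(x,y,z). (x + 2/3, y + 1/3, z + 1/3),
     \<lambda>(x,y,z). (-y, x - y, z), \<lambda>(x,y,z). (-x, -y, -z)]"
| "generator_list P_3m1 = [\<lambda>(x,y,z). (-y, x - y, z), \<lambda>(x,y,z). (y, x, -z), \<lambda>(x,y,z). (-x, -y, -z)]"
| "generator_list R_3m = [\<lambda>(x,y,z). (x + 2/3, y + 1/3, z + 1/3),
     \<lambda>(x,y,z). (-y, x - y, z), \<lambda>(x,y,z). (y, x, -z), \<lambda>(x,y,z). (-x, -y, -z)]"
| "generator_list Fm_3m = [\<lambda>(x,y,z). (x, y + 1/2, z + 1/2), \<lambda>(x,y,z). (x + 1/2, y, z + 1/2),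
     \<lambda>(x,y,z). (-x, -y, z), \<lambda>(x,y,z). (-x, y, -z), \<lambda>(x,y,z). (z, x, y),
     \<lambda>(x,y,z). (y, x, -z), \<lambda>(x,y,z). (-x, -y, -z)]"
| "generator_list Im_3m = [\<lambda>(x,y,z). (x + 1/2, y + 1/2, z + 1/2),
     \<lambda>(x,y,z). (-x, -y, z), \<lambda>(x,y,z). (-x, y, -z), \<lambda>(x,y,z). (z, x, y),
     \<lambda>(x,y,z). (y, x, -z), \<lambda>(x,y,z). (-x, -y, -z)]"
| "generator_list Ia_3d = [\<lambda>(x,y,z). (x + 1/2, y + 1/2, z + 1/2),
     \<lambda>(x,y,z). (-x + 1/2, -y, z + 1/2), \<lambda>(x,y,z). (-x, y + 1/2, -z + 1/2),
     \<lambda>(x,y,z). (z, x, y), \<lambda>(x,y,z). (y + 3/4, x + 1/4, -z + 1/4), \<lambda>(x,y,z). (-x, -y, -z)]"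

lemma set_generator_list: "set (generator_list T) = generators T"
  by (cases T) (simp_all only: generator_list.simps generators.simps list.set)

lemma wyckoff_lookup:
  "the (map_of wyckoff_representatives (P4_m, CHR ''a'')) = {(0, 0, 0)}"
  "the (map_of wyckoff_representatives (P4_m, CHR ''j'')) = {(x, y, 0) |x y. True}"
  "the (map_of wyckoff_representatives (P4_mmm, CHR ''b'')) = {(0, 0, 1/2)}"
  "the (map_of wyckoff_representatives (P4_mmm, CHR ''c'')) = {(1/2, 1/2, 0)}"
  "the (map_of wyckoff_representatives (P4_mmm, CHR ''d'')) = {(1/2, 1/2, 1/2)}"
  "the (map_of wyckoff_representatives (P4_mmm, CHR ''g'')) = {(0, 0, z) |z. True}"
  "the (map_of wyckoff_representatives (P4_mmm, CHR ''h'')) = {(1/2, 1/2, z) |z. True}"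
  "the (map_of wyckoff_representatives (P4_mmm, CHR ''l'')) = {(x, 0, 0) |x. True}"
  "the (map_of wyckoff_representatives (P4_mmm, CHR ''n'')) = {(x, 1/2, 0) |x. True}"
  "the (map_of wyckoff_representatives (I4_mmm, CHR ''e'')) = {(0, 0, z) |z. True}"
  "the (map_of wyckoff_representatives (I4_mmm, CHR ''i'')) = {(x, 0, 0) |x. True}"
  "the (map_of wyckoff_representatives (I4_mmm, CHR ''j'')) = {(x, 1/2, 0) |x. True}"
  "the (map_of wyckoff_representatives (I4_1_amd, CHR ''e'')) = {(0, 1/4, z) |z. True}"
  "the (map_of wyckoff_representatives (I4_1_amd, CHR ''h'')) = {(0, y, z) |y z. True}"
  "the (map_of wyckoff_representatives (I4_1_amd, CHR ''i'')) = UNIV"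
  "the (map_of wyckoff_representatives (I4_1_acd, CHR ''g'')) = UNIV"
  "the (map_of wyckoff_representatives (Pmma, CHR ''e'')) = {(1/4, 0, z) |z. True}"
  "the (map_of wyckoff_representatives (Cmcm, CHR ''c'')) = {(0, y, 1/4) |y. True}"
  "the (map_of wyckoff_representatives (Cmcm, CHR ''g'')) = {(x, y, 1/4) |x y. True}"
  "the (map_of wyckoff_representatives (Cmmm, CHR ''b'')) = {(1/2, 0, 0)}"
  "the (map_of wyckoff_representatives (Cmmm, CHR ''g'')) = {(x, 0, 0) |x. True}"
  "the (map_of wyckoff_representatives (Cmmm, CHR ''h'')) = {(x, 0, 1/2) |x. True}"
  "the (map_of wyckoff_representatives (R_3, CHR ''a'')) = {(0, 0, 0)}"
  "the (map_of wyckoff_representatives (R_3, CHR ''f'')) = UNIV"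
  "the (map_of wyckoff_representatives (P_3m1, CHR ''a'')) = {(0, 0, 0)}"
  "the (map_of wyckoff_representatives (P_3m1, CHR ''d'')) = {(1/3, 2/3, z) |z. True}"
  "the (map_of wyckoff_representatives (R_3m, CHR ''c'')) = {(0, 0, z) |z. True}"
  "the (map_of wyckoff_representatives (Fm_3m, CHR ''a'')) = {(0, 0, 0)}"
  "the (map_of wyckoff_representatives (Fm_3m, CHR ''b'')) = {(1/2, 1/2, 1/2)}"
  "the (map_of wyckoff_representatives (Fm_3m, CHR ''f'')) = {(x, x, x) |x. True}"
  "the (map_of wyckoff_representatives (Im_3m, CHR ''a'')) = {(0, 0, 0)}"
  "the (map_of wyckoff_representatives (Im_3m, CHR ''b'')) = {(0, 1/2, 1/2)}"
  "the (map_of wyckoff_representatives (Im_3m, CHR ''f'')) = {(x, x, x) |x. True}"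
  "the (map_of wyckoff_representatives (Im_3m, CHR ''k'')) = {(x, x, z) |x z. True}"
  "the (map_of wyckoff_representatives (Ia_3d, CHR ''b'')) = {(1/8, 1/8, 1/8)}"
  "the (map_of wyckoff_representatives (Ia_3d, CHR ''g'')) = {(1/8, y, -y + 1/4) |y. True}"
  by (simp add: wyckoff_representatives_def)+

definition directions :: "coords set \<Rightarrow> pt list \<Rightarrow> bool" where
  "directions W ds \<longleftrightarrow> (\<forall>u\<in>W. \<forall>v\<in>W. u - v \<in> span (real_pt ` set ds))"

lemma span_combination:
  "r *\<^sub>R real_pt D \<in> span (real_pt ` set [D])"
  "r *\<^sub>R real_pt D + r' *\<^sub>R real_pt D' \<in> span (real_pt ` set [D, D'])"
  "r *\<^sub>R real_pt D + r' *\<^sub>R real_pt D' + r'' *\<^sub>R real_pt D'' \<in> span (real_pt ` set [D, D', D''])"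
  by (intro span_add span_scale span_base; simp)+

text \<open>One rule for each shape of a tabulated Wyckoff set: the free parameters are coordinates
  of a difference with respect to the listed directions.\<close>

lemma directions_intros:
  "directions {w} []"
  "directions {(p, q, z) |z. True} [Tri 0 0 1]"
  "directions {(x, q, r) |x. True} [Tri 1 0 0]"
  "directions {(p, y, r) |y. True} [Tri 0 1 0]"
  "directions {(x, x, x) |x. True} [Tri 1 1 1]"
  "directions {(p, y, - y + r) |y. True} [Tri 0 1 (- 1)]"
  "directions {(x, y, r) |x y. True} [Tri 1 0 0, Tri 0 1 0]"
  "directions {(p, y, z) |y z. True} [Tri 0 1 0, Tri 0 0 1]"
  "directions {(x, x, z) |x z. True} [Tri 1 1 0, Tri 0 0 1]"
  "directions UNIV [Tri 1 0 0, Tri 0 1 0, Tri 0 0 1]"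
proof -
  have one: "directions W [D]" if "\<And>u v. u \<in> W \<Longrightarrow> v \<in> W \<Longrightarrow> u - v = f (u - v) *\<^sub>R real_pt D" for W D f
    unfolding directions_def using that span_combination(1) by metis
  have two: "directions W [D, D']" if "\<And>u v. u \<in> W \<Longrightarrow> v \<in> W \<Longrightarrow> u - v = f (u - v) *\<^sub>R real_pt D + f' (u - v) *\<^sub>R real_pt D'"
    for W D D' f f' unfolding directions_def using that span_combination(2) by metis
  show "directions {w} []" by (simp add: directions_def)
  show "directions {(x, q, r) |x. True} [Tri 1 0 0]" "directions {(x, x, x) |x. True} [Tri 1 1 1]"
    by (rule one[where f = fst]; auto simp: real_pt_def zero_prod_def)+
  show "directions {(p, y, r) |y. True} [Tri 0 1 0]" "directions {(p, y, - y + r) |y. True} [Tri 0 1 (- 1)]"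
    by (rule one[where f = "\<lambda>u. fst (snd u)"]; auto simp: real_pt_def zero_prod_def)+
  show "directions {(p, q, z) |z. True} [Tri 0 0 1]"
    by (rule one[where f = "\<lambda>u. snd (snd u)"]; auto simp: real_pt_def zero_prod_def)
  show "directions {(x, y, r) |x y. True} [Tri 1 0 0, Tri 0 1 0]"
    by (rule two[where f = fst and f' = "\<lambda>u. fst (snd u)"]; auto simp: real_pt_def zero_prod_def)
  show "directions {(p, y, z) |y z. True} [Tri 0 1 0, Tri 0 0 1]"
    by (rule two[where f = "\<lambda>u. fst (snd u)" and f' = "\<lambda>u. snd (snd u)"]; auto simp: real_pt_def zero_prod_def)
  show "directions {(x, x, z) |x z. True} [Tri 1 1 0, Tri 0 0 1]"
    by (rule two[where f = fst and f' = "\<lambda>u. snd (snd u)"]; auto simp: real_pt_def zero_prod_def)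
  have "u = fst u *\<^sub>R real_pt (Tri 1 0 0) + fst (snd u) *\<^sub>R real_pt (Tri 0 1 0) + snd (snd u) *\<^sub>R real_pt (Tri 0 0 1)" for u
    by (cases u) (simp add: real_pt_def)
  then show "directions UNIV [Tri 1 0 0, Tri 0 1 0, Tri 0 0 1]"
    unfolding directions_def using span_combination(3) by metis
qed

text \<open>Serves the position \<open>g\<close> of \<open>Ia_3d\<close>, where the third coordinate
  depends on the second and the witness has to be given explicitly.\<close>

lemma diagonal_point: "y + z = r \<Longrightarrow> (p, y, z) \<in> {(p, y, - y + r) |y. True}" for y z r :: real
  by (intro CollectI exI[of _ y]) simp

lemma frame_Tri:
  "frame ((1/2) *\<^sub>R emb (Tri h1 h2 h3)) (emb (Tri a1 a2 a3)) (emb (Tri b1 b2 b3)) (emb (Tri c1 c2 c3)) (x, y, z) =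
   V (Tri (of_int h1 / 2 + x * of_int a1 + y * of_int b1 + z * of_int c1)
     (of_int h2 / 2 + x * of_int a2 + y * of_int b2 + z * of_int c2)
     (of_int h3 / 2 + x * of_int a3 + y * of_int b3 + z * of_int c3))"
  by (simp add: frame_def emb_def vec_eq_iff forall_3)

lemma rmov_V: "rmov (Motion L t) (V p) = V (act L p + map_tri of_int t)"
  by (simp add: emb_def V_add)

text \<open>Reduces the metric conditions to integers. For hexagonal axes the two lengths are equal,
  so the product of the norms is an integral square length and no root remains.\<close>

lemma conventional_basis_emb:
  assumes "idot a (cross b c) > 0" "x = of_int (idot a a)" "y = of_int (idot b b)" "z = of_int (idot c c)"
    "idot a c = 0" "idot b c = 0"
    "if hexagonal_axes T then idot b b = idot a a \<and> 2 * idot a b = - idot a a else idot a b = 0"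
  shows "conventional_basis T (x, y, z) (emb a) (emb b) (emb c)"
proof -
  have sq: "(norm (emb v))\<^sup>2 = of_int (idot v v)" for v by (simp add: power2_norm_eq_inner inner_emb)
  have "emb a \<bullet> emb b = (if hexagonal_axes T then - (norm (emb a) * norm (emb b)) / 2 else 0)"
  proof (cases "hexagonal_axes T")
    case True
    then have i: "idot b b = idot a a" "2 * idot a b = - idot a a" using assms(7) by simp_all
    have "(norm (emb a))\<^sup>2 = (norm (emb b))\<^sup>2" unfolding sq i(1) ..
    then have "norm (emb a) = norm (emb b)" by simp
    then have "norm (emb a) * norm (emb b) = of_int (idot a a)" using sq[of a] by (simp add: power2_eq_square)
    moreover have "2 * (emb a \<bullet> emb b) = - of_int (idot a a)" unfolding inner_emb using i(2) by (metis of_int_minus of_int_mult of_int_numeral)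
    ultimately show ?thesis using True by simp
  qed (use assms(7) in \<open>simp add: inner_emb\<close>)
  then show ?thesis
    using assms by (simp add: conventional_basis_def right_handed_emb sq inner_emb)
qed

definition check_all :: "int \<Rightarrow> bool \<Rightarrow> nat \<Rightarrow> nat \<Rightarrow> nat \<Rightarrow> nat \<Rightarrow> model \<Rightarrow> bool" where
  "check_all r s it ik k1 k2 M \<longleftrightarrow> check_invariant M \<and> check_transitive M \<and> check_stabilizer M \<and> check_translations M \<and>
     check_index it ik M \<and> check_sites M \<and> check_rigid r M \<and> check_multiplicities k1 k2 M \<and> check_direct s M"

lemma list_all2_partner:
  assumes "list_all2 R xs ys"
  shows "x \<in> set xs \<Longrightarrow> \<exists>y\<in>set ys. R x y" "y \<in> set ys \<Longrightarrow> \<exists>x\<in>set xs. R x y"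
  using assms by (induction rule: list_all2_induct) auto

text \<open>The generators of the space group are listed in the same order as their images in the model.\<close>

lemma realised_byI:
  fixes F :: "coords \<Rightarrow> real ^ 3"
  assumes M: "M = Model m T (a # b # c # ts) half q gs rb ax rt w y1 g1 d1 y2 g2 d2"
    and checks: "check_all r s it ik k1 k2 M" and r: "r = 3 \<or> r = 6"
    and e: "e = Entry S it ik (k1, l1) p1 (k2, l2) p2 (A2, B2, C2)"
    and basis: "conventional_basis S (A2 / 4, B2 / 4, C2 / 4) (emb a) (emb b) (emb c)"
    and F: "F = frame ((1/2) *\<^sub>R emb half) (emb a) (emb b) (emb c)"
    and match: "list_all2 (\<lambda>h g. \<forall>u. F (h u) = rmov g (F u))
       ([\<lambda>(x,y,z). (x + 1, y, z), \<lambda>(x,y,z). (x, y + 1, z), \<lambda>(x,y,z). (x, y, z + 1)] @ generator_list S)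
       (map shift (a # b # c # ts) @ gs)"
    and pts: "F p1 = 0" "F p2 = emb q"
    and w1: "emb y1 = F u1" "u1 \<in> the (map_of wyckoff_representatives (S, l1))" "directions (the (map_of wyckoff_representatives (S, l1))) d1"
    and w2: "emb y2 = F u2" "u2 \<in> the (map_of wyckoff_representatives (S, l2))" "directions (the (map_of wyckoff_representatives (S, l2))) d2"
  shows "realised_by m r s e M"
proof -
  let ?ag = "map shift (a # b # c # ts) @ gs"
  have ch: "check_invariant M" "check_transitive M" "check_stabilizer M" "check_translations M" "check_index it ik M"
    "check_sites M" "check_rigid r M" "check_multiplicities k1 k2 M" "check_direct s M"
    using checks by (simp_all add: check_all_def)
  have m: "checked_model M m T (a # b # c # ts) half q gs rb ax rt w y1 g1 d1 y2 g2 d2 it ik"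
    using M ch by unfold_locales simp_all
  have gens: "entry_gens (sg e) = set ([\<lambda>(x,y,z). (x + 1, y, z), \<lambda>(x,y,z). (x, y + 1, z), \<lambda>(x,y,z). (x, y, z + 1)] @ generator_list S)"
    unfolding set_append set_generator_list list.set entry_gens_def e entry.sel ..
  have G1: "\<exists>g\<in>set ?ag. \<forall>u. F (h u) = rmov g (F u)" if "h \<in> entry_gens (sg e)" for h
    using list_all2_partner(1)[OF match] that unfolding gens by blast
  have G2: "\<exists>h\<in>entry_gens (sg e). \<forall>u. F (h u) = rmov g (F u)" if "g \<in> set ?ag" for g
    using list_all2_partner(2)[OF match] that unfolding gens by blast
  have "entry_model_axioms (a # b # c # ts) q gs y1 d1 y2 d2 it ik e (emb a) (emb b) (emb c) ((1/2) *\<^sub>R emb half) F"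
    unfolding entry_model_axioms_def checked_model.ag_def[OF m]
  proof (intro conjI)
    show "\<forall>h. h \<in> entry_gens (sg e) \<longrightarrow> (\<exists>g\<in>set ?ag. \<forall>u. F (h u) = rmov g (F u))" using G1 by blast
    show "\<forall>g. g \<in> set ?ag \<longrightarrow> (\<exists>h\<in>entry_gens (sg e). \<forall>u. F (h u) = rmov g (F u))" using G2 by blast
  qed (use F basis pts w1(2-) w2(2-) w1(1) w2(1) imageI[OF w1(2), of F] imageI[OF w2(2), of F] in \<open>simp_all add: e directions_def\<close>)
  with m have "entry_model M m T (a # b # c # ts) half q gs rb ax rt w y1 g1 d1 y2 g2 d2 it ik e (emb a) (emb b) (emb c) ((1/2) *\<^sub>R emb half) F"
    by (rule entry_model.intro)
  then show ?thesis by (rule entry_model.realised) (use ch r in \<open>simp_all add: e\<close>)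
qed

lemma V_eq_emb: "V p = emb q \<longleftrightarrow> p = map_tri of_int q" "emb q = V p \<longleftrightarrow> p = map_tri of_int q"
  and V_eq_0: "V (Tri x y z) = 0 \<longleftrightarrow> x = 0 \<and> y = 0 \<and> z = 0"
proof -
  show "V p = emb q \<longleftrightarrow> p = map_tri of_int q" "emb q = V p \<longleftrightarrow> p = map_tri of_int q" by (auto simp: emb_def V_inj)
  show "V (Tri x y z) = 0 \<longleftrightarrow> x = 0 \<and> y = 0 \<and> z = 0" by (simp add: vec_eq_iff forall_3)
qed

lemmas entry_simps = frame_Tri rmov_V V_inj V_eq_emb V_eq_0 signed_def algebra_simps


section \<open>Evaluation and realisation of each entry\<close>

lemma check_1: "check_all 3 False 2 1 4 4 model1"
  by code_simp
lemma entry_1: "entry 1 = Entry Fm_3m 2 1 (4, CHR ''a'') (0, 0, 0) (4, CHR ''b'') (0, 0, 1/2) (16, 16, 16)"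
  by (simp add: entry_def entries_def)

text \<open>The two instantiated triples are the fractional coordinates of \<open>rep1\<close> and
  \<open>rep2\<close> on the tabulated Wyckoff sets. They may differ from the listed points: here
  the second listed point is (0,0,1/2), while the tabulated representative of its position is
  (1/2,1/2,1/2).\<close>

lemma realised_1: "realised_by 4 3 False (entry 1) model1"
  by ((rule realised_byI[OF model1_def check_1 _ entry_1 _ refl, of "(0, 0, 0)" "(1/2, 1/2, 1/2)"], unfold wyckoff_lookup);
    (rule directions_intros | (rule conventional_basis_emb; simp add: hexagonal_axes_def; fail) |
     (simp add: entry_simps del: rmov.simps; fail) | (rule diagonal_point; simp; fail) | blast))

lemma check_2: "check_all 3 False 4 1 2 6 model2"
  by code_simp
lemma entry_2: "entry 2 = Entry Im_3m 4 1 (2, CHR ''a'') (0, 0, 0) (6, CHR ''b'') (0, 0, 1/2) (16, 16, 16)"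
  by (simp add: entry_def entries_def)

lemma realised_2: "realised_by 4 3 False (entry 2) model2"
  by ((rule realised_byI[OF model2_def check_2 _ entry_2 _ refl, of "(0, 0, 0)" "(0, 1/2, 1/2)"], unfold wyckoff_lookup);
    (rule directions_intros | (rule conventional_basis_emb; simp add: hexagonal_axes_def; fail) |
     (simp add: entry_simps del: rmov.simps; fail) | (rule diagonal_point; simp; fail) | blast))

lemma check_3: "check_all 3 True 2 3 1 1 model3"
  by code_simp
lemma entry_3: "entry 3 = Entry P4_mmm 2 3 (1, CHR ''c'') (1/2, 1/2, 0) (1, CHR ''d'') (1/2, 1/2, 1/2) (4, 4, 16)"
  by (simp add: entry_def entries_def)

lemma realised_3: "realised_by 4 3 True (entry 3) model3"
  by ((rule realised_byI[OF model3_def check_3 _ entry_3 _ refl, of "(1/2, 1/2, 0)" "(1/2, 1/2, 1/2)"], unfold wyckoff_lookup);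
    (rule directions_intros | (rule conventional_basis_emb; simp add: hexagonal_axes_def; fail) |
     (simp add: entry_simps del: rmov.simps; fail) | (rule diagonal_point; simp; fail) | blast))

lemma check_4: "check_all 3 True 2 3 1 1 model4"
  by code_simp
lemma entry_4: "entry 4 = Entry P4_mmm 2 3 (1, CHR ''b'') (0, 0, 1/2) (1, CHR ''d'') (1/2, 1/2, 1/2) (8, 8, 4)"
  by (simp add: entry_def entries_def)

lemma realised_4: "realised_by 4 3 True (entry 4) model4"
  by ((rule realised_byI[OF model4_def check_4 _ entry_4 _ refl, of "(0, 0, 1/2)" "(1/2, 1/2, 1/2)"], unfold wyckoff_lookup);
    (rule directions_intros | (rule conventional_basis_emb; simp add: hexagonal_axes_def; fail) |
     (simp add: entry_simps del: rmov.simps; fail) | (rule diagonal_point; simp; fail) | blast))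

lemma check_5: "check_all 3 True 3 3 1 2 model5"
  by code_simp
lemma entry_5: "entry 5 = Entry P4_mmm 3 3 (1, CHR ''c'') (1/2, 1/2, 0) (2, CHR ''h'') (1/2, 1/2, 1/3) (4, 4, 36)"
  by (simp add: entry_def entries_def)

lemma realised_5: "realised_by 3 3 True (entry 5) model5"
  by ((rule realised_byI[OF model5_def check_5 _ entry_5 _ refl, of "(1/2, 1/2, 0)" "(1/2, 1/2, 1/3)"], unfold wyckoff_lookup);
    (rule directions_intros | (rule conventional_basis_emb; simp add: hexagonal_axes_def; fail) |
     (simp add: entry_simps del: rmov.simps; fail) | (rule diagonal_point; simp; fail) | blast))

lemma check_6: "check_all 3 True 4 3 2 2 model6"
  by code_simp
lemma entry_6: "entry 6 = Entry P4_mmm 4 3 (2, CHR ''g'') (0, 0, 7/8) (2, CHR ''g'') (0, 0, 3/8) (4, 4, 64)"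
  by (simp add: entry_def entries_def)

lemma realised_6: "realised_by 4 3 True (entry 6) model6"
  by ((rule realised_byI[OF model6_def check_6 _ entry_6 _ refl, of "(0, 0, 7/8)" "(0, 0, 3/8)"], unfold wyckoff_lookup);
    (rule directions_intros | (rule conventional_basis_emb; simp add: hexagonal_axes_def; fail) |
     (simp add: entry_simps del: rmov.simps; fail) | (rule diagonal_point; simp; fail) | blast))

lemma check_7: "check_all 3 False 4 3 4 4 model7"
  by code_simp
lemma entry_7: "entry 7 = Entry I4_mmm 4 3 (4, CHR ''e'') (1/2, 1/2, 3/8) (4, CHR ''e'') (0, 0, 3/8) (8, 8, 64)"
  by (simp add: entry_def entries_def)

lemma realised_7: "realised_by 4 3 False (entry 7) model7"
  by ((rule realised_byI[OF model7_def check_7 _ entry_7 _ refl, of "(0, 0, -1/8)" "(0, 0, 3/8)"], unfold wyckoff_lookup);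
    (rule directions_intros | (rule conventional_basis_emb; simp add: hexagonal_axes_def; fail) |
     (simp add: entry_simps del: rmov.simps; fail) | (rule diagonal_point; simp; fail) | blast))

lemma check_8: "check_all 3 False 3 4 2 1 model8"
  by code_simp
lemma entry_8: "entry 8 = Entry P_3m1 3 4 (2, CHR ''d'') (1/3, 2/3, 1/3) (1, CHR ''a'') (0, 0, 0) (8, 8, 12)"
  by (simp add: entry_def entries_def)

lemma realised_8: "realised_by 3 3 False (entry 8) model8"
  by ((rule realised_byI[OF model8_def check_8 _ entry_8 _ refl, of "(1/3, 2/3, 1/3)" "(0, 0, 0)"], unfold wyckoff_lookup);
    (rule directions_intros | (rule conventional_basis_emb; simp add: hexagonal_axes_def; fail) |
     (simp add: entry_simps del: rmov.simps; fail) | (rule diagonal_point; simp; fail) | blast))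

lemma check_9: "check_all 3 False 16 1 32 32 model9"
  by code_simp
lemma entry_9: "entry 9 = Entry Fm_3m 16 1 (32, CHR ''f'') (3/8, 3/8, 7/8) (32, CHR ''f'') (3/8, 3/8, 3/8) (64, 64, 64)"
  by (simp add: entry_def entries_def)

lemma realised_9: "realised_by 4 3 False (entry 9) model9"
  by ((rule realised_byI[OF model9_def check_9 _ entry_9 _ refl, of "(-1/8, -1/8, -1/8)" "(3/8, 3/8, 3/8)"], unfold wyckoff_lookup);
    (rule directions_intros | (rule conventional_basis_emb; simp add: hexagonal_axes_def; fail) |
     (simp add: entry_simps del: rmov.simps; fail) | (rule diagonal_point; simp; fail) | blast))

lemma check_10: "check_all 3 False 4 4 6 6 model10"
  by code_simp
lemma entry_10: "entry 10 = Entry R_3m 4 4 (6, CHR ''c'') (0, 0, 3/8) (6, CHR ''c'') (0, 0, 7/8) (8, 8, 192)"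
  by (simp add: entry_def entries_def)

lemma realised_10: "realised_by 4 3 False (entry 10) model10"
  by ((rule realised_byI[OF model10_def check_10 _ entry_10 _ refl, of "(0, 0, 3/8)" "(0, 0, 7/8)"], unfold wyckoff_lookup);
    (rule directions_intros | (rule conventional_basis_emb; simp add: hexagonal_axes_def; fail) |
     (simp add: entry_simps del: rmov.simps; fail) | (rule diagonal_point; simp; fail) | blast))

lemma check_11: "check_all 3 True 3 6 2 4 model11"
  by code_simp
lemma entry_11: "entry 11 = Entry Cmmm 3 6 (2, CHR ''b'') (0, 1/2, 0) (4, CHR ''g'') (1/6, 0, 0) (72, 8, 4)"
  by (simp add: entry_def entries_def)

lemma realised_11: "realised_by 3 3 True (entry 11) model11"
  by ((rule realised_byI[OF model11_def check_11 _ entry_11 _ refl, of "(1/2, 0, 0)" "(1/6, 0, 0)"], unfold wyckoff_lookup);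
    (rule directions_intros | (rule conventional_basis_emb; simp add: hexagonal_axes_def; fail) |
     (simp add: entry_simps del: rmov.simps; fail) | (rule diagonal_point; simp; fail) | blast))

lemma check_12: "check_all 3 True 8 3 4 4 model12"
  by code_simp
lemma entry_12: "entry 12 = Entry P4_mmm 8 3 (4, CHR ''l'') (3/4, 0, 0) (4, CHR ''n'') (1/4, 1/2, 0) (32, 32, 4)"
  by (simp add: entry_def entries_def)

lemma realised_12: "realised_by 4 3 True (entry 12) model12"
  by ((rule realised_byI[OF model12_def check_12 _ entry_12 _ refl, of "(3/4, 0, 0)" "(1/4, 1/2, 0)"], unfold wyckoff_lookup);
    (rule directions_intros | (rule conventional_basis_emb; simp add: hexagonal_axes_def; fail) |
     (simp add: entry_simps del: rmov.simps; fail) | (rule diagonal_point; simp; fail) | blast))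

lemma check_13: "check_all 3 False 8 3 8 8 model13"
  by code_simp
lemma entry_13: "entry 13 = Entry I4_mmm 8 3 (8, CHR ''i'') (0, 3/4, 0) (8, CHR ''j'') (0, 3/4, 1/2) (32, 32, 16)"
  by (simp add: entry_def entries_def)

lemma realised_13: "realised_by 4 3 False (entry 13) model13"
  by ((rule realised_byI[OF model13_def check_13 _ entry_13 _ refl, of "(3/4, 0, 0)" "(1/4, 1/2, 0)"], unfold wyckoff_lookup);
    (rule directions_intros | (rule conventional_basis_emb; simp add: hexagonal_axes_def; fail) |
     (simp add: entry_simps del: rmov.simps; fail) | (rule diagonal_point; simp; fail) | blast))

lemma check_14: "check_all 3 True 4 6 4 4 model14"
  by code_simp
lemma entry_14: "entry 14 = Entry Cmmm 4 6 (4, CHR ''h'') (3/8, 1/2, 1/2) (4, CHR ''h'') (3/8, 0, 1/2) (64, 16, 4)"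
  by (simp add: entry_def entries_def)

lemma realised_14: "realised_by 4 3 True (entry 14) model14"
  by ((rule realised_byI[OF model14_def check_14 _ entry_14 _ refl, of "(-1/8, 0, 1/2)" "(3/8, 0, 1/2)"], unfold wyckoff_lookup);
    (rule directions_intros | (rule conventional_basis_emb; simp add: hexagonal_axes_def; fail) |
     (simp add: entry_simps del: rmov.simps; fail) | (rule diagonal_point; simp; fail) | blast))

lemma check_15: "check_all 3 True 4 6 2 2 model15"
  by code_simp
lemma entry_15: "entry 15 = Entry Pmma 4 6 (2, CHR ''e'') (1/4, 0, 7/8) (2, CHR ''e'') (1/4, 0, 3/8) (8, 4, 32)"
  by (simp add: entry_def entries_def)

lemma realised_15: "realised_by 4 3 True (entry 15) model15"
  by ((rule realised_byI[OF model15_def check_15 _ entry_15 _ refl, of "(1/4, 0, 7/8)" "(1/4, 0, 3/8)"], unfold wyckoff_lookup);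
    (rule directions_intros | (rule conventional_basis_emb; simp add: hexagonal_axes_def; fail) |
     (simp add: entry_simps del: rmov.simps; fail) | (rule diagonal_point; simp; fail) | blast))

lemma check_16: "check_all 3 False 4 6 4 4 model16"
  by code_simp
lemma entry_16: "entry 16 = Entry Cmcm 4 6 (4, CHR ''c'') (1/2, 3/8, 3/4) (4, CHR ''c'') (0, 3/8, 3/4) (16, 32, 8)"
  by (simp add: entry_def entries_def)

lemma realised_16: "realised_by 4 3 False (entry 16) model16"
  by ((rule realised_byI[OF model16_def check_16 _ entry_16 _ refl, of "(0, 1/8, 1/4)" "(0, -3/8, 1/4)"], unfold wyckoff_lookup);
    (rule directions_intros | (rule conventional_basis_emb; simp add: hexagonal_axes_def; fail) |
     (simp add: entry_simps del: rmov.simps; fail) | (rule diagonal_point; simp; fail) | blast))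

lemma check_17: "check_all 3 False 8 3 8 8 model17"
  by code_simp
lemma entry_17: "entry 17 = Entry I4_1_amd 8 3 (8, CHR ''e'') (1/2, 1/4, 0) (8, CHR ''e'') (0, 1/4, 0) (16, 16, 64)"
  by (simp add: entry_def entries_def)

lemma realised_17: "realised_by 4 3 False (entry 17) model17"
  by ((rule realised_byI[OF model17_def check_17 _ entry_17 _ refl, of "(0, 1/4, 1/2)" "(0, 1/4, 0)"], unfold wyckoff_lookup);
    (rule directions_intros | (rule conventional_basis_emb; simp add: hexagonal_axes_def; fail) |
     (simp add: entry_simps del: rmov.simps; fail) | (rule diagonal_point; simp; fail) | blast))

lemma check_18: "check_all 6 True 5 6 4 1 model18"
  by code_simp
lemma entry_18: "entry 18 = Entry P4_m 5 6 (4, CHR ''j'') (1/5, 3/5, 0) (1, CHR ''a'') (0, 0, 0) (20, 20, 4)"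
  by (simp add: entry_def entries_def)

lemma realised_18: "realised_by 5 6 True (entry 18) model18"
  by ((rule realised_byI[OF model18_def check_18 _ entry_18 _ refl, of "(1/5, 3/5, 0)" "(0, 0, 0)"], unfold wyckoff_lookup);
    (rule directions_intros | (rule conventional_basis_emb; simp add: hexagonal_axes_def; fail) |
     (simp add: entry_simps del: rmov.simps; fail) | (rule diagonal_point; simp; fail) | blast))

lemma check_19: "check_all 3 False 32 1 16 48 model19"
  by code_simp
lemma entry_19: "entry 19 = Entry Im_3m 32 1 (16, CHR ''f'') (3/8, 3/8, 3/8) (48, CHR ''k'') (3/8, 3/8, 7/8) (64, 64, 64)"
  by (simp add: entry_def entries_def)

lemma realised_19: "realised_by 4 3 False (entry 19) model19"
  by ((rule realised_byI[OF model19_def check_19 _ entry_19 _ refl, of "(3/8, 3/8, 3/8)" "(3/8, 3/8, 7/8)"], unfold wyckoff_lookup);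
    (rule directions_intros | (rule conventional_basis_emb; simp add: hexagonal_axes_def; fail) |
     (simp add: entry_simps del: rmov.simps; fail) | (rule diagonal_point; simp; fail) | blast))

lemma check_20: "check_all 3 False 32 1 16 48 model20"
  by code_simp
lemma entry_20: "entry 20 = Entry Ia_3d 32 1 (16, CHR ''b'') (3/8, 5/8, 1/8) (48, CHR ''g'') (3/8, 5/8, 3/8) (64, 64, 64)"
  by (simp add: entry_def entries_def)

lemma realised_20: "realised_by 4 3 False (entry 20) model20"
  by ((rule realised_byI[OF model20_def check_20 _ entry_20 _ refl, of "(1/8, 1/8, 1/8)" "(1/8, -5/8, 7/8)"], unfold wyckoff_lookup);
    (rule directions_intros | (rule conventional_basis_emb; simp add: hexagonal_axes_def; fail) |
     (simp add: entry_simps del: rmov.simps; fail) | (rule diagonal_point; simp; fail) | blast))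

lemma check_21: "check_all 3 False 8 6 8 8 model21"
  by code_simp
lemma entry_21: "entry 21 = Entry Cmcm 8 6 (8, CHR ''g'') (3/8, 1/8, 3/4) (8, CHR ''g'') (3/8, 5/8, 3/4) (64, 32, 8)"
  by (simp add: entry_def entries_def)

lemma realised_21: "realised_by 4 3 False (entry 21) model21"
  by ((rule realised_byI[OF model21_def check_21 _ entry_21 _ refl, of "(-3/8, -1/8, 1/4)" "(-3/8, -5/8, 1/4)"], unfold wyckoff_lookup);
    (rule directions_intros | (rule conventional_basis_emb; simp add: hexagonal_axes_def; fail) |
     (simp add: entry_simps del: rmov.simps; fail) | (rule diagonal_point; simp; fail) | blast))

lemma check_22: "check_all 3 False 16 3 16 16 model22"
  by code_simp
lemma entry_22: "entry 22 = Entry I4_1_amd 16 3 (16, CHR ''h'') (0, 0, 3/8) (16, CHR ''h'') (0, 0, 7/8) (32, 32, 64)"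
  by (simp add: entry_def entries_def)

lemma realised_22: "realised_by 4 3 False (entry 22) model22"
  by ((rule realised_byI[OF model22_def check_22 _ entry_22 _ refl, of "(0, 0, 3/8)" "(0, 0, 7/8)"], unfold wyckoff_lookup);
    (rule directions_intros | (rule conventional_basis_emb; simp add: hexagonal_axes_def; fail) |
     (simp add: entry_simps del: rmov.simps; fail) | (rule diagonal_point; simp; fail) | blast))

lemma check_23: "check_all 6 False 7 8 3 18 model23"
  by code_simp
lemma entry_23: "entry 23 = Entry R_3 7 8 (3, CHR ''a'') (0, 0, 0) (18, CHR ''f'') (5/21, 4/21, 1/3) (56, 56, 12)"
  by (simp add: entry_def entries_def)

lemma realised_23: "realised_by 7 6 False (entry 23) model23"
  by ((rule realised_byI[OF model23_def check_23 _ entry_23 _ refl, of "(0, 0, 0)" "(5/21, 4/21, 1/3)"], unfold wyckoff_lookup);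
    (rule directions_intros | (rule conventional_basis_emb; simp add: hexagonal_axes_def; fail) |
     (simp add: entry_simps del: rmov.simps; fail) | (rule diagonal_point; simp; fail) | blast))

lemma check_24: "check_all 3 False 32 3 32 32 model24"
  by code_simp
lemma entry_24: "entry 24 = Entry I4_1_amd 32 3 (32, CHR ''i'') (3/8, 1/8, 0) (32, CHR ''i'') (3/8, 1/8, 1/2) (64, 64, 64)"
  by (simp add: entry_def entries_def)

lemma realised_24: "realised_by 4 3 False (entry 24) model24"
  by ((rule realised_byI[OF model24_def check_24 _ entry_24 _ refl, of "(3/8, 1/8, 0)" "(3/8, 1/8, 1/2)"], unfold wyckoff_lookup);
    (rule directions_intros | (rule conventional_basis_emb; simp add: hexagonal_axes_def; fail) |
     (simp add: entry_simps del: rmov.simps; fail) | (rule diagonal_point; simp; fail) | blast))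

lemma check_25: "check_all 3 False 32 3 32 32 model25"
  by code_simp
lemma entry_25: "entry 25 = Entry I4_1_acd 32 3 (32, CHR ''g'') (1/8, 3/8, 0) (32, CHR ''g'') (1/8, 3/8, 1/2) (64, 64, 64)"
  by (simp add: entry_def entries_def)

lemma realised_25: "realised_by 4 3 False (entry 25) model25"
  by ((rule realised_byI[OF model25_def check_25 _ entry_25 _ refl, of "(1/8, 3/8, 0)" "(1/8, 3/8, 1/2)"], unfold wyckoff_lookup);
    (rule directions_intros | (rule conventional_basis_emb; simp add: hexagonal_axes_def; fail) |
     (simp add: entry_simps del: rmov.simps; fail) | (rule diagonal_point; simp; fail) | blast))

section \<open>Evaluation of the case analysis\<close>

lemma cert_0: "verified_cert 0"
  by code_simp
lemma cert_1: "verified_cert 1"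
  by code_simp
lemma cert_2: "verified_cert 2"
  by code_simp
lemma cert_3: "verified_cert 3"
  by code_simp
lemma cert_4: "verified_cert 4"
  by code_simp
lemma cert_5: "verified_cert 5"
  by code_simp
lemma cert_6: "verified_cert 6"
  by code_simp
lemma cert_7: "verified_cert 7"
  by code_simp
lemma cert_8: "verified_cert 8"
  by code_simp
lemma cert_9: "verified_cert 9"
  by code_simp
lemma cert_10: "verified_cert 10"
  by code_simp
lemma cert_11: "verified_cert 11"
  by code_simp
lemma cert_12: "verified_cert 12"
  by code_simp
lemma cert_13: "verified_cert 13"
  by code_simp
lemma cert_14: "verified_cert 14"
  by code_simp
lemma cert_15: "verified_cert 15"
  by code_simp
lemma cert_16: "verified_cert 16"
  by code_simp
lemma cert_17: "verified_cert 17"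
  by code_simp

lemma leaves_bound: "list_all (\<lambda>a. certificate.leaves a \<subseteq> {1..25}) certs"
  by (simp add: certs_def certificate.leaves.simps)

lemma degrees_list: "map degrees models = [(6, 6), (6, 2), (2, 2), (4, 4), (2, 1), (1, 1), (5, 5), (3, 6), (3, 3), (3, 3), (4, 2), (2, 2), (4, 4), (3, 3), (2, 2), (4, 4), (3, 3), (1, 4), (3, 1), (6, 2), (3, 3), (3, 3), (6, 1), (2, 2), (4, 4)]"
  by code_simp

lemma all_realised:
  assumes "n \<in> {1..25}"
  shows "\<exists>m. realised_by m (if n = 18 \<or> n = 23 then 6 else 3) (n \<in> {3, 4, 5, 6, 11, 12, 14, 15, 18}) (entry n) (models ! (n - 1))"
proof -
  have "n = 1 \<or> n = 2 \<or> n = 3 \<or> n = 4 \<or> n = 5 \<or> n = 6 \<or> n = 7 \<or> n = 8 \<or> n = 9 \<or> n = 10 \<or> n = 11 \<or> n = 12 \<or> n = 13 \<or> n = 14 \<or> n = 15 \<or> n = 16 \<or> n = 17 \<or> n = 18 \<or> n = 19 \<or> n = 20 \<or> n = 21 \<or> n = 22 \<or> n = 23 \<or> n = 24 \<or> n = 25"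
    using assms unfolding atLeastAtMost_iff by presburger
  then show ?thesis
    by (elim disjE; hypsubst; simp add: models_def;
      blast intro: realised_1[unfolded One_nat_def] realised_2 realised_3 realised_4 realised_5 realised_6 realised_7 realised_8 realised_9 realised_10 realised_11 realised_12 realised_13 realised_14 realised_15 realised_16 realised_17 realised_18 realised_19 realised_20 realised_21 realised_22 realised_23 realised_24 realised_25)
qed

text \<open>The indices alone do not suffice: entries 14, 15 and 16, for example, share both of them
  and are told apart by the degrees 3, 2 and 4.\<close>

lemma invariants_distinct: "inj_on entry_invariants {1..25}"
proof -
  have deg: "degrees (models ! k) = map degrees models ! k" if "k < 25" for k
    using that by (simp add: models_def del: list.map)
  have upt: "[1..<26] = [1, 2, 3, 4, 5, 6, 7, 8, 9, 10, 11, 12, 13, 14, 15, 16, 17, 18, 19, 20, 21, 22, 23, 24, 25 :: nat]"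
    by code_simp
  have "map entry_invariants [1..<26] = [(2, 2, 6, 6), (4, 4, 2, 6), (2, 6, 2, 2), (2, 6, 4, 4), (3, 9, 1, 2), (4, 12, 1, 1), (4, 12, 5, 5), (3, 12, 3, 6), (16, 16, 3, 3), (4, 16, 3, 3), (3, 18, 2, 4), (8, 24, 2, 2), (8, 24, 4, 4), (4, 24, 3, 3), (4, 24, 2, 2), (4, 24, 4, 4), (8, 24, 3, 3), (5, 30, 1, 4), (32, 32, 1, 3), (32, 32, 2, 6), (8, 48, 3, 3), (16, 48, 3, 3), (7, 56, 1, 6), (32, 96, 2, 2), (32, 96, 4, 4)]"
    unfolding upt by (simp add: entry_invariants_def deg degrees_list entry_1[unfolded One_nat_def] entry_2 entry_3 entry_4 entry_5 entry_6 entry_7 entry_8 entry_9 entry_10 entry_11 entry_12 entry_13 entry_14 entry_15 entry_16 entry_17 entry_18 entry_19 entry_20 entry_21 entry_22 entry_23 entry_24 entry_25)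
  then have "distinct (map entry_invariants [1..<26])" by simp
  moreover have "set [1..<26] = {1..25::nat}" by auto
  ultimately show ?thesis by (metis distinct_map)
qed

theorem mainTheorem1:
  shows
    "card ((orbit_partitions 2 :: (real ^ 3) set set set) // partition_equiv) = 25
   \<and> bij_betw (\<lambda>n. represented_partitions (entry n)) {1..25} (orbit_partitions 2 // partition_equiv)
   \<and> (\<forall>n\<in>{1..25}. \<forall>F. entry_frame (entry n) F \<longrightarrow>
        (\<exists>f :: real ^ 3 \<Rightarrow> real ^ 3. isometry f \<and>
             f ` (entry_orbit1 (entry n) F \<union> entry_orbit2 (entry n) F) = (\<lambda>x. 2 *\<^sub>R x) ` integer_lattice)
      \<and> F (point1 (entry n)) \<in> wyckoff_position (sg (entry n)) F (snd (wyck1 (entry n)))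
      \<and> multiplicity_in_cell F (entry_orbit1 (entry n) F) = fst (wyck1 (entry n))
      \<and> F (point2 (entry n)) \<in> wyckoff_position (sg (entry n)) F (snd (wyck2 (entry n)))
      \<and> multiplicity_in_cell F (entry_orbit2 (entry n) F) = fst (wyck2 (entry n))
      \<and> (\<forall>s. entry_similarity (entry n) F s \<longrightarrow>
           aut_partition (entry_partition (entry n) F s) = (\<lambda>g. s \<circ> g \<circ> inv_into UNIV s) ` entry_group (entry n) F))
   \<and> (\<forall>n\<in>{1..25}. \<forall>P\<in>represented_partitions (entry n).
        has_space_group_type (aut_partition P) (sg (entry n))
      \<and> translation_index P = idx_t (entry n)
      \<and> point_index P = real (idx_k (entry n))
      \<and> aut_index P = idx_t (entry n) * idx_k (entry n)
      \<and> (direct_superposition P \<longleftrightarrow> n \<in> {3, 4, 5, 6, 11, 12, 14, 15, 18}))"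
proof -
  let ?rep = "\<lambda>n. represented_partitions (entry n)"
  have "bij_betw ?rep {1..25} (orbit_partitions 2 // partition_equiv)"
  proof (rule bijection_of_classes)
    show "\<exists>m r s. realised_by m r s (entry n) (models ! (n - 1))" if "n \<in> {1..25}" for n
      using all_realised[OF that] by blast
    show "\<exists>n\<in>{1..25}. equiv_col c (model_of n)" if c: "two_orbit c" for c
    proof (rule classification)
      show "two_orbit (model_of n) \<and> (\<forall>y. rigid_at (set (nbrs n)) (model_of n) y)" if n: "n \<in> {1..25}" for n
        using all_realised[OF n] realised_byD(1,2) unfolding model_of_def nbrs_def by blast
      have len: "length patterns = 18" "length certs = 18" by (simp_all add: patterns_def certs_def)
      show "certificate.leaves (certs ! i) \<subseteq> {1..25}" if "i < length patterns" for i
        using leaves_bound that len unfolding list_all_length by metis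
      show "verified_cert i" if "i < length patterns" for i
      proof -
        have "i = 0 \<or> i = 1 \<or> i = 2 \<or> i = 3 \<or> i = 4 \<or> i = 5 \<or> i = 6 \<or> i = 7 \<or> i = 8 \<or> i = 9 \<or> i = 10 \<or> i = 11 \<or> i = 12 \<or> i = 13 \<or> i = 14 \<or> i = 15 \<or> i = 16 \<or> i = 17" using that unfolding len by presburger
        then show ?thesis by (elim disjE; hypsubst) (rule cert_0 cert_1 cert_2 cert_3 cert_4 cert_5 cert_6 cert_7 cert_8 cert_9 cert_10 cert_11 cert_12 cert_13 cert_14 cert_15 cert_16 cert_17)+
      qed
      show "patterns \<noteq> []" "last patterns = [(0, False), (Tri 1 0 0, True)]" by (simp_all add: patterns_def zero_tri_def)
    qed (rule c)
    show "inj_on entry_invariants {1..25}" by (rule invariants_distinct)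
  qed
  then have bij: "bij_betw ?rep {1..25} (orbit_partitions 2 // partition_equiv)" .
  have card: "card ((orbit_partitions 2 :: (real ^ 3) set set set) // partition_equiv) = 25"
    using bij_betw_same_card[OF bij] by simp
  show ?thesis
  proof (intro conjI, goal_cases)
    case 1 show ?case by (rule card)
  next
    case 2 show ?case by (rule bij)
  next
    case 3 show ?case by (rule ballI, drule all_realised, erule exE, erule realised_by_frames)
  next
    case 4 show ?case by (intro ballI, drule all_realised, erule exE, drule (1) realised_by_partitions)
  qed
qed

end
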